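(* Let $k\ge0$ be an integer, let $\kappa,\beta_0,\beta_1>0$ and let $t>0$ (the plate thickness), and let $(\mathcal M_h)_h$ be a regular sequence of polygonal meshes of $\Omega$ with regularity parameter $\varrho$. There exists a constant $C>0$, independent of the meshsize $h$ and of the plate thickness $t$ (it may depend only on $\Omega$, $\varrho$, $k$, $\beta_0$, $\beta_1$ and $\kappa$), such that for every mesh of the sequence and all $(\underline{\boldsymbol\phi}_h,\underline v_h)\in\underline H^{k+1}_{1,0}(\mathcal T_h)^2\times\underline H^k_{2,1,0}(\mathcal T_h)$, $$\|(\underline{\boldsymbol\phi}_h,\underline v_h)\|_{1\times2,h}^2\le C\,A_h\big((\underline{\boldsymbol\phi}_h,\underline v_h),(\underline{\boldsymbol\phi}_h,\underline v_h)\big).$$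
   Context: For $\boldsymbol A\in\mathbb R^{2\times2}$ with symmetric part $\boldsymbol A_s$, $\boldsymbol C\boldsymbol A=\beta_0\boldsymbol A_s+\beta_1\operatorname{tr}(\boldsymbol A)\,\mathrm{Id}$. The divergence of a tensor field is row-wise. **Mesh.** $\Omega\subset\mathbb R^2$ is a bounded polygonal domain. A polygonal mesh is $\mathcal M_h=(\mathcal T_h,\mathcal E_h,\mathcal V_h)$: $\mathcal T_h$ is a finite set of pairwise disjoint open polygons $T$ (elements) of diameter $h_T$ with $\overline\Omega=\bigcup_T\overline T$; $h=\max_T h_T$; $\mathcal E_h$ is the set of (pairwise disjoint, open, straight) edges $E$ of length $h_E$; $\mathcal V_h$ is the set of vertices $V$, with position $\boldsymbol x_V$. Every edge lies either in $\partial\Omega$ (boundary edge) or in the common boundary of exactly two elements (interior edge); for each $T$, $\partial T$ is the union of the closures of the edges in a subset $\mathcal E_T\subset\mathcal E_h$ (a straight side of $T$ may be split into several edges). For $Y\in\mathcal T_h\cup\mathcal E_h$, $\mathcal V_Y$ is the set of its vertices. $\mathcal E_h^{\rm b},\mathcal V_h^{\rm b}$ are the edges/vertices lying on $\partial\Omega$. Each $E$ has a fixed unit tangent $\boldsymbol t_E$ and the unit normal $\boldsymbol n_E$ such that $(\boldsymbol t_E,\boldsymbol n_E)$ is positively oriented; $\partial_{\boldsymbol t_E}$ is the derivative along $E$ in the direction $\boldsymbol t_E$; $\omega_{TE}\in\{-1,1\}$ is such that $\omega_{TE}\boldsymbol n_E$ points out of $T$; $\omega_{EV}\in\{-1,1\}$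 is such that $\omega_{EV}\boldsymbol t_E$ points towards $V\in\mathcal V_E$. The sequence is regular with parameter $\varrho\in(0,1)$: each mesh admits a matching simplicial submesh (each element a union of submesh triangles, each mesh edge a union of submesh edges) whose triangles $\tau$ have inradius $\ge\varrho h_\tau$ ($h_\tau$ the diameter of $\tau$) and satisfy $h_\tau\ge\varrho h_T$ whenever $\tau\subset T$, and each $T$ is star-shaped with respect to every point of a ball of radius $\varrho h_T$. For each $T$ a point $\boldsymbol x_T\in T$ is fixed such that $T$ contains a ball centred at $\boldsymbol x_T$ of diameter comparable to $h_T$ uniformly in the mesh sequence. **Polynomials.** $\mathcal P^\ell(Y)$ is the space of restrictions to $Y$ of bivariate polynomials of total degree $\le\ell$, with $\mathcal P^\ell(Y)=\{0\}$ for $\ell\le-1$. $\pi^\ell_{\mathcal P,Y}$ is the $L^2(Y)$-orthogonal projector on it, also applied component-wise. $\mathcal P^\ell_{\rm c}(\mathcal E_T)$: continuous functions on $\partial T$ whose restriction to each $E\in\mathcal E_T$ is in $\mathcal P^\ell(E)$. $\mathcal R^{{\rm c},\ell}(T)^2$ is the set of tensor fields whose rows are in $\mathcal R^{{\rm c},\ell}(T)=(\boldsymbol x-\boldsymbol x_T)\mathcal P^{\ell-1}(T)$. **Discrete rotation space.** $\underline H^{k+1}_1(\mathcal T_h)^2$ is the set of $\underline{\boldsymbol v}_h=((\boldsymbol v_T)_T,(\boldsymbol v_E)_E,(\boldsymbol v_V)_V)$ with $\boldsymbol v_T\in\mathcal P^k(T)^2$, $\boldsymbol v_E\in\mathcal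 P^k(E)^2$, $\boldsymbol v_V\in\mathbb R^2$; $\underline H^{k+1}_{1,0}(\mathcal T_h)^2$ is its subspace with $\boldsymbol v_E=\boldsymbol0$ for $E\in\mathcal E_h^{\rm b}$ and $\boldsymbol v_V=\boldsymbol0$ for $V\in\mathcal V_h^{\rm b}$. A subscript $T$ or $E$ on a discrete vector denotes restriction to the components on $T$ or $E$ and its boundary entities. - Trace $\boldsymbol\gamma^{k+2}_{1,\partial T}\underline{\boldsymbol v}_T\in\mathcal P^{k+2}_{\rm c}(\mathcal E_T)^2$: $\pi^k_{\mathcal P,E}(\boldsymbol\gamma^{k+2}_{1,\partial T}\underline{\boldsymbol v}_T)=\boldsymbol v_E$ for $E\in\mathcal E_T$, value $\boldsymbol v_V$ at each $V\in\mathcal V_T$. - Gradient $\boldsymbol G^{k+1}_{1,T}\underline{\boldsymbol v}_T\in\mathcal P^{k+1}(T)^{2\times2}$: $\int_T\boldsymbol G^{k+1}_{1,T}\underline{\boldsymbol v}_T:\boldsymbol\zeta=-\int_T\boldsymbol v_T\cdot\operatorname{div}\boldsymbol\zeta+\sum_{E\in\mathcal E_T}\omega_{TE}\int_E\boldsymbol\gamma^{k+2}_{1,\partial T}\underline{\boldsymbol v}_T\cdot(\boldsymbol\zeta\boldsymbol n_E)$ for all $\boldsymbol\zeta\in\mathcal P^{k+1}(T)^{2\times2}$. $\boldsymbol G^{k+1}_{1,s,T}\underline{\boldsymbol v}_T$ is its symmetric part and $(\boldsymbol G^{k+1}_{1,s,h}\underline{\boldsymbol v}_h)_{|T}=\boldsymbol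 G^{k+1}_{1,s,T}\underline{\boldsymbol v}_T$. - Potential $\boldsymbol P^{k+2}_{\mathbf{grad},T}\underline{\boldsymbol v}_T\in\mathcal P^{k+2}(T)^2$: $\int_T\boldsymbol P^{k+2}_{\mathbf{grad},T}\underline{\boldsymbol v}_T\cdot\operatorname{div}\boldsymbol\chi=-\int_T\boldsymbol G^{k+1}_{1,T}\underline{\boldsymbol v}_T:\boldsymbol\chi+\sum_{E\in\mathcal E_T}\omega_{TE}\int_E\boldsymbol\gamma^{k+2}_{1,\partial T}\underline{\boldsymbol v}_T\cdot(\boldsymbol\chi\boldsymbol n_E)$ for all $\boldsymbol\chi\in\mathcal R^{{\rm c},k+3}(T)^2$. - $s_{1,T}(\underline{\boldsymbol v}_T,\underline{\boldsymbol w}_T)=\sum_{E\in\mathcal E_T}h_E\int_E(\boldsymbol P^{k+2}_{\mathbf{grad},T}\underline{\boldsymbol v}_T-\boldsymbol\gamma^{k+2}_{1,\partial T}\underline{\boldsymbol v}_T)\cdot(\boldsymbol P^{k+2}_{\mathbf{grad},T}\underline{\boldsymbol w}_T-\boldsymbol\gamma^{k+2}_{1,\partial T}\underline{\boldsymbol w}_T)$. - $(\underline{\boldsymbol v}_h,\underline{\boldsymbol w}_h)_{1,h}=\sum_{T}\big[(\boldsymbol P^{k+2}_{\mathbf{grad},T}\underline{\boldsymbol v}_T,\boldsymbol P^{k+2}_{\mathbf{grad},T}\underline{\boldsymbol w}_T)_{L^2(T)^2}+s_{1,T}(\underline{\boldsymbol v}_T,\underline{\boldsymbol w}_T)\big]$,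 with norm $\|\cdot\|_{1,h}$. **Discrete displacement space.** $\underline H^k_2(\mathcal T_h)$ is the set of $\underline q_h=((q_T)_T,(q_E)_E,(G^{\boldsymbol n}_{q,E})_E,(q_V)_V,(\boldsymbol G_{q,V})_V)$ with $q_T\in\mathcal P^{k-1}(T)$, $q_E\in\mathcal P^{k-1}(E)$, $G^{\boldsymbol n}_{q,E}\in\mathcal P^k(E)$, $q_V\in\mathbb R$, $\boldsymbol G_{q,V}\in\mathbb R^2$; $\underline H^k_{2,1,0}(\mathcal T_h)$ is its subspace with $q_E=0$ for $E\in\mathcal E_h^{\rm b}$ and $q_V=0$ for $V\in\mathcal V_h^{\rm b}$. - Trace $\gamma^{k+1}_{2,\partial T}\underline q_T\in\mathcal P^{k+1}_{\rm c}(\mathcal E_T)$: $\pi^{k-1}_{\mathcal P,E}(\gamma^{k+1}_{2,\partial T}\underline q_T)=q_E$ for $E\in\mathcal E_T$, value $q_V$ at each $V\in\mathcal V_T$. - $G^{\boldsymbol t}_{2,E}\underline q_E\in\mathcal P^k(E)$: $\int_EG^{\boldsymbol t}_{2,E}\underline q_E\,r=-\int_Eq_E\,\partial_{\boldsymbol t_E}r+\sum_{V\in\mathcal V_E}\omega_{EV}q_Vr(\boldsymbol x_V)$ for all $r\in\mathcal P^k(E)$. - $\boldsymbol G^k_{2,T}\underline q_T\in\mathcal P^k(T)^2$: $\int_T\boldsymbol G^k_{2,T}\underline q_T\cdot\boldsymbol w=-\int_Tq_T\operatorname{div}\boldsymbol w+\sum_{E\in\mathcal E_T}\omega_{TE}\int_E\gamma^{k+1}_{2,\partial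 T}\underline q_T\,(\boldsymbol w\cdot\boldsymbol n_E)$ for all $\boldsymbol w\in\mathcal P^k(T)^2$. - $\underline{\boldsymbol G}^k_{2,h}\underline q_h=((\boldsymbol G^k_{2,T}\underline q_T)_T,(G^{\boldsymbol t}_{2,E}\underline q_E\,\boldsymbol t_E+G^{\boldsymbol n}_{q,E}\boldsymbol n_E)_E,(\boldsymbol G_{q,V})_V)\in\underline H^{k+1}_1(\mathcal T_h)^2$. **Bilinear form.** $$A_h((\underline{\boldsymbol\xi}_h,\underline w_h),(\underline{\boldsymbol\phi}_h,\underline v_h))=(\boldsymbol C\boldsymbol G^{k+1}_{1,s,h}\underline{\boldsymbol\xi}_h,\boldsymbol G^{k+1}_{1,s,h}\underline{\boldsymbol\phi}_h)_{L^2(\Omega)^{2\times2}}+\beta_0\sum_{T}h_T^{-2}s_{1,T}(\underline{\boldsymbol\xi}_T,\underline{\boldsymbol\phi}_T)+\frac{\kappa}{t^2}(\underline{\boldsymbol\xi}_h-\underline{\boldsymbol G}^k_{2,h}\underline w_h,\underline{\boldsymbol\phi}_h-\underline{\boldsymbol G}^k_{2,h}\underline v_h)_{1,h}.$$ **Energy norm.** With $\mu=\min(\kappa,\beta_0)$, $$\|(\underline{\boldsymbol\phi}_h,\underline v_h)\|_{1\times2,h}^2=\|\boldsymbol C\boldsymbol G^{k+1}_{1,s,h}\underline{\boldsymbol\phi}_h\|_{L^2(\Omega)^{2\times2}}^2+\beta_0\sum_Th_T^{-2}s_{1,T}(\underline{\boldsymbol\phi}_T,\underline{\boldsymbol\phi}_T)+\frac{\kappa}{t^2}\|\underline{\boldsymbol\phi}_h-\underline{\boldsymbol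 G}^k_{2,h}\underline v_h\|_{1,h}^2+\mu\big(\|\underline{\boldsymbol\phi}_h\|_{1,h}^2+\|\underline{\boldsymbol G}^k_{2,h}\underline v_h\|_{1,h}^2\big).$$
   Formalization: The plate thickness is restricted to 0 < t ≤ t_max for an arbitrary fixed t_max > 0, on which C may also depend; with one C for all t > 0 the claim fails (take φ = 0 and v with nonzero discrete gradient: the ratio is 1 + μt²/κ, unbounded as t → ∞). *)

theory Defs
  imports "HOL-Analysis.Analysis"
begin

type_synonym point = "real^2"

section \<open>Polygonal meshes\<close>

text \<open>Used both for the domain and for the mesh elements.  Holes and slits are not excluded
  here; an element of a regular mesh can have neither, being star-shaped with respect to a ball.\<close>

definition polygonal :: "point set \<Rightarrow> bool" where
  "polygonal U \<longleftrightarrow> U \<noteq> {} \<and> open U \<and> connected U \<and> bounded U \<and>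
     (\<exists>S. finite S \<and> frontier U = (\<Union>(a, b)\<in>S. closed_segment a b))"

text \<open>Edges are open segments and a vertex is identified with its position.  The field
  \<open>centre\<close> is the point $x_T$ attached to each element.  The values of \<open>tangent\<close> and
  \<open>centre\<close> outside the mesh are irrelevant.\<close>

record mesh =
  elements :: "point set set"
  edges :: "point set set"
  tangent :: "point set \<Rightarrow> point"
  centre :: "point set \<Rightarrow> point"

definition edge_vertices :: "point set \<Rightarrow> point set" where
  "edge_vertices E = closure E - E"

definition mesh_vertices :: "mesh \<Rightarrow> point set" where
  "mesh_vertices M = (\<Union>E\<in>edges M. edge_vertices E)"

definition element_edges :: "mesh \<Rightarrow> point set \<Rightarrow> point set set" where
  "element_edges M T = {E \<in> edges M. E \<subseteq> frontier T}"

text \<open>The vertices of an element include the hanging nodes at which a straight side is split.\<close>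

definition element_vertices :: "mesh \<Rightarrow> point set \<Rightarrow> point set" where
  "element_vertices M T = (\<Union>E\<in>element_edges M T. edge_vertices E)"

text \<open>The inclusion of the elements in \<open>\<Omega>\<close> follows from the covering property when \<open>\<Omega>\<close> is the
  interior of its closure; it matters only for a domain with slits.\<close>

definition polygonal_mesh :: "point set \<Rightarrow> mesh \<Rightarrow> bool" where
  "polygonal_mesh \<Omega> M \<longleftrightarrow>
     finite (elements M) \<and> (\<forall>T\<in>elements M. polygonal T \<and> T \<subseteq> \<Omega>) \<and>
     pairwise disjnt (elements M) \<and>
     closure \<Omega> = (\<Union>T\<in>elements M. closure T) \<and>
     finite (edges M) \<and>
     (\<forall>E\<in>edges M. \<exists>a b. a \<noteq> b \<and> E = open_segment a b \<and> tangent M E = sgn (b - a)) \<and>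
     pairwise disjnt (edges M) \<and>
     (\<forall>E\<in>edges M. E \<subseteq> frontier \<Omega> \<or> card {T \<in> elements M. E \<subseteq> frontier T} = 2) \<and>
     (\<forall>T\<in>elements M. frontier T = (\<Union>E\<in>element_edges M T. closure E)) \<and>
     (\<forall>T\<in>elements M. centre M T \<in> T)"

text \<open>The rotation of the tangent by $+\pi/2$, so that (tangent, normal) is positively oriented.\<close>

definition normal :: "mesh \<Rightarrow> point set \<Rightarrow> point" where
  "normal M E = vector [- (tangent M E $ 2), tangent M E $ 1]"

definition points_out_of :: "point \<Rightarrow> point set \<Rightarrow> point set \<Rightarrow> bool" where
  "points_out_of n E T \<longleftrightarrow>
     (\<forall>x\<in>E. \<exists>\<epsilon>>0. \<forall>s. 0 < s \<and> s < \<epsilon> \<longrightarrow> x + s *\<^sub>R n \<notin> closure T \<and> x - s *\<^sub>R n \<in> T)"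

definition \<omega>TE :: "mesh \<Rightarrow> point set \<Rightarrow> point set \<Rightarrow> real" where
  "\<omega>TE M T E = (if points_out_of (normal M E) E T then 1 else - 1)"

definition \<omega>EV :: "mesh \<Rightarrow> point set \<Rightarrow> point \<Rightarrow> real" where
  "\<omega>EV M E V = (if \<forall>x\<in>E. (V - x) \<bullet> tangent M E > 0 then 1 else - 1)"

definition inradius :: "point set \<Rightarrow> real" where
  "inradius \<tau> = Sup {r. 0 \<le> r \<and> (\<exists>z. ball z r \<subseteq> \<tau>)}"

text \<open>The triangles of the submesh are closed, hence the closures of elements and edges.\<close>

definition matching_simplicial_submesh :: "point set \<Rightarrow> mesh \<Rightarrow> point set set \<Rightarrow> bool" where
  "matching_simplicial_submesh \<Omega> M \<S> \<longleftrightarrow>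
     triangulation \<S> \<and> (\<forall>\<tau>\<in>\<S>. 2 simplex \<tau>) \<and> \<Union>\<S> = closure \<Omega> \<and>
     (\<forall>T\<in>elements M. closure T = \<Union>{\<tau> \<in> \<S>. \<tau> \<subseteq> closure T}) \<and>
     (\<forall>E\<in>edges M. closure E = \<Union>{e. (\<exists>\<tau>\<in>\<S>. e edge_of \<tau>) \<and> e \<subseteq> closure E})"

definition regular_mesh :: "point set \<Rightarrow> real \<Rightarrow> mesh \<Rightarrow> bool" where
  "regular_mesh \<Omega> \<rho> M \<longleftrightarrow>
     (\<exists>\<S>. matching_simplicial_submesh \<Omega> M \<S> \<and>
        (\<forall>\<tau>\<in>\<S>. inradius \<tau> \<ge> \<rho> * diameter \<tau>) \<and>
        (\<forall>T\<in>elements M. \<forall>\<tau>\<in>\<S>. \<tau> \<subseteq> closure T \<longrightarrow> diameter \<tau> \<ge> \<rho> * diameter T)) \<and>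
     (\<forall>T\<in>elements M. \<exists>z. \<forall>y\<in>ball z (\<rho> * diameter T). y \<in> T \<and> (\<forall>x\<in>T. closed_segment y x \<subseteq> T))"

definition regular_mesh_sequence :: "point set \<Rightarrow> real \<Rightarrow> (nat \<Rightarrow> mesh) \<Rightarrow> bool" where
  "regular_mesh_sequence \<Omega> \<rho> \<M> \<longleftrightarrow>
     (\<forall>n. polygonal_mesh \<Omega> (\<M> n) \<and> regular_mesh \<Omega> \<rho> (\<M> n)) \<and>
     (\<exists>c>0. \<forall>n. \<forall>T\<in>elements (\<M> n). ball (centre (\<M> n) T) (c * diameter T) \<subseteq> T)"

section \<open>Calculus and polynomial spaces\<close>

definition area_integral :: "point set \<Rightarrow> (point \<Rightarrow> real) \<Rightarrow> real" where
  "area_integral T f = set_lebesgue_integral lborel T f"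

text \<open>The integral with respect to arc length; it does not depend on the order of the end points.\<close>

definition edge_integral :: "point set \<Rightarrow> (point \<Rightarrow> real) \<Rightarrow> real" where
  "edge_integral E f = (let (a, b) = (SOME (a, b). E = open_segment a b) in
     dist a b * set_lebesgue_integral lborel {0..1} (\<lambda>s. f ((1 - s) *\<^sub>R a + s *\<^sub>R b)))"

definition divergence :: "(point \<Rightarrow> real^2) \<Rightarrow> point \<Rightarrow> real" where
  "divergence w x = trace (jacobian w (at x))"

definition tensor_divergence :: "(point \<Rightarrow> real^2^2) \<Rightarrow> point \<Rightarrow> real^2" where
  "tensor_divergence \<zeta> x = (\<chi> i. divergence (\<lambda>y. \<zeta> y $ i) x)"

definition directional_deriv :: "point \<Rightarrow> (point \<Rightarrow> real) \<Rightarrow> point \<Rightarrow> real" where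
  "directional_deriv d r x = deriv (\<lambda>s. r (x + s *\<^sub>R d)) 0"

definition sym_part :: "real^2^2 \<Rightarrow> real^2^2" where
  "sym_part A = (1 / 2) *\<^sub>R (A + transpose A)"

definition stiffness :: "real \<Rightarrow> real \<Rightarrow> real^2^2 \<Rightarrow> real^2^2" where
  "stiffness \<beta>\<^sub>0 \<beta>\<^sub>1 A = \<beta>\<^sub>0 *\<^sub>R sym_part A + (\<beta>\<^sub>1 * trace A) *\<^sub>R mat 1"

text \<open>Polynomial functions on \<open>Y\<close> are represented by their values on the closure of \<open>Y\<close>, so that
  they can be evaluated on the boundary of an element and at the end points of an edge, and are
  set to zero elsewhere, so that they are determined by their values on \<open>Y\<close>.\<close>

definition poly_space :: "int \<Rightarrow> point set \<Rightarrow> (point \<Rightarrow> real) set" where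
  "poly_space l Y = {f. \<exists>c. \<forall>x. f x =
     (if x \<in> closure Y
      then \<Sum>(i, j) | int i + int j \<le> l. c i j * (x $ 1) ^ i * (x $ 2) ^ j else 0)}"

definition vec_poly_space :: "int \<Rightarrow> point set \<Rightarrow> (point \<Rightarrow> real^2) set" where
  "vec_poly_space l Y = {f. \<forall>i. (\<lambda>x. f x $ i) \<in> poly_space l Y}"

definition tensor_poly_space :: "int \<Rightarrow> point set \<Rightarrow> (point \<Rightarrow> real^2^2) set" where
  "tensor_poly_space l Y = {f. \<forall>i. (\<lambda>x. f x $ i) \<in> vec_poly_space l Y}"

definition Rc_space :: "mesh \<Rightarrow> int \<Rightarrow> point set \<Rightarrow> (point \<Rightarrow> real^2) set" where
  "Rc_space M l T = {f. \<exists>p\<in>poly_space (l - 1) T. f = (\<lambda>x. p x *\<^sub>R (x - centre M T))}"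

definition tensor_Rc_space :: "mesh \<Rightarrow> int \<Rightarrow> point set \<Rightarrow> (point \<Rightarrow> real^2^2) set" where
  "tensor_Rc_space M l T = {f. \<forall>i. (\<lambda>x. f x $ i) \<in> Rc_space M l T}"

text \<open>Functions on the boundary of \<open>T\<close>, again extended by zero.\<close>

definition boundary_poly_space :: "mesh \<Rightarrow> int \<Rightarrow> point set \<Rightarrow> (point \<Rightarrow> real) set" where
  "boundary_poly_space M l T = {f. continuous_on (frontier T) f \<and> (\<forall>x. x \<notin> frontier T \<longrightarrow> f x = 0) \<and>
     (\<forall>E\<in>element_edges M T. (\<lambda>x. if x \<in> closure E then f x else 0) \<in> poly_space l E)}"

definition vec_boundary_poly_space :: "mesh \<Rightarrow> int \<Rightarrow> point set \<Rightarrow> (point \<Rightarrow> real^2) set" where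
  "vec_boundary_poly_space M l T = {f. \<forall>i. (\<lambda>x. f x $ i) \<in> boundary_poly_space M l T}"

definition edge_proj :: "int \<Rightarrow> point set \<Rightarrow> (point \<Rightarrow> real) \<Rightarrow> point \<Rightarrow> real" where
  "edge_proj l E f = (THE p. p \<in> poly_space l E \<and>
     (\<forall>r\<in>poly_space l E. edge_integral E (\<lambda>x. p x * r x) = edge_integral E (\<lambda>x. f x * r x)))"

definition vec_edge_proj :: "int \<Rightarrow> point set \<Rightarrow> (point \<Rightarrow> real^2) \<Rightarrow> point \<Rightarrow> real^2" where
  "vec_edge_proj l E f x = (\<chi> i. edge_proj l E (\<lambda>y. f y $ i) x)"

section \<open>Discrete rotations\<close>

text \<open>As usual for families indexed by a set, the values outside the mesh are irrelevant.\<close>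

record rotation =
  rot_T :: "point set \<Rightarrow> point \<Rightarrow> real^2"
  rot_E :: "point set \<Rightarrow> point \<Rightarrow> real^2"
  rot_V :: "point \<Rightarrow> real^2"

definition H1_space :: "nat \<Rightarrow> mesh \<Rightarrow> rotation set" where
  "H1_space k M = {v. (\<forall>T\<in>elements M. rot_T v T \<in> vec_poly_space (int k) T) \<and>
     (\<forall>E\<in>edges M. rot_E v E \<in> vec_poly_space (int k) E)}"

definition H10_space :: "nat \<Rightarrow> point set \<Rightarrow> mesh \<Rightarrow> rotation set" where
  "H10_space k \<Omega> M = {v \<in> H1_space k M.
     (\<forall>E\<in>edges M. E \<subseteq> frontier \<Omega> \<longrightarrow> rot_E v E = (\<lambda>x. 0)) \<and>
     (\<forall>V\<in>mesh_vertices M. V \<in> frontier \<Omega> \<longrightarrow> rot_V v V = 0)}"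

definition rot_diff :: "rotation \<Rightarrow> rotation \<Rightarrow> rotation" where
  "rot_diff v w = \<lparr>rot_T = (\<lambda>T x. rot_T v T x - rot_T w T x),
     rot_E = (\<lambda>E x. rot_E v E x - rot_E w E x), rot_V = (\<lambda>V. rot_V v V - rot_V w V)\<rparr>"

definition trace1 :: "nat \<Rightarrow> mesh \<Rightarrow> point set \<Rightarrow> rotation \<Rightarrow> point \<Rightarrow> real^2" where
  "trace1 k M T v = (THE g. g \<in> vec_boundary_poly_space M (int k + 2) T \<and>
     (\<forall>E\<in>element_edges M T. vec_edge_proj (int k) E g = rot_E v E) \<and>
     (\<forall>V\<in>element_vertices M T. g V = rot_V v V))"

text \<open>The inner product on \<^typ>\<open>real^2^2\<close> is the Frobenius product.\<close>

definition grad1 :: "nat \<Rightarrow> mesh \<Rightarrow> point set \<Rightarrow> rotation \<Rightarrow> point \<Rightarrow> real^2^2" where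
  "grad1 k M T v = (THE G. G \<in> tensor_poly_space (int k + 1) T \<and>
     (\<forall>\<zeta>\<in>tensor_poly_space (int k + 1) T.
        area_integral T (\<lambda>x. G x \<bullet> \<zeta> x) =
        - area_integral T (\<lambda>x. rot_T v T x \<bullet> tensor_divergence \<zeta> x)
        + (\<Sum>E\<in>element_edges M T.
             \<omega>TE M T E * edge_integral E (\<lambda>x. trace1 k M T v x \<bullet> (\<zeta> x *v normal M E)))))"

definition sym_grad1 :: "nat \<Rightarrow> mesh \<Rightarrow> point set \<Rightarrow> rotation \<Rightarrow> point \<Rightarrow> real^2^2" where
  "sym_grad1 k M T v x = sym_part (grad1 k M T v x)"

definition global_sym_grad1 :: "nat \<Rightarrow> mesh \<Rightarrow> rotation \<Rightarrow> point \<Rightarrow> real^2^2" where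
  "global_sym_grad1 k M v x = (\<Sum>T\<in>elements M. indicator T x *\<^sub>R sym_grad1 k M T v x)"

definition potential :: "nat \<Rightarrow> mesh \<Rightarrow> point set \<Rightarrow> rotation \<Rightarrow> point \<Rightarrow> real^2" where
  "potential k M T v = (THE P. P \<in> vec_poly_space (int k + 2) T \<and>
     (\<forall>\<eta>\<in>tensor_Rc_space M (int k + 3) T.
        area_integral T (\<lambda>x. P x \<bullet> tensor_divergence \<eta> x) =
        - area_integral T (\<lambda>x. grad1 k M T v x \<bullet> \<eta> x)
        + (\<Sum>E\<in>element_edges M T.
             \<omega>TE M T E * edge_integral E (\<lambda>x. trace1 k M T v x \<bullet> (\<eta> x *v normal M E)))))"

definition stab1 :: "nat \<Rightarrow> mesh \<Rightarrow> point set \<Rightarrow> rotation \<Rightarrow> rotation \<Rightarrow> real" where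
  "stab1 k M T v w = (\<Sum>E\<in>element_edges M T. diameter E * edge_integral E
     (\<lambda>x. (potential k M T v x - trace1 k M T v x) \<bullet> (potential k M T w x - trace1 k M T w x)))"

definition inner1 :: "nat \<Rightarrow> mesh \<Rightarrow> rotation \<Rightarrow> rotation \<Rightarrow> real" where
  "inner1 k M v w = (\<Sum>T\<in>elements M.
     area_integral T (\<lambda>x. potential k M T v x \<bullet> potential k M T w x) + stab1 k M T v w)"

definition norm1 :: "nat \<Rightarrow> mesh \<Rightarrow> rotation \<Rightarrow> real" where
  "norm1 k M v = sqrt (inner1 k M v v)"

section \<open>Discrete displacements\<close>

record displacement =
  dis_T :: "point set \<Rightarrow> point \<Rightarrow> real"
  dis_E :: "point set \<Rightarrow> point \<Rightarrow> real"
  dis_Gn :: "point set \<Rightarrow> point \<Rightarrow> real"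
  dis_V :: "point \<Rightarrow> real"
  dis_GV :: "point \<Rightarrow> real^2"

definition H2_space :: "nat \<Rightarrow> mesh \<Rightarrow> displacement set" where
  "H2_space k M = {q. (\<forall>T\<in>elements M. dis_T q T \<in> poly_space (int k - 1) T) \<and>
     (\<forall>E\<in>edges M. dis_E q E \<in> poly_space (int k - 1) E \<and> dis_Gn q E \<in> poly_space (int k) E)}"

definition H210_space :: "nat \<Rightarrow> point set \<Rightarrow> mesh \<Rightarrow> displacement set" where
  "H210_space k \<Omega> M = {q \<in> H2_space k M.
     (\<forall>E\<in>edges M. E \<subseteq> frontier \<Omega> \<longrightarrow> dis_E q E = (\<lambda>x. 0)) \<and>
     (\<forall>V\<in>mesh_vertices M. V \<in> frontier \<Omega> \<longrightarrow> dis_V q V = 0)}"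

definition trace2 :: "nat \<Rightarrow> mesh \<Rightarrow> point set \<Rightarrow> displacement \<Rightarrow> point \<Rightarrow> real" where
  "trace2 k M T q = (THE g. g \<in> boundary_poly_space M (int k + 1) T \<and>
     (\<forall>E\<in>element_edges M T. edge_proj (int k - 1) E g = dis_E q E) \<and>
     (\<forall>V\<in>element_vertices M T. g V = dis_V q V))"

definition tangential_grad2 :: "nat \<Rightarrow> mesh \<Rightarrow> point set \<Rightarrow> displacement \<Rightarrow> point \<Rightarrow> real" where
  "tangential_grad2 k M E q = (THE g. g \<in> poly_space (int k) E \<and>
     (\<forall>r\<in>poly_space (int k) E.
        edge_integral E (\<lambda>x. g x * r x) =
        - edge_integral E (\<lambda>x. dis_E q E x * directional_deriv (tangent M E) r x)
        + (\<Sum>V\<in>edge_vertices E. \<omega>EV M E V * dis_V q V * r V)))"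

definition element_grad2 :: "nat \<Rightarrow> mesh \<Rightarrow> point set \<Rightarrow> displacement \<Rightarrow> point \<Rightarrow> real^2" where
  "element_grad2 k M T q = (THE G. G \<in> vec_poly_space (int k) T \<and>
     (\<forall>w\<in>vec_poly_space (int k) T.
        area_integral T (\<lambda>x. G x \<bullet> w x) =
        - area_integral T (\<lambda>x. dis_T q T x * divergence w x)
        + (\<Sum>E\<in>element_edges M T.
             \<omega>TE M T E * edge_integral E (\<lambda>x. trace2 k M T q x * (w x \<bullet> normal M E)))))"

definition grad2 :: "nat \<Rightarrow> mesh \<Rightarrow> displacement \<Rightarrow> rotation" where
  "grad2 k M q = \<lparr>rot_T = (\<lambda>T. element_grad2 k M T q),
     rot_E = (\<lambda>E x. tangential_grad2 k M E q x *\<^sub>R tangent M E + dis_Gn q E x *\<^sub>R normal M E),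
     rot_V = dis_GV q\<rparr>"

section \<open>Bilinear form and energy norm\<close>

definition A_form :: "nat \<Rightarrow> point set \<Rightarrow> mesh \<Rightarrow> real \<Rightarrow> real \<Rightarrow> real \<Rightarrow> real \<Rightarrow>
    rotation \<times> displacement \<Rightarrow> rotation \<times> displacement \<Rightarrow> real" where
  "A_form k \<Omega> M \<kappa> \<beta>\<^sub>0 \<beta>\<^sub>1 t = (\<lambda>(\<xi>, w) (\<phi>, v).
     area_integral \<Omega>
       (\<lambda>x. stiffness \<beta>\<^sub>0 \<beta>\<^sub>1 (global_sym_grad1 k M \<xi> x) \<bullet> global_sym_grad1 k M \<phi> x)
     + \<beta>\<^sub>0 * (\<Sum>T\<in>elements M. stab1 k M T \<xi> \<phi> / (diameter T)\<^sup>2)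
     + \<kappa> / t\<^sup>2 * inner1 k M (rot_diff \<xi> (grad2 k M w)) (rot_diff \<phi> (grad2 k M v)))"

definition energy_norm :: "nat \<Rightarrow> point set \<Rightarrow> mesh \<Rightarrow> real \<Rightarrow> real \<Rightarrow> real \<Rightarrow> real \<Rightarrow>
    rotation \<times> displacement \<Rightarrow> real" where
  "energy_norm k \<Omega> M \<kappa> \<beta>\<^sub>0 \<beta>\<^sub>1 t = (\<lambda>(\<phi>, v). sqrt (
     area_integral \<Omega> (\<lambda>x. (norm (stiffness \<beta>\<^sub>0 \<beta>\<^sub>1 (global_sym_grad1 k M \<phi> x)))\<^sup>2)
     + \<beta>\<^sub>0 * (\<Sum>T\<in>elements M. stab1 k M T \<phi> \<phi> / (diameter T)\<^sup>2)
     + \<kappa> / t\<^sup>2 * (norm1 k M (rot_diff \<phi> (grad2 k M v)))\<^sup>2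
     + min \<kappa> \<beta>\<^sub>0 * ((norm1 k M \<phi>)\<^sup>2 + (norm1 k M (grad2 k M v))\<^sup>2)))"

end

theory Submission
  imports Defs "HOL-Computational_Algebra.Polynomial"
begin

text \<open>The form controls everything but the discrete \<open>L\<^sup>2\<close> norms of the rotation and of the discrete gradient
  of the displacement; the latter is bounded by the former and the shear term, as \<open>t \<le> t_max\<close>. So it
  suffices to prove a discrete Korn-Poincare inequality for a rotation that vanishes on the boundary, with
  a constant independent of the mesh.

  For a field \<open>p\<close> and a direction \<open>\<xi> = (1, s)\<close>, the derivative of \<open>p \<bullet> \<xi>\<close> along \<open>\<xi>\<close> only involves the
  symmetric gradient, since \<open>\<xi> \<bullet> (\<nabla>p \<xi>) = \<xi> \<bullet> (\<nabla>\<^sub>s p \<xi>)\<close>.  Integrating along a ray from \<open>x\<close> out of the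
  domain bounds \<open>\<bar>p(x) \<bullet> \<xi>\<bar>\<close> by the elementwise symmetric gradient on the ray and by the differences of
  \<open>p\<close> with the single-valued trace at the crossed edges.  Two components of \<open>p\<close> are recovered from the
  directions \<open>s \<in> [0, 1]\<close>.  Averaging over \<open>s\<close>, an element \<open>T\<close> contributes its jumps with the weight
  \<open>h\<^sub>T / (h\<^sub>T + \<bar>x - z\<^sub>T\<bar>)\<close>, the fraction of rays that meet it, and a Schur test bounds the resulting sum
  by the stabilisation, because the elements contain disjoint balls of comparable size.  Inverse
  inequalities compare the jumps and the symmetric gradient of the potential with the stabilisation and
  the discrete symmetric gradient.\<close>

section \<open>Orthonormal bases of function spaces\<close>

text \<open>The operators of the scheme are definite descriptions, so a trace, gradient or potential
  is accessible only after existence and uniqueness; each is a Riesz representative in a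
  finite-dimensional polynomial space. Orthonormal bases give these representatives and also the
  inverse inequalities, proved on one reference ball and one reference segment and carried over by
  scaling, so that no constant depends on the shape of an element. Star-shapedness with respect to a
  ball shapes the geometry. The line of an edge misses that ball, hence the element lies locally on
  one side of each edge and its indicator along a generic line is a sum of steps. This identity is
  used twice: on coordinate lines it gives the divergence theorem, on slanted rays the pointwise
  bound. Exceptional lines, through a vertex or along an edge, are finitely many among the rays from
  one point. A compactness argument would not give one constant for all meshes. Here every constant
  is explicit in \<open>diameter \<Omega>\<close>, \<open>\<rho>\<close>, \<open>t_max\<close>, the
  material data and two inverse constants; the domain enters through a bound on the length of its
  rays.\<close>

definition fspan :: "('i \<Rightarrow> 'a \<Rightarrow> real) \<Rightarrow> 'i set \<Rightarrow> ('a \<Rightarrow> real) set" where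
  "fspan g I = {f. \<exists>c. f = (\<lambda>x. \<Sum>i\<in>I. c i * g i x)}"

lemma fspan_add: "f \<in> fspan g I \<Longrightarrow> h \<in> fspan g I \<Longrightarrow> (\<lambda>x. f x + h x) \<in> fspan g I"
  unfolding fspan_def
proof (clarify)
  fix c d show "\<exists>e. (\<lambda>x. (\<Sum>i\<in>I. c i * g i x) + (\<Sum>i\<in>I. d i * g i x)) = (\<lambda>x. \<Sum>i\<in>I. e i * g i x)"
    by (rule exI[of _ "\<lambda>i. c i + d i"]) (simp add: distrib_right sum.distrib)
qed

lemma fspan_scale: "f \<in> fspan g I \<Longrightarrow> (\<lambda>x. a * f x) \<in> fspan g I"
  unfolding fspan_def
proof (clarify)
  fix c show "\<exists>e. (\<lambda>x. a * (\<Sum>i\<in>I. c i * g i x)) = (\<lambda>x. \<Sum>i\<in>I. e i * g i x)"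
    by (rule exI[of _ "\<lambda>i. a * c i"]) (simp add: sum_distrib_left mult.assoc)
qed

lemma fspan_zero: "(\<lambda>x. 0) \<in> fspan g I"
  unfolding fspan_def by (auto intro!: exI[of _ "\<lambda>i. 0"])

lemma fspan_sum:
  "finite J \<Longrightarrow> (\<And>j. j \<in> J \<Longrightarrow> h j \<in> fspan g I) \<Longrightarrow> (\<lambda>x. \<Sum>j\<in>J. a j * h j x) \<in> fspan g I"
proof (induction rule: finite_induct)
  case empty then show ?case by (simp add: fspan_zero)
next
  case (insert j J)
  have "(\<lambda>x. a j * h j x + (\<Sum>j\<in>J. a j * h j x)) \<in> fspan g I"
    by (intro fspan_add fspan_scale) (use insert in auto)
  then show ?case using insert by simp
qed

text \<open>The laws are restricted to \<open>V\<close> because the products are integrals, which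
  are additive only on functions such as the continuous ones in the space. Closure of
  \<open>V\<close> under linear combinations comes from \<open>fspan\<close>.\<close>

locale fun_inner =
  fixes V :: "('a \<Rightarrow> real) set" and B :: "('a \<Rightarrow> real) \<Rightarrow> ('a \<Rightarrow> real) \<Rightarrow> real"
  assumes sym: "f \<in> V \<Longrightarrow> h \<in> V \<Longrightarrow> B f h = B h f"
    and add: "f \<in> V \<Longrightarrow> f' \<in> V \<Longrightarrow> h \<in> V \<Longrightarrow> B (\<lambda>x. f x + f' x) h = B f h + B f' h"
    and scale: "f \<in> V \<Longrightarrow> h \<in> V \<Longrightarrow> B (\<lambda>x. a * f x) h = a * B f h"
    and pos: "f \<in> V \<Longrightarrow> f \<noteq> (\<lambda>x. 0) \<Longrightarrow> 0 < B f f"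

lemma (in fun_inner) sum_left:
  assumes "finite J" "V = fspan g I" "\<And>j. j \<in> J \<Longrightarrow> h j \<in> V" "f \<in> V"
  shows "B (\<lambda>x. \<Sum>j\<in>J. a j * h j x) f = (\<Sum>j\<in>J. a j * B (h j) f)"
  using assms(1,3)
proof (induction rule: finite_induct)
  case empty
  show ?case using scale[of "\<lambda>x. 0" f 0] fspan_zero[of g I] assms(2,4) by simp
next
  case (insert j J)
  have *: "(\<lambda>x. \<Sum>j\<in>J. a j * h j x) \<in> V"
    unfolding assms(2) by (rule fspan_sum) (use insert assms in auto)
  have **: "(\<lambda>x. a j * h j x) \<in> V" using insert assms(2) fspan_scale by blast
  have "B (\<lambda>x. a j * h j x + (\<Sum>j\<in>J. a j * h j x)) f = a j * B (h j) f + (\<Sum>j\<in>J. a j * B (h j) f)"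
    using insert add[OF ** *] scale[of "h j" f "a j"] assms(4) by auto
  then show ?case using insert by simp
qed

text \<open>Gram-Schmidt, one generator at a time; the generators may be dependent. The basis is
  recorded only through its reproducing formula, which yields Riesz representatives and pointwise
  bounds directly.\<close>

lemma orthonormal_basis:
  fixes g :: "'i \<Rightarrow> 'a \<Rightarrow> real"
  assumes "finite I" "fun_inner (fspan g I) B"
  shows "\<exists>n (e :: nat \<Rightarrow> 'a \<Rightarrow> real). (\<forall>i<n. e i \<in> fspan g I) \<and>
    (\<forall>f\<in>fspan g I. f = (\<lambda>x. \<Sum>i<n. B f (e i) * e i x))"
  using assms
proof (induction I rule: finite_induct)
  case empty
  show ?case by (intro exI[of _ 0]) (auto simp: fspan_def)
next
  case (insert j I)
  let ?V = "fspan g I" and ?W = "fspan g (insert j I)"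
  interpret W: fun_inner ?W B by (rule insert.prems)
  have gj: "g j \<in> ?W" unfolding fspan_def
  proof (clarify, intro exI ext)
    fix x
    have "(\<Sum>i\<in>insert j I. (if i = j then 1 else 0) * g i x) = (\<Sum>i\<in>insert j I. if i = j then g i x else 0)"
      by (intro sum.cong) auto
    then show "g j x = (\<Sum>i\<in>insert j I. (if i = j then 1 else 0) * g i x)" using insert by simp
  qed
  have VW: "f \<in> ?W" if "f \<in> ?V" for f
  proof -
    obtain c where "f = (\<lambda>x. \<Sum>i\<in>I. c i * g i x)" using \<open>f \<in> ?V\<close> unfolding fspan_def by blast
    then have "f = (\<lambda>x. \<Sum>i\<in>insert j I. (c(j := 0)) i * g i x)"
      using insert by (auto intro!: ext sum.cong)
    then show ?thesis unfolding fspan_def by blast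
  qed
  have "fun_inner ?V B" by unfold_locales (use VW W.sym W.add W.scale W.pos in auto)
  from insert.IH[OF this] obtain n and e :: "nat \<Rightarrow> 'a \<Rightarrow> real" where e: "\<And>i. i < n \<Longrightarrow> e i \<in> ?V"
    and rep: "\<And>f. f \<in> ?V \<Longrightarrow> f = (\<lambda>x. \<Sum>i<n. B f (e i) * e i x)" by blast
  \<comment> \<open>The orthogonal projection of the new generator on the old span; \<open>w\<close>
    below is the residual.\<close>
  define p where "p = (\<lambda>x. \<Sum>i<n. B (g j) (e i) * e i x)"
  have pV: "p \<in> ?V" unfolding p_def by (rule fspan_sum) (use e in auto)
  define w where "w = (\<lambda>x. 1 * g j x + (- 1) * p x)"
  have wW: "w \<in> ?W" unfolding w_def by (intro fspan_add fspan_scale gj VW pV)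
  have decomp: "\<exists>c. \<exists>h\<in>?V. f = (\<lambda>x. c * w x + h x)" if fW: "f \<in> ?W" for f
  proof -
    obtain c where c: "f = (\<lambda>x. \<Sum>i\<in>insert j I. c i * g i x)" using fW by (auto simp: fspan_def)
    have 1: "(\<lambda>x. \<Sum>i\<in>I. c i * g i x) \<in> ?V" by (auto simp: fspan_def)
    have 2: "(\<lambda>x. c j * p x + (\<Sum>i\<in>I. c i * g i x)) \<in> ?V"
      by (intro fspan_add fspan_scale pV 1)
    show ?thesis by (rule exI[of _ "c j"], rule bexI[OF _ 2])
        (use insert in \<open>auto simp: c w_def algebra_simps\<close>)
  qed
  \<comment> \<open>Orthogonality follows from the reproducing formula alone: by symmetry, the
    expansion of \<open>B p f\<close> is the expansion of \<open>f\<close> tested with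
    \<open>g j\<close>.\<close>
  have orth: "B w f = 0" if f: "f \<in> ?V" for f
  proof -
    have "B w f = B (\<lambda>x. 1 * g j x) f + B (\<lambda>x. (-1) * p x) f"
      unfolding w_def by (rule W.add[OF fspan_scale[OF gj] fspan_scale[OF VW[OF pV]] VW[OF f]])
    also have "\<dots> = B (g j) f - B p f"
      using W.scale[OF gj VW[OF f], of 1] W.scale[OF VW[OF pV] VW[OF f], of "-1"] by simp
    also have "B p f = (\<Sum>i<n. B (g j) (e i) * B (e i) f)"
      unfolding p_def by (rule W.sum_left[OF _ refl]) (use e VW f in auto)
    also have "\<dots> = (\<Sum>i<n. B f (e i) * B (e i) (g j))"
      by (rule sum.cong) (use W.sym VW f gj e in \<open>auto simp: mult.commute\<close>)
    also have "\<dots> = B (\<lambda>x. \<Sum>i<n. B f (e i) * e i x) (g j)"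
      by (rule W.sum_left[OF _ refl, symmetric]) (use e VW gj in auto)
    also have "\<dots> = B (g j) f" using rep[OF f, symmetric] W.sym[OF gj VW[OF f]] by simp
    finally show ?thesis by simp
  qed
  show ?case
  \<comment> \<open>A dependent generator leaves the span, and hence the basis, unchanged.\<close>
  proof (cases "w = (\<lambda>x. 0)")
    case True
    have "?W \<subseteq> ?V"
    proof
      fix f assume "f \<in> ?W"
      then obtain c h where "h \<in> ?V" "f = (\<lambda>x. c * w x + h x)" using decomp by blast
      then show "f \<in> ?V" using True by auto
    qed
    then show ?thesis using e rep VW by blast
  next
    case False
    define s where "s = sqrt (B w w)"
    have s: "s > 0" "s * s = B w w" using W.pos[OF wW False] by (auto simp: s_def)
    \<comment> \<open>The normalised residual is appended. The old coefficients stay the same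
      because \<open>w\<close> is orthogonal to the old span.\<close>
    define e' where "e' = e(n := (\<lambda>x. (1/s) * w x))"
    have e'n: "e' n = (\<lambda>x. (1/s) * w x)" by (simp add: e'_def)
    have en: "e' i \<in> ?W" if "i < Suc n" for i
    proof (cases "i = n")
      case True then show ?thesis using fspan_scale[OF wW, of "1/s"] e'n by simp
    next
      case False then show ?thesis using that e VW by (auto simp: e'_def)
    qed
    have "f = (\<lambda>x. \<Sum>i<Suc n. B f (e' i) * e' i x)" if fW: "f \<in> ?W" for f
    proof -
      obtain c h where h: "h \<in> ?V" and f: "f = (\<lambda>x. c * w x + h x)" using decomp[OF fW] by blast
      have Bf: "B f q = c * B w q + B h q" if "q \<in> ?W" for q
        unfolding f using W.add[OF fspan_scale[OF wW] VW[OF h] that] W.scale[OF wW that] by simp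
      have 1: "B f (e i) = B h (e i)" if "i < n" for i
        using Bf[OF VW[OF e[OF that]]] orth[OF e[OF that]] by simp
      have Bhw: "B h w = 0" using orth[OF h] W.sym[OF VW[OF h] wW] by simp
      have "B f (e' n) = (1/s) * B w f"
        using W.sym[OF fW en[of n]] W.scale[OF wW fW, of "1/s"] e'n by simp
      also have "B w f = c * (s * s)" using Bf[OF wW] W.sym[OF fW wW] Bhw unfolding s(2) by simp
      finally have 2: "B f (e' n) = c * s" using s(1) by simp
      have "(\<Sum>i<Suc n. B f (e' i) * e' i x) = f x" for x
      proof -
        have "(\<Sum>i<n. B f (e' i) * e' i x) = (\<Sum>i<n. B h (e i) * e i x)"
          by (rule sum.cong) (auto simp: e'_def 1)
        also have "\<dots> = h x" using fun_cong[OF rep[OF h], of x] by simp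
        finally show ?thesis using 2 s by (simp add: f e'n)
      qed
      then show ?thesis by auto
    qed
    then show ?thesis using en by blast
  qed
qed

text \<open>The coefficients of the representative in an orthonormal basis are the values of
  \<open>L\<close> on it. Linearity of \<open>L\<close> is asked on the span only, since the
  functionals are again integrals.\<close>

lemma riesz_representation:
  fixes g :: "'i \<Rightarrow> 'a \<Rightarrow> real"
  assumes "finite I" "fun_inner (fspan g I) B"
    and Ladd: "\<And>f h. f \<in> fspan g I \<Longrightarrow> h \<in> fspan g I \<Longrightarrow> L (\<lambda>x. f x + h x) = L f + L h"
    and Lscale: "\<And>f a. f \<in> fspan g I \<Longrightarrow> L (\<lambda>x. a * f x) = a * L f"
  shows "\<exists>w\<in>fspan g I. \<forall>f\<in>fspan g I. B w f = L f"
proof -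
  interpret fun_inner "fspan g I" B by (rule assms(2))
  obtain n and e :: "nat \<Rightarrow> 'a \<Rightarrow> real" where e: "\<And>i. i < n \<Longrightarrow> e i \<in> fspan g I"
    and rep: "\<And>f. f \<in> fspan g I \<Longrightarrow> f = (\<lambda>x. \<Sum>i<n. B f (e i) * e i x)"
    using orthonormal_basis[OF assms(1,2)] by blast
  let ?w = "\<lambda>x. \<Sum>i<n. L (e i) * e i x"
  have Lsum: "L (\<lambda>x. \<Sum>i<m. a i * e i x) = (\<Sum>i<m. a i * L (e i))" if "m \<le> n" for m a
    using that
  proof (induction m)
    case 0 show ?case using Lscale[OF fspan_zero, of 0] by simp
  next
    case (Suc m)
    have "(\<lambda>x. \<Sum>i<m. a i * e i x) \<in> fspan g I" by (rule fspan_sum) (use e Suc in auto)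
    then show ?case using Suc Ladd[of "\<lambda>x. \<Sum>i<m. a i * e i x" "\<lambda>x. a m * e m x"] e[of m]
        fspan_scale[OF e[of m], of "a m"] Lscale[OF e[of m], of "a m"] by simp
  qed
  show ?thesis
  proof (intro bexI[of _ ?w] ballI)
    show "?w \<in> fspan g I" by (rule fspan_sum) (use e in auto)
    fix f assume f: "f \<in> fspan g I"
    have "B ?w f = (\<Sum>i<n. L (e i) * B (e i) f)" by (rule sum_left[OF _ refl]) (use e f in auto)
    also have "\<dots> = (\<Sum>i<n. B f (e i) * L (e i))"
      by (rule sum.cong) (use sym e f in \<open>auto simp: mult.commute\<close>)
    also have "\<dots> = L (\<lambda>x. \<Sum>i<n. B f (e i) * e i x)" using Lsum[of n] by simp
    also have "\<dots> = L f" using rep[OF f] by simp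
    finally show "B ?w f = L f" .
  qed
qed

text \<open>The residual of \<open>f\<close> after projection on \<open>h\<close> has a nonnegative
  square.\<close>

lemma (in fun_inner) cauchy_schwarz:
  assumes f: "f \<in> V" and h: "h \<in> V"
    and cl: "\<And>f h a. f \<in> V \<Longrightarrow> h \<in> V \<Longrightarrow> (\<lambda>x. a * f x) \<in> V \<and> (\<lambda>x. f x + h x) \<in> V"
  shows "(B f h)\<^sup>2 \<le> B f f * B h h"
proof (cases "h = (\<lambda>x. 0)")
  case True
  have "B h f = 0" using scale[OF h f, of 0] True by simp
  moreover have "B h h = 0" using scale[OF h h, of 0] True by simp
  ultimately show ?thesis using sym[OF f h] by simp
next
  case False
  have p: "0 < B h h" using pos[OF h False] .
  define a where "a = - B f h / B h h"
  define q where "q = (\<lambda>x. f x + a * h x)"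
  have ah: "(\<lambda>x. a * h x) \<in> V" using cl h by blast
  have qV: "q \<in> V" unfolding q_def using cl[OF f ah] by blast
  have "B q h = B f h + a * B h h" unfolding q_def using add[OF f ah h] scale[OF h h, of a] by simp
  then have qh: "B q h = 0" using p by (simp add: a_def)
  have "B q q = B f q + a * B h q" using add[OF f ah qV] scale[OF h qV, of a] unfolding q_def by simp
  also have "B h q = 0" using qh sym qV h by simp
  also have "B f q = B q f" using sym f qV by simp
  also have "B q f = B f f + a * B h f" unfolding q_def using add[OF f ah f] scale[OF h f, of a] by simp
  finally have "B q q = B f f - (B f h)\<^sup>2 / B h h"
    using sym[OF f h] by (simp add: a_def power2_eq_square)
  moreover have "0 \<le> B q q"
    using pos[OF qV] scale[OF qV qV, of 0] by (cases "q = (\<lambda>x. 0)") (auto simp: less_imp_le)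
  ultimately have "0 \<le> (B f f - (B f h)\<^sup>2 / B h h) * B h h" using p by (simp add: less_imp_le)
  then show ?thesis using p by (simp add: left_diff_distrib)
qed

text \<open>Equivalence of norms in finite dimension without compactness: expand in the basis and
  bound the coefficients by Cauchy-Schwarz. \<open>S\<close> is unrelated to the set behind
  \<open>B\<close>, so that an integral over a small ball can control values on a larger
  one.\<close>

lemma pointwise_bound:
  fixes g :: "'i \<Rightarrow> 'a \<Rightarrow> real"
  assumes "finite I" "fun_inner (fspan g I) B"
    and bnd: "\<And>i x. i \<in> I \<Longrightarrow> x \<in> S \<Longrightarrow> \<bar>g i x\<bar> \<le> K"
  shows "\<exists>C>0. \<forall>f\<in>fspan g I. \<forall>x\<in>S. (f x)\<^sup>2 \<le> C * B f f"
proof -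
  interpret fun_inner "fspan g I" B by (rule assms(2))
  obtain n and e :: "nat \<Rightarrow> 'a \<Rightarrow> real" where e: "\<And>i. i < n \<Longrightarrow> e i \<in> fspan g I"
    and rep: "\<And>f. f \<in> fspan g I \<Longrightarrow> f = (\<lambda>x. \<Sum>i<n. B f (e i) * e i x)"
    using orthonormal_basis[OF assms(1,2)] by blast
  have "\<forall>i<n. \<exists>K'. \<forall>x\<in>S. \<bar>e i x\<bar> \<le> K'"
  proof (intro allI impI)
    fix i assume "i < n"
    then obtain c where c: "e i = (\<lambda>x. \<Sum>i\<in>I. c i * g i x)" using e by (auto simp: fspan_def)
    show "\<exists>K'. \<forall>x\<in>S. \<bar>e i x\<bar> \<le> K'"
    proof (intro exI ballI)
      fix x assume x: "x \<in> S"
      have "\<bar>e i x\<bar> \<le> (\<Sum>i\<in>I. \<bar>c i * g i x\<bar>)" unfolding c by (rule sum_abs)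
      also have "\<dots> \<le> (\<Sum>i\<in>I. \<bar>c i\<bar> * K)"
        by (rule sum_mono) (use bnd x in \<open>auto simp: abs_mult mult_left_mono\<close>)
      finally show "\<bar>e i x\<bar> \<le> (\<Sum>i\<in>I. \<bar>c i\<bar> * K)" .
    qed
  qed
  then obtain K' where K': "\<And>i x. i < n \<Longrightarrow> x \<in> S \<Longrightarrow> \<bar>e i x\<bar> \<le> K' i" by metis
  have ee: "0 \<le> B f f" if "f \<in> fspan g I" for f
    using pos[OF that] scale[OF that that, of 0] by (cases "f = (\<lambda>x. 0)") (auto simp: less_imp_le)
  define C where "C = (\<Sum>i<n. sqrt (B (e i) (e i)) * \<bar>K' i\<bar>)"
  have C0: "C \<ge> 0" unfolding C_def by (rule sum_nonneg) (use ee e in auto)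
  \<comment> \<open>The summand 1 keeps the final constant positive even if the basis is
    empty.\<close>
  have "(f x)\<^sup>2 \<le> (C\<^sup>2 + 1) * B f f" if f: "f \<in> fspan g I" and x: "x \<in> S" for f x
  proof -
    have "\<bar>f x\<bar> = \<bar>\<Sum>i<n. B f (e i) * e i x\<bar>" using fun_cong[OF rep[OF f], of x] by simp
    also have "\<dots> \<le> (\<Sum>i<n. \<bar>B f (e i) * e i x\<bar>)" by (rule sum_abs)
    also have "\<dots> \<le> (\<Sum>i<n. (sqrt (B f f) * sqrt (B (e i) (e i))) * \<bar>K' i\<bar>)"
    proof (rule sum_mono)
      fix i assume i: "i \<in> {..<n}"
      have "(B f (e i))\<^sup>2 \<le> B f f * B (e i) (e i)"
        by (rule cauchy_schwarz) (use f e i fspan_add fspan_scale in auto)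
      then have "\<bar>B f (e i)\<bar> \<le> sqrt (B f f) * sqrt (B (e i) (e i))"
        by (metis real_sqrt_abs real_sqrt_le_mono real_sqrt_mult)
      moreover have "\<bar>e i x\<bar> \<le> \<bar>K' i\<bar>" using K'[of i x] i x by fastforce
      ultimately show "\<bar>B f (e i) * e i x\<bar> \<le> (sqrt (B f f) * sqrt (B (e i) (e i))) * \<bar>K' i\<bar>"
        unfolding abs_mult by (intro mult_mono) (use ee f e i in auto)
    qed
    also have "\<dots> = C * sqrt (B f f)" unfolding C_def sum_distrib_right by (rule sum.cong) (auto simp: mult_ac)
    finally have "\<bar>f x\<bar> \<le> C * sqrt (B f f)" .
    then have "(f x)\<^sup>2 \<le> (C * sqrt (B f f))\<^sup>2" using C0 ee[OF f] by (intro abs_le_square_iff[THEN iffD1]) auto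
    also have "\<dots> = C\<^sup>2 * B f f" using ee[OF f] by (simp add: power_mult_distrib)
    finally show ?thesis using ee[OF f] by (simp add: algebra_simps)
  qed
  then show ?thesis by (intro exI[of _ "C\<^sup>2+1"]) (auto simp: add_nonneg_pos)
qed

section \<open>Bivariate polynomials\<close>

text \<open>Empty for negative \<open>l\<close>, so that the span is \<open>{0}\<close>, as the
  convention for negative degrees demands.\<close>

definition idx :: "int \<Rightarrow> (nat \<times> nat) set" where
  "idx l = {(i, j). int i + int j \<le> l}"

definition monom2 :: "nat \<times> nat \<Rightarrow> point \<Rightarrow> real" where
  "monom2 = (\<lambda>(i, j) x. (x $ 1) ^ i * (x $ 2) ^ j)"

definition pfun :: "int \<Rightarrow> (point \<Rightarrow> real) set" where
  "pfun l = fspan monom2 (idx l)"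

text \<open>Functions of the discrete spaces are cut-offs of global polynomials. Calculus is done on
  the global polynomial, which is smooth across the boundary, and \<open>cut\<close> carries the
  result back.\<close>

definition cut :: "point set \<Rightarrow> (point \<Rightarrow> 'a) \<Rightarrow> point \<Rightarrow> 'a::zero" where
  "cut Y f = (\<lambda>x. if x \<in> closure Y then f x else 0)"

lemma cut_in [simp]: "x \<in> closure Y \<Longrightarrow> cut Y f x = f x"
  and cut_out [simp]: "x \<notin> closure Y \<Longrightarrow> cut Y f x = 0"
  by (auto simp: cut_def)

lemma finite_idx [simp]: "finite (idx l)"
proof (rule finite_subset)
  show "idx l \<subseteq> {..nat l} \<times> {..nat l}" by (auto simp: idx_def)
qed auto

lemma pfun_add: "f \<in> pfun l \<Longrightarrow> g \<in> pfun l \<Longrightarrow> (\<lambda>x. f x + g x) \<in> pfun l"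
  and pfun_scale: "f \<in> pfun l \<Longrightarrow> (\<lambda>x. a * f x) \<in> pfun l"
  and pfun_zero [simp]: "(\<lambda>x. 0) \<in> pfun l"
  and pfun_lincomb: "finite J \<Longrightarrow> (\<And>j. j \<in> J \<Longrightarrow> h j \<in> pfun l) \<Longrightarrow> (\<lambda>x. \<Sum>j\<in>J. c j * h j x) \<in> pfun l"
  unfolding pfun_def by (rule fspan_add fspan_scale fspan_zero fspan_sum; assumption)+

lemma pfun_diff: "f \<in> pfun l \<Longrightarrow> g \<in> pfun l \<Longrightarrow> (\<lambda>x. f x - g x) \<in> pfun l"
  using pfun_add[of f l "\<lambda>x. (-1) * g x"] pfun_scale[of g l "-1"] by simp

lemma pfunE:
  assumes "f \<in> pfun l" obtains c where "f = (\<lambda>x. \<Sum>k\<in>idx l. c k * monom2 k x)"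
  using assms unfolding pfun_def fspan_def by blast

lemma monom2_pfun: "k \<in> idx l \<Longrightarrow> monom2 k \<in> pfun l"
proof -
  assume k: "k \<in> idx l"
  have "monom2 k x = (\<Sum>i\<in>idx l. (if i = k then 1 else 0) * monom2 i x)" for x
  proof -
    have "(\<Sum>i\<in>idx l. (if i = k then 1 else 0) * monom2 i x) = (\<Sum>i\<in>idx l. if i = k then monom2 i x else 0)"
      by (intro sum.cong) auto
    then show ?thesis using k by simp
  qed
  then show ?thesis unfolding pfun_def fspan_def
    by (intro CollectI exI[of _ "\<lambda>i. if i = k then 1 else 0"]) auto
qed

lemma pfun_const: "0 \<le> l \<Longrightarrow> (\<lambda>x. a) \<in> pfun l"
  using pfun_scale[OF monom2_pfun[of "(0,0)" l], of a] by (simp add: idx_def monom2_def)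

lemma pfun_coord: "1 \<le> l \<Longrightarrow> (\<lambda>x. x $ i) \<in> pfun l"
  using monom2_pfun[of "(1,0)" l] monom2_pfun[of "(0,1)" l] exhaust_2[of i]
  by (auto simp: idx_def monom2_def)

lemma pfun_mono: "l \<le> m \<Longrightarrow> f \<in> pfun l \<Longrightarrow> f \<in> pfun m"
proof -
  assume "l \<le> m" "f \<in> pfun l"
  then obtain c where "f = (\<lambda>x. \<Sum>k\<in>idx l. c k * monom2 k x)" by (auto elim: pfunE)
  moreover have "(\<lambda>x. \<Sum>k\<in>idx l. c k * monom2 k x) \<in> pfun m"
    by (rule pfun_lincomb[OF finite_idx]) (use \<open>l \<le> m\<close> in \<open>auto intro!: monom2_pfun simp: idx_def\<close>)
  ultimately show ?thesis by simp
qed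

lemma pfun_mult: "f \<in> pfun l \<Longrightarrow> g \<in> pfun m \<Longrightarrow> (\<lambda>x. f x * g x) \<in> pfun (l + m)"
proof -
  have mono: "(\<lambda>x. monom2 k x * g x) \<in> pfun (l + m)" if "k \<in> idx l" "g \<in> pfun m" for k g l m
  proof -
    obtain c where g: "g = (\<lambda>x. \<Sum>k\<in>idx m. c k * monom2 k x)" using \<open>g \<in> pfun m\<close> by (rule pfunE)
    have eq: "(\<lambda>x. monom2 k x * g x) = (\<lambda>x. \<Sum>q\<in>idx m. c q * monom2 (fst k + fst q, snd k + snd q) x)"
      by (auto simp: g sum_distrib_left monom2_def power_add split_beta intro!: ext sum.cong)
    show ?thesis unfolding eq
      by (rule pfun_lincomb[OF finite_idx]) (use \<open>k \<in> idx l\<close> in \<open>auto intro!: monom2_pfun simp: idx_def\<close>)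
  qed
  assume f: "f \<in> pfun l" and g: "g \<in> pfun m"
  obtain c where fc: "f = (\<lambda>x. \<Sum>k\<in>idx l. c k * monom2 k x)" using f by (rule pfunE)
  have eq: "(\<lambda>x. f x * g x) = (\<lambda>x. \<Sum>k\<in>idx l. c k * (monom2 k x * g x))"
    by (auto simp: fc sum_distrib_right mult.assoc)
  show ?thesis unfolding eq by (rule pfun_lincomb) (use mono g in auto)
qed

lemma pfun_power: "f \<in> pfun 1 \<Longrightarrow> (\<lambda>x. f x ^ n) \<in> pfun (int n)"
proof (induction n)
  case 0 then show ?case by (simp add: pfun_const)
next
  case (Suc n)
  then show ?case using pfun_mult[of f 1 "\<lambda>x. f x ^ n" "int n"] by simp
qed

lemma pfun_compose:
  assumes f: "f \<in> pfun l" and \<phi>: "\<And>i. (\<lambda>x. \<phi> x $ i) \<in> pfun 1"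
  shows "(\<lambda>x. f (\<phi> x)) \<in> pfun l"
proof -
  obtain c where fc: "f = (\<lambda>x. \<Sum>k\<in>idx l. c k * monom2 k x)" using f by (rule pfunE)
  show ?thesis unfolding fc
  proof (rule pfun_lincomb)
    fix k assume k: "k \<in> idx l"
    obtain i j where ij: "k = (i, j)" by fastforce
    have "(\<lambda>x. (\<phi> x $ 1) ^ i * (\<phi> x $ 2) ^ j) \<in> pfun (int i + int j)"
      by (intro pfun_mult pfun_power \<phi>)
    then show "(\<lambda>x. monom2 k (\<phi> x)) \<in> pfun l"
      using k by (auto simp: monom2_def ij idx_def intro: pfun_mono)
  qed simp
qed

lemma pfun_affine:
  assumes "f \<in> pfun l" shows "(\<lambda>x. f (a + r *\<^sub>R x)) \<in> pfun l"
proof (rule pfun_compose[OF assms])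
  fix i show "(\<lambda>x. (a + r *\<^sub>R x) $ i) \<in> pfun 1"
    using pfun_add[OF pfun_const[of 1 "a $ i"] pfun_scale[OF pfun_coord[of 1 i], of r]] by simp
qed

lemma pfun_affine_line:
  assumes "f \<in> pfun l" shows "(\<lambda>x. f (a + (x $ i) *\<^sub>R v)) \<in> pfun l"
proof (rule pfun_compose[OF assms])
  fix j show "(\<lambda>x. (a + (x $ i) *\<^sub>R v) $ j) \<in> pfun 1"
    using pfun_add[OF pfun_const[of 1 "a $ j"] pfun_scale[OF pfun_coord[of 1 i], of "v $ j"]]
    by (simp add: mult.commute)
qed

section \<open>Partial derivatives and restrictions to lines\<close>

definition pd :: "2 \<Rightarrow> (point \<Rightarrow> real) \<Rightarrow> point \<Rightarrow> real" where
  "pd i f x = frechet_derivative f (at x) (axis i 1)"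

lemma pd_unique:
  assumes "(f has_derivative (\<lambda>v. v $ 1 * a + v $ 2 * b)) (at x)"
  shows "pd 1 f x = a" "pd 2 f x = b"
  unfolding pd_def frechet_derivative_at[OF assms, symmetric] by (auto simp: axis_def)

lemma monom2_derivative:
  assumes "k \<in> idx l"
  shows "\<exists>a\<in>pfun (l-1). \<exists>b\<in>pfun (l-1). \<forall>x. (monom2 k has_derivative (\<lambda>v. v $ 1 * a x + v $ 2 * b x)) (at x)"
proof -
  obtain i j where ij: "k = (i, j)" by fastforce
  define a where "a = (\<lambda>x. real i * monom2 (i - 1, j) x)"
  define b where "b = (\<lambda>x. real j * monom2 (i, j - 1) x)"
  have "a \<in> pfun (l-1)"
  \<comment> \<open>For \<open>i = 0\<close> the truncated exponent \<open>i - 1\<close> is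
    meaningless, but its coefficient vanishes; otherwise the degree drops by one.\<close>
  proof (cases "i = 0")
    case True then show ?thesis by (simp add: a_def)
  next
    case False then show ?thesis unfolding a_def
      by (intro pfun_scale monom2_pfun) (use assms in \<open>auto simp: idx_def ij\<close>)
  qed
  moreover have "b \<in> pfun (l-1)"
  proof (cases "j = 0")
    case True then show ?thesis by (simp add: b_def)
  next
    case False then show ?thesis unfolding b_def
      by (intro pfun_scale monom2_pfun) (use assms in \<open>auto simp: idx_def ij\<close>)
  qed
  moreover have "(monom2 k has_derivative (\<lambda>v. v $ 1 * a x + v $ 2 * b x)) (at x)" for x
    unfolding ij monom2_def a_def b_def
    by (auto intro!: derivative_eq_intros bounded_linear_imp_has_derivative bounded_linear_vec_nth
        simp: algebra_simps)
  ultimately show ?thesis by blast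
qed

lemma pfun_derivative:
  assumes "f \<in> pfun l"
  shows "pd i f \<in> pfun (l - 1)"
    and "(f has_derivative (\<lambda>v. v $ 1 * pd 1 f x + v $ 2 * pd 2 f x)) (at x)"
proof -
  obtain c where fc: "f = (\<lambda>x. \<Sum>k\<in>idx l. c k * monom2 k x)" using assms by (rule pfunE)
  define Q where "Q k a b \<longleftrightarrow> a \<in> pfun (l-1) \<and> b \<in> pfun (l-1) \<and>
      (\<forall>x. (monom2 k has_derivative (\<lambda>v. v $ 1 * a x + v $ 2 * b x)) (at x))" for k a b
  have "\<forall>k\<in>idx l. \<exists>a b. Q k a b" unfolding Q_def using monom2_derivative by blast
  then obtain A B where "\<forall>k\<in>idx l. Q k (A k) (B k)" by metis
  then have A: "\<And>k. k \<in> idx l \<Longrightarrow> A k \<in> pfun (l-1)" and B: "\<And>k. k \<in> idx l \<Longrightarrow> B k \<in> pfun (l-1)"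
    and D: "\<And>k x. k \<in> idx l \<Longrightarrow> (monom2 k has_derivative (\<lambda>v. v $ 1 * A k x + v $ 2 * B k x)) (at x)"
    unfolding Q_def by blast+
  let ?a = "\<lambda>x. \<Sum>k\<in>idx l. c k * A k x" and ?b = "\<lambda>x. \<Sum>k\<in>idx l. c k * B k x"
  have d: "(f has_derivative (\<lambda>v. v $ 1 * ?a x + v $ 2 * ?b x)) (at x)" for x
  proof -
    have "(f has_derivative (\<lambda>v. \<Sum>k\<in>idx l. c k * (v $ 1 * A k x + v $ 2 * B k x))) (at x)"
      unfolding fc by (intro has_derivative_sum has_derivative_mult_right D)
    moreover have "(\<lambda>v::point. \<Sum>k\<in>idx l. c k * (v $ 1 * A k x + v $ 2 * B k x))
        = (\<lambda>v. v $ 1 * ?a x + v $ 2 * ?b x)"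
      by (rule ext) (simp add: distrib_left sum.distrib sum_distrib_left mult_ac)
    ultimately show ?thesis by simp
  qed
  have p: "pd 1 f = ?a" "pd 2 f = ?b" using pd_unique[OF d] by auto
  have "?a \<in> pfun (l-1)" "?b \<in> pfun (l-1)" by (auto intro!: pfun_lincomb A B)
  then show "pd i f \<in> pfun (l - 1)" using p exhaust_2[of i] by auto
  show "(f has_derivative (\<lambda>v. v $ 1 * pd 1 f x + v $ 2 * pd 2 f x)) (at x)" using d p by simp
qed

lemma pfun_continuous_on: "f \<in> pfun l \<Longrightarrow> continuous_on S f"
  by (meson has_derivative_continuous pfun_derivative(2) continuous_at_imp_continuous_on)

lemma pfun_line_derivative:
  assumes "f \<in> pfun l"
  shows "((\<lambda>t. f (a + t *\<^sub>R v)) has_real_derivative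
    (v $ 1 * pd 1 f (a + t *\<^sub>R v) + v $ 2 * pd 2 f (a + t *\<^sub>R v))) (at t within S)"
proof -
  have 1: "((\<lambda>t. a + t *\<^sub>R v) has_derivative (\<lambda>s. s *\<^sub>R v)) (at t within S)"
    by (auto intro!: derivative_eq_intros)
  have "((\<lambda>t. f (a + t *\<^sub>R v)) has_derivative
     (\<lambda>s. (s *\<^sub>R v) $ 1 * pd 1 f (a + t *\<^sub>R v) + (s *\<^sub>R v) $ 2 * pd 2 f (a + t *\<^sub>R v))) (at t within S)"
    by (rule has_derivative_compose[OF 1 pfun_derivative(2)[OF assms]])
  then show ?thesis unfolding has_field_derivative_def
    by (rule has_derivative_eq_rhs) (auto simp: algebra_simps)
qed

definition upoly :: "int \<Rightarrow> real poly set" where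
  "upoly l = {P. P = 0 \<or> int (degree P) \<le> l}"

lemma upoly_add: "P \<in> upoly l \<Longrightarrow> Q \<in> upoly l \<Longrightarrow> P + Q \<in> upoly l"
  unfolding upoly_def using degree_add_le_max[of P Q] by auto

lemma upoly_sum: "(\<And>k. k \<in> J \<Longrightarrow> P k \<in> upoly l) \<Longrightarrow> sum P J \<in> upoly l"
proof (induction J rule: infinite_finite_induct)
  case (insert x F)
  then show ?case using upoly_add[of "P x" l "sum P F"] by simp
qed (auto simp: upoly_def)

text \<open>The bridge to univariate polynomials, where counting roots and dividing by linear
  factors are possible.\<close>

lemma pfun_line:
  assumes "f \<in> pfun l"
  obtains P where "P \<in> upoly l" "\<And>t. f (a + t *\<^sub>R v) = poly P t"
proof -
  obtain c where fc: "f = (\<lambda>x. \<Sum>k\<in>idx l. c k * monom2 k x)" using assms by (rule pfunE)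
  define Q where "Q = (\<lambda>(i, j). [:a $ 1, v $ 1:] ^ i * [:a $ 2, v $ 2:] ^ j)"
  have deg: "smult (c k) (Q k) \<in> upoly l" if "k \<in> idx l" for k
  proof -
    obtain i j where ij: "k = (i, j)" by fastforce
    have "degree (Q k) \<le> degree ([:a $ 1, v $ 1:] ^ i) + degree ([:a $ 2, v $ 2:] ^ j)"
      unfolding Q_def ij using degree_mult_le by auto
    also have "\<dots> \<le> i + j"
      by (rule add_mono; rule order.trans[OF degree_power_le]) auto
    finally have "degree (smult (c k) (Q k)) \<le> i + j" using degree_smult_le order.trans by blast
    then show ?thesis using that by (auto simp: upoly_def idx_def ij)
  qed
  show thesis
  proof (rule that[of "\<Sum>k\<in>idx l. smult (c k) (Q k)"])
    show "(\<Sum>k\<in>idx l. smult (c k) (Q k)) \<in> upoly l" by (rule upoly_sum) (rule deg)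
    show "f (a + t *\<^sub>R v) = poly (\<Sum>k\<in>idx l. smult (c k) (Q k)) t" for t
      by (auto simp: fc poly_sum Q_def monom2_def intro!: sum.cong)
  qed
qed

lemma poly_pfun:
  assumes P: "P \<in> upoly l" and \<sigma>: "\<sigma> \<in> pfun 1"
  shows "(\<lambda>x. poly P (\<sigma> x)) \<in> pfun l"
proof (cases "P = 0")
  case False
  have "(\<lambda>x. \<Sum>i\<le>degree P. coeff P i * \<sigma> x ^ i) \<in> pfun l"
  proof (rule pfun_lincomb)
    fix i assume "i \<in> {..degree P}"
    then show "(\<lambda>x. \<sigma> x ^ i) \<in> pfun l" using P False pfun_mono[OF _ pfun_power[OF \<sigma>], of i l]
      by (auto simp: upoly_def)
  qed simp
  then show ?thesis by (simp add: poly_altdef)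
qed simp

text \<open>On the line from \<open>y\<close> to \<open>x\<close> the restriction is a univariate
  polynomial with infinitely many zeros near \<open>y\<close>.\<close>

lemma pfun_identity:
  assumes f: "f \<in> pfun l" and U: "open U" "y \<in> U" and z: "\<And>x. x \<in> U \<Longrightarrow> f x = 0"
  shows "f x = 0"
proof -
  obtain P where P: "P \<in> upoly l" and line: "\<And>t. f (y + t *\<^sub>R (x - y)) = poly P t"
    using pfun_line[OF f] by blast
  have "\<forall>\<^sub>F t in at_right 0. y + t *\<^sub>R (x - y) \<in> U"
  proof -
    have "((\<lambda>t. y + t *\<^sub>R (x - y)) \<longlongrightarrow> y + 0 *\<^sub>R (x - y)) (at_right 0)" by (intro tendsto_intros)
    then show ?thesis using U topological_tendstoD by fastforce
  qed
  then obtain b where b: "b > 0" "\<And>t. 0 < t \<Longrightarrow> t < b \<Longrightarrow> y + t *\<^sub>R (x - y) \<in> U"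
    unfolding eventually_at_right_field by auto
  have "{0<..<b} \<subseteq> {t. poly P t = 0}" using b z line by force
  then have "infinite {t. poly P t = 0}" using b(1) infinite_Ioo finite_subset by metis
  then have "P = 0" using poly_roots_finite by blast
  then show ?thesis using line[of 1] by simp
qed

section \<open>The discrete polynomial spaces as cut-offs of global polynomials\<close>

lemma poly_space_iff: "f \<in> poly_space l Y \<longleftrightarrow> (\<exists>p\<in>pfun l. f = cut Y p)"
proof -
  have "(\<lambda>x. if x \<in> closure Y then \<Sum>(i, j) | int i + int j \<le> l. c i j * (x $ 1) ^ i * (x $ 2) ^ j else 0)
      = cut Y (\<lambda>x. \<Sum>k\<in>idx l. (\<lambda>(i,j). c i j) k * monom2 k x)" for c
    by (auto simp: cut_def idx_def monom2_def mult.assoc intro!: ext sum.cong)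
  then have 1: "(\<exists>c. \<forall>x. f x = (if x \<in> closure Y then \<Sum>(i, j) | int i + int j \<le> l. c i j * (x $ 1) ^ i * (x $ 2) ^ j else 0))
      \<longleftrightarrow> (\<exists>c. f = cut Y (\<lambda>x. \<Sum>k\<in>idx l. (\<lambda>(i,j). c i j) k * monom2 k x))"
    by (simp add: fun_eq_iff)
  also have "\<dots> \<longleftrightarrow> (\<exists>c. f = cut Y (\<lambda>x. \<Sum>k\<in>idx l. c k * monom2 k x))"
  proof (safe, blast)
    fix c show "\<exists>d. cut Y (\<lambda>x. \<Sum>k\<in>idx l. c k * monom2 k x) = cut Y (\<lambda>x. \<Sum>k\<in>idx l. (\<lambda>(i,j). d i j) k * monom2 k x)"
      by (rule exI[of _ "curry c"]) (simp add: curry_def)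
  qed
  finally show ?thesis unfolding poly_space_def pfun_def fspan_def by auto
qed

lemma poly_space_fspan: "poly_space l Y = fspan (\<lambda>k. cut Y (monom2 k)) (idx l)"
proof -
  have "cut Y (\<lambda>x. \<Sum>k\<in>idx l. c k * monom2 k x) = (\<lambda>x. \<Sum>k\<in>idx l. c k * cut Y (monom2 k) x)" for c
    by (auto simp: cut_def)
  then show ?thesis
    by (auto simp: set_eq_iff poly_space_iff pfun_def fspan_def)
qed

lemma poly_space_add: "f \<in> poly_space l Y \<Longrightarrow> g \<in> poly_space l Y \<Longrightarrow> (\<lambda>x. f x + g x) \<in> poly_space l Y"
  and poly_space_scale: "f \<in> poly_space l Y \<Longrightarrow> (\<lambda>x. a * f x) \<in> poly_space l Y"
  and poly_space_zero [simp]: "(\<lambda>x. 0) \<in> poly_space l Y"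
  unfolding poly_space_fspan by (rule fspan_add fspan_scale fspan_zero; assumption)+

lemma poly_space_diff: "f \<in> poly_space l Y \<Longrightarrow> g \<in> poly_space l Y \<Longrightarrow> (\<lambda>x. f x - g x) \<in> poly_space l Y"
  using poly_space_add[of f l Y "\<lambda>x. (-1) * g x"] poly_space_scale[of g l Y "-1"] by simp

lemma poly_space_continuous: "f \<in> poly_space l Y \<Longrightarrow> continuous_on (closure Y) f"
  by (auto simp: poly_space_iff cong: continuous_on_cong intro: pfun_continuous_on)

lemma poly_space_outside: "f \<in> poly_space l Y \<Longrightarrow> x \<notin> closure Y \<Longrightarrow> f x = 0"
  by (auto simp: poly_space_iff)

lemma cut_poly_space: "p \<in> pfun l \<Longrightarrow> cut Y p \<in> poly_space l Y"
  by (auto simp: poly_space_iff)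

section \<open>Integrals over elements and edges\<close>

lemma area_integrable:
  fixes f :: "point \<Rightarrow> real"
  assumes "open T" "bounded T" "continuous_on (closure T) f"
  shows "set_integrable lborel T f"
proof (rule set_integrable_subset)
  show "set_integrable lborel (closure T) f"
    unfolding set_integrable_def
    by (rule borel_integrable_compact) (use assms in auto)
qed (use assms closure_subset in auto)

lemma area_integral_add:
  assumes "open T" "bounded T" "continuous_on (closure T) f" "continuous_on (closure T) g"
  shows "area_integral T (\<lambda>x. f x + g x) = area_integral T f + area_integral T g"
  unfolding area_integral_def by (intro set_integral_add area_integrable assms)

lemma area_integral_diff:
  assumes "open T" "bounded T" "continuous_on (closure T) f" "continuous_on (closure T) g"
  shows "area_integral T (\<lambda>x. f x - g x) = area_integral T f - area_integral T g"
  unfolding area_integral_def by (intro set_integral_diff area_integrable assms)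

lemma area_integral_cmul: "area_integral T (\<lambda>x. a * f x) = a * area_integral T f"
  unfolding area_integral_def by simp

lemma area_integral_cong: "(\<And>x. x \<in> T \<Longrightarrow> f x = g x) \<Longrightarrow> area_integral T f = area_integral T g"
  unfolding area_integral_def set_lebesgue_integral_def
  by (intro Bochner_Integration.integral_cong) (auto simp: indicator_def)

lemma area_integral_nonneg: "(\<And>x. x \<in> T \<Longrightarrow> 0 \<le> f x) \<Longrightarrow> 0 \<le> area_integral T f"
  unfolding area_integral_def set_lebesgue_integral_def
  by (intro Bochner_Integration.integral_nonneg) (auto simp: indicator_def)

lemma area_integral_mono:
  assumes "open T" "bounded T" "continuous_on (closure T) f" "continuous_on (closure T) g"
    and "\<And>x. x \<in> T \<Longrightarrow> f x \<le> g x"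
  shows "area_integral T f \<le> area_integral T g"
  unfolding area_integral_def by (intro set_integral_mono area_integrable assms)

lemma open_AE_empty:
  fixes U :: "point set"
  assumes "open U" "AE x in lborel. x \<notin> U" shows "U = {}"
proof -
  have "U \<in> null_sets lborel" using assms by (subst AE_iff_null_sets) auto
  then have "U \<in> null_sets lebesgue" by (rule null_sets_completionI)
  then have "negligible U" by (simp add: negligible_iff_null_sets)
  then show ?thesis using open_not_negligible[OF assms(1)] by auto
qed

text \<open>The points of \<open>T\<close> with nonzero value form an open null set, hence none
  exist; continuity then reaches the closure, where the cut-off functions live.\<close>

lemma area_integral_zero_imp:
  assumes T: "open T" "bounded T" "continuous_on (closure T) f" "\<And>x. x \<in> T \<Longrightarrow> 0 \<le> f x"
    and 0: "area_integral T f = 0" and x: "x \<in> closure T"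
  shows "f x = 0"
proof -
  have int: "integrable lborel (\<lambda>x. indicator T x *\<^sub>R f x)"
    using area_integrable[OF T(1-3)] unfolding set_integrable_def .
  have "AE x in lborel. indicator T x *\<^sub>R f x = 0"
    using integral_nonneg_eq_0_iff_AE[OF int] T(4) 0
    by (auto simp: area_integral_def set_lebesgue_integral_def indicator_def)
  then have AE: "AE x in lborel. x \<notin> {x \<in> T. f x \<noteq> 0}"
    by eventually_elim (auto simp: indicator_def split: if_splits)
  have "continuous_on T f" using T(3) closure_subset continuous_on_subset by blast
  then have "open (f -` (- {0}) \<inter> T)" using T(1) by (subst (asm) continuous_on_open_vimage) auto
  also have "f -` (- {0}) \<inter> T = {x \<in> T. f x \<noteq> 0}" by auto
  finally have "{x \<in> T. f x \<noteq> 0} = {}" using open_AE_empty AE by blast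
  then show ?thesis by (intro continuous_constant_on_closure[OF T(3) _ x]) auto
qed

text \<open>\<open>edge_integral\<close> selects some pair of end points. The closure of a
  nondegenerate open segment determines the pair up to order, and the substitution of
  \<open>1 - s\<close> for \<open>s\<close> removes the order.\<close>

lemma edge_integral_segment:
  fixes a b :: point
  assumes "a \<noteq> b"
  shows "edge_integral (open_segment a b) f =
    dist a b * set_lebesgue_integral lborel {0..1} (\<lambda>s. f ((1 - s) *\<^sub>R a + s *\<^sub>R b))"
proof -
  let ?E = "open_segment a b"
  define I where "I a b = set_lebesgue_integral lborel {0..1} (\<lambda>s. f ((1 - s) *\<^sub>R a + s *\<^sub>R b))" for a b
  have sw: "I a b = I b a" for a b
  proof -
    have "I a b = \<bar>-1\<bar> * (\<integral>s. indicator {0..1} (1 + (-1) * s) *\<^sub>R f ((1 - (1 + (-1) * s)) *\<^sub>R a + (1 + (-1) * s) *\<^sub>R b) \<partial>lborel)"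
      unfolding I_def set_lebesgue_integral_def
      using lborel_integral_real_affine[of "-1" "\<lambda>s. indicator {0..1} s *\<^sub>R f ((1 - s) *\<^sub>R a + s *\<^sub>R b)" 1] by simp
    also have "\<dots> = I b a"
      unfolding I_def set_lebesgue_integral_def
      by (simp, intro Bochner_Integration.integral_cong) (auto simp: indicator_def add.commute)
    finally show ?thesis .
  qed
  obtain a' b' where ab: "(SOME (a, b). ?E = open_segment a b) = (a', b')" by fastforce
  have "case (SOME (a, b). ?E = open_segment a b) of (a', b') \<Rightarrow> ?E = open_segment a' b'"
    by (rule someI[of _ "(a, b)"]) simp
  then have E: "?E = open_segment a' b'" using ab by simp
  then have "closure ?E = closure (open_segment a' b')" by (rule arg_cong)
  moreover have "a' \<noteq> b'" using E assms by (metis open_segment_idem open_segment_eq_empty)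
  ultimately have "closed_segment a b = closed_segment a' b'"
    using assms by (metis closure_open_segment)
  then have "{a, b} = {a', b'}" using closed_segment_eq by blast
  then have "(a' = a \<and> b' = b) \<or> (a' = b \<and> b' = a)" by (auto simp: doubleton_eq_iff)
  then show ?thesis using ab sw[of a b] by (auto simp: edge_integral_def I_def[symmetric] dist_commute)
qed

definition is_segment :: "point set \<Rightarrow> bool" where
  "is_segment E \<longleftrightarrow> (\<exists>a b. a \<noteq> b \<and> E = open_segment a b)"

lemma edge_param_closure:
  fixes a b :: point
  assumes "a \<noteq> b" "s \<in> {0..1}"
  shows "(1 - s) *\<^sub>R a + s *\<^sub>R b \<in> closure (open_segment a b)"
  using assms by (auto simp: closure_open_segment closed_segment_def)

lemma edge_param_open:
  fixes a b :: point
  assumes "a \<noteq> b" "s \<in> {0<..<1}"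
  shows "(1 - s) *\<^sub>R a + s *\<^sub>R b \<in> open_segment a b"
  using assms by (auto simp: in_segment)

lemma edge_param_continuous:
  fixes a b :: point
  assumes "a \<noteq> b" "continuous_on (closure (open_segment a b)) f"
  shows "continuous_on {0..1::real} (\<lambda>s. f ((1 - s) *\<^sub>R a + s *\<^sub>R b))"
proof (rule continuous_on_compose2[OF assms(2)])
  show "continuous_on {0..1} (\<lambda>s. (1 - s) *\<^sub>R a + s *\<^sub>R b)" by (intro continuous_intros)
  show "(\<lambda>s. (1 - s) *\<^sub>R a + s *\<^sub>R b) ` {0..1} \<subseteq> closure (open_segment a b)"
    using edge_param_closure[OF assms(1)] by blast
qed

lemma diameter_open_segment:
  fixes a b :: point
  assumes "a \<noteq> b" shows "diameter (open_segment a b) = dist a b"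
proof -
  have "diameter (open_segment a b) = diameter (closed_segment a b)"
    using diameter_closure[of "open_segment a b"] assms by (simp add: bounded_open_segment)
  also have "\<dots> = dist a b"
  proof (rule antisym)
    show "diameter (closed_segment a b) \<le> dist a b"
    proof (rule diameter_le, simp)
      fix x y assume "x \<in> closed_segment a b" "y \<in> closed_segment a b"
      then obtain u v where uv: "x = (1 - u) *\<^sub>R a + u *\<^sub>R b" "0 \<le> u" "u \<le> 1"
          "y = (1 - v) *\<^sub>R a + v *\<^sub>R b" "0 \<le> v" "v \<le> 1" by (auto simp: closed_segment_def)
      have "x - y = (v - u) *\<^sub>R (a - b)" unfolding uv by (simp add: algebra_simps)
      then have "norm (x - y) = \<bar>v - u\<bar> * dist a b" by (simp add: dist_norm)
      also have "\<dots> \<le> 1 * dist a b" by (rule mult_right_mono) (use uv in auto)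
      finally show "norm (x - y) \<le> dist a b" by simp
    qed
    show "dist a b \<le> diameter (closed_segment a b)"
      by (rule diameter_bounded_bound) (auto simp: bounded_closed_segment)
  qed
  finally show ?thesis .
qed

lemma interval_integrable:
  assumes "continuous_on {0..1::real} (f :: real \<Rightarrow> real)"
  shows "set_integrable lborel {0..1} f"
  unfolding set_integrable_def by (rule borel_integrable_compact) (use assms in auto)

lemma edge_integrable:
  fixes a b :: point
  assumes "a \<noteq> b" "continuous_on (closure (open_segment a b)) f"
  shows "set_integrable lborel {0..1::real} (\<lambda>s. f ((1 - s) *\<^sub>R a + s *\<^sub>R b) :: real)"
  by (rule interval_integrable edge_param_continuous assms)+

lemma edge_integral_add:
  assumes "is_segment E" "continuous_on (closure E) f" "continuous_on (closure E) g"
  shows "edge_integral E (\<lambda>x. f x + g x) = edge_integral E f + edge_integral E g"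
proof -
  obtain a b where E: "a \<noteq> b" "E = open_segment a b" using assms(1) by (auto simp: is_segment_def)
  show ?thesis unfolding E(2) edge_integral_segment[OF E(1)] distrib_left[symmetric]
    by (subst set_integral_add) (use E assms edge_integrable[OF E(1), of f] edge_integrable[OF E(1), of g] in auto)
qed

lemma edge_integral_cmul:
  assumes "is_segment E"
  shows "edge_integral E (\<lambda>x. a * f x) = a * edge_integral E f"
  using assms by (auto simp: is_segment_def edge_integral_segment)

lemma edge_integral_diff:
  assumes "is_segment E" "continuous_on (closure E) f" "continuous_on (closure E) g"
  shows "edge_integral E (\<lambda>x. f x - g x) = edge_integral E f - edge_integral E g"
  using edge_integral_add[of E f "\<lambda>x. (-1) * g x"] edge_integral_cmul[OF assms(1), of "-1" g] assms
  by (auto intro: continuous_intros)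

text \<open>Agreement on the open edge suffices, as the two end points form a null set of
  parameters.\<close>

lemma edge_integral_cong:
  assumes "is_segment E" "\<And>x. x \<in> E \<Longrightarrow> f x = g x"
  shows "edge_integral E f = edge_integral E g"
proof -
  obtain a b where E: "a \<noteq> b" "E = open_segment a b" using assms(1) by (auto simp: is_segment_def)
  have "(\<integral>s. indicator {0..1} s *\<^sub>R f ((1 - s) *\<^sub>R a + s *\<^sub>R b) \<partial>lborel)
      = (\<integral>s. indicator {0..1} s *\<^sub>R g ((1 - s) *\<^sub>R a + s *\<^sub>R b) \<partial>lborel)"
  proof (rule integral_discrete_difference[of "{0, 1}"])
    fix s :: real assume s: "s \<notin> {0, 1}"
    show "indicator {0..1} s *\<^sub>R f ((1 - s) *\<^sub>R a + s *\<^sub>R b) = indicator {0..1} s *\<^sub>R g ((1 - s) *\<^sub>R a + s *\<^sub>R b)"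
      using assms(2)[of "(1 - s) *\<^sub>R a + s *\<^sub>R b"] edge_param_open[OF E(1), of s] s E(2)
      by (auto simp: indicator_def)
  qed auto
  then show ?thesis unfolding E(2) edge_integral_segment[OF E(1)] set_lebesgue_integral_def by simp
qed

lemma edge_integral_mono:
  assumes "is_segment E" "continuous_on (closure E) f" "continuous_on (closure E) g"
    and "\<And>x. x \<in> closure E \<Longrightarrow> f x \<le> g x"
  shows "edge_integral E f \<le> edge_integral E g"
proof -
  obtain a b where E: "a \<noteq> b" "E = open_segment a b" using assms(1) by (auto simp: is_segment_def)
  show ?thesis unfolding E(2) edge_integral_segment[OF E(1)]
    by (intro mult_left_mono set_integral_mono edge_integrable E assms(4))
      (use E assms edge_param_closure[OF E(1)] in auto)
qed

lemma edge_integral_const: "is_segment E \<Longrightarrow> edge_integral E (\<lambda>x. c) = c * diameter E"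
proof -
  assume "is_segment E"
  then obtain a b where E: "a \<noteq> b" "E = open_segment a b" by (auto simp: is_segment_def)
  have "diameter E = dist a b" using E by (simp add: diameter_open_segment)
  then show ?thesis unfolding E(2) edge_integral_segment[OF E(1)] set_lebesgue_integral_def by simp
qed

lemma edge_integral_zero_imp:
  assumes "is_segment E" "continuous_on (closure E) f" "\<And>x. x \<in> E \<Longrightarrow> 0 \<le> f x"
    and 0: "edge_integral E f = 0" and x: "x \<in> closure E"
  shows "f x = 0"
proof -
  obtain a b where E: "a \<noteq> b" "E = open_segment a b" using assms(1) by (auto simp: is_segment_def)
  let ?g = "\<lambda>s. f ((1 - s) *\<^sub>R a + s *\<^sub>R b)"
  have cg: "continuous_on {0..1} ?g" using edge_param_continuous E assms by blast
  have nn: "0 \<le> f x" if "x \<in> closure E" for x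
    by (rule continuous_ge_on_closure[OF assms(2) that]) (use assms(3) in auto)
  have "set_lebesgue_integral lborel {0..1} ?g = integral {0..1} ?g"
    by (rule set_borel_integral_eq_integral(2)[OF interval_integrable[OF cg]])
  moreover have "set_lebesgue_integral lborel {0..1} ?g = 0"
    using 0 E(1) unfolding E(2) edge_integral_segment[OF E(1)] by simp
  ultimately have "(?g has_integral 0) (cbox 0 1)"
    using integrable_continuous_interval[OF cg] by (auto simp: has_integral_iff)
  then have "?g s = 0" if "s \<in> cbox 0 1" for s
    by (intro has_integral_0_cbox_imp_0[of 0 1 ?g s])
      (use cg nn that edge_param_closure[OF E(1)] E in auto)
  moreover obtain s where "x = (1 - s) *\<^sub>R a + s *\<^sub>R b" "0 \<le> s" "s \<le> 1"
    using x E by (auto simp: closure_open_segment closed_segment_def)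
  ultimately show ?thesis by auto
qed

section \<open>Riesz representation in polynomial spaces\<close>

definition lin_on :: "('a \<Rightarrow> 'b::real_vector) set \<Rightarrow> (('a \<Rightarrow> 'b) \<Rightarrow> real) \<Rightarrow> bool" where
  "lin_on S L \<longleftrightarrow> (\<forall>f\<in>S. \<forall>g\<in>S. L (\<lambda>x. f x + g x) = L f + L g) \<and>
     (\<forall>f\<in>S. \<forall>a. L (\<lambda>x. a *\<^sub>R f x) = a * L f)"

definition vec_space :: "('a \<Rightarrow> 'b) set \<Rightarrow> ('a \<Rightarrow> 'b^2) set" where
  "vec_space S = {f. \<forall>i. (\<lambda>x. f x $ i) \<in> S}"

lemma vec_poly_space_eq: "vec_poly_space l T = vec_space (poly_space l T)"
  and tensor_poly_space_eq: "tensor_poly_space l T = vec_space (vec_poly_space l T)"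
  by (auto simp: vec_poly_space_def tensor_poly_space_def vec_space_def)

text \<open>The common properties of the scalar, vector and tensor polynomial spaces on an element.\<close>

definition rep_space :: "point set \<Rightarrow> (point \<Rightarrow> 'b::euclidean_space) set \<Rightarrow> bool" where
  "rep_space T S \<longleftrightarrow> (\<lambda>x. 0) \<in> S \<and> (\<forall>f\<in>S. \<forall>g\<in>S. (\<lambda>x. f x + g x) \<in> S) \<and>
     (\<forall>f\<in>S. \<forall>a. (\<lambda>x. a *\<^sub>R f x) \<in> S) \<and>
     (\<forall>f\<in>S. continuous_on (closure T) f \<and> (\<forall>x. x \<notin> closure T \<longrightarrow> f x = 0)) \<and>
     (\<forall>L. lin_on S L \<longrightarrow> (\<exists>w\<in>S. \<forall>f\<in>S. area_integral T (\<lambda>x. w x \<bullet> f x) = L f))"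

lemma rep_space_zero: "rep_space T S \<Longrightarrow> (\<lambda>x. 0) \<in> S"
  and rep_space_add: "rep_space T S \<Longrightarrow> f \<in> S \<Longrightarrow> g \<in> S \<Longrightarrow> (\<lambda>x. f x + g x) \<in> S"
  and rep_space_scale: "rep_space T S \<Longrightarrow> f \<in> S \<Longrightarrow> (\<lambda>x. a *\<^sub>R f x) \<in> S"
  and rep_space_continuous: "rep_space T S \<Longrightarrow> f \<in> S \<Longrightarrow> continuous_on (closure T) f"
  and rep_space_outside: "rep_space T S \<Longrightarrow> f \<in> S \<Longrightarrow> x \<notin> closure T \<Longrightarrow> f x = 0"
  by (auto simp: rep_space_def)

lemma rep_space_diff: "rep_space T S \<Longrightarrow> f \<in> S \<Longrightarrow> g \<in> S \<Longrightarrow> (\<lambda>x. f x - g x) \<in> S"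
  using rep_space_add[of T S f "\<lambda>x. (-1) *\<^sub>R g x"] rep_space_scale[of T S g "-1"] by simp

text \<open>Definiteness speaks of functions on the whole plane; it holds because members of the
  space vanish off the closure of \<open>T\<close>.\<close>

lemma poly_space_inner:
  assumes "open T" "bounded T"
  shows "fun_inner (poly_space l T) (\<lambda>f g. area_integral T (\<lambda>x. f x * g x))"
proof
  fix f f' h :: "point \<Rightarrow> real" and a :: real
  assume f: "f \<in> poly_space l T"
  show "area_integral T (\<lambda>x. a * f x * h x) = a * area_integral T (\<lambda>x. f x * h x)"
    using area_integral_cmul[of T a "\<lambda>x. f x * h x"] by (simp add: mult.assoc)
  { assume h: "h \<in> poly_space l T"
    show "area_integral T (\<lambda>x. f x * h x) = area_integral T (\<lambda>x. h x * f x)" by (simp add: mult.commute)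
    assume f': "f' \<in> poly_space l T"
    show "area_integral T (\<lambda>x. (f x + f' x) * h x) = area_integral T (\<lambda>x. f x * h x) + area_integral T (\<lambda>x. f' x * h x)"
      unfolding distrib_right
      by (intro area_integral_add assms continuous_on_mult poly_space_continuous[OF f] poly_space_continuous[OF f'] poly_space_continuous[OF h]) }
  assume "f \<noteq> (\<lambda>x. 0)"
  have nn: "0 \<le> area_integral T (\<lambda>x. f x * f x)" by (rule area_integral_nonneg) auto
  have "area_integral T (\<lambda>x. f x * f x) \<noteq> 0"
  proof
    assume 0: "area_integral T (\<lambda>x. f x * f x) = 0"
    have "f x = 0" for x
    proof (cases "x \<in> closure T")
      case True
      have "f x * f x = 0"
        by (rule area_integral_zero_imp[OF assms _ _ 0 True]) (auto intro!: continuous_on_mult poly_space_continuous[OF f])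
      then show ?thesis by simp
    qed (rule poly_space_outside[OF f])
    then show False using \<open>f \<noteq> (\<lambda>x. 0)\<close> by auto
  qed
  then show "0 < area_integral T (\<lambda>x. f x * f x)" using nn by simp
qed

lemma rep_space_poly:
  assumes "open T" "bounded T"
  shows "rep_space T (poly_space l T)"
  unfolding rep_space_def
proof (intro conjI ballI allI impI)
  fix L assume L: "lin_on (poly_space l T) L"
  have "\<exists>w\<in>poly_space l T. \<forall>f\<in>poly_space l T. area_integral T (\<lambda>x. w x * f x) = L f"
    unfolding poly_space_fspan
    by (rule riesz_representation[OF finite_idx poly_space_inner[OF assms, unfolded poly_space_fspan]])
      (use L in \<open>auto simp: lin_on_def poly_space_fspan[symmetric]\<close>)
  then show "\<exists>w\<in>poly_space l T. \<forall>f\<in>poly_space l T. area_integral T (\<lambda>x. w x \<bullet> f x) = L f" by simp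
qed (auto intro: poly_space_add poly_space_scale poly_space_continuous poly_space_outside)

text \<open>A functional on vector fields is represented one component at a time, by restricting it
  to fields along one axis. Applied twice, this leads from scalars to vectors and then to
  tensors.\<close>

lemma rep_space_vec:
  assumes T: "open T" "bounded T" and S: "rep_space T S"
  shows "rep_space T (vec_space S)"
  unfolding rep_space_def
proof (intro conjI ballI allI impI)
  show "(\<lambda>x. 0) \<in> vec_space S" using rep_space_zero[OF S] by (simp add: vec_space_def)
next
  fix f g assume "f \<in> vec_space S" "g \<in> vec_space S"
  then show "(\<lambda>x. f x + g x) \<in> vec_space S" using rep_space_add[OF S] by (simp add: vec_space_def)
next
  fix f a assume "f \<in> vec_space S"
  then show "(\<lambda>x. a *\<^sub>R f x) \<in> vec_space S" using rep_space_scale[OF S] by (simp add: vec_space_def)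
next
  fix f assume "f \<in> vec_space S"
  then have "continuous_on (closure T) (\<lambda>x. \<chi> i. f x $ i)"
    using rep_space_continuous[OF S] by (intro continuous_on_vec_lambda) (auto simp: vec_space_def)
  then show "continuous_on (closure T) f" by simp
next
  fix f x assume "f \<in> vec_space S" "x \<notin> closure T"
  then show "f x = 0" using rep_space_outside[OF S] by (auto simp: vec_space_def vec_eq_iff)
next
  fix L assume L: "lin_on (vec_space S) L"
  have ax: "(\<lambda>x. axis i (r x)) \<in> vec_space S" if "r \<in> S" for i r
    unfolding vec_space_def
  proof (clarify)
    fix j show "(\<lambda>x. axis i (r x) $ j) \<in> S"
      using that rep_space_zero[OF S] by (cases "j = i") (simp_all add: axis_def)
  qed
  have Ladd: "L (\<lambda>x. f x + g x) = L f + L g" if "f \<in> vec_space S" "g \<in> vec_space S" for f g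
    using L that by (auto simp: lin_on_def)
  have "lin_on S (\<lambda>r. L (\<lambda>x. axis i (r x)))" for i
    unfolding lin_on_def
  proof (intro conjI ballI allI)
    fix f g assume "f \<in> S" "g \<in> S"
    then show "L (\<lambda>x. axis i (f x + g x)) = L (\<lambda>x. axis i (f x)) + L (\<lambda>x. axis i (g x))"
      using Ladd[OF ax ax, of f g i i] by (simp add: axis_def vec_eq_iff plus_vec_def if_distrib cong: if_cong)
  next
    fix f a assume "f \<in> S"
    then have "L (\<lambda>x. a *\<^sub>R axis i (f x)) = a * L (\<lambda>x. axis i (f x))"
      using L ax by (auto simp: lin_on_def)
    moreover have "(\<lambda>x. a *\<^sub>R axis i (f x)) = (\<lambda>x. axis i (a *\<^sub>R f x))" by (auto simp: axis_def vec_eq_iff)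
    ultimately show "L (\<lambda>x. axis i (a *\<^sub>R f x)) = a * L (\<lambda>x. axis i (f x))" by simp
  qed
  then have "\<forall>i. \<exists>w\<in>S. \<forall>f\<in>S. area_integral T (\<lambda>x. w x \<bullet> f x) = L (\<lambda>x. axis i (f x))"
    using S unfolding rep_space_def by blast
  then obtain w where w: "\<And>i. w i \<in> S"
    "\<And>i f. f \<in> S \<Longrightarrow> area_integral T (\<lambda>x. w i x \<bullet> f x) = L (\<lambda>x. axis i (f x))" by metis
  show "\<exists>w\<in>vec_space S. \<forall>f\<in>vec_space S. area_integral T (\<lambda>x. w x \<bullet> f x) = L f"
  proof (intro bexI ballI)
    show "(\<lambda>x. \<chi> i. w i x) \<in> vec_space S" using w by (simp add: vec_space_def)
    fix f assume f: "f \<in> vec_space S"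
    then have fi: "(\<lambda>x. f x $ i) \<in> S" for i by (simp add: vec_space_def)
    have "area_integral T (\<lambda>x. (\<chi> i. w i x) \<bullet> f x) = area_integral T (\<lambda>x. w 1 x \<bullet> f x $ 1 + w 2 x \<bullet> f x $ 2)"
      by (simp add: inner_vec_def sum_2)
    also have "\<dots> = area_integral T (\<lambda>x. w 1 x \<bullet> f x $ 1) + area_integral T (\<lambda>x. w 2 x \<bullet> f x $ 2)"
      by (intro area_integral_add T continuous_on_inner rep_space_continuous[OF S] w fi)
    also have "\<dots> = L (\<lambda>x. axis 1 (f x $ 1)) + L (\<lambda>x. axis 2 (f x $ 2))" using w(2)[OF fi] by simp
    also have "\<dots> = L (\<lambda>x. axis 1 (f x $ 1) + axis 2 (f x $ 2))" using Ladd[OF ax[OF fi] ax[OF fi]] by simp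
    also have "(\<lambda>x. axis 1 (f x $ 1) + axis 2 (f x $ 2)) = f"
      by (auto simp: vec_eq_iff axis_def forall_2)
    finally show "area_integral T (\<lambda>x. (\<chi> i. w i x) \<bullet> f x) = L f" .
  qed
qed

lemma rep_space_vec_poly: "open T \<Longrightarrow> bounded T \<Longrightarrow> rep_space T (vec_poly_space l T)"
  unfolding vec_poly_space_eq by (intro rep_space_vec rep_space_poly)

lemma rep_space_tensor_poly: "open T \<Longrightarrow> bounded T \<Longrightarrow> rep_space T (tensor_poly_space l T)"
  unfolding tensor_poly_space_eq by (intro rep_space_vec rep_space_vec_poly)

lemma rep_space_definite:
  assumes "open T" "bounded T" "rep_space T S" "f \<in> S" "area_integral T (\<lambda>x. f x \<bullet> f x) = 0"
  shows "f = (\<lambda>x. 0)"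
proof
  fix x show "f x = 0"
  proof (cases "x \<in> closure T")
    case True
    have "f x \<bullet> f x = 0"
      by (rule area_integral_zero_imp[OF assms(1,2) _ _ assms(5) True])
        (auto intro!: continuous_on_inner rep_space_continuous[OF assms(3,4)])
    then show ?thesis by simp
  qed (rule rep_space_outside[OF assms(3,4)])
qed

lemma rep_space_unique:
  assumes T: "open T" "bounded T" and S: "rep_space T S"
    and v: "v \<in> S" and w: "w \<in> S"
    and eq: "\<And>f. f \<in> S \<Longrightarrow> area_integral T (\<lambda>x. v x \<bullet> f x) = area_integral T (\<lambda>x. w x \<bullet> f x)"
  shows "v = w"
proof -
  let ?d = "\<lambda>x. v x - w x"
  have d: "?d \<in> S" by (rule rep_space_diff[OF S v w])
  have "area_integral T (\<lambda>x. ?d x \<bullet> ?d x) = area_integral T (\<lambda>x. v x \<bullet> ?d x - w x \<bullet> ?d x)"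
    by (simp add: inner_diff_left)
  also have "\<dots> = area_integral T (\<lambda>x. v x \<bullet> ?d x) - area_integral T (\<lambda>x. w x \<bullet> ?d x)"
    by (intro area_integral_diff T continuous_on_inner rep_space_continuous[OF S] v w d)
  finally have "?d = (\<lambda>x. 0)" using eq[OF d] by (intro rep_space_definite[OF T S d]) simp
  then show ?thesis by (auto simp: fun_eq_iff)
qed

text \<open>The form in which the definite descriptions of gradients and potentials are
  justified.\<close>

lemma rep_space_ex1:
  assumes T: "open T" "bounded T" and S: "rep_space T S" and L: "lin_on S L"
  shows "\<exists>!w. w \<in> S \<and> (\<forall>f\<in>S. area_integral T (\<lambda>x. w x \<bullet> f x) = L f)"
proof -
  obtain w where "w \<in> S" "\<forall>f\<in>S. area_integral T (\<lambda>x. w x \<bullet> f x) = L f"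
    using S L unfolding rep_space_def by blast
  then show ?thesis by (intro ex1I[of _ w]) (auto intro!: rep_space_unique[OF T S])
qed

text \<open>Positivity of the weight is asked on the open edge only: interpolation uses a bubble
  that vanishes at both end points, while projections use the weight 1.\<close>

lemma edge_poly_inner:
  assumes E: "is_segment E" and w: "continuous_on (closure E) w" "\<And>x. x \<in> E \<Longrightarrow> 0 < w x"
  shows "fun_inner (poly_space l E) (\<lambda>f g. edge_integral E (\<lambda>x. w x * (f x * g x)))"
proof
  fix f f' h :: "point \<Rightarrow> real" and a :: real
  assume f: "f \<in> poly_space l E"
  show "edge_integral E (\<lambda>x. w x * (a * f x * h x)) = a * edge_integral E (\<lambda>x. w x * (f x * h x))"
    using edge_integral_cmul[OF E, of a "\<lambda>x. w x * (f x * h x)"] by (simp add: mult_ac)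
  { assume h: "h \<in> poly_space l E"
    show "edge_integral E (\<lambda>x. w x * (f x * h x)) = edge_integral E (\<lambda>x. w x * (h x * f x))" by (simp add: mult.commute)
    assume f': "f' \<in> poly_space l E"
    show "edge_integral E (\<lambda>x. w x * ((f x + f' x) * h x)) = edge_integral E (\<lambda>x. w x * (f x * h x)) + edge_integral E (\<lambda>x. w x * (f' x * h x))"
      unfolding distrib_right distrib_left
      by (intro edge_integral_add E w continuous_on_mult poly_space_continuous[OF f] poly_space_continuous[OF f'] poly_space_continuous[OF h]) }
  assume "f \<noteq> (\<lambda>x. 0)"
  have c: "continuous_on (closure E) (\<lambda>x. w x * (f x * f x))"
    by (intro continuous_on_mult poly_space_continuous[OF f] w)
  have nnE: "0 \<le> w x * (f x * f x)" if "x \<in> E" for x using w(2)[OF that] by simp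
  then have nn: "0 \<le> w x * (f x * f x)" if "x \<in> closure E" for x
    by (intro continuous_ge_on_closure[OF c that]) auto
  then have nn': "0 \<le> edge_integral E (\<lambda>x. w x * (f x * f x))"
    using edge_integral_mono[OF E _ c, of "\<lambda>x. 0"] edge_integral_const[OF E, of 0] by auto
  have "edge_integral E (\<lambda>x. w x * (f x * f x)) \<noteq> 0"
  proof
    assume 0: "edge_integral E (\<lambda>x. w x * (f x * f x)) = 0"
    have "f x = 0" if "x \<in> E" for x
    proof -
      have "w x * (f x * f x) = 0"
        by (rule edge_integral_zero_imp[OF E c nnE 0]) (use that closure_subset in auto)
      then show ?thesis using w(2)[OF that] by simp
    qed
    then have "f x = 0" if "x \<in> closure E" for x
      by (intro continuous_constant_on_closure[OF poly_space_continuous[OF f] _ that]) auto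
    then have "f x = 0" for x using poly_space_outside[OF f] by metis
    then show False using \<open>f \<noteq> (\<lambda>x. 0)\<close> by auto
  qed
  then show "0 < edge_integral E (\<lambda>x. w x * (f x * f x))" using nn' by simp
qed

lemma edge_riesz:
  assumes E: "is_segment E" and w: "continuous_on (closure E) w" "\<And>x. x \<in> E \<Longrightarrow> 0 < w x"
    and L: "lin_on (poly_space l E) L"
  shows "\<exists>!p. p \<in> poly_space l E \<and> (\<forall>r\<in>poly_space l E. edge_integral E (\<lambda>x. w x * (p x * r x)) = L r)"
proof -
  let ?B = "\<lambda>f g. edge_integral E (\<lambda>x. w x * (f x * g x))"
  interpret fun_inner "poly_space l E" ?B by (rule edge_poly_inner[OF E w])
  have "\<exists>p\<in>poly_space l E. \<forall>r\<in>poly_space l E. ?B p r = L r"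
    unfolding poly_space_fspan
    by (rule riesz_representation[OF finite_idx edge_poly_inner[OF E w, unfolded poly_space_fspan]])
      (use L in \<open>auto simp: lin_on_def poly_space_fspan[symmetric]\<close>)
  moreover have "p = q" if p: "p \<in> poly_space l E" and q: "q \<in> poly_space l E"
    and eq: "\<forall>r\<in>poly_space l E. ?B p r = ?B q r" for p q
  proof -
    let ?d = "\<lambda>x. p x + (-1) * q x"
    have q': "(\<lambda>x. (-1) * q x) \<in> poly_space l E" by (rule poly_space_scale[OF q])
    have d: "?d \<in> poly_space l E" by (rule poly_space_add[OF p q'])
    have "?B ?d ?d = 0" using add[OF p q' d] scale[OF q d, of "-1"] eq d by simp
    then have "?d = (\<lambda>x. 0)" using pos[OF d] by linarith
    then show ?thesis by (auto simp: fun_eq_iff)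
  qed
  ultimately show ?thesis by (auto 0 4)
qed

section \<open>Scale-invariant bounds for polynomials\<close>

text \<open>The Jacobian of a dilation of the plane is \<open>h\<^sup>2\<close>; this power is the
  scaling of the inverse inequality that follows.\<close>

lemma area_integral_ball_scale:
  assumes f: "continuous_on UNIV f" and h: "0 < h"
  shows "area_integral (ball z (\<rho> * h)) f = h\<^sup>2 * area_integral (ball 0 \<rho>) (\<lambda>y. f (z + h *\<^sub>R y))"
proof -
  have "f \<in> borel_measurable borel" using f by (rule borel_measurable_continuous_onI)
  then have m: "(\<lambda>x. indicator (ball z (\<rho> * h)) x *\<^sub>R f x) \<in> borel_measurable borel"
    by (intro borel_measurable_scaleR borel_measurable_indicator) auto
  have DIM: "DIM(point) = 2" by simp
  have "area_integral (ball z (\<rho> * h)) f = (\<integral>x. indicator (ball z (\<rho> * h)) x *\<^sub>R f x \<partial>density (distr lborel borel (\<lambda>x. z + h *\<^sub>R x)) (\<lambda>_. \<bar>h\<bar> ^ DIM(point)))"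
    unfolding area_integral_def set_lebesgue_integral_def using h by (subst lborel_affine[of h z]) auto
  also have "\<dots> = h\<^sup>2 * (\<integral>x. indicator (ball z (\<rho> * h)) (z + h *\<^sub>R x) *\<^sub>R f (z + h *\<^sub>R x) \<partial>lborel)"
  proof -
    have "(\<integral>x. indicator (ball z (\<rho> * h)) x *\<^sub>R f x \<partial>density (distr lborel borel (\<lambda>x. z + h *\<^sub>R x)) (\<lambda>_. ennreal (h\<^sup>2)))
        = (\<integral>x. h\<^sup>2 *\<^sub>R (indicator (ball z (\<rho> * h)) x *\<^sub>R f x) \<partial>distr lborel borel (\<lambda>x. z + h *\<^sub>R x))"
      by (rule integral_density) (use m in auto)
    also have "\<dots> = (\<integral>x. h\<^sup>2 *\<^sub>R (indicator (ball z (\<rho> * h)) (z + h *\<^sub>R x) *\<^sub>R f (z + h *\<^sub>R x)) \<partial>lborel)"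
      by (rule integral_distr) (use borel_measurable_scaleR[OF borel_measurable_const m] in auto)
    finally show ?thesis using h by (simp add: DIM)
  qed
  also have "(\<lambda>x. indicator (ball z (\<rho> * h)) (z + h *\<^sub>R x) *\<^sub>R f (z + h *\<^sub>R x)) = (\<lambda>x. indicator (ball 0 \<rho>) x *\<^sub>R f (z + h *\<^sub>R x))"
    using h by (auto simp: indicator_def dist_norm mult.commute)
  finally show ?thesis unfolding area_integral_def set_lebesgue_integral_def .
qed

text \<open>The dilation \<open>y \<mapsto> z + h *\<^sub>R y\<close> preserves
  \<open>pfun l\<close> and reduces the claim to the unit ball and a concentric ball of radius
  \<open>\<rho>\<close>. An element that lies in \<open>cball z h\<close> and contains
  \<open>ball z (\<rho> * h)\<close> inherits the inequality whatever its shape.\<close>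

lemma pfun_sup_bound:
  assumes "0 < \<rho>"
  shows "\<exists>C>0. \<forall>p\<in>pfun l. \<forall>z::point. \<forall>h>0. \<forall>x\<in>cball z h.
    (p x)\<^sup>2 \<le> C / h\<^sup>2 * area_integral (ball z (\<rho> * h)) (\<lambda>x. (p x)\<^sup>2)"
proof -
  let ?T = "ball (0::point) \<rho>"
  let ?B = "\<lambda>f g. area_integral ?T (\<lambda>x. f x * g x)"
  have inner: "fun_inner (pfun l) ?B"
  proof
    fix f f' h :: "point \<Rightarrow> real" and a :: real
    assume f: "f \<in> pfun l"
    show "?B (\<lambda>x. a * f x) h = a * ?B f h"
      using area_integral_cmul[of ?T a "\<lambda>x. f x * h x"] by (simp add: mult.assoc)
    { assume h: "h \<in> pfun l"
      show "?B f h = ?B h f" by (simp add: mult.commute)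
      assume f': "f' \<in> pfun l"
      show "?B (\<lambda>x. f x + f' x) h = ?B f h + ?B f' h"
        unfolding distrib_right
        by (intro area_integral_add continuous_on_mult pfun_continuous_on[OF f] pfun_continuous_on[OF f'] pfun_continuous_on[OF h]) auto }
    assume nz: "f \<noteq> (\<lambda>x. 0)"
    have "?B f f \<noteq> 0"
    proof
      assume 0: "?B f f = 0"
      have "f x = 0" if "x \<in> ?T" for x
      proof -
        have "f x * f x = 0"
          by (rule area_integral_zero_imp[OF _ _ _ _ 0])
            (use that closure_subset[of ?T] in \<open>auto intro!: continuous_on_mult pfun_continuous_on[OF f]\<close>)
        then show ?thesis by simp
      qed
      then have "f x = 0" for x using pfun_identity[OF f open_ball, of 0 0 \<rho>] assms by auto
      then show False using nz by auto
    qed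
    moreover have "0 \<le> ?B f f" by (rule area_integral_nonneg) auto
    ultimately show "0 < ?B f f" by simp
  qed
  have "\<bar>monom2 k x\<bar> \<le> 1" if "x \<in> cball 0 1" for k x
  proof -
    obtain i j where k: "k = (i, j)" by fastforce
    have "\<bar>x $ 1\<bar> \<le> 1" "\<bar>x $ 2\<bar> \<le> 1" using that component_le_norm_cart[of x] order.trans by auto
    then have "\<bar>x $ 1\<bar> ^ i * \<bar>x $ 2\<bar> ^ j \<le> 1 * 1" by (intro mult_mono power_le_one) auto
    then show ?thesis by (simp add: k monom2_def abs_mult power_abs)
  qed
  then obtain C where C: "C > 0" "\<And>f x. f \<in> pfun l \<Longrightarrow> x \<in> cball 0 1 \<Longrightarrow> (f x)\<^sup>2 \<le> C * ?B f f"
    using pointwise_bound[OF finite_idx inner[unfolded pfun_def], of "cball 0 1" 1] unfolding pfun_def by blast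
  show ?thesis
  proof (intro exI[of _ C] conjI ballI allI impI C(1))
    fix p and z x :: point and h :: real assume p: "p \<in> pfun l" and h: "0 < h" and x: "x \<in> cball z h"
    let ?y = "(1 / h) *\<^sub>R (x - z)"
    have "norm (x - z) \<le> h" using x by (simp add: dist_norm norm_minus_commute)
    then have "?y \<in> cball 0 1" using h by (simp add: divide_le_eq del: scaleR_right_diff_distrib)
    from C(2)[OF pfun_affine[OF p, of z h] this]
    have "(p x)\<^sup>2 \<le> C * ?B (\<lambda>x. p (z + h *\<^sub>R x)) (\<lambda>x. p (z + h *\<^sub>R x))" using h by simp
    also have "area_integral (ball z (\<rho> * h)) (\<lambda>x. (p x)\<^sup>2) = h\<^sup>2 * ?B (\<lambda>x. p (z + h *\<^sub>R x)) (\<lambda>x. p (z + h *\<^sub>R x))"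
      by (subst area_integral_ball_scale) (auto simp: h power2_eq_square intro!: continuous_on_mult pfun_continuous_on[OF p])
    ultimately show "(p x)\<^sup>2 \<le> C / h\<^sup>2 * area_integral (ball z (\<rho> * h)) (\<lambda>x. (p x)\<^sup>2)" using h by simp
  qed
qed

text \<open>All segments are affine images of one reference segment on the first axis, so the
  constant depends on the degree alone.\<close>

lemma edge_sup_bound:
  "\<exists>C>0. \<forall>E. is_segment E \<longrightarrow> (\<forall>f\<in>poly_space l E. \<forall>x\<in>closure E.
    diameter E * (f x)\<^sup>2 \<le> C * edge_integral E (\<lambda>x. (f x)\<^sup>2))"
proof -
  let ?u = "axis 1 1 :: point"
  let ?E = "open_segment 0 ?u"
  have u: "0 \<noteq> ?u" by (simp add: axis_eq_0_iff)
  have E: "is_segment ?E" unfolding is_segment_def using u by blast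
  let ?B = "\<lambda>f g. edge_integral ?E (\<lambda>x. 1 * (f x * g x))"
  have inner: "fun_inner (poly_space l ?E) ?B" by (rule edge_poly_inner[OF E]) auto
  have "\<bar>cut ?E (monom2 k) x\<bar> \<le> 1" if x: "x \<in> closure ?E" for k x
  proof -
    obtain i j where k: "k = (i, j)" by fastforce
    obtain s where s: "x = s *\<^sub>R ?u" "0 \<le> s" "s \<le> 1"
      using x u by (auto simp: closure_open_segment closed_segment_def)
    have "s ^ i * 0 ^ j \<le> 1" using s by (cases "j = 0") (auto simp: power_le_one power_0_left)
    then show ?thesis using x s by (simp add: k monom2_def axis_def abs_mult power_abs)
  qed
  then obtain C where C: "C > 0"
      "\<And>f x. f \<in> poly_space l ?E \<Longrightarrow> x \<in> closure ?E \<Longrightarrow> (f x)\<^sup>2 \<le> C * ?B f f"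
    using pointwise_bound[OF finite_idx inner[unfolded poly_space_fspan], of "closure ?E" 1]
    unfolding poly_space_fspan by blast
  show ?thesis
  proof (intro exI[of _ C] conjI ballI allI impI C(1))
    fix E :: "point set" and f x assume "is_segment E" and f: "f \<in> poly_space l E" and x: "x \<in> closure E"
    then obtain a b where ab: "a \<noteq> b" "E = open_segment a b" by (auto simp: is_segment_def)
    obtain p where p: "p \<in> pfun l" "f = cut E p" using f by (auto simp: poly_space_iff)
    obtain s where s: "x = (1 - s) *\<^sub>R a + s *\<^sub>R b" "0 \<le> s" "s \<le> 1"
      using x ab by (auto simp: closure_open_segment closed_segment_def)
    \<comment> \<open>On the reference segment the first coordinate is the parameter, so this is
      \<open>f\<close> transported to it.\<close>
    let ?q = "cut ?E (\<lambda>y. p (a + (y $ 1) *\<^sub>R (b - a)))"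
    have q: "?q \<in> poly_space l ?E" by (rule cut_poly_space[OF pfun_affine_line[OF p(1)]])
    have qs: "?q (s *\<^sub>R ?u) = f ((1 - s) *\<^sub>R a + s *\<^sub>R b)" if "s \<in> {0..1}" for s
    proof -
      have "s *\<^sub>R ?u \<in> closure ?E" using edge_param_closure[OF u that] by simp
      moreover have "(1 - s) *\<^sub>R a + s *\<^sub>R b \<in> closure E" using edge_param_closure[OF ab(1) that] ab by simp
      ultimately show ?thesis by (simp add: p(2) algebra_simps axis_def)
    qed
    have "s *\<^sub>R ?u \<in> closure ?E" using edge_param_closure[OF u, of s] s by simp
    from C(2)[OF q this] have "(f x)\<^sup>2 \<le> C * ?B ?q ?q" using qs[of s] s by simp
    also have "?B ?q ?q = set_lebesgue_integral lborel {0..1} (\<lambda>s. (f ((1 - s) *\<^sub>R a + s *\<^sub>R b))\<^sup>2)"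
      unfolding edge_integral_segment[OF u] set_lebesgue_integral_def
      by (simp, intro Bochner_Integration.integral_cong) (auto simp: indicator_def qs power2_eq_square)
    finally have "dist a b * (f x)\<^sup>2 \<le> dist a b * (C * set_lebesgue_integral lborel {0..1} (\<lambda>s. (f ((1 - s) *\<^sub>R a + s *\<^sub>R b))\<^sup>2))"
      by (rule mult_left_mono) simp
    moreover have "diameter E = dist a b" using ab by (simp add: diameter_open_segment)
    ultimately show "diameter E * (f x)\<^sup>2 \<le> C * edge_integral E (\<lambda>x. (f x)\<^sup>2)"
      unfolding ab(2) edge_integral_segment[OF ab(1)] by (simp add: mult_ac)
  qed
qed

section \<open>Elements that are star-shaped with respect to a ball\<close>

locale mesh_edges =
  fixes M :: mesh
  assumes edge_segment: "E \<in> edges M \<Longrightarrow> \<exists>a b. a \<noteq> b \<and> E = open_segment a b \<and> tangent M E = sgn (b - a)"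
    and edges_disjoint: "E \<in> edges M \<Longrightarrow> E' \<in> edges M \<Longrightarrow> E \<noteq> E' \<Longrightarrow> E \<inter> E' = {}"
    and finite_edges: "finite (edges M)"
begin

lemma edgeE:
  assumes "E \<in> edges M"
  obtains a b where "a \<noteq> b" "E = open_segment a b" "tangent M E = sgn (b - a)"
    "normal M E \<bullet> (b - a) = 0"
    "normal M E $ 1 * norm (b - a) = - ((b - a) $ 2)" "normal M E $ 2 * norm (b - a) = (b - a) $ 1"
proof -
  obtain a b where ab: "a \<noteq> b" "E = open_segment a b" "tangent M E = sgn (b - a)"
    using edge_segment[OF assms] by blast
  have n: "normal M E $ 1 = - ((b - a) $ 2 / norm (b - a))" "normal M E $ 2 = (b - a) $ 1 / norm (b - a)"
    by (auto simp: normal_def ab(3) sgn_vec_def divide_inverse_commute sgn_div_norm)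
  have "norm (b - a) \<noteq> 0" using ab by simp
  then show ?thesis
    by (intro that[OF ab]) (auto simp: n inner_vec_def sum_2)
qed

lemma edge_is_segment: "E \<in> edges M \<Longrightarrow> is_segment E"
  unfolding is_segment_def using edge_segment by blast

lemma norm_normal: assumes "E \<in> edges M" shows "norm (normal M E) = 1"
proof -
  obtain a b where ab: "a \<noteq> b" "tangent M E = sgn (b - a)" using edge_segment[OF assms] by blast
  have "norm (normal M E) = norm (tangent M E)"
    by (simp add: normal_def norm_vec_def L2_set_def sum_2 add.commute)
  then show ?thesis using ab by (simp add: norm_sgn)
qed

lemma normal_inner_self: "E \<in> edges M \<Longrightarrow> normal M E \<bullet> normal M E = 1"
  using norm_normal by (simp add: norm_eq_1)

text \<open>An edge lies on a level line of its normal. The closure is included so that the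
  statement covers the end points.\<close>

lemma edge_normal_const:
  assumes E: "E \<in> edges M" and x: "x \<in> E" and y: "y \<in> closure E"
  shows "(x - w) \<bullet> normal M E = (y - w) \<bullet> normal M E"
proof -
  obtain a b where ab: "a \<noteq> b" "E = open_segment a b" "normal M E \<bullet> (b - a) = 0" using edgeE[OF E] by metis
  have "y \<in> closed_segment a b" using y ab(1) unfolding ab(2) by simp
  moreover have "x \<in> closed_segment a b" using x unfolding ab(2) by (simp add: open_segment_def)
  ultimately obtain u v where uv: "x = (1 - u) *\<^sub>R a + u *\<^sub>R b" "y = (1 - v) *\<^sub>R a + v *\<^sub>R b"
    by (auto simp: closed_segment_def)
  have "x - y = (u - v) *\<^sub>R (b - a)" unfolding uv by (simp add: algebra_simps)
  then have "(x - y) \<bullet> normal M E = 0" using ab(3) by (simp add: inner_commute)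
  then show ?thesis by (simp add: inner_diff_left)
qed

text \<open>In the plane, orthogonal to the normal means parallel to the edge; the parameter on the
  line is then read off by projection on \<open>b - a\<close>.\<close>

lemma edge_line:
  assumes ab: "a \<noteq> b" and E: "E \<in> edges M" "E = open_segment a b" and n: "normal M E \<bullet> (b - a) = 0"
    and x: "x \<in> E" and w: "(w - x) \<bullet> normal M E = 0"
  shows "w = a + ((w - a) \<bullet> (b - a) / (norm (b - a))\<^sup>2) *\<^sub>R (b - a)"
proof -
  let ?d = "b - a" and ?n = "normal M E"
  obtain u where "x = (1 - u) *\<^sub>R a + u *\<^sub>R b" using x E by (auto simp: in_segment)
  then have xa: "x - a = u *\<^sub>R ?d" by (simp add: algebra_simps)
  have "(w - a) \<bullet> ?n = (w - x) \<bullet> ?n + (x - a) \<bullet> ?n" by (simp add: inner_diff_left)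
  also have "\<dots> = 0" using w n xa by (simp add: inner_commute)
  finally have wn: "(w - a) \<bullet> ?n = 0" .
  obtain a' b' where e: "E = open_segment a' b'" "a' \<noteq> b'"
    "?n $ 1 * norm (b' - a') = - ((b' - a') $ 2)" "?n $ 2 * norm (b' - a') = (b' - a') $ 1"
    using edgeE[OF E(1)] by metis
  have d0: "?d $ 1 * ?d $ 1 + ?d $ 2 * ?d $ 2 \<noteq> 0"
    using ab by (auto simp: sum_squares_eq_zero_iff vec_eq_iff forall_2)
  have n0: "?n $ 1 * ?n $ 1 + ?n $ 2 * ?n $ 2 = 1"
    using normal_inner_self[OF E(1)] by (simp add: inner_vec_def sum_2)
  define p q where "p = (w - a) $ 1" and "q = (w - a) $ 2"
  define n1 n2 where "n1 = ?n $ 1" and "n2 = ?n $ 2"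
  define d1 d2 where "d1 = ?d $ 1" and "d2 = ?d $ 2"
  have 1: "p * n1 + q * n2 = 0" using wn by (simp add: inner_vec_def sum_2 p_def q_def n1_def n2_def)
  have 2: "n1 * d1 + n2 * d2 = 0" using n by (simp add: inner_vec_def sum_2 d1_def d2_def n1_def n2_def)
  have 3: "n1 * n1 + n2 * n2 = 1" using n0 by (simp add: n1_def n2_def)
  have 4: "d1 * d1 + d2 * d2 \<noteq> 0" using d0 by (simp add: d1_def d2_def)
  \<comment> \<open>The cross product with the edge direction is annihilated by both components of
    the normal, which is a unit vector.\<close>
  have pq: "p * d2 = q * d1"
  proof -
    have "n1 * (p * d2 - q * d1) = 0" "n2 * (p * d2 - q * d1) = 0" using 1 2 by algebra+
    then have "(n1 * n1 + n2 * n2) * (p * d2 - q * d1) = 0" by algebra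
    then show ?thesis using 3 by simp
  qed
  have c: "(w - a) \<bullet> ?d = p * d1 + q * d2" "(norm ?d)\<^sup>2 = d1 * d1 + d2 * d2"
    by (auto simp: inner_vec_def sum_2 power2_norm_eq_inner p_def q_def d1_def d2_def)
  have "p * (d1 * d1 + d2 * d2) = (p * d1 + q * d2) * d1" using pq by algebra
  then have "p = (p * d1 + q * d2) / (d1 * d1 + d2 * d2) * d1" using 4 by (simp add: field_simps)
  moreover have "q * (d1 * d1 + d2 * d2) = (p * d1 + q * d2) * d2" using pq by algebra
  then have "q = (p * d1 + q * d2) / (d1 * d1 + d2 * d2) * d2" using 4 by (simp add: field_simps)
  ultimately have "(w - a) $ i = (((w - a) \<bullet> ?d / (norm ?d)\<^sup>2) *\<^sub>R ?d) $ i" for i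
    unfolding c using exhaust_2[of i] by (auto simp: p_def q_def d1_def d2_def)
  then have "w - a = ((w - a) \<bullet> ?d / (norm ?d)\<^sup>2) *\<^sub>R ?d" by (simp add: vec_eq_iff)
  then show ?thesis by (simp add: algebra_simps)
qed

end

text \<open>The radius is kept abstract; a regular element supplies
  \<open>\<rho> * diameter T\<close>. Star-shapedness is with respect to every point of the ball,
  which is what excludes edges seen tangentially.\<close>

locale star_element = mesh_edges +
  fixes T :: "point set" and z :: point and r :: real
  assumes openT: "open T" and boundedT: "bounded T"
    and frontierT: "frontier T = (\<Union>E\<in>element_edges M T. closure E)"
    and r: "0 < r"
    and star: "y \<in> ball z r \<Longrightarrow> x \<in> T \<Longrightarrow> closed_segment y x \<subseteq> T"
    and ballT: "ball z r \<subseteq> T"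
begin

lemma finite_element_edges: "finite (element_edges M T)"
  using finite_edges by (simp add: element_edges_def)

lemma element_edge: "E \<in> element_edges M T \<Longrightarrow> E \<in> edges M"
  and element_edge_frontier: "E \<in> element_edges M T \<Longrightarrow> E \<subseteq> frontier T"
  by (auto simp: element_edges_def)

lemma frontier_disjoint: "x \<in> frontier T \<Longrightarrow> x \<notin> T"
  using openT by (simp add: frontier_def interior_open)

lemma frontier_closure: "x \<in> frontier T \<Longrightarrow> x \<in> closure T"
  by (simp add: frontier_def)

lemma closure_edge_closure: "E \<in> element_edges M T \<Longrightarrow> x \<in> closure E \<Longrightarrow> x \<in> closure T"
  using frontierT frontier_closure by blast

lemma zT: "z \<in> T" using ballT r by auto

text \<open>Star-shapedness extends to boundary points. A point \<open>w\<close> of the segment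
  stays fixed while \<open>x\<close> is replaced by a nearby point of \<open>T\<close>; the other
  end then moves only slightly and remains in the ball.\<close>

lemma open_segment_star:
  assumes y: "y \<in> ball z r" and x: "x \<in> closure T"
  shows "open_segment y x \<subseteq> T"
proof
  fix w assume "w \<in> open_segment y x"
  then obtain u where u: "0 < u" "u < 1" "w = (1 - u) *\<^sub>R y + u *\<^sub>R x" by (auto simp: in_segment)
  have "open ((\<lambda>x'. (1 / (1 - u)) *\<^sub>R (w - u *\<^sub>R x')) -` ball z r)"
    by (intro continuous_open_vimage continuous_intros) auto
  moreover have "(1 / (1 - u)) *\<^sub>R (w - u *\<^sub>R x) = y" using u by simp
  then have "x \<in> (\<lambda>x'. (1 / (1 - u)) *\<^sub>R (w - u *\<^sub>R x')) -` ball z r" using y by simp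
  ultimately have "(\<lambda>x'. (1 / (1 - u)) *\<^sub>R (w - u *\<^sub>R x')) -` ball z r \<inter> T \<noteq> {}"
    using x open_Int_closure_eq_empty by blast
  then obtain x' where x': "x' \<in> T" "(1 / (1 - u)) *\<^sub>R (w - u *\<^sub>R x') \<in> ball z r" by blast
  let ?y = "(1 / (1 - u)) *\<^sub>R (w - u *\<^sub>R x')"
  have "w = (1 - u) *\<^sub>R ?y + u *\<^sub>R x'" using u by simp
  then have "w \<in> closed_segment ?y x'" unfolding closed_segment_def using u(1,2) by (intro CollectI exI[of _ u]) auto
  then show "w \<in> T" using star[OF x'(2,1)] by blast
qed

text \<open>The line of an edge misses the ball. Otherwise the foot \<open>y\<close> of the
  perpendicular from \<open>z\<close> lies in the ball, and the open segment from \<open>y\<close>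
  to a point of the edge beyond \<open>x\<close> would put the boundary point \<open>x\<close> into
  \<open>T\<close>.\<close>

lemma edge_distance:
  assumes E: "E \<in> element_edges M T" and x: "x \<in> E"
  shows "r \<le> \<bar>(x - z) \<bullet> normal M E\<bar>"
proof (rule ccontr)
  assume neg: "\<not> r \<le> \<bar>(x - z) \<bullet> normal M E\<bar>"
  let ?n = "normal M E"
  have EE: "E \<in> edges M" using E element_edge by blast
  obtain a b where ab: "a \<noteq> b" "E = open_segment a b" "normal M E \<bullet> (b - a) = 0"
    using edgeE[OF EE] by metis
  let ?d = "b - a"
  define y where "y = z + ((x - z) \<bullet> ?n) *\<^sub>R ?n"
  have yb: "y \<in> ball z r" using neg norm_normal[OF EE] by (simp add: y_def dist_norm)
  have "(y - x) \<bullet> ?n = 0" unfolding y_def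
    using normal_inner_self[OF EE] by (simp add: inner_diff_left inner_add_left)
  from edge_line[OF ab(1) EE ab(2,3) x this] obtain v where v: "y = a + v *\<^sub>R ?d" by blast
  obtain s where s: "0 < s" "s < 1" "x = (1 - s) *\<^sub>R a + s *\<^sub>R b" using x ab by (auto simp: in_segment)
  have xs: "x = a + s *\<^sub>R ?d" using s by (simp add: algebra_simps)
  have xT: "x \<notin> T" "x \<in> frontier T" using frontier_disjoint element_edge_frontier[OF E] x by auto
  then have "v \<noteq> s" using yb ballT v xs by auto
  \<comment> \<open>A parameter on the edge on the far side of \<open>s\<close> as seen from
    \<open>v\<close>, so that \<open>x\<close> lies strictly between \<open>y\<close> and
    \<open>x'\<close>.\<close>
  define s' where "s' = (if v < s then (s + 1) / 2 else s / 2)"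
  define x' where "x' = a + s' *\<^sub>R ?d"
  have s': "0 < s'" "s' < 1" using s by (auto simp: s'_def)
  have "x' = (1 - s') *\<^sub>R a + s' *\<^sub>R b" by (simp add: x'_def algebra_simps)
  then have "x' \<in> E" using ab s' by (auto simp: in_segment)
  then have "x' \<in> closure T" using element_edge_frontier[OF E] frontier_closure by blast
  then have sub: "open_segment y x' \<subseteq> T" by (rule open_segment_star[OF yb])
  have sv: "s' \<noteq> v" using \<open>v \<noteq> s\<close> s by (auto simp: s'_def split: if_splits)
  define u where "u = (s - v) / (s' - v)"
  have u: "0 < u" "u < 1" using \<open>v \<noteq> s\<close> s by (auto simp: u_def s'_def field_simps)
  have us: "u * (s' - v) = s - v" using sv by (simp add: u_def)
  have "(1 - u) *\<^sub>R y + u *\<^sub>R x' = a + (v + u * (s' - v)) *\<^sub>R ?d"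
    unfolding v x'_def by (simp add: algebra_simps)
  also have "\<dots> = x" using us xs by simp
  finally have "x = (1 - u) *\<^sub>R y + u *\<^sub>R x'" by simp
  moreover have "y \<noteq> x'" using v x'_def sv ab(1) by simp
  ultimately have "x \<in> open_segment y x'" using u by (auto simp: in_segment)
  then show False using sub xT by blast
qed

text \<open>Central projection \<open>\<pi>\<close> from \<open>z\<close> onto the line of the edge
  maps a neighbourhood of \<open>x\<close> into the edge. A nearby \<open>w\<close> in front of the
  edge lies on the open segment from \<open>z\<close> to \<open>\<pi> w\<close>, hence in
  \<open>T\<close>; a \<open>w\<close> behind it in the closure would force \<open>\<pi> w\<close>
  into \<open>T\<close>.\<close>

lemma edge_local:
  assumes E: "E \<in> element_edges M T" and x: "x \<in> E"
  defines "\<sigma> \<equiv> sgn ((x - z) \<bullet> normal M E)"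
  shows "\<exists>\<delta>>0. \<forall>w\<in>ball x \<delta>. (\<sigma> * ((w - x) \<bullet> normal M E) < 0 \<longrightarrow> w \<in> T) \<and>
    (0 < \<sigma> * ((w - x) \<bullet> normal M E) \<longrightarrow> w \<notin> closure T) \<and> ((w - x) \<bullet> normal M E = 0 \<longrightarrow> w \<in> E)"
proof -
  let ?n = "normal M E"
  have EE: "E \<in> edges M" using E element_edge by blast
  obtain a b where ab: "a \<noteq> b" "E = open_segment a b" "normal M E \<bullet> (b - a) = 0"
    using edgeE[OF EE] by metis
  let ?d = "b - a"
  define c where "c = (x - z) \<bullet> ?n"
  have c: "r \<le> \<bar>c\<bar>" "c \<noteq> 0" using edge_distance[OF E x] r by (auto simp: c_def)
  define g where "g w = (w - z) \<bullet> ?n" for w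
  define \<pi> where "\<pi> w = z + (c / g w) *\<^sub>R (w - z)" for w
  define \<tau> where "\<tau> w = (w - a) \<bullet> ?d / (norm ?d)\<^sup>2" for w
  have gx: "g x = c" by (simp add: g_def c_def)
  obtain s where s: "0 < s" "s < 1" "x = (1 - s) *\<^sub>R a + s *\<^sub>R b" using x ab by (auto simp: in_segment)
  have xs: "x = a + s *\<^sub>R ?d" using s by (simp add: algebra_simps)
  have "\<tau> x = s" unfolding \<tau>_def xs using ab(1) by (simp add: power2_norm_eq_inner)
  have "isCont g x" unfolding g_def by (intro continuous_intros)
  then have t1: "(g \<longlongrightarrow> c) (at x)" using gx by (simp add: isCont_def)
  have "\<pi> x = x" using c gx by (simp add: \<pi>_def)
  have "((\<lambda>w. \<tau> (\<pi> w)) \<longlongrightarrow> ((z + (c / c) *\<^sub>R (x - z)) - a) \<bullet> ?d / (norm ?d)\<^sup>2) (at x)"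
    unfolding \<tau>_def \<pi>_def by (intro tendsto_intros t1) (use c ab in auto)
  then have t2: "((\<lambda>w. \<tau> (\<pi> w)) \<longlongrightarrow> s) (at x)" using c \<open>\<tau> x = s\<close> by (simp add: \<tau>_def)
  have ev: "eventually (\<lambda>w. 0 < \<tau> (\<pi> w) \<and> \<tau> (\<pi> w) < 1 \<and> dist (g w) c < \<bar>c\<bar>) (at x)"
  proof -
    have "\<forall>\<^sub>F w in at x. 0 < \<tau> (\<pi> w)" "\<forall>\<^sub>F w in at x. \<tau> (\<pi> w) < 1"
      using order_tendstoD[OF t2] s by blast+
    moreover have "\<forall>\<^sub>F w in at x. dist (g w) c < \<bar>c\<bar>" using tendstoD[OF t1, of "\<bar>c\<bar>"] c by simp
    ultimately show ?thesis by eventually_elim simp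
  qed
  then obtain \<delta> where \<delta>: "\<delta> > 0"
    "\<And>w. w \<noteq> x \<Longrightarrow> dist w x < \<delta> \<Longrightarrow> 0 < \<tau> (\<pi> w) \<and> \<tau> (\<pi> w) < 1 \<and> dist (g w) c < \<bar>c\<bar>"
    unfolding eventually_at by blast
  have all: "0 < \<tau> (\<pi> w) \<and> \<tau> (\<pi> w) < 1 \<and> dist (g w) c < \<bar>c\<bar>" if "w \<in> ball x \<delta>" for w
    using \<delta>(2)[of w] that \<open>\<pi> x = x\<close> \<open>\<tau> x = s\<close> s gx c by (cases "w = x") (auto simp: dist_commute)
  show ?thesis
  proof (intro exI[of _ \<delta>] conjI ballI impI \<delta>(1))
    fix w assume w: "w \<in> ball x \<delta>"
    \<comment> \<open>Near \<open>x\<close> the height over \<open>z\<close> keeps its sign, so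
      \<open>\<pi> w\<close> lies on the ray from \<open>z\<close> through \<open>w\<close> and not
      on the opposite one.\<close>
    have gc: "g w / c > 0"
    proof -
      have "\<bar>g w - c\<bar> < \<bar>c\<bar>" using all[OF w] by (simp add: dist_real_def)
      then show ?thesis using c by (auto simp: zero_less_divide_iff abs_if split: if_splits)
    qed
    then have g0: "g w \<noteq> 0" by auto
    have "(\<pi> w - z) \<bullet> ?n = (c / g w) * g w" by (simp add: \<pi>_def g_def)
    then have "(\<pi> w - z) \<bullet> ?n = c" using g0 by simp
    then have "(\<pi> w - x) \<bullet> ?n = 0" by (simp add: c_def inner_diff_left)
    from edge_line[OF ab(1) EE ab(2,3) x this]
    have "\<pi> w = a + \<tau> (\<pi> w) *\<^sub>R ?d" by (simp add: \<tau>_def)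
    then have "\<pi> w = (1 - \<tau> (\<pi> w)) *\<^sub>R a + \<tau> (\<pi> w) *\<^sub>R b"
      by (metis (no_types, lifting) add.commute add_diff_eq diff_add_eq scaleR_left_diff_distrib scaleR_one scaleR_right_diff_distrib)
    then have \<pi>E: "\<pi> w \<in> E" using all[OF w] ab by (auto simp: in_segment)
    then have \<pi>F: "\<pi> w \<in> frontier T" using element_edge_frontier[OF E] by blast
    have gw: "g w = c + (w - x) \<bullet> ?n" by (simp add: g_def c_def inner_diff_left)
    have sc: "\<sigma> * c = \<bar>c\<bar>" "\<sigma> = sgn c" by (auto simp: \<sigma>_def c_def sgn_if)
    have wz: "w \<noteq> z" using g0 by (auto simp: g_def)
    { assume "\<sigma> * ((w - x) \<bullet> ?n) < 0"
      then have q: "g w / c < 1" using gw c sc(2) by (auto simp: field_simps sgn_if split: if_splits)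
      have "w = (1 - g w / c) *\<^sub>R z + (g w / c) *\<^sub>R \<pi> w"
        using g0 c by (simp add: \<pi>_def algebra_simps)
      moreover have "z \<noteq> \<pi> w" using \<pi>F zT frontier_disjoint by auto
      ultimately have "w \<in> open_segment z (\<pi> w)" using q gc by (auto simp: in_segment)
      then show "w \<in> T" using open_segment_star[of z "\<pi> w"] \<pi>F frontier_closure r by auto }
    { assume "0 < \<sigma> * ((w - x) \<bullet> ?n)"
      then have "g w / c > 1" using gw c sc(2) by (auto simp: field_simps sgn_if split: if_splits)
      then have q: "0 < c / g w" "c / g w < 1" using gc g0 c by (auto simp: field_simps zero_less_divide_iff)
      have "\<pi> w = (1 - c / g w) *\<^sub>R z + (c / g w) *\<^sub>R w" by (simp add: \<pi>_def algebra_simps)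
      then have "\<pi> w \<in> open_segment z w" using q wz by (auto simp: in_segment)
      then show "w \<notin> closure T" using open_segment_star[of z w] \<pi>F frontier_disjoint r by auto }
    { assume "(w - x) \<bullet> ?n = 0"
      then have "g w = c" using gw by simp
      then have "\<pi> w = w" using c by (simp add: \<pi>_def)
      then show "w \<in> E" using \<pi>E by simp }
  qed
qed

text \<open>The outward side is the one away from \<open>z\<close>. The default \<open>- 1\<close>
  in the definition of the sign is therefore taken exactly when the normal points inwards.\<close>

lemma omega_eq:
  assumes E: "E \<in> element_edges M T" and x: "x \<in> E"
  shows "\<omega>TE M T E = sgn ((x - z) \<bullet> normal M E)"
proof -
  let ?n = "normal M E"
  have EE: "E \<in> edges M" using E element_edge by blast
  have c: "(y - z) \<bullet> ?n = (x - z) \<bullet> ?n" if "y \<in> E" for y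
    using edge_normal_const[OF EE that, of x] x closure_subset by blast
  have nn: "?n \<bullet> ?n = 1" "norm ?n = 1" using normal_inner_self[OF EE] norm_normal[OF EE] by auto
  have ne: "(x - z) \<bullet> ?n \<noteq> 0" using edge_distance[OF E x] r by auto
  show ?thesis
  proof (cases "(x - z) \<bullet> ?n > 0")
    case True
    have "points_out_of ?n E T" unfolding points_out_of_def
    proof
      fix y assume y: "y \<in> E"
      obtain \<delta> where \<delta>: "\<delta> > 0" "\<And>w. w \<in> ball y \<delta> \<Longrightarrow> ((w - y) \<bullet> ?n < 0 \<longrightarrow> w \<in> T) \<and> (0 < (w - y) \<bullet> ?n \<longrightarrow> w \<notin> closure T)"
        using edge_local[OF E y] c[OF y] True by auto
      show "\<exists>\<epsilon>>0. \<forall>s. 0 < s \<and> s < \<epsilon> \<longrightarrow> y + s *\<^sub>R ?n \<notin> closure T \<and> y - s *\<^sub>R ?n \<in> T"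
        using \<delta>(1) \<delta>(2)[of "y + _ *\<^sub>R ?n"] \<delta>(2)[of "y - _ *\<^sub>R ?n"] nn
        by (intro exI[of _ \<delta>]) (auto simp: dist_norm)
    qed
    then show ?thesis using True by (simp add: \<omega>TE_def)
  next
    case False
    then have neg: "(x - z) \<bullet> ?n < 0" using ne by simp
    obtain \<delta> where \<delta>: "\<delta> > 0" "\<And>w. w \<in> ball x \<delta> \<Longrightarrow> (0 < - ((w - x) \<bullet> ?n) \<longrightarrow> w \<notin> closure T)"
      using edge_local[OF E x] neg by auto
    have "\<not> points_out_of ?n E T"
    proof
      assume "points_out_of ?n E T"
      then obtain \<epsilon> where \<epsilon>: "\<epsilon> > 0" "\<And>s. 0 < s \<Longrightarrow> s < \<epsilon> \<Longrightarrow> x - s *\<^sub>R ?n \<in> T"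
        using x unfolding points_out_of_def by blast
      define s where "s = min \<epsilon> \<delta> / 2"
      have s: "0 < s" "s < \<epsilon>" "s < \<delta>" using \<epsilon>(1) \<delta>(1) by (auto simp: s_def)
      have "x - s *\<^sub>R ?n \<notin> closure T" using \<delta>(2)[of "x - s *\<^sub>R ?n"] s nn by (auto simp: dist_norm)
      then show False using \<epsilon>(2)[OF s(1,2)] closure_subset by blast
    qed
    then show ?thesis using neg by (simp add: \<omega>TE_def)
  qed
qed

lemma omega_local:
  assumes E: "E \<in> element_edges M T" and x: "x \<in> E"
  obtains \<delta> where "\<delta> > 0"
    "\<And>w. w \<in> ball x \<delta> \<Longrightarrow> \<omega>TE M T E * ((w - x) \<bullet> normal M E) < 0 \<Longrightarrow> w \<in> T"
    "\<And>w. w \<in> ball x \<delta> \<Longrightarrow> 0 < \<omega>TE M T E * ((w - x) \<bullet> normal M E) \<Longrightarrow> w \<notin> closure T"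
    "\<And>w. w \<in> ball x \<delta> \<Longrightarrow> (w - x) \<bullet> normal M E = 0 \<Longrightarrow> w \<in> E"
  using edge_local[OF E x] unfolding omega_eq[OF E x, symmetric] by blast

text \<open>Edges of one element meet only at common vertices. If an end point of \<open>E\<close>
  were inside \<open>E'\<close>, nearby points of \<open>E\<close>, being on the frontier, would lie
  on \<open>E'\<close> by the local picture, although the two edges are disjoint. Gluing traces
  relies on this.\<close>

lemma element_edges_separated:
  assumes E: "E \<in> element_edges M T" and E': "E' \<in> element_edges M T" and ne: "E \<noteq> E'"
  shows "closure E \<inter> E' = {}"
proof (rule ccontr)
  assume "closure E \<inter> E' \<noteq> {}"
  then obtain V where V: "V \<in> closure E" "V \<in> E'" by blast
  have disj: "E \<inter> E' = {}" using edges_disjoint element_edge E E' ne by blast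
  obtain \<delta> where \<delta>: "\<delta> > 0"
    "\<And>w. w \<in> ball V \<delta> \<Longrightarrow> \<omega>TE M T E' * ((w - V) \<bullet> normal M E') < 0 \<Longrightarrow> w \<in> T"
    "\<And>w. w \<in> ball V \<delta> \<Longrightarrow> 0 < \<omega>TE M T E' * ((w - V) \<bullet> normal M E') \<Longrightarrow> w \<notin> closure T"
    "\<And>w. w \<in> ball V \<delta> \<Longrightarrow> (w - V) \<bullet> normal M E' = 0 \<Longrightarrow> w \<in> E'"
    using omega_local[OF E' V(2)] by blast
  obtain w where w: "w \<in> E" "dist w V < \<delta>" using V(1) \<delta>(1) unfolding closure_approachable by blast
  have wb: "w \<in> ball V \<delta>" using w by (simp add: dist_commute)
  have wF: "w \<in> frontier T" using element_edge_frontier[OF E] w by blast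
  have "\<omega>TE M T E' \<noteq> 0" by (simp add: \<omega>TE_def)
  moreover have "\<omega>TE M T E' * ((w - V) \<bullet> normal M E') = 0"
    using \<delta>(2,3)[OF wb] frontier_disjoint[OF wF] frontier_closure[OF wF] by fastforce
  ultimately have "w \<in> E'" using \<delta>(4)[OF wb] by simp
  then show False using w disj by blast
qed

lemma frontier_cases:
  assumes "x \<in> frontier T" "x \<notin> element_vertices M T"
  obtains E where "E \<in> element_edges M T" "x \<in> E"
  using assms frontierT by (auto simp: element_vertices_def edge_vertices_def)

lemma edge_vertices_eq: "a \<noteq> b \<Longrightarrow> edge_vertices (open_segment a b) = {a, b}" for a b :: point
proof -
  assume "a \<noteq> b"
  then have "closure (open_segment a b) = closed_segment a b" by simp
  then show ?thesis unfolding edge_vertices_def by (auto simp: open_segment_def)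
qed

lemma finite_element_vertices: "finite (element_vertices M T)"
proof -
  have "finite (edge_vertices E)" if E: "E \<in> element_edges M T" for E
  proof -
    obtain a b where "a \<noteq> b" "E = open_segment a b" using edge_segment[OF element_edge[OF E]] by blast
    then show ?thesis using edge_vertices_eq by simp
  qed
  then show ?thesis unfolding element_vertices_def using finite_element_edges by blast
qed

section \<open>The divergence theorem on an element\<close>

text \<open>The line meets the boundary only inside edges and transversally, so each edge is crossed
  at most once.\<close>

definition generic_line :: "point \<Rightarrow> point \<Rightarrow> bool" where
  "generic_line x \<xi> \<longleftrightarrow> (\<forall>t. x + t *\<^sub>R \<xi> \<notin> element_vertices M T) \<and>
     (\<forall>E\<in>element_edges M T. \<forall>t. x + t *\<^sub>R \<xi> \<in> E \<longrightarrow> normal M E \<bullet> \<xi> \<noteq> 0)"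

lemma crossing_unique:
  assumes "generic_line x \<xi>" "E \<in> element_edges M T" "x + s *\<^sub>R \<xi> \<in> E" "x + t *\<^sub>R \<xi> \<in> E"
  shows "s = t"
proof -
  have "(x + s *\<^sub>R \<xi> - x) \<bullet> normal M E = (x + t *\<^sub>R \<xi> - x) \<bullet> normal M E"
    by (rule edge_normal_const[OF element_edge[OF assms(2)] assms(3)]) (use assms(4) closure_subset in blast)
  moreover have "normal M E \<bullet> \<xi> \<noteq> 0" using assms by (auto simp: generic_line_def)
  ultimately show ?thesis by (simp add: inner_commute)
qed

text \<open>Along a generic line the indicator of the element, with the value $1/2$ on the boundary, is
  a constant plus a sum of steps, one for each crossed edge.\<close>

definition half_ind :: "point \<Rightarrow> real" where
  "half_ind w = (if w \<in> T then 1 else if w \<in> frontier T then 1/2 else 0)"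

definition step :: "point \<Rightarrow> point \<Rightarrow> point set \<Rightarrow> real \<Rightarrow> real" where
  "step x \<xi> E t = (if \<exists>u. x + u *\<^sub>R \<xi> \<in> E then (1 + sgn (t - (THE u. x + u *\<^sub>R \<xi> \<in> E))) / 2 else 0)"

lemma step_crossed:
  assumes "generic_line x \<xi>" "E \<in> element_edges M T" "x + u *\<^sub>R \<xi> \<in> E"
  shows "step x \<xi> E t = (1 + sgn (t - u)) / 2"
proof -
  have "(THE u. x + u *\<^sub>R \<xi> \<in> E) = u" using crossing_unique[OF assms(1,2)] assms(3) by blast
  then show ?thesis using assms(3) by (auto simp: step_def)
qed

lemma step_locally_const:
  assumes g: "generic_line x \<xi>" and E: "E \<in> element_edges M T" and t: "x + t *\<^sub>R \<xi> \<notin> E"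
  shows "\<forall>\<^sub>F s in nhds t. step x \<xi> E s = step x \<xi> E t"
proof (cases "\<exists>u. x + u *\<^sub>R \<xi> \<in> E")
  case True
  then obtain u where u: "x + u *\<^sub>R \<xi> \<in> E" by blast
  then have "u \<noteq> t" using t by auto
  have "\<forall>\<^sub>F s in nhds t. dist s t < \<bar>t - u\<bar>"
    using \<open>u \<noteq> t\<close> by (intro eventually_nhds_metric[THEN iffD2] exI[of _ "\<bar>t - u\<bar>"]) auto
  then show ?thesis
  proof eventually_elim
    case (elim s)
    then have "sgn (s - u) = sgn (t - u)" by (auto simp: sgn_if dist_real_def abs_if split: if_splits)
    then show ?case by (simp add: step_crossed[OF g E u])
  qed
qed (simp add: step_def)

text \<open>The two sides are values of one function of \<open>t\<close> that is locally constant on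
  the whole real line. Away from the boundary each summand is locally constant; at a crossing the
  jump of the indicator is cancelled by the step of the crossed edge.\<close>

lemma half_ind_steps:
  assumes g: "generic_line x \<xi>"
  shows "half_ind (x + t *\<^sub>R \<xi>) + (\<Sum>E\<in>element_edges M T. \<omega>TE M T E * sgn (normal M E \<bullet> \<xi>) * step x \<xi> E t)
       = half_ind x + (\<Sum>E\<in>element_edges M T. \<omega>TE M T E * sgn (normal M E \<bullet> \<xi>) * step x \<xi> E 0)"
proof -
  let ?p = "\<lambda>t. x + t *\<^sub>R \<xi>"
  let ?S = "\<lambda>A t. \<Sum>E\<in>A. \<omega>TE M T E * sgn (normal M E \<bullet> \<xi>) * step x \<xi> E t"
  let ?A = "element_edges M T"
  define D where "D t = half_ind (?p t) + ?S ?A t" for t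
  have contp: "isCont ?p t" for t by (intro continuous_intros)
  have pU: "\<forall>\<^sub>F s in nhds t. ?p s \<in> U" if "open U" "?p t \<in> U" for U t
    using contp[of t] that continuous_within_tendsto_compose by (metis filterlim_def filterlim_iff isCont_def tendsto_at_iff_tendsto_nhds topological_tendstoD)
  have sumc: "\<forall>\<^sub>F s in nhds t. ?S A s = ?S A t" if A: "A \<subseteq> ?A" and t: "\<And>E. E \<in> A \<Longrightarrow> ?p t \<notin> E" for A t
  proof -
    have "\<forall>\<^sub>F s in nhds t. \<forall>E\<in>A. step x \<xi> E s = step x \<xi> E t"
      using A finite_element_edges finite_subset step_locally_const[OF g] t
      by (intro eventually_ball_finite) blast+
    then show ?thesis by eventually_elim (auto intro: sum.cong)
  qed
  have loc: "\<forall>\<^sub>F s in nhds t. D s = D t" for t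
  proof (cases "?p t \<in> frontier T")
    case False
    then have noE: "?p t \<notin> E" if "E \<in> ?A" for E using element_edge_frontier that by blast
    have "\<forall>\<^sub>F s in nhds t. half_ind (?p s) = half_ind (?p t)"
    proof (cases "?p t \<in> T")
      case True
      show ?thesis using pU[OF openT True] by eventually_elim (use True in \<open>simp add: half_ind_def\<close>)
    next
      case F: False
      then have "?p t \<in> - closure T" using False by (auto simp: frontier_def interior_open[OF openT])
      then have "\<forall>\<^sub>F s in nhds t. ?p s \<in> - closure T" by (intro pU) auto
      then show ?thesis
        by eventually_elim (use F False frontier_closure closure_subset in \<open>auto simp: half_ind_def\<close>)
    qed
    moreover have "\<forall>\<^sub>F s in nhds t. ?S ?A s = ?S ?A t" by (rule sumc) (use noE in auto)
    ultimately show ?thesis by eventually_elim (simp add: D_def)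
  next
    case True
    obtain E where E: "E \<in> ?A" "?p t \<in> E" using frontier_cases[OF True] g by (auto simp: generic_line_def)
    have nx: "normal M E \<bullet> \<xi> \<noteq> 0" using g E by (auto simp: generic_line_def)
    have other: "?p t \<notin> E'" if "E' \<in> ?A - {E}" for E'
      using edges_disjoint[OF element_edge[OF E(1)], of E'] element_edge that E(2) by blast
    obtain \<delta> where \<delta>: "\<delta> > 0"
      "\<And>w. w \<in> ball (?p t) \<delta> \<Longrightarrow> \<omega>TE M T E * ((w - ?p t) \<bullet> normal M E) < 0 \<Longrightarrow> w \<in> T"
      "\<And>w. w \<in> ball (?p t) \<delta> \<Longrightarrow> 0 < \<omega>TE M T E * ((w - ?p t) \<bullet> normal M E) \<Longrightarrow> w \<notin> closure T"
      using omega_local[OF E] by metis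
    let ?c = "\<omega>TE M T E * sgn (normal M E \<bullet> \<xi>)"
    have c1: "?c = 1 \<or> ?c = -1" using nx by (auto simp: \<omega>TE_def sgn_if)
    have "\<forall>\<^sub>F s in nhds t. ?p s \<in> ball (?p t) \<delta>" using pU[of "ball (?p t) \<delta>"] \<delta>(1) by simp
    \<comment> \<open>With \<open>?c\<close> the sign of the crossing, the indicator is
      \<open>(1 - ?c * sgn (s - t)) / 2\<close> and the step \<open>(1 + sgn (s - t)) / 2\<close>;
      the dependence on \<open>s\<close> cancels.\<close>
    then have "\<forall>\<^sub>F s in nhds t. half_ind (?p s) + ?c * step x \<xi> E s = (1 + ?c) / 2"
    proof eventually_elim
      case (elim s)
      have d: "\<omega>TE M T E * ((?p s - ?p t) \<bullet> normal M E) = (s - t) * (\<omega>TE M T E * (normal M E \<bullet> \<xi>))"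
        by (simp add: algebra_simps inner_commute)
      have sg: "sgn (\<omega>TE M T E * (normal M E \<bullet> \<xi>)) = ?c" by (simp add: sgn_mult \<omega>TE_def)
      have "half_ind (?p s) = (1 - sgn (s - t) * ?c) / 2"
      proof -
        consider "s = t" | "(s - t) * (\<omega>TE M T E * (normal M E \<bullet> \<xi>)) < 0" | "0 < (s - t) * (\<omega>TE M T E * (normal M E \<bullet> \<xi>))"
        proof (cases "s = t")
          case False
          have "\<omega>TE M T E \<noteq> 0" by (simp add: \<omega>TE_def)
          then have "(s - t) * (\<omega>TE M T E * (normal M E \<bullet> \<xi>)) \<noteq> 0" using nx False by simp
          then show ?thesis using that by linarith
        qed
        then show ?thesis
        proof cases
          case 1 then show ?thesis using True frontier_disjoint by (simp add: half_ind_def)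
        next
          case 2
          then have "sgn (s - t) * ?c = -1" unfolding sg[symmetric] sgn_mult[symmetric] by simp
          moreover have "?p s \<in> T" using \<delta>(2)[OF elim] 2 unfolding d by blast
          ultimately show ?thesis by (simp add: half_ind_def)
        next
          case 3
          then have "sgn (s - t) * ?c = 1" unfolding sg[symmetric] sgn_mult[symmetric] by simp
          moreover have "?p s \<notin> closure T" using \<delta>(3)[OF elim] 3 unfolding d by blast
          then have "half_ind (?p s) = 0" using frontier_closure closure_subset by (auto simp: half_ind_def)
          ultimately show ?thesis by simp
        qed
      qed
      then show ?case by (simp add: step_crossed[OF g E] field_simps)
    qed
    moreover have "\<forall>\<^sub>F s in nhds t. ?S (?A - {E}) s = ?S (?A - {E}) t" by (rule sumc) (use other in auto)
    ultimately have "\<forall>\<^sub>F s in nhds t. D s = (1 + ?c) / 2 + ?S (?A - {E}) t"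
    proof eventually_elim
      case (elim s)
      show ?case unfolding D_def sum.remove[OF finite_element_edges E(1)] using elim by simp
    qed
    then show ?thesis using eventually_nhds_x_imp_x by (fastforce elim: eventually_mono)
  qed
  \<comment> \<open>A locally constant function has derivative zero everywhere, hence is
    constant.\<close>
  have "(D has_real_derivative 0) (at t)" for t
  proof (rule DERIV_cong_ev[THEN iffD2, OF refl loc refl])
    show "((\<lambda>_. D t) has_real_derivative 0) (at t)" by simp
  qed
  then have "D t = D 0" using DERIV_isconst_all by blast
  then show ?thesis by (simp add: D_def)
qed

end

text \<open>The step restricts the fundamental theorem of calculus to the times after
  \<open>c\<close>. Since \<open>c\<close> is neither end point, the boundary terms carry the
  factors 0 or 1 and never 1/2.\<close>

lemma step_integral:
  assumes f: "\<And>t. (f has_real_derivative f' t) (at t)" and m: "0 < m" and c: "c \<noteq> 0" "c \<noteq> m"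
  shows "((\<lambda>t. (1 + sgn (t - c)) / 2 * f' t) has_integral
     ((1 + sgn (m - c)) / 2 * f m - (1 + sgn (0 - c)) / 2 * f 0 - (if 0 < c \<and> c < m then f c else 0))) {0..m}"
proof -
  have FTC: "(f' has_integral (f b - f a)) {a..b}" if "a \<le> b" for a b
    using f that by (intro fundamental_theorem_of_calculus)
      (auto simp: has_real_derivative_iff_has_vector_derivative[symmetric] intro: DERIV_subset)
  have one: "((\<lambda>t. (1 + sgn (t - c)) / 2 * f' t) has_integral (f b - f a)) {a..b}" if "a \<le> b" "c \<le> a" for a b
    by (rule has_integral_spike_finite[OF _ _ FTC[OF that(1)], of "{c}"]) (use that in auto)
  have zero: "((\<lambda>t. (1 + sgn (t - c)) / 2 * f' t) has_integral 0) {a..b}" if "b \<le> c" for a b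
    by (rule has_integral_spike_finite[OF _ _ has_integral_0, of "{c}"]) (use that in auto)
  consider "c < 0" | "0 < c \<and> c < m" | "m < c" using c by linarith
  then show ?thesis
  proof cases
    case 1 then show ?thesis using one[of 0 m] m by simp
  next
    case 2
    then have "((\<lambda>t. (1 + sgn (t - c)) / 2 * f' t) has_integral (0 + (f m - f c))) {0..m}"
      by (intro has_integral_combine[of 0 c m] zero one) auto
    then show ?thesis using 2 by simp
  next
    case 3 then show ?thesis using zero[of m 0] m by simp
  qed
qed

context star_element
begin

text \<open>The indicator is replaced by its steps and \<open>step_integral\<close> is applied to
  each. At time \<open>m\<close> the line has left the element and the boundary terms cancel; at
  time 0 the point may be inside, which leaves the term at \<open>x\<close>. The divergence theorem
  starts its lines outside, the Korn-Poincare bound at the point to be estimated.\<close>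

lemma slice_integral:
  assumes g: "generic_line x \<xi>" and x: "x \<notin> frontier T" and m: "0 < m"
    and far: "\<And>t. m \<le> t \<Longrightarrow> x + t *\<^sub>R \<xi> \<notin> closure T"
    and f: "\<And>t. ((\<lambda>t. f (x + t *\<^sub>R \<xi>)) has_real_derivative f' t) (at t)"
  shows "((\<lambda>t. indicator T (x + t *\<^sub>R \<xi>) * f' t) has_integral
     ((\<Sum>E\<in>element_edges M T. \<omega>TE M T E * sgn (normal M E \<bullet> \<xi>) * (\<Sum>t | 0 < t \<and> x + t *\<^sub>R \<xi> \<in> E. f (x + t *\<^sub>R \<xi>)))
      - indicator T x * f x)) {0..m}"
proof -
  let ?A = "element_edges M T" and ?p = "\<lambda>t. x + t *\<^sub>R \<xi>"
  let ?c = "\<lambda>E. \<omega>TE M T E * sgn (normal M E \<bullet> \<xi>)"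
  define F where "F t = f (?p t)" for t
  have F: "(F has_real_derivative f' t) (at t)" for t using f unfolding F_def .
  define K where "K E = (\<Sum>t | 0 < t \<and> ?p t \<in> E. f (?p t))" for E
  have FTC: "(f' has_integral (F m - F 0)) {0..m}"
    using F m by (intro fundamental_theorem_of_calculus)
      (auto simp: has_real_derivative_iff_has_vector_derivative[symmetric] intro: DERIV_subset)
  have st: "((\<lambda>t. step x \<xi> E t * f' t) has_integral (step x \<xi> E m * F m - step x \<xi> E 0 * F 0 - K E)) {0..m}"
    if E: "E \<in> ?A" for E
  proof (cases "\<exists>u. ?p u \<in> E")
    case True
    then obtain u where u: "?p u \<in> E" by blast
    have uF: "?p u \<in> frontier T" using element_edge_frontier[OF E] u by blast
    have u0: "u \<noteq> 0" using uF x by auto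
    have um: "u < m" using uF far[of u] frontier_closure by force
    have uniq: "?p v \<in> E \<longleftrightarrow> v = u" for v using crossing_unique[OF g E _ u] u by blast
    have set: "{t. 0 < t \<and> ?p t \<in> E} = (if 0 < u then {u} else {})" unfolding uniq by auto
    have "K E = (if 0 < u \<and> u < m then F u else 0)" unfolding K_def set using um by (auto simp: F_def)
    then show ?thesis using step_integral[OF F m u0, of] um by (simp add: step_crossed[OF g E u])
  next
    case False
    then show ?thesis by (simp add: step_def K_def)
  qed
  define D where "D = half_ind x + (\<Sum>E\<in>?A. ?c E * step x \<xi> E 0)"
  have hi: "half_ind (?p t) = D - (\<Sum>E\<in>?A. ?c E * step x \<xi> E t)" for t
    using half_ind_steps[OF g, of t] by (simp add: D_def)
  have "((\<lambda>t. D * f' t - (\<Sum>E\<in>?A. ?c E * (step x \<xi> E t * f' t))) has_integral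
      (D * (F m - F 0) - (\<Sum>E\<in>?A. ?c E * (step x \<xi> E m * F m - step x \<xi> E 0 * F 0 - K E)))) {0..m}"
    by (rule has_integral_diff[OF has_integral_mult_right[OF FTC] has_integral_sum[OF finite_element_edges has_integral_mult_right[OF st]]])
  moreover have "D * f' t - (\<Sum>E\<in>?A. ?c E * (step x \<xi> E t * f' t)) = half_ind (?p t) * f' t" for t
    unfolding hi by (simp add: left_diff_distrib sum_distrib_right mult.assoc)
  moreover have "D * (F m - F 0) - (\<Sum>E\<in>?A. ?c E * (step x \<xi> E m * F m - step x \<xi> E 0 * F 0 - K E))
      = (D - (\<Sum>E\<in>?A. ?c E * step x \<xi> E m)) * F m - (D - (\<Sum>E\<in>?A. ?c E * step x \<xi> E 0)) * F 0 + (\<Sum>E\<in>?A. ?c E * K E)"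
  proof -
    have "(\<Sum>E\<in>?A. ?c E * (step x \<xi> E m * F m - step x \<xi> E 0 * F 0 - K E))
      = (\<Sum>E\<in>?A. ?c E * step x \<xi> E m) * F m - (\<Sum>E\<in>?A. ?c E * step x \<xi> E 0) * F 0 - (\<Sum>E\<in>?A. ?c E * K E)"
      by (simp add: right_diff_distrib sum_subtractf sum_distrib_right mult.assoc)
    then show ?thesis by argo
  qed
  moreover have "(D - (\<Sum>E\<in>?A. ?c E * step x \<xi> E m)) = 0"
  proof -
    have "?p m \<notin> T" "?p m \<notin> frontier T" using far[of m] frontier_closure closure_subset by blast+
    then show ?thesis using hi[of m] by (simp add: half_ind_def)
  qed
  moreover have "(D - (\<Sum>E\<in>?A. ?c E * step x \<xi> E 0)) = indicator T x"
    using x by (auto simp: D_def half_ind_def)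
  ultimately have main: "((\<lambda>t. half_ind (?p t) * f' t) has_integral ((\<Sum>E\<in>?A. ?c E * K E) - indicator T x * f x)) {0..m}"
    by (simp add: F_def)
  \<comment> \<open>The half values on the frontier occur at finitely many times, so they may be
    exchanged for the values of the indicator.\<close>
  have "finite {t. ?p t \<in> frontier T}"
  proof (rule finite_subset)
    show "{t. ?p t \<in> frontier T} \<subseteq> (\<Union>E\<in>?A. {t. ?p t \<in> E})"
      using frontier_cases g by (fastforce simp: generic_line_def)
    have "finite {t. ?p t \<in> E}" if E: "E \<in> ?A" for E
    proof (cases "\<exists>u. ?p u \<in> E")
      case True
      then obtain u where "?p u \<in> E" by blast
      then have "{t. ?p t \<in> E} \<subseteq> {u}" using crossing_unique[OF g E] by blast
      then show ?thesis using finite_subset by blast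
    qed simp
    then show "finite (\<Union>E\<in>?A. {t. ?p t \<in> E})" using finite_element_edges by blast
  qed
  then show ?thesis unfolding K_def[symmetric]
    by (rule has_integral_spike_finite[OF _ _ main]) (auto simp: half_ind_def)
qed

end

section \<open>Slicing the plane by coordinate lines\<close>

lemma coordinates_measurable:
  "(\<lambda>(y, t). axis j y + axis i t :: point) \<in> borel_measurable (lborel \<Otimes>\<^sub>M lborel)"
proof -
  have "continuous_on UNIV (\<lambda>p. axis j (fst p) + axis i (snd p) :: point)"
  proof (intro continuous_on_add)
    have vl: "continuous_on UNIV (\<lambda>x. \<chi> k. if k = j then f x else (0 :: real))"
      if "continuous_on UNIV f" for j :: 2 and f :: "real \<times> real \<Rightarrow> real"
    proof (rule continuous_on_vec_lambda)
      fix k show "continuous_on UNIV (\<lambda>x. if k = j then f x else (0 :: real))"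
        by (cases "k = j") (simp_all add: that)
    qed
    show "continuous_on UNIV (\<lambda>p :: real \<times> real. axis j (fst p) :: point)"
      and "continuous_on UNIV (\<lambda>p :: real \<times> real. axis i (snd p) :: point)"
      unfolding axis_def by (rule vl, intro continuous_intros)+
  qed
  then have "(\<lambda>(y, t). axis j y + axis i t :: point) \<in> borel_measurable (borel \<Otimes>\<^sub>M borel)"
    unfolding borel_prod split_beta by (rule borel_measurable_continuous_onI)
  then show ?thesis by (simp cong: measurable_cong_sets)
qed

text \<open>Both orders of the coordinates are covered, so that one proof of the divergence theorem
  serves both partial derivatives. Agreement of the two measures on boxes suffices.\<close>

lemma lborel_coordinates:
  fixes i j :: 2
  assumes "i \<noteq> j"
  shows "(lborel :: point measure) = distr (lborel \<Otimes>\<^sub>M lborel) borel (\<lambda>(y, t). axis j y + axis i t)"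
proof (rule lborel_eqI)
  let ?g = "\<lambda>(y, t). axis j y + axis i t :: point"
  have U: "(UNIV :: 2 set) = {j, i}" using assms exhaust_2[of i] exhaust_2[of j] UNIV_2 by auto
  note [measurable] = coordinates_measurable[of j i]
  fix l u :: point assume lu: "\<And>b. b \<in> Basis \<Longrightarrow> l \<bullet> b \<le> u \<bullet> b"
  have B: "(Basis :: point set) = (\<lambda>k. axis k 1) ` UNIV" by (auto simp: Basis_vec_def)
  have le: "l $ k \<le> u $ k" for k using lu[of "axis k 1"] by (auto simp: B inner_axis)
  have vim: "?g -` box l u \<inter> space (lborel \<Otimes>\<^sub>M lborel) = {l $ j <..< u $ j} \<times> {l $ i <..< u $ i}"
  proof -
    have all: "(\<forall>k. P k) \<longleftrightarrow> P j \<and> P i" for P :: "2 \<Rightarrow> bool"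
    proof -
      have "(\<forall>k. P k) \<longleftrightarrow> (\<forall>k\<in>UNIV. P k)" by simp
      then show ?thesis unfolding U by simp
    qed
    have c: "(axis j y + axis i t :: point) $ j = y" "(axis j y + axis i t :: point) $ i = t" for y t
      using assms by (auto simp: axis_def)
    have "?g p \<in> box l u \<longleftrightarrow> p \<in> {l $ j <..< u $ j} \<times> {l $ i <..< u $ i}" for p
      unfolding mem_box_cart all split_beta c by (cases p) auto
    then show ?thesis by (auto simp: space_pair_measure)
  qed
  have "emeasure (distr (lborel \<Otimes>\<^sub>M lborel) borel ?g) (box l u)
      = emeasure (lborel \<Otimes>\<^sub>M lborel) ({l $ j <..< u $ j} \<times> {l $ i <..< u $ i})"
    by (subst emeasure_distr) (auto simp: vim[symmetric])
  also have "\<dots> = ennreal (u $ j - l $ j) * ennreal (u $ i - l $ i)"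
    by (subst lborel.emeasure_pair_measure_Times) (auto simp: le)
  also have "\<dots> = ennreal ((u $ j - l $ j) * (u $ i - l $ i))" using le by (simp add: ennreal_mult)
  also have "(u $ j - l $ j) * (u $ i - l $ i) = (\<Prod>k\<in>UNIV. (u - l) $ k)" unfolding U using assms by simp
  also have "\<dots> = (\<Prod>b\<in>Basis. (u - l) \<bullet> b)"
    unfolding B by (subst prod.reindex) (auto simp: inj_on_def axis_eq_axis inner_axis)
  finally show "emeasure (distr (lborel \<Otimes>\<^sub>M lborel) borel ?g) (box l u) = ennreal (\<Prod>b\<in>Basis. (u - l) \<bullet> b)" .
qed simp

lemma coordinates_fubini:
  fixes F :: "point \<Rightarrow> real"
  assumes ij: "i \<noteq> j" and F: "integrable lborel F"
  shows "AE y in lborel. integrable lborel (\<lambda>t. F (axis j y + axis i t))"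
    and "integrable lborel (\<lambda>y. \<integral>t. F (axis j y + axis i t) \<partial>lborel)"
    and "integral\<^sup>L lborel F = (\<integral>y. \<integral>t. F (axis j y + axis i t) \<partial>lborel \<partial>lborel)"
proof -
  let ?g = "\<lambda>(y, t). axis j y + axis i t :: point"
  have Fb: "F \<in> borel_measurable borel" using F by auto
  have 1: "integrable (lborel \<Otimes>\<^sub>M lborel) (\<lambda>p. F (?g p))"
    using F by (subst (asm) lborel_coordinates[OF ij], subst (asm) integrable_distr_eq)
      (auto intro: coordinates_measurable Fb)
  have eq: "(\<lambda>p. F (?g p)) = (\<lambda>(y, t). F (axis j y + axis i t))" by (auto simp: split_beta)
  show "AE y in lborel. integrable lborel (\<lambda>t. F (axis j y + axis i t))"
    using lborel_pair.AE_integrable_fst'[OF 1] by simp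
  show "integrable lborel (\<lambda>y. \<integral>t. F (axis j y + axis i t) \<partial>lborel)"
    using lborel_pair.integrable_fst'[OF 1] by simp
  have "integral\<^sup>L lborel F = (\<integral>p. F (?g p) \<partial>(lborel \<Otimes>\<^sub>M lborel))"
    by (subst lborel_coordinates[OF ij], subst integral_distr) (auto intro: coordinates_measurable Fb)
  also have "\<dots> = (\<integral>y. \<integral>t. F (axis j y + axis i t) \<partial>lborel \<partial>lborel)"
    using lborel_pair.integral_fst'[OF 1] by simp
  finally show "integral\<^sup>L lborel F = (\<integral>y. \<integral>t. F (axis j y + axis i t) \<partial>lborel \<partial>lborel)" .
qed

context star_element
begin

text \<open>A line not parallel to the edge meets it at most once, so \<open>G\<close> is
  \<open>f\<close> carried over to the \<open>j\<close> axis. Projection of the edge onto that axis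
  contracts length by the modulus of \<open>normal M E $ i\<close>.\<close>

lemma edge_slices:
  assumes ij: "i \<noteq> j" and E: "E \<in> element_edges M T" and f: "f \<in> pfun l"
    and G: "G = (\<lambda>y. \<Sum>t | axis j y + axis i t \<in> E. f (axis j y + axis i t))"
    and n0: "normal M E $ i \<noteq> 0"
  shows "integrable lborel G" "integral\<^sup>L lborel G = \<bar>normal M E $ i\<bar> * edge_integral E f"
proof -
  obtain a b where ab: "a \<noteq> b" "E = open_segment a b"
    "normal M E $ 1 * norm (b - a) = - ((b - a) $ 2)" "normal M E $ 2 * norm (b - a) = (b - a) $ 1"
    using edgeE[OF element_edge[OF E]] by metis
  let ?d = "b - a"
  have ij': "(i = 1 \<and> j = 2) \<or> (i = 2 \<and> j = 1)" using ij exhaust_2[of i] exhaust_2[of j] by auto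
  have "norm ?d > 0" using ab by simp
  have nd: "\<bar>normal M E $ i\<bar> * norm ?d = \<bar>?d $ j\<bar>"
  proof -
    have "\<bar>normal M E $ i * norm ?d\<bar> = \<bar>?d $ j\<bar>" using ij' ab(3,4) by auto
    then show ?thesis by (simp add: abs_mult)
  qed
  have dj: "?d $ j \<noteq> 0" using nd n0 ab(1) by auto
  have pt: "x = axis j (x $ j) + axis i (x $ i)" for x :: point
    using ij' by (auto simp: vec_eq_iff axis_def forall_2)
  have ptj: "(axis j y + axis i t :: point) $ j = y" and pti: "(axis j y + axis i t :: point) $ i = t" for y t
    using ij by (auto simp: axis_def)
  \<comment> \<open>In the edge parameter \<open>s\<close>, the slice sum is \<open>f\<close> on the
    open edge and zero elsewhere.\<close>
  have Gs: "G (a $ j + ?d $ j * s) = indicator {0<..<1} s * f (a + s *\<^sub>R ?d)" for s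
  proof -
    have "{t. axis j (a $ j + ?d $ j * s) + axis i t \<in> E} = (if s \<in> {0<..<1} then {(a + s *\<^sub>R ?d) $ i} else {})"
      (is "?L = ?R")
    proof (intro set_eqI iffI)
      fix t assume "t \<in> ?L"
      then obtain u where u: "0 < u" "u < 1" "axis j (a $ j + ?d $ j * s) + axis i t = (1 - u) *\<^sub>R a + u *\<^sub>R b"
        using ab(2) by (auto simp: in_segment)
      then have eq: "axis j (a $ j + ?d $ j * s) + axis i t = a + u *\<^sub>R ?d" by (simp add: algebra_simps)
      have "a $ j + ?d $ j * s = a $ j + u * ?d $ j" using arg_cong[OF eq, of "\<lambda>x. x $ j"] ptj by simp
      then have "u = s" using dj by simp
      moreover have "t = (a + u *\<^sub>R ?d) $ i" by (metis eq pti)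
      ultimately show "t \<in> ?R" using u by auto
    next
      fix t assume "t \<in> ?R"
      then have s: "0 < s" "s < 1" and t: "t = (a + s *\<^sub>R ?d) $ i" by (auto split: if_splits)
      have "axis j (a $ j + ?d $ j * s) + axis i t = a + s *\<^sub>R ?d"
      proof -
        have "a $ j + ?d $ j * s = (a + s *\<^sub>R ?d) $ j" by (simp add: mult.commute)
        then show ?thesis using pt[of "a + s *\<^sub>R ?d"] t by metis
      qed
      also have "\<dots> = (1 - s) *\<^sub>R a + s *\<^sub>R b" by (simp add: algebra_simps)
      finally show "t \<in> ?L" using s ab by (auto simp: in_segment)
    qed
    then have "G (a $ j + ?d $ j * s) = (if s \<in> {0<..<1} then f (axis j ((a + s *\<^sub>R ?d) $ j) + axis i ((a + s *\<^sub>R ?d) $ i)) else 0)"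
      unfolding G by (simp add: mult.commute)
    then show ?thesis unfolding pt[of "a + s *\<^sub>R ?d", symmetric] by (simp add: indicator_def)
  qed
  have cont: "continuous_on {0..1} (\<lambda>s. f (a + s *\<^sub>R ?d))"
    by (rule continuous_on_compose2[OF pfun_continuous_on[OF f, of UNIV]]) (auto intro!: continuous_intros)
  have "set_integrable lborel {0<..<1} (\<lambda>s. f (a + s *\<^sub>R ?d))"
    by (rule set_integrable_subset[OF interval_integrable[OF cont]]) auto
  then have int: "integrable lborel (\<lambda>s. G (a $ j + ?d $ j * s))" unfolding Gs set_integrable_def by simp
  then show "integrable lborel G" using lborel_integrable_real_affine_iff[OF dj] by blast
  have "integral\<^sup>L lborel G = \<bar>?d $ j\<bar> *\<^sub>R (\<integral>s. G (a $ j + ?d $ j * s) \<partial>lborel)"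
    by (rule lborel_integral_real_affine[OF dj])
  also have "(\<integral>s. G (a $ j + ?d $ j * s) \<partial>lborel) = (\<integral>s. indicator {0..1} s *\<^sub>R f ((1 - s) *\<^sub>R a + s *\<^sub>R b) \<partial>lborel)"
  proof (rule integral_discrete_difference[of "{0, 1}"])
    fix s :: real assume "s \<notin> {0, 1}"
    moreover have "(1 - s) *\<^sub>R a + s *\<^sub>R b = a + s *\<^sub>R ?d" by (simp add: algebra_simps)
    ultimately show "G (a $ j + ?d $ j * s) = indicator {0..1} s *\<^sub>R f ((1 - s) *\<^sub>R a + s *\<^sub>R b)"
      unfolding Gs by (auto simp: indicator_def)
  qed auto
  finally show "integral\<^sup>L lborel G = \<bar>normal M E $ i\<bar> * edge_integral E f"
    unfolding ab(2) edge_integral_segment[OF ab(1)] set_lebesgue_integral_def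
    using nd by (simp add: ab(2) dist_norm norm_minus_commute mult.assoc[symmetric])
qed

text \<open>Fubini in direction \<open>i\<close> with \<open>slice_integral\<close> on each line.
  The slice gives the sign of the normal component, integration over the slices its modulus, and
  together they restore \<open>normal M E $ i\<close>.\<close>

theorem divergence_theorem:
  assumes f: "f \<in> pfun l"
  shows "area_integral T (pd i f) = (\<Sum>E\<in>element_edges M T. \<omega>TE M T E * normal M E $ i * edge_integral E f)"
proof -
  obtain j :: 2 where ij: "i \<noteq> j"
  proof (cases "i = 1")
    case True then show ?thesis using that[of 2] by simp
  next
    case False then show ?thesis using that[of 1] by simp
  qed
  have ij': "(i = 1 \<and> j = 2) \<or> (i = 2 \<and> j = 1)" using ij exhaust_2[of i] exhaust_2[of j] by auto
  let ?A = "element_edges M T" and ?\<xi> = "axis i 1 :: point"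
  let ?p = "\<lambda>y t. axis j y + axis i t :: point"
  have ptj: "(?p y t) $ j = y" and pti: "(?p y t) $ i = t" for y t
    using ij by (auto simp: axis_def)
  define F where "F = (\<lambda>x. indicator T x * pd i f x)"
  have pdc: "continuous_on S (pd i f)" for S by (rule pfun_continuous_on[OF pfun_derivative(1)[OF f]])
  have intF: "integrable lborel F"
    using area_integrable[OF openT boundedT pdc] unfolding set_integrable_def F_def by simp
  define G where "G E = (\<lambda>y. \<Sum>t | ?p y t \<in> E. f (?p y t))" for E
  let ?A' = "{E \<in> ?A. normal M E $ i \<noteq> 0}"
  obtain R where R: "0 < R" "closure T \<subseteq> ball 0 R"
    using bounded_subset_ballD[OF bounded_closure[OF boundedT], of 0] by blast
  have far: "?p y t \<notin> closure T" if "R \<le> \<bar>t\<bar>" for y t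
  proof -
    have "R \<le> norm (?p y t)" using component_le_norm_cart[of "?p y t" i] that unfolding pti by linarith
    then have "?p y t \<notin> ball 0 R" by simp
    then show ?thesis using R(2) by blast
  qed
  \<comment> \<open>Lines through a vertex. This also excludes the lines that contain an edge, since
    its end points are vertices.\<close>
  define bad where "bad = (\<lambda>V. V $ j) ` element_vertices M T"
  have slice: "(\<integral>t. F (?p y t) \<partial>lborel) = (\<Sum>E\<in>?A'. \<omega>TE M T E * sgn (normal M E $ i) * G E y)"
    if int: "integrable lborel (\<lambda>t. F (?p y t))" and y: "y \<notin> bad" for y
  proof -
    \<comment> \<open>Every line is started outside the closure of \<open>T\<close>, so the term at
      the starting point vanishes.\<close>
    let ?x = "?p y (- R)"
    have xt: "?x + t *\<^sub>R ?\<xi> = ?p y (- R + t)" for t by (auto simp: vec_eq_iff axis_def)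
    have nov: "?p y t \<notin> element_vertices M T" for t using y unfolding bad_def by (metis imageI ptj)
    have noE: "normal M E $ i \<noteq> 0" if E: "E \<in> ?A" "?p y t \<in> E" for E t
    proof
      assume n0: "normal M E $ i = 0"
      obtain a b where ab: "a \<noteq> b" "E = open_segment a b"
        "normal M E $ 1 * norm (b - a) = - ((b - a) $ 2)" "normal M E $ 2 * norm (b - a) = (b - a) $ 1"
        using edgeE[OF element_edge[OF E(1)]] by metis
      have "b $ j = a $ j" using n0 ab(3,4) ij' by auto
      moreover obtain u where "?p y t = (1 - u) *\<^sub>R a + u *\<^sub>R b" using E(2) ab(2) by (auto simp: in_segment)
      then have "y = (1 - u) * a $ j + u * b $ j" using ptj[of y t] by simp
      ultimately have "y = a $ j" by (simp add: algebra_simps)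
      moreover have "a \<in> element_vertices M T"
        using E(1) edge_vertices_eq[OF ab(1)] unfolding element_vertices_def ab(2)[symmetric] by blast
      ultimately show False using y by (auto simp: bad_def)
    qed
    have gl: "generic_line ?x ?\<xi>"
      unfolding generic_line_def xt using nov noE by (auto simp: inner_axis)
    have der: "((\<lambda>t. f (?x + t *\<^sub>R ?\<xi>)) has_real_derivative pd i f (?x + t *\<^sub>R ?\<xi>)) (at t)" for t
      using pfun_line_derivative[OF f, of ?x ?\<xi> t UNIV] exhaust_2[of i] by (auto simp: axis_def)
    have "((\<lambda>t. indicator T (?x + t *\<^sub>R ?\<xi>) * pd i f (?x + t *\<^sub>R ?\<xi>)) has_integral
        ((\<Sum>E\<in>?A. \<omega>TE M T E * sgn (normal M E \<bullet> ?\<xi>) * (\<Sum>t | 0 < t \<and> ?x + t *\<^sub>R ?\<xi> \<in> E. f (?x + t *\<^sub>R ?\<xi>)))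
         - indicator T ?x * f ?x)) {0..2 * R}"
    proof (rule slice_integral[OF gl _ _ _ der])
      show "?x \<notin> frontier T" using far[of "-R" y] frontier_closure R(1) by auto
      show "?x + t *\<^sub>R ?\<xi> \<notin> closure T" if "2 * R \<le> t" for t unfolding xt by (rule far) (use that R(1) in auto)
    qed (use R(1) in simp)
    moreover have "indicator T ?x = (0::real)" using far[of "-R" y] closure_subset R(1) by (auto simp: indicator_def)
    moreover have "(\<Sum>t | 0 < t \<and> ?x + t *\<^sub>R ?\<xi> \<in> E. f (?x + t *\<^sub>R ?\<xi>)) = G E y" if E: "E \<in> ?A" for E
      unfolding G_def xt
    proof (rule sum.reindex_bij_witness[of _ "\<lambda>t. t + R" "\<lambda>t. - R + t"])
      fix t assume "t \<in> {t. ?p y t \<in> E}"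
      then have "?p y t \<in> closure T" using element_edge_frontier[OF E] frontier_closure by blast
      then have "\<not> R \<le> \<bar>t\<bar>" using far by blast
      then have "- R < t" by linarith
      then show "t + R \<in> {t. 0 < t \<and> ?p y (- R + t) \<in> E}" using \<open>t \<in> _\<close> by auto
    qed auto
    ultimately have hi: "((\<lambda>t. F (?x + t *\<^sub>R ?\<xi>)) has_integral (\<Sum>E\<in>?A. \<omega>TE M T E * sgn (normal M E $ i) * G E y)) {0..2 * R}"
      by (simp add: F_def inner_axis cong: sum.cong)
    have int2: "integrable lborel (\<lambda>t. F (?x + t *\<^sub>R ?\<xi>))"
      unfolding xt using lborel_integrable_real_affine[OF int, of 1 "-R"] by simp
    have "((\<lambda>t. F (?x + t *\<^sub>R ?\<xi>)) has_integral (\<Sum>E\<in>?A. \<omega>TE M T E * sgn (normal M E $ i) * G E y)) UNIV"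
    proof (rule has_integral_on_superset[OF hi])
      fix t assume "t \<notin> {0..2 * R}"
      then have "R \<le> \<bar>- R + t\<bar>" by (auto simp: abs_if)
      then show "F (?x + t *\<^sub>R ?\<xi>) = 0" unfolding xt using far closure_subset by (auto simp: F_def indicator_def)
    qed auto
    then have "(\<integral>t. F (?x + t *\<^sub>R ?\<xi>) \<partial>lborel) = (\<Sum>E\<in>?A. \<omega>TE M T E * sgn (normal M E $ i) * G E y)"
      using has_integral_integral_lborel[OF int2] has_integral_unique by blast
    also have "\<dots> = (\<Sum>E\<in>?A'. \<omega>TE M T E * sgn (normal M E $ i) * G E y)"
      by (rule sum.mono_neutral_right) (use finite_element_edges in auto)
    also have "(\<integral>t. F (?x + t *\<^sub>R ?\<xi>) \<partial>lborel) = (\<integral>t. F (?p y t) \<partial>lborel)"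
      unfolding xt using lborel_integral_real_affine[of 1 "\<lambda>t. F (?p y t)" "-R"] by simp
    finally show ?thesis .
  qed
  have GE: "integrable lborel (G E)" "integral\<^sup>L lborel (G E) = \<bar>normal M E $ i\<bar> * edge_integral E f" if "E \<in> ?A'" for E
    using edge_slices[OF ij _ f G_def] that by auto
  have "area_integral T (pd i f) = integral\<^sup>L lborel F"
    by (simp add: area_integral_def set_lebesgue_integral_def F_def)
  also have "\<dots> = (\<integral>y. \<integral>t. F (?p y t) \<partial>lborel \<partial>lborel)" by (rule coordinates_fubini[OF ij intF])
  also have "\<dots> = (\<integral>y. (\<Sum>E\<in>?A'. \<omega>TE M T E * sgn (normal M E $ i) * G E y) \<partial>lborel)"
  proof (rule integral_cong_AE)
    have "finite bad" unfolding bad_def using finite_element_vertices by blast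
    then have "AE y in lborel. y \<notin> bad" by (intro AE_not_in finite_imp_null_set_lborel)
    then show "AE y in lborel. (\<integral>t. F (?p y t) \<partial>lborel) = (\<Sum>E\<in>?A'. \<omega>TE M T E * sgn (normal M E $ i) * G E y)"
      using coordinates_fubini(1)[OF ij intF] by eventually_elim (rule slice)
    show "(\<lambda>y. \<integral>t. F (?p y t) \<partial>lborel) \<in> borel_measurable lborel"
      using coordinates_fubini(2)[OF ij intF] by auto
    show "(\<lambda>y. \<Sum>E\<in>?A'. \<omega>TE M T E * sgn (normal M E $ i) * G E y) \<in> borel_measurable lborel"
      using GE(1) by (intro borel_measurable_sum borel_measurable_times) auto
  qed
  also have "\<dots> = (\<Sum>E\<in>?A'. \<omega>TE M T E * sgn (normal M E $ i) * integral\<^sup>L lborel (G E))"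
    using GE(1) by (subst Bochner_Integration.integral_sum) auto
  also have "\<dots> = (\<Sum>E\<in>?A'. \<omega>TE M T E * normal M E $ i * edge_integral E f)"
    by (rule sum.cong) (use GE(2) in \<open>auto simp: mult.assoc[symmetric] sgn_mult_abs\<close>)
  also have "\<dots> = (\<Sum>E\<in>?A. \<omega>TE M T E * normal M E $ i * edge_integral E f)"
    by (rule sum.mono_neutral_left) (use finite_element_edges in auto)
  finally show ?thesis .
qed

end

section \<open>Interpolation on an edge and traces\<close>

lemma edge_proj_eq:
  assumes E: "is_segment E" and f: "continuous_on (closure E) f"
  shows "edge_proj l E f = q \<longleftrightarrow> q \<in> poly_space l E \<and>
    (\<forall>r\<in>poly_space l E. edge_integral E (\<lambda>x. q x * r x) = edge_integral E (\<lambda>x. f x * r x))"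
proof -
  have "lin_on (poly_space l E) (\<lambda>r. edge_integral E (\<lambda>x. f x * r x))"
    unfolding lin_on_def
  proof (intro conjI ballI allI)
    fix g h assume "g \<in> poly_space l E" "h \<in> poly_space l E"
    then show "edge_integral E (\<lambda>x. f x * (g x + h x)) = edge_integral E (\<lambda>x. f x * g x) + edge_integral E (\<lambda>x. f x * h x)"
      unfolding distrib_left by (intro edge_integral_add E continuous_on_mult f) (auto intro: poly_space_continuous)
  next
    fix g a show "edge_integral E (\<lambda>x. f x * (a *\<^sub>R g x)) = a * edge_integral E (\<lambda>x. f x * g x)"
      using edge_integral_cmul[OF E, of a "\<lambda>x. f x * g x"] by (simp add: mult_ac)
  qed
  from edge_riesz[OF E _ _ this, of "\<lambda>_. 1"]
  have ex1: "\<exists>!p. p \<in> poly_space l E \<and> (\<forall>r\<in>poly_space l E. edge_integral E (\<lambda>x. p x * r x) = edge_integral E (\<lambda>x. f x * r x))"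
    by simp
  show ?thesis unfolding edge_proj_def using theI'[OF ex1] the1_equality[OF ex1] by blast
qed

text \<open>The conditions that a trace imposes on one edge. Two end values and \<open>l - 1\<close>
  moments match the dimension \<open>l + 1\<close>.\<close>

definition is_interp :: "int \<Rightarrow> point set \<Rightarrow> (point \<Rightarrow> real) \<Rightarrow> (point \<Rightarrow> real) \<Rightarrow> (point \<Rightarrow> real) \<Rightarrow> bool" where
  "is_interp l E q val p \<longleftrightarrow> p \<in> poly_space l E \<and> (\<forall>V\<in>edge_vertices E. p V = val V) \<and>
     (\<forall>r\<in>poly_space (l - 2) E. edge_integral E (\<lambda>x. p x * r x) = edge_integral E (\<lambda>x. q x * r x))"

definition interp :: "int \<Rightarrow> point set \<Rightarrow> (point \<Rightarrow> real) \<Rightarrow> (point \<Rightarrow> real) \<Rightarrow> point \<Rightarrow> real" where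
  "interp l E q val = (THE p. is_interp l E q val p)"

text \<open>The interpolant is the linear function through the end values plus the bubble
  \<open>w\<close> times a polynomial of degree \<open>l - 2\<close>, found by Riesz representation
  with weight \<open>w\<close>. For uniqueness, a difference that vanishes at both ends is divisible
  by the bubble, and its moment against the quotient is definite.\<close>

lemma is_interp_ex1:
  assumes E: "is_segment E" and l: "1 \<le> l" and q: "continuous_on (closure E) q"
  shows "\<exists>!p. is_interp l E q val p"
proof -
  obtain a b where ab: "a \<noteq> b" "E = open_segment a b" using E by (auto simp: is_segment_def)
  let ?d = "b - a" and ?l = "l - 2"
  have clE: "closure E = closed_segment a b" using ab by simp
  have V: "edge_vertices E = {a, b}" unfolding edge_vertices_def clE unfolding ab(2) by (auto simp: open_segment_def)
  have dd: "?d \<bullet> ?d \<noteq> 0" using ab(1) by simp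
  \<comment> \<open>An affine function on the plane that restricts to the edge parameter: 0 at
    \<open>a\<close> and 1 at \<open>b\<close>.\<close>
  define \<sigma> where "\<sigma> x = (x - a) \<bullet> ?d / (?d \<bullet> ?d)" for x
  have \<sigma>p: "\<sigma> \<in> pfun 1"
  proof -
    have "\<sigma> = (\<lambda>x. (?d $ 1 / (?d \<bullet> ?d)) * x $ 1 + ((?d $ 2 / (?d \<bullet> ?d)) * x $ 2 + (- (a \<bullet> ?d) / (?d \<bullet> ?d))))"
      by (auto simp: \<sigma>_def inner_vec_def sum_2 diff_divide_distrib add_divide_distrib algebra_simps)
    also have "\<dots> \<in> pfun 1" by (intro pfun_add pfun_scale pfun_coord pfun_const) auto
    finally show ?thesis .
  qed
  have \<sigma>s: "\<sigma> (a + s *\<^sub>R ?d) = s" for s using dd by (simp add: \<sigma>_def)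
  have par: "\<exists>s. 0 \<le> s \<and> s \<le> 1 \<and> x = a + s *\<^sub>R ?d" if "x \<in> closure E" for x
    using that unfolding clE by (auto simp: closed_segment_def algebra_simps)
  have paro: "\<exists>s. 0 < s \<and> s < 1 \<and> x = a + s *\<^sub>R ?d" if "x \<in> E" for x
    using that unfolding ab(2) by (auto simp: in_segment algebra_simps)
  define w where "w x = \<sigma> x * (1 - \<sigma> x)" for x
  have wp: "w \<in> pfun 2" unfolding w_def
    using pfun_mult[OF \<sigma>p pfun_diff[OF pfun_const[of 1 1] \<sigma>p]] by simp
  have wc: "continuous_on (closure E) w" by (rule pfun_continuous_on[OF wp])
  have wpos: "0 < w x" if "x \<in> E" for x using paro[OF that] by (auto simp: w_def \<sigma>s)
  have aE: "a \<in> closure E" "b \<in> closure E" using clE by auto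
  have wab: "w a = 0" "w b = 0" using \<sigma>s[of 0] \<sigma>s[of 1] by (auto simp: w_def)
  define lin where "lin x = val a + (val b - val a) * \<sigma> x" for x
  have linp: "lin \<in> pfun 1" unfolding lin_def by (intro pfun_add pfun_const pfun_scale \<sigma>p) auto
  have linc: "continuous_on (closure E) lin" by (rule pfun_continuous_on[OF linp])
  note pc = poly_space_continuous
  \<comment> \<open>The part of the prescribed moments that the linear function does not yet
    produce.\<close>
  let ?L = "\<lambda>r. edge_integral E (\<lambda>x. q x * r x) - edge_integral E (\<lambda>x. lin x * r x)"
  have "lin_on (poly_space ?l E) ?L"
    unfolding lin_on_def
  proof (intro conjI ballI allI)
    fix g h assume "g \<in> poly_space ?l E" "h \<in> poly_space ?l E"
    then have "edge_integral E (\<lambda>x. f x * (g x + h x)) = edge_integral E (\<lambda>x. f x * g x) + edge_integral E (\<lambda>x. f x * h x)"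
      if "continuous_on (closure E) f" for f
      unfolding distrib_left by (intro edge_integral_add E continuous_on_mult that) (auto intro: pc)
    then show "?L (\<lambda>x. g x + h x) = ?L g + ?L h" using q linc by simp
  next
    fix g c have "edge_integral E (\<lambda>x. f x * (c *\<^sub>R g x)) = c * edge_integral E (\<lambda>x. f x * g x)" for f
      using edge_integral_cmul[OF E, of c "\<lambda>x. f x * g x"] by (simp add: mult_ac)
    then show "?L (\<lambda>x. c *\<^sub>R g x) = c * ?L g" by (simp add: right_diff_distrib)
  qed
  from edge_riesz[OF E wc wpos this] obtain u where u: "u \<in> poly_space ?l E"
    "\<And>r. r \<in> poly_space ?l E \<Longrightarrow> edge_integral E (\<lambda>x. w x * (u x * r x)) = ?L r" by blast
  obtain u0 where u0: "u0 \<in> pfun ?l" "u = cut E u0" using u(1) by (auto simp: poly_space_iff)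
  define p where "p = cut E (\<lambda>x. lin x + w x * u0 x)"
  have "(\<lambda>x. lin x + w x * u0 x) \<in> pfun l"
    by (rule pfun_add[OF pfun_mono[OF l linp]]) (use pfun_mult[OF wp u0(1)] in simp)
  then have pP: "p \<in> poly_space l E" unfolding p_def by (rule cut_poly_space)
  have "is_interp l E q val p" unfolding is_interp_def V
  proof (intro conjI ballI pP)
    fix V assume "V \<in> {a, b}"
    then show "p V = val V" using aE wab \<sigma>s[of 0] \<sigma>s[of 1] by (auto simp: p_def lin_def)
  next
    fix r assume r: "r \<in> poly_space (l - 2) E"
    have "edge_integral E (\<lambda>x. p x * r x) = edge_integral E (\<lambda>x. lin x * r x + w x * (u x * r x))"
    proof (rule edge_integral_cong[OF E])
      fix x assume "x \<in> E"
      then have "x \<in> closure E" using closure_subset by blast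
      then show "p x * r x = lin x * r x + w x * (u x * r x)" by (simp add: p_def u0(2) algebra_simps)
    qed
    also have "\<dots> = edge_integral E (\<lambda>x. lin x * r x) + edge_integral E (\<lambda>x. w x * (u x * r x))"
      by (intro edge_integral_add E continuous_on_mult linc wc pc[OF r] pc[OF u(1)])
    finally show "edge_integral E (\<lambda>x. p x * r x) = edge_integral E (\<lambda>x. q x * r x)" using u(2)[OF r] by simp
  qed
  moreover have "p1 = p2" if 1: "is_interp l E q val p1" and 2: "is_interp l E q val p2" for p1 p2
  proof -
    define e where "e x = p1 x - p2 x" for x
    have eP: "e \<in> poly_space l E" unfolding e_def using 1 2 by (intro poly_space_diff) (auto simp: is_interp_def)
    have eab: "e a = 0" "e b = 0" using 1 2 V by (auto simp: e_def is_interp_def)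
    have em: "edge_integral E (\<lambda>x. e x * r x) = 0" if r: "r \<in> poly_space ?l E" for r
    proof -
      have "edge_integral E (\<lambda>x. e x * r x) = edge_integral E (\<lambda>x. p1 x * r x) - edge_integral E (\<lambda>x. p2 x * r x)"
        unfolding e_def left_diff_distrib using 1 2 r
        by (intro edge_integral_diff E continuous_on_mult) (auto simp: is_interp_def intro: pc)
      then show ?thesis using 1 2 r by (auto simp: is_interp_def)
    qed
    obtain e0 where e0: "e0 \<in> pfun l" "e = cut E e0" using eP by (auto simp: poly_space_iff)
    obtain P where P: "P \<in> upoly l" "\<And>t. e0 (a + t *\<^sub>R ?d) = poly P t" using pfun_line[OF e0(1)] by blast
    have P01: "poly P 0 = 0" "poly P 1 = 0" using eab aE P(2)[of 0] P(2)[of 1] by (auto simp: e0(2))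
    \<comment> \<open>The roots 0 and 1 split off one after the other, which lowers the degree to
      \<open>l - 2\<close>. The bubble is \<open>t * (1 - t)\<close>, whence the minus sign in
      \<open>es\<close>.\<close>
    obtain Q where Q: "P = [:0, 1:] * Q" using P01(1) poly_eq_0_iff_dvd[of P 0] by (auto elim: dvdE)
    have "poly Q 1 = 0" using P01(2) by (simp add: Q)
    then obtain S where S: "Q = [:- 1, 1:] * S" using poly_eq_0_iff_dvd[of Q 1] by (auto elim: dvdE)
    have Su: "S \<in> upoly ?l"
    proof (cases "S = 0")
      case False
      have "degree Q = degree [:- 1, 1 :: real:] + degree S" unfolding S by (rule degree_mult_eq) (use False in auto)
      moreover have Q0: "Q \<noteq> 0" unfolding S using False by (simp only: mult_eq_0_iff) simp
      have "degree P = degree [:0, 1 :: real:] + degree Q" unfolding Q by (rule degree_mult_eq) (use Q0 in auto)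
      moreover have "P \<noteq> 0" unfolding Q using Q0 by (simp only: mult_eq_0_iff) simp
      ultimately show ?thesis using P(1) by (auto simp: upoly_def)
    qed (simp add: upoly_def)
    define s where "s = cut E (\<lambda>x. poly S (\<sigma> x))"
    have sP: "s \<in> poly_space ?l E" unfolding s_def by (intro cut_poly_space poly_pfun Su \<sigma>p)
    have es: "e x = - (w x * s x)" if "x \<in> closure E" for x
    proof -
      from par[OF that] obtain t where t: "x = a + t *\<^sub>R ?d" by blast
      have "e x = e0 x" using that by (simp add: e0(2))
      moreover have "e0 x = poly P t" unfolding t by (rule P(2))
      moreover have \<sigma>x: "\<sigma> x = t" unfolding t by (rule \<sigma>s)
      moreover have "s x = poly S t" using that by (simp add: s_def \<sigma>x)
      ultimately show ?thesis by (simp add: w_def Q S algebra_simps)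
    qed
    interpret fun_inner "poly_space ?l E" "\<lambda>f g. edge_integral E (\<lambda>x. w x * (f x * g x))"
      by (rule edge_poly_inner[OF E wc wpos])
    have "edge_integral E (\<lambda>x. w x * (s x * s x)) = edge_integral E (\<lambda>x. (-1) * (e x * s x))"
    proof (rule edge_integral_cong[OF E])
      fix x assume "x \<in> E"
      then have "x \<in> closure E" using closure_subset by blast
      then show "w x * (s x * s x) = (-1) * (e x * s x)" using es by simp
    qed
    also have "\<dots> = 0" using em[OF sP] edge_integral_cmul[OF E, of "-1" "\<lambda>x. e x * s x"] by simp
    finally have "s = (\<lambda>x. 0)" using pos[OF sP] by linarith
    then have "e x = 0" for x using es[of x] poly_space_outside[OF eP, of x] by (cases "x \<in> closure E") auto
    then show ?thesis by (auto simp: e_def fun_eq_iff)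
  qed
  ultimately show ?thesis by blast
qed

lemma is_interp_interp:
  "is_segment E \<Longrightarrow> 1 \<le> l \<Longrightarrow> continuous_on (closure E) q \<Longrightarrow> is_interp l E q val (interp l E q val)"
  unfolding interp_def by (rule theI'[OF is_interp_ex1])

lemma interp_eqI:
  "is_segment E \<Longrightarrow> 1 \<le> l \<Longrightarrow> continuous_on (closure E) q \<Longrightarrow> is_interp l E q val p \<Longrightarrow> interp l E q val = p"
  unfolding interp_def by (rule the1_equality[OF is_interp_ex1])

lemma interp_diff:
  assumes E: "is_segment E" and l: "1 \<le> l" and q: "continuous_on (closure E) q" "continuous_on (closure E) q'"
  shows "interp l E (\<lambda>x. q x - q' x) (\<lambda>V. val V - val' V) = (\<lambda>x. interp l E q val x - interp l E q' val' x)"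
proof (rule interp_eqI[OF E l])
  let ?p = "interp l E q val" and ?p' = "interp l E q' val'"
  have 1: "is_interp l E q val ?p" "is_interp l E q' val' ?p'" using is_interp_interp[OF E l] q by auto
  show "continuous_on (closure E) (\<lambda>x. q x - q' x)" using q by (intro continuous_intros)
  show "is_interp l E (\<lambda>x. q x - q' x) (\<lambda>V. val V - val' V) (\<lambda>x. ?p x - ?p' x)"
    unfolding is_interp_def
  proof (intro conjI ballI)
    show "(\<lambda>x. ?p x - ?p' x) \<in> poly_space l E" using 1 by (intro poly_space_diff) (auto simp: is_interp_def)
    show "?p V - ?p' V = val V - val' V" if "V \<in> edge_vertices E" for V using 1 that by (auto simp: is_interp_def)
    fix r assume r: "r \<in> poly_space (l - 2) E"
    note rc = poly_space_continuous[OF r]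
    have pc: "continuous_on (closure E) ?p" "continuous_on (closure E) ?p'"
      using 1 by (auto simp: is_interp_def intro: poly_space_continuous)
    show "edge_integral E (\<lambda>x. (?p x - ?p' x) * r x) = edge_integral E (\<lambda>x. (q x - q' x) * r x)"
      unfolding left_diff_distrib using 1 r
      by (subst (1 2) edge_integral_diff[OF E]) (auto simp: is_interp_def intro!: continuous_on_mult q rc pc)
  qed
qed

lemma interp_zero:
  assumes E: "is_segment E" and l: "1 \<le> l" and val: "\<And>V. V \<in> edge_vertices E \<Longrightarrow> val V = 0"
  shows "interp l E (\<lambda>x. 0) val = (\<lambda>x. 0)"
  by (rule interp_eqI[OF E l]) (use val in \<open>auto simp: is_interp_def\<close>)

context star_element
begin

text \<open>Common to both traces: a rotation uses \<open>l = k + 2\<close> with moments of degree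
  \<open>k\<close>, a displacement \<open>l = k + 1\<close> with moments of degree
  \<open>k - 1\<close>.\<close>

definition is_trace :: "int \<Rightarrow> (point set \<Rightarrow> point \<Rightarrow> real) \<Rightarrow> (point \<Rightarrow> real) \<Rightarrow> (point \<Rightarrow> real) \<Rightarrow> bool" where
  "is_trace l q val g \<longleftrightarrow> g \<in> boundary_poly_space M l T \<and>
     (\<forall>E\<in>element_edges M T. edge_proj (l - 2) E g = q E) \<and> (\<forall>V\<in>element_vertices M T. g V = val V)"

lemma boundary_poly_continuous: "g \<in> boundary_poly_space M l T \<Longrightarrow> E \<in> element_edges M T \<Longrightarrow> continuous_on (closure E) g"
  by (rule continuous_on_subset[of "frontier T"]) (use frontierT in \<open>auto simp: boundary_poly_space_def\<close>)

text \<open>On an edge the trace depends on the data of that edge only and not on the element. This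
  makes it single-valued between neighbours and lets their contributions cancel.\<close>

lemma is_trace_interp:
  assumes l: "1 \<le> l" and g: "is_trace l q val g" and E: "E \<in> element_edges M T" and x: "x \<in> closure E"
  shows "g x = interp l E (q E) val x"
proof -
  have seg: "is_segment E" using edge_is_segment[OF element_edge[OF E]] .
  have gc: "continuous_on (closure E) g" using g E boundary_poly_continuous by (auto simp: is_trace_def)
  have "edge_proj (l - 2) E g = q E" using g E by (auto simp: is_trace_def)
  then have qE: "q E \<in> poly_space (l - 2) E"
    "\<And>r. r \<in> poly_space (l - 2) E \<Longrightarrow> edge_integral E (\<lambda>x. q E x * r x) = edge_integral E (\<lambda>x. g x * r x)"
    using edge_proj_eq[OF seg gc] by auto
  let ?p = "\<lambda>x. if x \<in> closure E then g x else 0"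
  have "is_interp l E (q E) val ?p"
    unfolding is_interp_def
  proof (intro conjI ballI)
    show "?p \<in> poly_space l E" using g E by (auto simp: is_trace_def boundary_poly_space_def)
    fix V assume V: "V \<in> edge_vertices E"
    then show "?p V = val V" using g E by (auto simp: is_trace_def element_vertices_def edge_vertices_def)
  next
    fix r assume r: "r \<in> poly_space (l - 2) E"
    have "edge_integral E (\<lambda>x. ?p x * r x) = edge_integral E (\<lambda>x. g x * r x)"
      by (rule edge_integral_cong[OF seg]) (use closure_subset in auto)
    then show "edge_integral E (\<lambda>x. ?p x * r x) = edge_integral E (\<lambda>x. q E x * r x)" using qE(2)[OF r] by simp
  qed
  then have "interp l E (q E) val = ?p" by (rule interp_eqI[OF seg l poly_space_continuous[OF qE(1)]])
  then show ?thesis using x by simp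
qed

text \<open>The interpolants on the edges are glued. Two edges share at most vertices, where both
  interpolants take the prescribed value.\<close>

lemma is_trace_ex1:
  assumes l: "1 \<le> l" and q: "\<And>E. E \<in> element_edges M T \<Longrightarrow> q E \<in> poly_space (l - 2) E"
  shows "\<exists>!g. is_trace l q val g"
proof -
  define P where "P E = interp l E (q E) val" for E
  have seg: "is_segment E" if "E \<in> element_edges M T" for E using edge_is_segment[OF element_edge[OF that]] .
  have P: "is_interp l E (q E) val (P E)" if "E \<in> element_edges M T" for E
    unfolding P_def by (rule is_interp_interp[OF seg[OF that] l poly_space_continuous[OF q[OF that]]])
  \<comment> \<open>The chosen edge is immaterial: by \<open>gE\<close> all edges through
    \<open>x\<close> give the same value.\<close>
  define g where "g x = (if x \<in> frontier T then P (SOME E. E \<in> element_edges M T \<and> x \<in> closure E) x else 0)" for x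
  have gE: "g x = P E x" if E: "E \<in> element_edges M T" and x: "x \<in> closure E" for E x
  proof -
    have xF: "x \<in> frontier T" using E x frontierT by blast
    define E' where "E' = (SOME E. E \<in> element_edges M T \<and> x \<in> closure E)"
    have E': "E' \<in> element_edges M T" "x \<in> closure E'"
      unfolding E'_def using someI[of "\<lambda>E. E \<in> element_edges M T \<and> x \<in> closure E", of E] E x by auto
    have "P E' x = P E x"
    proof (cases "E = E'")
      case False
      then have "x \<in> edge_vertices E" "x \<in> edge_vertices E'"
        using element_edges_separated[OF E E'(1)] element_edges_separated[OF E'(1) E] x E'(2)
        by (auto simp: edge_vertices_def)
      then show ?thesis using P[OF E] P[OF E'(1)] by (auto simp: is_interp_def)
    qed simp
    then show ?thesis using xF by (simp add: g_def E'_def)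
  qed
  have gcut: "(\<lambda>x. if x \<in> closure E then g x else 0) = P E" if "E \<in> element_edges M T" for E
    using gE[OF that] P[OF that] poly_space_outside by (auto simp: is_interp_def fun_eq_iff)
  have "is_trace l q val g" unfolding is_trace_def
  proof (intro conjI ballI)
    show gB: "g \<in> boundary_poly_space M l T" unfolding boundary_poly_space_def
    proof (intro CollectI conjI allI impI ballI)
      have "continuous_on (closure E) g" if E: "E \<in> element_edges M T" for E
        using P[OF E] gE[OF E] by (auto simp: is_interp_def cong: continuous_on_cong intro: poly_space_continuous)
      then show "continuous_on (frontier T) g"
        unfolding frontierT by (intro continuous_on_closed_Union finite_element_edges) auto
      show "g x = 0" if "x \<notin> frontier T" for x using that by (simp add: g_def)
      show "(\<lambda>x. if x \<in> closure E then g x else 0) \<in> poly_space l E" if "E \<in> element_edges M T" for E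
        using gcut[OF that] P[OF that] by (simp add: is_interp_def)
    qed
    fix E assume E: "E \<in> element_edges M T"
    show "edge_proj (l - 2) E g = q E"
      unfolding edge_proj_eq[OF seg[OF E] boundary_poly_continuous[OF gB E]]
    proof (intro conjI ballI q E)
      fix r assume r: "r \<in> poly_space (l - 2) E"
      have "edge_integral E (\<lambda>x. g x * r x) = edge_integral E (\<lambda>x. P E x * r x)"
        by (rule edge_integral_cong[OF seg[OF E]]) (use gE[OF E] closure_subset in auto)
      then show "edge_integral E (\<lambda>x. q E x * r x) = edge_integral E (\<lambda>x. g x * r x)"
        using P[OF E] r by (auto simp: is_interp_def)
    qed
  next
    fix V assume "V \<in> element_vertices M T"
    then obtain E where E: "E \<in> element_edges M T" "V \<in> edge_vertices E" by (auto simp: element_vertices_def)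
    then show "g V = val V" using gE[of E V] P[OF E(1)] by (auto simp: is_interp_def edge_vertices_def)
  qed
  moreover have "g1 = g2" if 1: "is_trace l q val g1" and 2: "is_trace l q val g2" for g1 g2
  proof
    fix x show "g1 x = g2 x"
    proof (cases "x \<in> frontier T")
      case True
      then obtain E where "E \<in> element_edges M T" "x \<in> closure E" using frontierT by blast
      then show ?thesis using is_trace_interp[OF l 1] is_trace_interp[OF l 2] by simp
    next
      case False
      then show ?thesis using 1 2 by (auto simp: is_trace_def boundary_poly_space_def)
    qed
  qed
  ultimately show ?thesis by blast
qed

end

section \<open>Divergence of polynomial fields\<close>

lemma divergence_eq:
  assumes "\<And>i. ((\<lambda>y. w y $ i) has_derivative (\<lambda>v. v $ 1 * d i 1 + v $ 2 * d i 2)) (at x)"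
  shows "divergence w x = d 1 1 + d 2 2"
proof -
  have "(w has_derivative (\<lambda>v. \<chi> i. v $ 1 * d i 1 + v $ 2 * d i 2)) (at x)"
    unfolding has_derivative_componentwise_within[of w] Basis_vec_def
    using assms by (auto simp: inner_axis)
  from frechet_derivative_at[OF this]
  have "frechet_derivative w (at x) = (\<lambda>v. \<chi> i. v $ 1 * d i 1 + v $ 2 * d i 2)" by simp
  then show ?thesis by (simp add: divergence_def jacobian_def matrix_def trace_def sum_2 axis_def)
qed

lemma cut_has_derivative:
  assumes "open T" "x \<in> T" "f \<in> pfun l"
  shows "(cut T f has_derivative (\<lambda>v. v $ 1 * pd 1 f x + v $ 2 * pd 2 f x)) (at x)"
proof (rule has_derivative_transform_within_open[OF pfun_derivative(2)[OF assms(3)] assms(1,2)])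
  show "f y = cut T f y" if "y \<in> T" for y using that closure_subset by force
qed

lemma divergence_cut:
  assumes T: "open T" "x \<in> T" and f: "\<And>i. f i \<in> pfun l" and w: "\<And>y i. w y $ i = cut T (f i) y"
  shows "divergence w x = pd 1 (f 1) x + pd 2 (f 2) x"
proof -
  have "(\<lambda>y. w y $ i) = cut T (f i)" for i using w by auto
  then show ?thesis
    using divergence_eq[of w "\<lambda>i j. pd j (f i) x" x] cut_has_derivative[OF T f] by simp
qed

lemma pd_eqI:
  assumes "(f has_derivative (\<lambda>v. v $ 1 * a 1 + v $ 2 * a 2)) (at x)"
  shows "pd i f x = a i"
  using pd_unique[OF assms] exhaust_2[of i] by auto

lemma pd_add: "f \<in> pfun l \<Longrightarrow> g \<in> pfun m \<Longrightarrow> pd i (\<lambda>x. f x + g x) x = pd i f x + pd i g x"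
  by (rule pd_eqI[of _ "\<lambda>i. pd i f x + pd i g x"],
      rule has_derivative_eq_rhs[OF has_derivative_add[OF pfun_derivative(2) pfun_derivative(2)]])
    (auto simp: algebra_simps)

lemma pd_scale: "f \<in> pfun l \<Longrightarrow> pd i (\<lambda>x. c * f x) x = c * pd i f x"
  by (rule pd_eqI[of _ "\<lambda>i. c * pd i f x"],
      rule has_derivative_eq_rhs[OF has_derivative_mult_right[OF pfun_derivative(2)]])
    (auto simp: algebra_simps)

lemma pd_mult: "f \<in> pfun l \<Longrightarrow> g \<in> pfun m \<Longrightarrow> pd i (\<lambda>x. f x * g x) x = f x * pd i g x + pd i f x * g x"
  by (rule pd_eqI[of _ "\<lambda>i. f x * pd i g x + pd i f x * g x"],
      rule has_derivative_eq_rhs[OF has_derivative_mult[OF pfun_derivative(2) pfun_derivative(2)]])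
    (auto simp: algebra_simps)

lemma pd_coord: "pd i (\<lambda>x. x $ j - c) x = (if i = j then 1 else 0)"
proof (rule pd_eqI[of _ "\<lambda>i. if i = j then 1 else 0"])
  have "((\<lambda>x::point. x $ j - c) has_derivative (\<lambda>v. v $ j)) (at x)"
    by (auto intro!: derivative_eq_intros bounded_linear_imp_has_derivative bounded_linear_vec_nth)
  then show "((\<lambda>x. x $ j - c) has_derivative (\<lambda>v. v $ 1 * (if 1 = j then 1 else 0) + v $ 2 * (if 2 = j then 1 else 0))) (at x)"
    by (rule has_derivative_eq_rhs) (use exhaust_2[of j] in auto)
qed

lemma pfun_shift_coord: "(\<lambda>x. x $ j - c) \<in> pfun 1"
  by (intro pfun_diff pfun_coord pfun_const) auto

text \<open>The divergence of the field \<open>p x *\<^sub>R (x - c)\<close>: the dimension times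
  \<open>p\<close>, plus the Euler operator centred at \<open>c\<close>.\<close>

definition radial_div :: "point \<Rightarrow> (point \<Rightarrow> real) \<Rightarrow> point \<Rightarrow> real" where
  "radial_div c p x = 2 * p x + ((x - c) $ 1 * pd 1 p x + (x - c) $ 2 * pd 2 p x)"

lemma radial_div_pfun: "p \<in> pfun l \<Longrightarrow> radial_div c p \<in> pfun l"
proof -
  assume p: "p \<in> pfun l"
  have "(\<lambda>x. (x $ j - c $ j) * pd j p x) \<in> pfun l" for j
    using pfun_mult[OF pfun_shift_coord pfun_derivative(1)[OF p]] by simp
  then have "(\<lambda>x. 2 * p x + ((x $ 1 - c $ 1) * pd 1 p x + (x $ 2 - c $ 2) * pd 2 p x)) \<in> pfun l"
    by (intro pfun_add pfun_scale p)
  then show ?thesis by (simp add: radial_div_def[abs_def])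
qed

text \<open>Along the ray from \<open>c\<close> to \<open>x\<close>, the derivative of
  \<open>t\<^sup>2 * p\<close> is \<open>t * radial_div\<close>, so this product keeps its value 0
  from \<open>t = 0\<close> to \<open>t = 1\<close>.\<close>

lemma radial_div_inj:
  assumes p: "p \<in> pfun l" and 0: "\<And>x. radial_div c p x = 0"
  shows "p x = 0"
proof -
  let ?q = "\<lambda>t. c + t *\<^sub>R (x - c)"
  have "((\<lambda>t. t\<^sup>2 * p (?q t)) has_real_derivative 0) (at t)" for t
  proof -
    have "((\<lambda>t. t\<^sup>2 * p (?q t)) has_real_derivative
       (2 * t * p (?q t) + ((x - c) $ 1 * pd 1 p (?q t) + (x - c) $ 2 * pd 2 p (?q t)) * t\<^sup>2)) (at t)"
      by (auto intro!: derivative_eq_intros pfun_line_derivative[OF p])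
    also have "2 * t * p (?q t) + ((x - c) $ 1 * pd 1 p (?q t) + (x - c) $ 2 * pd 2 p (?q t)) * t\<^sup>2 = t * radial_div c p (?q t)"
      by (simp add: radial_div_def algebra_simps power2_eq_square)
    finally show ?thesis using 0 by simp
  qed
  then have "(1::real)\<^sup>2 * p (?q 1) = 0\<^sup>2 * p (?q 0)" using DERIV_isconst_all by blast
  then show ?thesis by simp
qed

text \<open>By Euler's identity a monomial of degree n centred at \<open>c\<close> is multiplied by
  n + 2, which is never zero; so the expansion of \<open>r\<close> about \<open>c\<close> is divided
  coefficient by coefficient.\<close>

lemma radial_div_surj:
  assumes r: "r \<in> pfun l"
  obtains p where "p \<in> pfun l" "radial_div c p = r"
proof -
  have "(\<lambda>x. r (c + 1 *\<^sub>R x)) \<in> pfun l" by (rule pfun_affine[OF r])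
  then obtain a where a: "(\<lambda>x. r (c + 1 *\<^sub>R x)) = (\<lambda>x. \<Sum>k\<in>idx l. a k * monom2 k x)" by (rule pfunE)
  have rx: "r x = (\<Sum>k\<in>idx l. a k * monom2 k (x - c))" for x using fun_cong[OF a, of "x - c"] by simp
  define m where "m k x = monom2 k (x - c)" for k x
  have m: "m k \<in> pfun l" if "k \<in> idx l" for k
    using pfun_affine[OF monom2_pfun[OF that], of "- c" 1] by (simp add: m_def[abs_def])
  have hom: "((x - c) $ 1 * pd 1 (m k) x + (x - c) $ 2 * pd 2 (m k) x) = real (fst k + snd k) * m k x" if k: "k \<in> idx l" for k x
  proof -
    obtain i j where ij: "k = (i, j)" by fastforce
    have "(m k has_derivative (\<lambda>v. v $ 1 * (real i * (x $ 1 - c $ 1) ^ (i - 1) * (x $ 2 - c $ 2) ^ j)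
        + v $ 2 * (real j * (x $ 1 - c $ 1) ^ i * (x $ 2 - c $ 2) ^ (j - 1)))) (at x)"
      unfolding m_def[abs_def] ij monom2_def
      by (auto intro!: derivative_eq_intros bounded_linear_imp_has_derivative bounded_linear_vec_nth
        simp: algebra_simps)
    note pds = pd_unique[OF this]
    have 1: "q * (real n * q ^ (n - 1)) = real n * q ^ n" for q :: real and n by (cases n) auto
    have "(x - c) $ 1 * pd 1 (m k) x + (x - c) $ 2 * pd 2 (m k) x
      = ((x $ 1 - c $ 1) * (real i * (x $ 1 - c $ 1) ^ (i - 1))) * (x $ 2 - c $ 2) ^ j
        + ((x $ 2 - c $ 2) * (real j * (x $ 2 - c $ 2) ^ (j - 1))) * (x $ 1 - c $ 1) ^ i"
      unfolding pds by (simp add: mult_ac)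
    also have "\<dots> = real (fst k + snd k) * m k x"
      unfolding 1 by (simp add: m_def ij monom2_def algebra_simps)
    finally show ?thesis .
  qed
  define b where "b k = a k / (2 + real (fst k + snd k))" for k
  define p where "p x = (\<Sum>k\<in>idx l. b k * m k x)" for x
  have pp: "p \<in> pfun l" unfolding p_def[abs_def] by (rule pfun_lincomb) (use m in auto)
  have pdp: "pd i p x = (\<Sum>k\<in>idx l. b k * pd i (m k) x)" for i x
  proof (rule pd_eqI[of _ "\<lambda>i. \<Sum>k\<in>idx l. b k * pd i (m k) x"])
    have "(p has_derivative (\<lambda>v. \<Sum>k\<in>idx l. b k * (v $ 1 * pd 1 (m k) x + v $ 2 * pd 2 (m k) x))) (at x)"
      unfolding p_def[abs_def] by (intro has_derivative_sum has_derivative_mult_right pfun_derivative(2)[OF m])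
    then show "(p has_derivative (\<lambda>v. v $ 1 * (\<Sum>k\<in>idx l. b k * pd 1 (m k) x) + v $ 2 * (\<Sum>k\<in>idx l. b k * pd 2 (m k) x))) (at x)"
      by (rule has_derivative_eq_rhs) (auto simp: distrib_left sum.distrib sum_distrib_left mult_ac)
  qed
  have "radial_div c p x = r x" for x
  proof -
    have "radial_div c p x = (\<Sum>k\<in>idx l. b k * (2 * m k x + ((x - c) $ 1 * pd 1 (m k) x + (x - c) $ 2 * pd 2 (m k) x)))"
      unfolding radial_div_def pdp p_def by (simp add: distrib_left sum.distrib sum_distrib_left mult_ac)
    also have "\<dots> = (\<Sum>k\<in>idx l. a k * m k x)"
    proof (rule sum.cong[OF refl])
      fix k assume "k \<in> idx l"
      then have "b k * (2 * m k x + ((x - c) $ 1 * pd 1 (m k) x + (x - c) $ 2 * pd 2 (m k) x))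
        = b k * (2 + real (fst k + snd k)) * m k x" by (simp only: hom) (simp add: algebra_simps)
      also have "b k * (2 + real (fst k + snd k)) = a k"
      proof -
        have "2 + real (fst k + snd k) \<noteq> 0" by linarith
        then show ?thesis by (simp add: b_def)
      qed
      finally show "b k * (2 * m k x + ((x - c) $ 1 * pd 1 (m k) x + (x - c) $ 2 * pd 2 (m k) x)) = a k * m k x" .
    qed
    finally show ?thesis by (simp add: rx m_def)
  qed
  then have "radial_div c p = r" by auto
  then show thesis by (rule that[OF pp])
qed

lemma vec_poly_rep:
  assumes "w \<in> vec_poly_space l Y"
  obtains W where "\<And>i. W i \<in> pfun l" "\<And>x i. w x $ i = cut Y (W i) x"
proof -
  have "\<forall>i. \<exists>W. W \<in> pfun l \<and> (\<lambda>x. w x $ i) = cut Y W" using assms by (auto simp: vec_poly_space_def poly_space_iff)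
  then obtain W where "\<forall>i. W i \<in> pfun l \<and> (\<lambda>x. w x $ i) = cut Y (W i)" by metis
  then show thesis by (intro that[of W]) (auto dest: fun_cong)
qed

lemma tensor_poly_rep:
  assumes "w \<in> tensor_poly_space l Y"
  obtains W where "\<And>i j. W i j \<in> pfun l" "\<And>x i j. w x $ i $ j = cut Y (W i j) x"
proof -
  have "\<forall>i. \<exists>W. (\<forall>j. W j \<in> pfun l) \<and> (\<forall>x j. w x $ i $ j = cut Y (W j) x)"
    using assms vec_poly_rep unfolding tensor_poly_space_def by (metis (mono_tags, lifting) mem_Collect_eq)
  then obtain W where "\<forall>i. (\<forall>j. W i j \<in> pfun l) \<and> (\<forall>x j. w x $ i $ j = cut Y (W i j) x)" by metis
  then show thesis by (intro that[of W]) auto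
qed

lemma vec_poly_cutI: "(\<And>i. W i \<in> pfun l) \<Longrightarrow> (\<And>x i. w x $ i = cut Y (W i) x) \<Longrightarrow> w \<in> vec_poly_space l Y"
  unfolding vec_poly_space_def poly_space_iff by (auto simp: fun_eq_iff)

lemma tensor_poly_cutI: "(\<And>i j. W i j \<in> pfun l) \<Longrightarrow> (\<And>x i j. w x $ i $ j = cut Y (W i j) x) \<Longrightarrow> w \<in> tensor_poly_space l Y"
  unfolding tensor_poly_space_def
proof (intro CollectI allI)
  fix i assume "\<And>i j. W i j \<in> pfun l" "\<And>x i j. w x $ i $ j = cut Y (W i j) x"
  then show "(\<lambda>x. w x $ i) \<in> vec_poly_space l Y" by (intro vec_poly_cutI[of "W i"]) auto
qed

section \<open>The discrete operators are well defined\<close>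

lemma lin_on_addI: "lin_on S L \<Longrightarrow> lin_on S L' \<Longrightarrow> lin_on S (\<lambda>f. L f + L' f)"
  and lin_on_cmul: "lin_on S L \<Longrightarrow> lin_on S (\<lambda>f. c * L f)"
  and lin_on_uminus: "lin_on S L \<Longrightarrow> lin_on S (\<lambda>f. - L f)"
  by (auto simp: lin_on_def algebra_simps)

lemma lin_on_sum: "finite J \<Longrightarrow> (\<And>j. j \<in> J \<Longrightarrow> lin_on S (L j)) \<Longrightarrow> lin_on S (\<lambda>f. \<Sum>j\<in>J. L j f)"
  by (induction J rule: finite_induct) (auto intro!: lin_on_addI simp: lin_on_def[of S "\<lambda>f. 0"])

lemma lin_on_compose:
  assumes "lin_on S L" and "\<And>f. f \<in> S' \<Longrightarrow> \<phi> f \<in> S"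
    and "\<And>f g. f \<in> S' \<Longrightarrow> g \<in> S' \<Longrightarrow> \<phi> (\<lambda>x. f x + g x) = (\<lambda>x. \<phi> f x + \<phi> g x)"
    and "\<And>f a. f \<in> S' \<Longrightarrow> \<phi> (\<lambda>x. a *\<^sub>R f x) = (\<lambda>x. a *\<^sub>R \<phi> f x)"
  shows "lin_on S' (\<lambda>f. L (\<phi> f))"
  using assms by (simp add: lin_on_def)

lemma lin_on_area:
  assumes T: "open T" "bounded T" and g: "continuous_on (closure T) g"
    and S: "\<And>f. f \<in> S \<Longrightarrow> continuous_on (closure T) f"
  shows "lin_on S (\<lambda>f. area_integral T (\<lambda>x. g x \<bullet> f x))"
  unfolding lin_on_def
proof (intro conjI ballI allI)
  fix f h assume "f \<in> S" "h \<in> S"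
  then show "area_integral T (\<lambda>x. g x \<bullet> (f x + h x)) = area_integral T (\<lambda>x. g x \<bullet> f x) + area_integral T (\<lambda>x. g x \<bullet> h x)"
    unfolding inner_add_right by (intro area_integral_add T continuous_on_inner g S)
next
  fix f a show "area_integral T (\<lambda>x. g x \<bullet> (a *\<^sub>R f x)) = a * area_integral T (\<lambda>x. g x \<bullet> f x)"
    using area_integral_cmul[of T a "\<lambda>x. g x \<bullet> f x"] by simp
qed

lemma lin_on_edge:
  assumes E: "is_segment E" and g: "continuous_on (closure E) g"
    and S: "\<And>f. f \<in> S \<Longrightarrow> continuous_on (closure E) f"
  shows "lin_on S (\<lambda>f. edge_integral E (\<lambda>x. g x \<bullet> f x))"
  unfolding lin_on_def
proof (intro conjI ballI allI)
  fix f h assume "f \<in> S" "h \<in> S"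
  then show "edge_integral E (\<lambda>x. g x \<bullet> (f x + h x)) = edge_integral E (\<lambda>x. g x \<bullet> f x) + edge_integral E (\<lambda>x. g x \<bullet> h x)"
    unfolding inner_add_right by (intro edge_integral_add E continuous_on_inner g S)
next
  fix f a show "edge_integral E (\<lambda>x. g x \<bullet> (a *\<^sub>R f x)) = a * edge_integral E (\<lambda>x. g x \<bullet> f x)"
    using edge_integral_cmul[OF E, of a "\<lambda>x. g x \<bullet> f x"] by simp
qed

lemma matrix_vector_continuous:
  fixes f :: "point \<Rightarrow> real^2^2"
  shows "continuous_on S f \<Longrightarrow> continuous_on S (\<lambda>x. f x *v n)"
  unfolding matrix_vector_mult_def by (intro continuous_intros continuous_on_vec_lambda)

lemma lin_on_edge_normal:
  fixes S :: "(point \<Rightarrow> real^2^2) set"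
  assumes E: "is_segment E" and g: "continuous_on (closure E) g"
    and S: "\<And>f. f \<in> S \<Longrightarrow> continuous_on (closure E) f"
  shows "lin_on S (\<lambda>f. edge_integral E (\<lambda>x. g x \<bullet> (f x *v n)))"
  by (rule lin_on_compose[OF lin_on_edge[OF E g, of "(\<lambda>f x. f x *v n) ` S"], of S "\<lambda>f x. f x *v n"])
    (auto intro: matrix_vector_continuous S simp: matrix_vector_mult_add_rdistrib scaleR_matrix_vector_assoc)

locale mesh_element = star_element +
  assumes element: "T \<in> elements M"
begin

lemma seg: "E \<in> element_edges M T \<Longrightarrow> is_segment E"
  using edge_is_segment[OF element_edge] .

lemma closure_edge_subset: "E \<in> element_edges M T \<Longrightarrow> closure E \<subseteq> closure T"
  using closure_edge_closure by blast

lemma on_edge: "continuous_on (closure T) f \<Longrightarrow> E \<in> element_edges M T \<Longrightarrow> continuous_on (closure E) f"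
  using closure_edge_subset continuous_on_subset by blast

lemma in_closure: "x \<in> T \<Longrightarrow> x \<in> closure T"
  using closure_subset by blast

lemma tensor_divergence_rep:
  assumes W: "\<And>i j. W i j \<in> pfun l" "\<And>x i j. w x $ i $ j = cut T (W i j) x" and x: "x \<in> T"
  shows "tensor_divergence w x = (\<chi> i. pd 1 (W i 1) x + pd 2 (W i 2) x)"
  unfolding tensor_divergence_def vec_eq_iff using divergence_cut[OF openT x W(1) W(2)] by simp

text \<open>The divergence itself is a junk value on the boundary of the element, where the fields,
  being cut off, are not differentiable.\<close>

definition cut_div :: "(point \<Rightarrow> real^2^2) \<Rightarrow> point \<Rightarrow> real^2" where
  "cut_div w = (THE d. (\<exists>l. d \<in> vec_poly_space l T) \<and> (\<forall>x\<in>T. d x = tensor_divergence w x))"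

text \<open>The degrees may differ: continuity passes from \<open>T\<close> to its closure, and both
  fields vanish elsewhere.\<close>

lemma poly_eq_on_element:
  assumes "f \<in> vec_poly_space l T" "g \<in> vec_poly_space m T" "\<And>x. x \<in> T \<Longrightarrow> f x = g x"
  shows "f = g"
proof
  fix x
  have fc: "continuous_on (closure T) f" "continuous_on (closure T) g"
    using rep_space_continuous[OF rep_space_vec_poly[OF openT boundedT]] assms by blast+
  show "f x = g x"
  proof (cases "x \<in> closure T")
    case True
    have "f x - g x = 0"
      by (rule continuous_constant_on_closure[of T "\<lambda>x. f x - g x"]) (use assms(3) fc True in \<open>auto intro: continuous_intros\<close>)
    then show ?thesis by simp
  next
    case False
    then show ?thesis using rep_space_outside[OF rep_space_vec_poly[OF openT boundedT]] assms by metis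
  qed
qed

lemma cut_div:
  assumes "w \<in> tensor_poly_space l T"
  shows "cut_div w \<in> vec_poly_space (l - 1) T" "x \<in> T \<Longrightarrow> tensor_divergence w x = cut_div w x"
proof -
  obtain W where W: "\<And>i j. W i j \<in> pfun l" "\<And>x i j. w x $ i $ j = cut T (W i j) x"
    using tensor_poly_rep[OF assms] by blast
  define d :: "point \<Rightarrow> real^2" where "d x = (\<chi> i. cut T (\<lambda>x. pd 1 (W i 1) x + pd 2 (W i 2) x) x)" for x
  have dP: "d \<in> vec_poly_space (l - 1) T"
    by (rule vec_poly_cutI[of "\<lambda>i x. pd 1 (W i 1) x + pd 2 (W i 2) x"])
      (auto intro!: pfun_add pfun_derivative(1) W simp: d_def)
  have dd: "d x = tensor_divergence w x" if "x \<in> T" for x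
    using tensor_divergence_rep[OF W that] that in_closure by (simp add: d_def vec_eq_iff)
  have "cut_div w = d" unfolding cut_div_def
    by (rule the_equality) (use dP dd poly_eq_on_element in \<open>force intro: poly_eq_on_element\<close>)+
  then show "cut_div w \<in> vec_poly_space (l - 1) T" "x \<in> T \<Longrightarrow> tensor_divergence w x = cut_div w x"
    using dP dd by auto
qed

lemma cut_div_linear:
  assumes f: "f \<in> tensor_poly_space l T" and g: "g \<in> tensor_poly_space l T"
  shows "cut_div (\<lambda>x. f x + g x) = (\<lambda>x. cut_div f x + cut_div g x)"
    and "cut_div (\<lambda>x. a *\<^sub>R f x) = (\<lambda>x. a *\<^sub>R cut_div f x)"
proof -
  note S = rep_space_tensor_poly[OF openT boundedT] and V = rep_space_vec_poly[OF openT boundedT]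
  obtain F where F: "\<And>i j. F i j \<in> pfun l" "\<And>x i j. f x $ i $ j = cut T (F i j) x"
    using tensor_poly_rep[OF f] by blast
  obtain G where G: "\<And>i j. G i j \<in> pfun l" "\<And>x i j. g x $ i $ j = cut T (G i j) x"
    using tensor_poly_rep[OF g] by blast
  have fg: "(\<lambda>x. f x + g x) \<in> tensor_poly_space l T" by (rule rep_space_add[OF S f g])
  have af: "(\<lambda>x. a *\<^sub>R f x) \<in> tensor_poly_space l T" by (rule rep_space_scale[OF S f])
  show "cut_div (\<lambda>x. f x + g x) = (\<lambda>x. cut_div f x + cut_div g x)"
  proof (rule poly_eq_on_element[OF cut_div(1)[OF fg] rep_space_add[OF V cut_div(1)[OF f] cut_div(1)[OF g]]])
    fix x assume x: "x \<in> T"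
    have "tensor_divergence (\<lambda>x. f x + g x) x = (\<chi> i. pd 1 (\<lambda>x. F i 1 x + G i 1 x) x + pd 2 (\<lambda>x. F i 2 x + G i 2 x) x)"
      by (rule tensor_divergence_rep[OF _ _ x, of "\<lambda>i j x. F i j x + G i j x"]) (auto intro!: pfun_add F(1) G(1) simp: F(2) G(2) cut_def)
    then show "cut_div (\<lambda>x. f x + g x) x = cut_div f x + cut_div g x"
      unfolding cut_div(2)[OF fg x, symmetric] cut_div(2)[OF f x, symmetric] cut_div(2)[OF g x, symmetric]
      using tensor_divergence_rep[OF F x] tensor_divergence_rep[OF G x]
      by (simp add: pd_add[OF F(1) G(1)] vec_eq_iff)
  qed
  show "cut_div (\<lambda>x. a *\<^sub>R f x) = (\<lambda>x. a *\<^sub>R cut_div f x)"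
  proof (rule poly_eq_on_element[OF cut_div(1)[OF af] rep_space_scale[OF V cut_div(1)[OF f]]])
    fix x assume x: "x \<in> T"
    have "tensor_divergence (\<lambda>x. a *\<^sub>R f x) x = (\<chi> i. pd 1 (\<lambda>x. a * F i 1 x) x + pd 2 (\<lambda>x. a * F i 2 x) x)"
      by (rule tensor_divergence_rep[OF _ _ x, of "\<lambda>i j x. a * F i j x"]) (auto intro!: pfun_scale F(1) simp: F(2) cut_def)
    then show "cut_div (\<lambda>x. a *\<^sub>R f x) x = a *\<^sub>R cut_div f x"
      unfolding cut_div(2)[OF af x, symmetric] cut_div(2)[OF f x, symmetric]
      using tensor_divergence_rep[OF F x] by (simp add: pd_scale[OF F(1)] vec_eq_iff distrib_left)
  qed
qed

text \<open>Under the integral the divergence may be exchanged for \<open>cut_div\<close>, which is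
  linear and has values in a polynomial space.\<close>

lemma lin_on_tensor_div:
  assumes "continuous_on (closure T) g"
  shows "lin_on (tensor_poly_space l T) (\<lambda>w. area_integral T (\<lambda>x. g x \<bullet> tensor_divergence w x))"
proof -
  have "lin_on (tensor_poly_space l T) (\<lambda>w. area_integral T (\<lambda>x. g x \<bullet> cut_div w x))"
    by (rule lin_on_compose[OF lin_on_area[OF openT boundedT assms, of "vec_poly_space (l-1) T"]])
      (auto intro: cut_div(1) cut_div_linear rep_space_continuous[OF rep_space_vec_poly[OF openT boundedT]])
  moreover have "area_integral T (\<lambda>x. g x \<bullet> cut_div w x) = area_integral T (\<lambda>x. g x \<bullet> tensor_divergence w x)"
    if "w \<in> tensor_poly_space l T" for w
    by (rule area_integral_cong) (simp add: cut_div(2)[OF that])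
  ultimately show ?thesis
    using rep_space_add[OF rep_space_tensor_poly[OF openT boundedT]] rep_space_scale[OF rep_space_tensor_poly[OF openT boundedT]]
    by (simp add: lin_on_def)
qed

definition vec_is_trace :: "int \<Rightarrow> (point set \<Rightarrow> point \<Rightarrow> real^2) \<Rightarrow> (point \<Rightarrow> real^2) \<Rightarrow> (point \<Rightarrow> real^2) \<Rightarrow> bool" where
  "vec_is_trace l q val g \<longleftrightarrow> (\<forall>i. is_trace l (\<lambda>E x. q E x $ i) (\<lambda>V. val V $ i) (\<lambda>x. g x $ i))"

lemma vec_is_trace_ex1:
  assumes l: "1 \<le> l" and q: "\<And>E. E \<in> element_edges M T \<Longrightarrow> q E \<in> vec_poly_space (l - 2) E"
  shows "\<exists>!g. vec_is_trace l q val g"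
proof -
  have ex1: "\<exists>!g. is_trace l (\<lambda>E x. q E x $ i) (\<lambda>V. val V $ i) g" for i
    by (rule is_trace_ex1[OF l]) (use q in \<open>auto simp: vec_poly_space_def\<close>)
  then obtain G where G: "\<And>i. is_trace l (\<lambda>E x. q E x $ i) (\<lambda>V. val V $ i) (G i)" by metis
  show ?thesis
  proof (rule ex1I[of _ "\<lambda>x. \<chi> i. G i x"])
    show "vec_is_trace l q val (\<lambda>x. \<chi> i. G i x)" using G by (simp add: vec_is_trace_def)
    fix g assume "vec_is_trace l q val g"
    then have "(\<lambda>x. g x $ i) = G i" for i using ex1[of i] G[of i] unfolding vec_is_trace_def by blast
    then show "g = (\<lambda>x. \<chi> i. G i x)" by (simp add: fun_eq_iff vec_eq_iff)
  qed
qed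

lemma trace1_is_trace:
  assumes v: "v \<in> H1_space k M"
  shows "vec_is_trace (int k + 2) (rot_E v) (rot_V v) (trace1 k M T v)"
proof -
  have eq: "(g \<in> vec_boundary_poly_space M (int k + 2) T \<and>
     (\<forall>E\<in>element_edges M T. vec_edge_proj (int k) E g = rot_E v E) \<and>
     (\<forall>V\<in>element_vertices M T. g V = rot_V v V)) \<longleftrightarrow> vec_is_trace (int k + 2) (rot_E v) (rot_V v) g" for g
    by (auto simp: vec_is_trace_def is_trace_def vec_boundary_poly_space_def vec_edge_proj_def fun_eq_iff vec_eq_iff)
  have "\<exists>!g. vec_is_trace (int k + 2) (rot_E v) (rot_V v) g"
    by (rule vec_is_trace_ex1) (use v element_edge in \<open>auto simp: H1_space_def\<close>)
  from theI'[OF this] show ?thesis unfolding trace1_def eq .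
qed

lemma trace1_interp:
  assumes v: "v \<in> H1_space k M" and E: "E \<in> element_edges M T" and x: "x \<in> closure E"
  shows "trace1 k M T v x $ i = interp (int k + 2) E (\<lambda>x. rot_E v E x $ i) (\<lambda>V. rot_V v V $ i) x"
proof -
  have "is_trace (int k + 2) (\<lambda>E x. rot_E v E x $ i) (\<lambda>V. rot_V v V $ i) (\<lambda>x. trace1 k M T v x $ i)"
    using trace1_is_trace[OF v] by (simp add: vec_is_trace_def)
  from is_trace_interp[OF _ this E x] show ?thesis by simp
qed

lemma trace1_poly:
  assumes v: "v \<in> H1_space k M" and E: "E \<in> element_edges M T"
  shows "(\<lambda>x. if x \<in> closure E then trace1 k M T v x $ i else 0) \<in> poly_space (int k + 2) E"
  using trace1_is_trace[OF v] E by (auto simp: vec_is_trace_def is_trace_def boundary_poly_space_def)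

lemma vec_continuous: "(\<And>i. continuous_on S (\<lambda>x. f x $ i)) \<Longrightarrow> continuous_on S (f :: point \<Rightarrow> real^2)"
  using continuous_on_vec_lambda[of S "\<lambda>i x. f x $ i"] by simp

lemma trace1_continuous:
  assumes v: "v \<in> H1_space k M" and E: "E \<in> element_edges M T"
  shows "continuous_on (closure E) (trace1 k M T v)"
proof (rule vec_continuous)
  fix i
  have "(\<lambda>x. trace1 k M T v x $ i) \<in> boundary_poly_space M (int k + 2) T"
    using trace1_is_trace[OF v] by (auto simp: vec_is_trace_def is_trace_def)
  then show "continuous_on (closure E) (\<lambda>x. trace1 k M T v x $ i)" by (rule boundary_poly_continuous[OF _ E])
qed

lemma trace1_outside: "v \<in> H1_space k M \<Longrightarrow> x \<notin> frontier T \<Longrightarrow> trace1 k M T v x = 0"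
  using trace1_is_trace[of v k] by (auto simp: vec_is_trace_def is_trace_def boundary_poly_space_def vec_eq_iff)

section \<open>Gradient and potential of a discrete rotation\<close>

definition is_grad :: "nat \<Rightarrow> rotation \<Rightarrow> (point \<Rightarrow> real^2^2) \<Rightarrow> bool" where
  "is_grad k v G \<longleftrightarrow> G \<in> tensor_poly_space (int k + 1) T \<and>
     (\<forall>\<zeta>\<in>tensor_poly_space (int k + 1) T.
        area_integral T (\<lambda>x. G x \<bullet> \<zeta> x) =
        - area_integral T (\<lambda>x. rot_T v T x \<bullet> tensor_divergence \<zeta> x)
        + (\<Sum>E\<in>element_edges M T.
             \<omega>TE M T E * edge_integral E (\<lambda>x. trace1 k M T v x \<bullet> (\<zeta> x *v normal M E))))"

lemma rot_T_continuous: "v \<in> H1_space k M \<Longrightarrow> continuous_on (closure T) (rot_T v T)"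
  using element rep_space_continuous[OF rep_space_vec_poly[OF openT boundedT]] by (auto simp: H1_space_def)

lemma tensor_continuous: "\<zeta> \<in> tensor_poly_space l T \<Longrightarrow> continuous_on (closure T) \<zeta>"
  by (rule rep_space_continuous[OF rep_space_tensor_poly[OF openT boundedT]])

lemma vec_poly_continuous: "w \<in> vec_poly_space l T \<Longrightarrow> continuous_on (closure T) w"
  by (rule rep_space_continuous[OF rep_space_vec_poly[OF openT boundedT]])

lemma is_grad_ex1:
  assumes v: "v \<in> H1_space k M" shows "\<exists>!G. is_grad k v G"
  unfolding is_grad_def
proof (rule rep_space_ex1[OF openT boundedT rep_space_tensor_poly[OF openT boundedT]])
  have "lin_on (tensor_poly_space (int k + 1) T) (\<lambda>\<zeta>. edge_integral E (\<lambda>x. trace1 k M T v x \<bullet> (\<zeta> x *v normal M E)))"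
    if E: "E \<in> element_edges M T" for E
    by (rule lin_on_edge_normal[OF seg[OF E] trace1_continuous[OF v E]]) (rule on_edge[OF tensor_continuous E])
  then show "lin_on (tensor_poly_space (int k + 1) T) (\<lambda>\<zeta>. - area_integral T (\<lambda>x. rot_T v T x \<bullet> tensor_divergence \<zeta> x)
        + (\<Sum>E\<in>element_edges M T. \<omega>TE M T E * edge_integral E (\<lambda>x. trace1 k M T v x \<bullet> (\<zeta> x *v normal M E))))"
    by (intro lin_on_addI lin_on_uminus lin_on_sum lin_on_cmul lin_on_tensor_div rot_T_continuous[OF v] finite_element_edges)
qed

lemma grad1_is_grad: "v \<in> H1_space k M \<Longrightarrow> is_grad k v (grad1 k M T v)"
  unfolding grad1_def is_grad_def[symmetric] by (rule theI'[OF is_grad_ex1])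

text \<open>Parametrises \<open>tensor_Rc_space\<close> by vector polynomials of one degree less,
  see \<open>tensor_Rc_eq\<close>.\<close>

definition radial :: "(point \<Rightarrow> real^2) \<Rightarrow> point \<Rightarrow> real^2^2" where
  "radial p x = (\<chi> i. p x $ i *\<^sub>R (x - centre M T))"

lemma radial_rep:
  assumes "\<And>i. P i \<in> pfun l" "\<And>x i. p x $ i = cut T (P i) x"
  shows "radial p x $ i $ j = cut T (\<lambda>x. P i x * (x $ j - centre M T $ j)) x"
  using assms by (auto simp: radial_def cut_def)

lemma radial_pfun: "p \<in> pfun l \<Longrightarrow> (\<lambda>x. p x * (x $ j - c)) \<in> pfun (l + 1)"
  by (rule pfun_mult[OF _ pfun_shift_coord])

lemma radial_tensor:
  assumes "p \<in> vec_poly_space l T" shows "radial p \<in> tensor_poly_space (l + 1) T"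
proof -
  obtain P where P: "\<And>i. P i \<in> pfun l" "\<And>x i. p x $ i = cut T (P i) x" using vec_poly_rep[OF assms] by blast
  show ?thesis by (rule tensor_poly_cutI[OF radial_pfun[OF P(1)] radial_rep[OF P]])
qed

lemma radial_divergence:
  assumes P: "\<And>i. P i \<in> pfun l" "\<And>x i. p x $ i = cut T (P i) x" and x: "x \<in> T"
  shows "tensor_divergence (radial p) x = (\<chi> i. radial_div (centre M T) (P i) x)"
  unfolding tensor_divergence_rep[OF radial_pfun[OF P(1)] radial_rep[OF P] x] radial_div_def
    pd_mult[OF P(1) pfun_shift_coord] pd_coord
  by (simp add: vec_eq_iff algebra_simps)

lemma tensor_Rc_eq: "tensor_Rc_space M l T = radial ` vec_poly_space (l - 1) T"
proof (intro set_eqI iffI)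
  fix f assume "f \<in> tensor_Rc_space M l T"
  then have "\<forall>i. \<exists>p. p \<in> poly_space (l - 1) T \<and> (\<lambda>x. f x $ i) = (\<lambda>x. p x *\<^sub>R (x - centre M T))"
    by (auto simp: tensor_Rc_space_def Rc_space_def)
  then obtain p where p: "\<forall>i. p i \<in> poly_space (l - 1) T \<and> (\<lambda>x. f x $ i) = (\<lambda>x. p i x *\<^sub>R (x - centre M T))" by metis
  then have "f = radial (\<lambda>x. \<chi> i. p i x)" by (auto simp: radial_def vec_eq_iff fun_eq_iff)
  moreover have "(\<lambda>x. \<chi> i. p i x) \<in> vec_poly_space (l - 1) T" using p by (simp add: vec_poly_space_def)
  ultimately show "f \<in> radial ` vec_poly_space (l - 1) T" by blast
qed (auto simp: tensor_Rc_space_def Rc_space_def radial_def vec_poly_space_def)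

text \<open>The divergence maps radial fields bijectively onto polynomial fields of the same degree
  as their coefficient. Testing the potential with such divergences is therefore testing it with its
  whole space.\<close>

lemma radial_primitive_ex1:
  assumes r: "u \<in> vec_poly_space l T"
  shows "\<exists>!p. p \<in> vec_poly_space l T \<and> cut_div (radial p) = u"
proof -
  obtain R where R: "\<And>i. R i \<in> pfun l" "\<And>x i. u x $ i = cut T (R i) x" using vec_poly_rep[OF r] by blast
  have "\<forall>i. \<exists>P. P \<in> pfun l \<and> radial_div (centre M T) P = R i" using radial_div_surj[OF R(1)] by metis
  then obtain P where P: "\<And>i. P i \<in> pfun l" "\<And>i. radial_div (centre M T) (P i) = R i" by metis
  define p :: "point \<Rightarrow> real^2" where "p x = (\<chi> i. cut T (P i) x)" for x
  have pc: "p x $ i = cut T (P i) x" for x i by (simp add: p_def)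
  have pP: "p \<in> vec_poly_space l T" by (rule vec_poly_cutI[OF P(1) pc])
  show ?thesis
  proof (rule ex1I[of _ p], intro conjI pP)
    show "cut_div (radial p) = u"
    proof (rule poly_eq_on_element[OF cut_div(1)[OF radial_tensor[OF pP]] r])
      fix x assume x: "x \<in> T"
      show "cut_div (radial p) x = u x"
        unfolding cut_div(2)[OF radial_tensor[OF pP] x, symmetric] radial_divergence[OF P(1) pc x] P(2)
        using x in_closure by (simp add: vec_eq_iff R(2))
    qed
    fix q assume q: "q \<in> vec_poly_space l T \<and> cut_div (radial q) = u"
    obtain Q where Q: "\<And>i. Q i \<in> pfun l" "\<And>x i. q x $ i = cut T (Q i) x" using vec_poly_rep q by blast
    have "Q i x = P i x" for i x
    proof -
      have d: "(\<lambda>x. Q i x + (-1) * P i x) \<in> pfun l" by (intro pfun_add pfun_scale Q P)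
      have rd: "radial_div (centre M T) (\<lambda>x. Q i x + (-1) * P i x) x = radial_div (centre M T) (Q i) x - R i x" for x
        unfolding P(2)[symmetric] radial_div_def pd_add[OF Q(1) pfun_scale[OF P(1)]] pd_scale[OF P(1)]
        by (simp add: algebra_simps)
      have z: "radial_div (centre M T) (\<lambda>x. Q i x + (-1) * P i x) x = 0" if x: "x \<in> T" for x
      proof -
        have "(\<chi> i. radial_div (centre M T) (Q i) x) = u x"
          using cut_div(2)[OF radial_tensor x, of q l] radial_divergence[OF Q x] q by auto
        then have "radial_div (centre M T) (Q i) x = R i x" using R(2)[of x i] x in_closure by (simp add: vec_eq_iff)
        then show ?thesis using rd by simp
      qed
      \<comment> \<open>The expression is a polynomial, so its vanishing on the open element extends
        to the plane, as injectivity along the rays from the centre requires.\<close>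
      have "radial_div (centre M T) (\<lambda>x. Q i x + (-1) * P i x) x = 0" for x
        by (rule pfun_identity[OF radial_div_pfun[OF d] openT zT z])
      then have "Q i x + (-1) * P i x = 0" using radial_div_inj[OF d] by blast
      then show ?thesis by simp
    qed
    then show "q = p" by (simp add: fun_eq_iff vec_eq_iff Q(2) pc cut_def)
  qed
qed

lemma radial_linear:
  "radial (\<lambda>x. f x + g x) = (\<lambda>x. radial f x + radial g x)" "radial (\<lambda>x. a *\<^sub>R f x) = (\<lambda>x. a *\<^sub>R radial f x)"
  by (auto simp: radial_def fun_eq_iff vec_eq_iff algebra_simps)

definition prim :: "int \<Rightarrow> (point \<Rightarrow> real^2) \<Rightarrow> point \<Rightarrow> real^2" where
  "prim l u = (THE p. p \<in> vec_poly_space l T \<and> cut_div (radial p) = u)"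

lemma prim:
  assumes "u \<in> vec_poly_space l T"
  shows "prim l u \<in> vec_poly_space l T" "cut_div (radial (prim l u)) = u"
  using theI'[OF radial_primitive_ex1[OF assms]] unfolding prim_def by auto

lemma prim_unique: "p \<in> vec_poly_space l T \<Longrightarrow> u \<in> vec_poly_space l T \<Longrightarrow> cut_div (radial p) = u \<Longrightarrow> prim l u = p"
  unfolding prim_def by (rule the1_equality[OF radial_primitive_ex1]) auto

lemma prim_linear:
  assumes f: "f \<in> vec_poly_space l T" and g: "g \<in> vec_poly_space l T"
  shows "prim l (\<lambda>x. f x + g x) = (\<lambda>x. prim l f x + prim l g x)"
    and "prim l (\<lambda>x. a *\<^sub>R f x) = (\<lambda>x. a *\<^sub>R prim l f x)"
proof -
  note V = rep_space_vec_poly[OF openT boundedT]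
  note pf = prim[OF f] and pg = prim[OF g]
  show "prim l (\<lambda>x. f x + g x) = (\<lambda>x. prim l f x + prim l g x)"
    by (rule prim_unique[OF rep_space_add[OF V pf(1) pg(1)] rep_space_add[OF V f g]])
      (simp add: radial_linear cut_div_linear(1)[OF radial_tensor[OF pf(1)] radial_tensor[OF pg(1)]] pf(2) pg(2))
  show "prim l (\<lambda>x. a *\<^sub>R f x) = (\<lambda>x. a *\<^sub>R prim l f x)"
    by (rule prim_unique[OF rep_space_scale[OF V pf(1)] rep_space_scale[OF V f]])
      (simp add: radial_linear cut_div_linear(2)[OF radial_tensor[OF pf(1)] radial_tensor[OF pf(1)]] pf(2))
qed

definition pot_rhs :: "nat \<Rightarrow> rotation \<Rightarrow> (point \<Rightarrow> real^2^2) \<Rightarrow> real" where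
  "pot_rhs k v \<eta> = - area_integral T (\<lambda>x. grad1 k M T v x \<bullet> \<eta> x)
        + (\<Sum>E\<in>element_edges M T. \<omega>TE M T E * edge_integral E (\<lambda>x. trace1 k M T v x \<bullet> (\<eta> x *v normal M E)))"

definition is_potential :: "nat \<Rightarrow> rotation \<Rightarrow> (point \<Rightarrow> real^2) \<Rightarrow> bool" where
  "is_potential k v P \<longleftrightarrow> P \<in> vec_poly_space (int k + 2) T \<and>
     (\<forall>\<eta>\<in>tensor_Rc_space M (int k + 3) T. area_integral T (\<lambda>x. P x \<bullet> tensor_divergence \<eta> x) = pot_rhs k v \<eta>)"

lemma grad1_tensor: "v \<in> H1_space k M \<Longrightarrow> grad1 k M T v \<in> tensor_poly_space (int k + 1) T"
  using grad1_is_grad by (auto simp: is_grad_def)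

lemma pot_rhs_linear:
  assumes v: "v \<in> H1_space k M"
  shows "lin_on (tensor_poly_space l T) (pot_rhs k v)"
proof -
  have "lin_on (tensor_poly_space l T) (\<lambda>\<eta>. edge_integral E (\<lambda>x. trace1 k M T v x \<bullet> (\<eta> x *v normal M E)))"
    if E: "E \<in> element_edges M T" for E
    by (rule lin_on_edge_normal[OF seg[OF E] trace1_continuous[OF v E]]) (rule on_edge[OF tensor_continuous E])
  moreover have "lin_on (tensor_poly_space l T) (\<lambda>\<eta>. area_integral T (\<lambda>x. grad1 k M T v x \<bullet> \<eta> x))"
    by (rule lin_on_area[OF openT boundedT tensor_continuous[OF grad1_tensor[OF v]] tensor_continuous])
  ultimately show ?thesis unfolding pot_rhs_def[abs_def]
    by (intro lin_on_addI lin_on_uminus lin_on_sum lin_on_cmul finite_element_edges)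
qed

text \<open>The change of test function from a radial field to its divergence turns the definition
  of the potential into a Riesz problem in \<open>vec_poly_space\<close>.\<close>

lemma is_potential_iff:
  "is_potential k v P \<longleftrightarrow> P \<in> vec_poly_space (int k + 2) T \<and>
    (\<forall>r\<in>vec_poly_space (int k + 2) T. area_integral T (\<lambda>x. P x \<bullet> r x) = pot_rhs k v (radial (prim (int k + 2) r)))"
proof -
  let ?l = "int k + 2" and ?V = "vec_poly_space (int k + 2) T"
  have l: "int k + 3 - 1 = ?l" by simp
  have div: "area_integral T (\<lambda>x. P x \<bullet> tensor_divergence (radial p) x) = area_integral T (\<lambda>x. P x \<bullet> cut_div (radial p) x)"
    if "p \<in> ?V" for p
    by (rule area_integral_cong) (use cut_div(2)[OF radial_tensor[OF that]] in simp)
  have cd: "cut_div (radial p) \<in> ?V" if "p \<in> ?V" for p using cut_div(1)[OF radial_tensor[OF that]] by (simp add: add.commute)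
  have "(\<forall>\<eta>\<in>tensor_Rc_space M (int k + 3) T. area_integral T (\<lambda>x. P x \<bullet> tensor_divergence \<eta> x) = pot_rhs k v \<eta>)
    \<longleftrightarrow> (\<forall>p\<in>?V. area_integral T (\<lambda>x. P x \<bullet> cut_div (radial p) x) = pot_rhs k v (radial p))"
    unfolding tensor_Rc_eq l using div by auto
  also have "\<dots> \<longleftrightarrow> (\<forall>r\<in>?V. area_integral T (\<lambda>x. P x \<bullet> r x) = pot_rhs k v (radial (prim ?l r)))"
  proof (intro iffI ballI)
    fix r assume "\<forall>p\<in>?V. area_integral T (\<lambda>x. P x \<bullet> cut_div (radial p) x) = pot_rhs k v (radial p)" "r \<in> ?V"
    then show "area_integral T (\<lambda>x. P x \<bullet> r x) = pot_rhs k v (radial (prim ?l r))" using prim[of r ?l] by metis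
  next
    fix p assume "\<forall>r\<in>?V. area_integral T (\<lambda>x. P x \<bullet> r x) = pot_rhs k v (radial (prim ?l r))" and p: "p \<in> ?V"
    then show "area_integral T (\<lambda>x. P x \<bullet> cut_div (radial p) x) = pot_rhs k v (radial p)"
      using cd[OF p] prim_unique[OF p cd[OF p] refl] by simp
  qed
  finally show ?thesis unfolding is_potential_def by blast
qed

lemma is_potential_ex1:
  assumes v: "v \<in> H1_space k M" shows "\<exists>!P. is_potential k v P"
  unfolding is_potential_iff
proof (rule rep_space_ex1[OF openT boundedT rep_space_vec_poly[OF openT boundedT]])
  have "lin_on (vec_poly_space (int k + 2) T) (\<lambda>p. pot_rhs k v (radial p))"
    by (rule lin_on_compose[OF pot_rhs_linear[OF v] radial_tensor radial_linear])
  then show "lin_on (vec_poly_space (int k + 2) T) (\<lambda>r. pot_rhs k v (radial (prim (int k + 2) r)))"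
    by (rule lin_on_compose) (auto intro: prim prim_linear)
qed

lemma potential_is_potential: "v \<in> H1_space k M \<Longrightarrow> is_potential k v (potential k M T v)"
  unfolding potential_def is_potential_def[unfolded pot_rhs_def, symmetric] by (rule theI'[OF is_potential_ex1])

lemma potential_vec: "v \<in> H1_space k M \<Longrightarrow> potential k M T v \<in> vec_poly_space (int k + 2) T"
  using potential_is_potential by (auto simp: is_potential_def)

text \<open>The defining relation of the potential extends from radial to arbitrary tensor fields: subtracting
  the radial field of the same divergence leaves a divergence-free test field for the gradient.\<close>

lemma potential_tensor:
  assumes v: "v \<in> H1_space k M" and \<psi>: "\<psi> \<in> tensor_poly_space (int k + 1) T"
  shows "area_integral T (\<lambda>x. potential k M T v x \<bullet> tensor_divergence \<psi> x) = pot_rhs k v \<psi>"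
proof -
  let ?S = "tensor_poly_space (int k + 1) T"
  note S = rep_space_tensor_poly[OF openT boundedT]
  have r: "cut_div \<psi> \<in> vec_poly_space (int k) T" using cut_div(1)[OF \<psi>] by simp
  define q where "q = prim (int k) (cut_div \<psi>)"
  have q: "q \<in> vec_poly_space (int k) T" "cut_div (radial q) = cut_div \<psi>" unfolding q_def by (rule prim[OF r])+
  have q2: "q \<in> vec_poly_space (int k + 2) T"
    using q(1) pfun_mono[of "int k" "int k + 2"] unfolding vec_poly_space_def poly_space_iff by force
  have rS: "radial q \<in> ?S" by (rule radial_tensor[OF q(1)])
  define \<zeta> where "\<zeta> x = \<psi> x - radial q x" for x
  have \<zeta>: "\<zeta> \<in> ?S" unfolding \<zeta>_def[abs_def] by (rule rep_space_diff[OF S \<psi> rS])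
  have \<psi>eq: "\<psi> = (\<lambda>x. \<zeta> x + radial q x)" by (simp add: \<zeta>_def)
  have "cut_div \<zeta> x = 0" for x
    using cut_div_linear(1)[OF \<zeta> rS] q(2) by (simp add: \<psi>eq[symmetric] fun_eq_iff)
  then have "tensor_divergence \<zeta> x = 0" if "x \<in> T" for x using cut_div(2)[OF \<zeta> that] by simp
  then have "area_integral T (\<lambda>x. rot_T v T x \<bullet> tensor_divergence \<zeta> x) = area_integral T (\<lambda>x. 0)"
    by (intro area_integral_cong) simp
  then have 0: "pot_rhs k v \<zeta> = 0"
    using grad1_is_grad[OF v] \<zeta> by (auto simp: is_grad_def pot_rhs_def area_integral_def)
  have "area_integral T (\<lambda>x. potential k M T v x \<bullet> tensor_divergence \<psi> x)
      = area_integral T (\<lambda>x. potential k M T v x \<bullet> tensor_divergence (radial q) x)"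
    by (rule area_integral_cong) (simp add: cut_div(2)[OF \<psi>] cut_div(2)[OF rS] q(2))
  also have "\<dots> = pot_rhs k v (radial q)"
  proof -
    have "radial q \<in> tensor_Rc_space M (int k + 3) T" unfolding tensor_Rc_eq using q2 by (simp add: add.commute)
    then show ?thesis using potential_is_potential[OF v] by (auto simp: is_potential_def)
  qed
  also have "\<dots> = pot_rhs k v \<psi>"
    using pot_rhs_linear[OF v] \<zeta> rS 0 unfolding lin_on_def by (subst \<psi>eq) simp
  finally show ?thesis .
qed

text \<open>The divergence theorem is applied to the four products of a component of
  \<open>p\<close> with an entry of \<open>\<psi>\<close>. Their derivatives are taken of the global
  polynomials, which agree with the cut-off fields on the open element.\<close>

lemma green:
  assumes P: "\<And>i. P i \<in> pfun l" "\<And>x i. p x $ i = cut T (P i) x"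
    and \<psi>: "\<psi> \<in> tensor_poly_space m T"
  shows "area_integral T (\<lambda>x. (\<chi> i j. cut T (pd j (P i)) x) \<bullet> \<psi> x) + area_integral T (\<lambda>x. p x \<bullet> tensor_divergence \<psi> x)
    = (\<Sum>E\<in>element_edges M T. \<omega>TE M T E * edge_integral E (\<lambda>x. p x \<bullet> (\<psi> x *v normal M E)))"
proof -
  obtain X where X: "\<And>i j. X i j \<in> pfun m" "\<And>x i j. \<psi> x $ i $ j = cut T (X i j) x"
    using tensor_poly_rep[OF \<psi>] by blast
  let ?A = "element_edges M T"
  define f where "f i j x = P i x * X i j x" for i j x
  have f: "f i j \<in> pfun (l + m)" for i j unfolding f_def[abs_def] by (rule pfun_mult[OF P(1) X(1)])
  have fc: "continuous_on S (f i j)" and pc: "continuous_on S (pd j (P i))" and pdf: "continuous_on S (pd j (f i j))" for i j S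
    by (rule pfun_continuous_on[OF f] pfun_continuous_on[OF pfun_derivative(1)[OF P(1)]] pfun_continuous_on[OF pfun_derivative(1)[OF f]])+
  have c1: "continuous_on (closure T) (\<lambda>x. \<chi> i j. cut T (pd j (P i)) x)"
    by (rule tensor_continuous, rule tensor_poly_cutI[of "\<lambda>i j. pd j (P i)" "l - 1"]) (auto intro: pfun_derivative(1) P(1))
  have p: "p \<in> vec_poly_space l T" by (rule vec_poly_cutI[OF P])
  have "area_integral T (\<lambda>x. (\<chi> i j. cut T (pd j (P i)) x) \<bullet> \<psi> x) + area_integral T (\<lambda>x. p x \<bullet> tensor_divergence \<psi> x)
     = area_integral T (\<lambda>x. (\<chi> i j. cut T (pd j (P i)) x) \<bullet> \<psi> x) + area_integral T (\<lambda>x. p x \<bullet> cut_div \<psi> x)"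
    by (intro arg_cong2[where f = "(+)"] refl area_integral_cong) (simp add: cut_div(2)[OF \<psi>])
  also have "\<dots> = area_integral T (\<lambda>x. (\<chi> i j. cut T (pd j (P i)) x) \<bullet> \<psi> x + p x \<bullet> cut_div \<psi> x)"
    by (intro area_integral_add[symmetric] openT boundedT continuous_on_inner c1 tensor_continuous[OF \<psi>]
        vec_poly_continuous[OF p] vec_poly_continuous[OF cut_div(1)[OF \<psi>]])
  also have "\<dots> = area_integral T (\<lambda>x. (pd 1 (f 1 1) x + pd 2 (f 1 2) x) + (pd 1 (f 2 1) x + pd 2 (f 2 2) x))"
  proof (rule area_integral_cong)
    fix x assume x: "x \<in> T"
    have "cut_div \<psi> x = (\<chi> i. pd 1 (X i 1) x + pd 2 (X i 2) x)"
      using cut_div(2)[OF \<psi> x] tensor_divergence_rep[OF X x] by simp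
    then show "(\<chi> i j. cut T (pd j (P i)) x) \<bullet> \<psi> x + p x \<bullet> cut_div \<psi> x = (pd 1 (f 1 1) x + pd 2 (f 1 2) x) + (pd 1 (f 2 1) x + pd 2 (f 2 2) x)"
      unfolding f_def[abs_def] pd_mult[OF P(1) X(1)]
      using x in_closure by (simp add: inner_vec_def sum_2 P(2) X(2) algebra_simps)
  qed
  also have "\<dots> = (area_integral T (pd 1 (f 1 1)) + area_integral T (pd 2 (f 1 2))) + (area_integral T (pd 1 (f 2 1)) + area_integral T (pd 2 (f 2 2)))"
    unfolding area_integral_add[OF openT boundedT continuous_on_add[OF pdf pdf] continuous_on_add[OF pdf pdf]]
      area_integral_add[OF openT boundedT pdf pdf] ..
  also have "\<dots> = (\<Sum>E\<in>?A. \<omega>TE M T E * ((normal M E $ 1 * edge_integral E (f 1 1) + normal M E $ 2 * edge_integral E (f 1 2))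
      + (normal M E $ 1 * edge_integral E (f 2 1) + normal M E $ 2 * edge_integral E (f 2 2))))"
    unfolding divergence_theorem[OF f] sum.distrib[symmetric] by (rule sum.cong) (auto simp: algebra_simps)
  also have "\<dots> = (\<Sum>E\<in>?A. \<omega>TE M T E * edge_integral E (\<lambda>x. p x \<bullet> (\<psi> x *v normal M E)))"
  proof (rule sum.cong[OF refl])
    fix E assume E: "E \<in> ?A"
    let ?n = "normal M E"
    have "edge_integral E (\<lambda>x. p x \<bullet> (\<psi> x *v ?n)) = edge_integral E (\<lambda>x. (?n $ 1 * f 1 1 x + ?n $ 2 * f 1 2 x) + (?n $ 1 * f 2 1 x + ?n $ 2 * f 2 2 x))"
    proof (rule edge_integral_cong[OF seg[OF E]])
      fix x assume "x \<in> E"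
      then have "x \<in> closure T" using closure_subset closure_edge_subset[OF E] by blast
      then show "p x \<bullet> (\<psi> x *v ?n) = (?n $ 1 * f 1 1 x + ?n $ 2 * f 1 2 x) + (?n $ 1 * f 2 1 x + ?n $ 2 * f 2 2 x)"
        by (simp add: inner_vec_def matrix_vector_mult_def sum_2 P(2) X(2) f_def algebra_simps)
    qed
    also have "\<dots> = (edge_integral E (\<lambda>x. ?n $ 1 * f 1 1 x) + edge_integral E (\<lambda>x. ?n $ 2 * f 1 2 x))
        + (edge_integral E (\<lambda>x. ?n $ 1 * f 2 1 x) + edge_integral E (\<lambda>x. ?n $ 2 * f 2 2 x))"
    proof -
      note c = continuous_on_mult[OF continuous_on_const fc]
      show ?thesis unfolding edge_integral_add[OF seg[OF E] continuous_on_add[OF c c] continuous_on_add[OF c c]]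
          edge_integral_add[OF seg[OF E] c c] ..
    qed
    finally show "\<omega>TE M T E * ((?n $ 1 * edge_integral E (f 1 1) + ?n $ 2 * edge_integral E (f 1 2))
      + (?n $ 1 * edge_integral E (f 2 1) + ?n $ 2 * edge_integral E (f 2 2))) = \<omega>TE M T E * edge_integral E (\<lambda>x. p x \<bullet> (\<psi> x *v ?n))"
      by (simp add: edge_integral_cmul[OF seg[OF E]])
  qed
  finally show ?thesis .
qed

section \<open>Linear dependence of trace, gradient and potential on the rotation\<close>

lemma rot_diff_H1: "v \<in> H1_space k M \<Longrightarrow> w \<in> H1_space k M \<Longrightarrow> rot_diff v w \<in> H1_space k M"
  by (auto simp: H1_space_def rot_diff_def vec_poly_space_def intro: poly_space_diff)

lemma trace1_diff:
  assumes v: "v \<in> H1_space k M" and w: "w \<in> H1_space k M"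
  shows "trace1 k M T (rot_diff v w) = (\<lambda>x. trace1 k M T v x - trace1 k M T w x)"
proof
  fix x
  note d = rot_diff_H1[OF v w]
  show "trace1 k M T (rot_diff v w) x = trace1 k M T v x - trace1 k M T w x"
  proof (cases "x \<in> frontier T")
    case True
    then obtain E where E: "E \<in> element_edges M T" "x \<in> closure E" using frontierT by blast
    have c: "continuous_on (closure E) (\<lambda>x. rot_E u E x $ i)" if "u \<in> H1_space k M" for u i
    proof (rule poly_space_continuous)
      show "(\<lambda>x. rot_E u E x $ i) \<in> poly_space (int k) E"
        using that element_edge[OF E(1)] by (auto simp: H1_space_def vec_poly_space_def)
    qed
    have "trace1 k M T (rot_diff v w) x $ i = (trace1 k M T v x - trace1 k M T w x) $ i" for i
      unfolding trace1_interp[OF d E] vector_minus_component trace1_interp[OF v E] trace1_interp[OF w E]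
      using interp_diff[OF seg[OF E(1)] _ c[OF v] c[OF w], of "int k + 2" i i] by (simp add: rot_diff_def)
    then show ?thesis by (simp add: vec_eq_iff)
  next
    case False
    then show ?thesis using trace1_outside d v w by simp
  qed
qed

lemma area_inner_diff:
  fixes a b c :: "point \<Rightarrow> 'b::euclidean_space"
  assumes "continuous_on (closure T) a" "continuous_on (closure T) b" "continuous_on (closure T) c"
  shows "area_integral T (\<lambda>x. (a x - b x) \<bullet> c x) = area_integral T (\<lambda>x. a x \<bullet> c x) - area_integral T (\<lambda>x. b x \<bullet> c x)"
  unfolding inner_diff_left by (intro area_integral_diff openT boundedT continuous_on_inner assms)

lemma area_tensor_div_diff:
  assumes a: "continuous_on (closure T) a" and b: "continuous_on (closure T) b" and w: "w \<in> tensor_poly_space l T"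
  shows "area_integral T (\<lambda>x. (a x - b x) \<bullet> tensor_divergence w x)
    = area_integral T (\<lambda>x. a x \<bullet> tensor_divergence w x) - area_integral T (\<lambda>x. b x \<bullet> tensor_divergence w x)"
proof -
  have "area_integral T (\<lambda>x. g x \<bullet> tensor_divergence w x) = area_integral T (\<lambda>x. g x \<bullet> cut_div w x)" for g
    by (rule area_integral_cong) (simp add: cut_div(2)[OF w])
  then show ?thesis using area_inner_diff[OF a b vec_poly_continuous[OF cut_div(1)[OF w]]] by simp
qed

lemma edge_sum_diff:
  assumes v: "v \<in> H1_space k M" and w: "w \<in> H1_space k M" and \<zeta>: "\<zeta> \<in> tensor_poly_space l T"
  shows "(\<Sum>E\<in>element_edges M T. \<omega>TE M T E * edge_integral E (\<lambda>x. trace1 k M T (rot_diff v w) x \<bullet> (\<zeta> x *v normal M E)))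
    = (\<Sum>E\<in>element_edges M T. \<omega>TE M T E * edge_integral E (\<lambda>x. trace1 k M T v x \<bullet> (\<zeta> x *v normal M E)))
    - (\<Sum>E\<in>element_edges M T. \<omega>TE M T E * edge_integral E (\<lambda>x. trace1 k M T w x \<bullet> (\<zeta> x *v normal M E)))"
  unfolding sum_subtractf[symmetric] right_diff_distrib[symmetric]
proof (rule sum.cong[OF refl], rule arg_cong2[where f = "(*)", OF refl])
  fix E assume E: "E \<in> element_edges M T"
  show "edge_integral E (\<lambda>x. trace1 k M T (rot_diff v w) x \<bullet> (\<zeta> x *v normal M E))
    = edge_integral E (\<lambda>x. trace1 k M T v x \<bullet> (\<zeta> x *v normal M E)) - edge_integral E (\<lambda>x. trace1 k M T w x \<bullet> (\<zeta> x *v normal M E))"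
    unfolding trace1_diff[OF v w] inner_diff_left
    by (intro edge_integral_diff seg[OF E] continuous_on_inner trace1_continuous[OF v E] trace1_continuous[OF w E]
        matrix_vector_continuous on_edge[OF tensor_continuous[OF \<zeta>] E])
qed

lemma grad1_diff:
  assumes v: "v \<in> H1_space k M" and w: "w \<in> H1_space k M"
  shows "grad1 k M T (rot_diff v w) = (\<lambda>x. grad1 k M T v x - grad1 k M T w x)"
proof -
  note d = rot_diff_H1[OF v w]
  have gv: "is_grad k v (grad1 k M T v)" and gw: "is_grad k w (grad1 k M T w)" using grad1_is_grad v w by auto
  have "is_grad k (rot_diff v w) (\<lambda>x. grad1 k M T v x - grad1 k M T w x)"
    unfolding is_grad_def
  proof (intro conjI ballI)
    show "(\<lambda>x. grad1 k M T v x - grad1 k M T w x) \<in> tensor_poly_space (int k + 1) T"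
      by (rule rep_space_diff[OF rep_space_tensor_poly[OF openT boundedT] grad1_tensor[OF v] grad1_tensor[OF w]])
    fix \<zeta> assume \<zeta>: "\<zeta> \<in> tensor_poly_space (int k + 1) T"
    have rT: "rot_T (rot_diff v w) T = (\<lambda>x. rot_T v T x - rot_T w T x)" by (simp add: rot_diff_def)
    show "area_integral T (\<lambda>x. (grad1 k M T v x - grad1 k M T w x) \<bullet> \<zeta> x) =
        - area_integral T (\<lambda>x. rot_T (rot_diff v w) T x \<bullet> tensor_divergence \<zeta> x)
        + (\<Sum>E\<in>element_edges M T.
             \<omega>TE M T E * edge_integral E (\<lambda>x. trace1 k M T (rot_diff v w) x \<bullet> (\<zeta> x *v normal M E)))"
      unfolding rT edge_sum_diff[OF v w \<zeta>] area_tensor_div_diff[OF rot_T_continuous[OF v] rot_T_continuous[OF w] \<zeta>]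
        area_inner_diff[OF tensor_continuous[OF grad1_tensor[OF v]] tensor_continuous[OF grad1_tensor[OF w]] tensor_continuous[OF \<zeta>]]
      using gv gw \<zeta> by (simp add: is_grad_def)
  qed
  then show ?thesis using is_grad_ex1[OF d] grad1_is_grad[OF d] by blast
qed

text \<open>The right-hand side of the defining relation is linear in the rotation through trace and
  gradient, and the potential is unique. This is what allows a triangle inequality for the discrete
  norm.\<close>

lemma potential_diff:
  assumes v: "v \<in> H1_space k M" and w: "w \<in> H1_space k M"
  shows "potential k M T (rot_diff v w) = (\<lambda>x. potential k M T v x - potential k M T w x)"
proof -
  note d = rot_diff_H1[OF v w]
  note V = rep_space_vec_poly[OF openT boundedT]
  have rhs: "pot_rhs k (rot_diff v w) \<eta> = pot_rhs k v \<eta> - pot_rhs k w \<eta>" if \<eta>: "\<eta> \<in> tensor_poly_space l T" for \<eta> l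
    unfolding pot_rhs_def edge_sum_diff[OF v w \<eta>] grad1_diff[OF v w]
      area_inner_diff[OF tensor_continuous[OF grad1_tensor[OF v]] tensor_continuous[OF grad1_tensor[OF w]] tensor_continuous[OF \<eta>]]
    by simp
  have pv: "is_potential k v (potential k M T v)" and pw: "is_potential k w (potential k M T w)"
    using potential_is_potential v w by auto
  have "is_potential k (rot_diff v w) (\<lambda>x. potential k M T v x - potential k M T w x)"
    unfolding is_potential_def
  proof (intro conjI ballI)
    show "(\<lambda>x. potential k M T v x - potential k M T w x) \<in> vec_poly_space (int k + 2) T"
      by (rule rep_space_diff[OF V potential_vec[OF v] potential_vec[OF w]])
    fix \<eta> assume \<eta>: "\<eta> \<in> tensor_Rc_space M (int k + 3) T"
    then obtain p where "p \<in> vec_poly_space (int k + 3 - 1) T" "\<eta> = radial p" unfolding tensor_Rc_eq by blast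
    then have \<eta>': "\<eta> \<in> tensor_poly_space (int k + 3 - 1 + 1) T" using radial_tensor by blast
    show "area_integral T (\<lambda>x. (potential k M T v x - potential k M T w x) \<bullet> tensor_divergence \<eta> x) = pot_rhs k (rot_diff v w) \<eta>"
      unfolding rhs[OF \<eta>'] area_tensor_div_diff[OF vec_poly_continuous[OF potential_vec[OF v]] vec_poly_continuous[OF potential_vec[OF w]] \<eta>']
      using pv pw \<eta> by (simp add: is_potential_def)
  qed
  then show ?thesis using is_potential_ex1[OF d] potential_is_potential[OF d] by blast
qed

section \<open>The discrete gradient of a displacement lies in the space of rotations\<close>

lemma trace2_is_trace:
  assumes q: "q \<in> H2_space k M"
  shows "is_trace (int k + 1) (dis_E q) (dis_V q) (trace2 k M T q)"
proof -
  have "\<exists>!g. is_trace (int k + 1) (dis_E q) (dis_V q) g"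
    by (rule is_trace_ex1) (use q element_edge in \<open>auto simp: H2_space_def\<close>)
  from theI'[OF this] show ?thesis unfolding trace2_def by (simp add: is_trace_def)
qed

text \<open>The term with the scalar divergence is read off from the tensor case by placing
  \<open>w\<close> in the first row of a matrix whose other row is zero.\<close>

lemma element_grad2_vec:
  assumes q: "q \<in> H2_space k M"
  shows "element_grad2 k M T q \<in> vec_poly_space (int k) T"
proof -
  let ?V = "vec_poly_space (int k) T"
  have qc: "continuous_on (closure T) (dis_T q T)" using q element by (auto simp: H2_space_def intro: poly_space_continuous)
  let ?e = "\<lambda>w x. axis 1 (w x) :: real^2^2"
  have eT: "?e w \<in> tensor_poly_space (int k) T" if w: "w \<in> ?V" for w
    unfolding tensor_poly_space_def
  proof (intro CollectI allI)
    fix i :: 2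
    have "(\<lambda>x. 0) \<in> vec_poly_space (int k) T" using rep_space_zero[OF rep_space_vec_poly[OF openT boundedT]] .
    then show "(\<lambda>x. axis 1 (w x) $ i) \<in> vec_poly_space (int k) T" using w by (cases "i = 1") (simp_all add: axis_def)
  qed
  have "continuous_on (closure T) (\<lambda>x. axis 1 (dis_T q T x) :: real^2)"
  proof (rule vec_continuous)
    fix i :: 2 show "continuous_on (closure T) (\<lambda>x. axis 1 (dis_T q T x) $ i)"
      using qc by (cases "i = 1") (simp_all add: axis_def)
  qed
  from lin_on_tensor_div[OF this]
  have "lin_on ?V (\<lambda>w. area_integral T (\<lambda>x. axis 1 (dis_T q T x) \<bullet> tensor_divergence (?e w) x))"
    by (rule lin_on_compose) (use eT in \<open>auto simp: axis_def vec_eq_iff fun_eq_iff\<close>)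
  moreover have "axis 1 (dis_T q T x) \<bullet> tensor_divergence (?e w) x = dis_T q T x * divergence w x" for w x
    by (simp add: inner_axis' tensor_divergence_def)
  ultimately have l1: "lin_on ?V (\<lambda>w. area_integral T (\<lambda>x. dis_T q T x * divergence w x))" by simp
  have l2: "lin_on ?V (\<lambda>w. edge_integral E (\<lambda>x. trace2 k M T q x * (w x \<bullet> normal M E)))" if E: "E \<in> element_edges M T" for E
  proof -
    have tc: "continuous_on (closure E) (trace2 k M T q)"
      using trace2_is_trace[OF q] boundary_poly_continuous[OF _ E] by (auto simp: is_trace_def)
    have "lin_on ?V (\<lambda>w. edge_integral E (\<lambda>x. (trace2 k M T q x *\<^sub>R normal M E) \<bullet> w x))"
      by (rule lin_on_edge[OF seg[OF E] continuous_on_scaleR[OF tc continuous_on_const]])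
        (rule on_edge[OF vec_poly_continuous E])
    then show ?thesis by (simp add: inner_commute)
  qed
  have "lin_on ?V (\<lambda>w. - area_integral T (\<lambda>x. dis_T q T x * divergence w x)
        + (\<Sum>E\<in>element_edges M T. \<omega>TE M T E * edge_integral E (\<lambda>x. trace2 k M T q x * (w x \<bullet> normal M E))))"
    by (intro lin_on_addI lin_on_uminus lin_on_sum lin_on_cmul l1 l2 finite_element_edges)
  from theI'[OF rep_space_ex1[OF openT boundedT rep_space_vec_poly[OF openT boundedT] this]]
  show ?thesis unfolding element_grad2_def by blast
qed

end

text \<open>The functional is linear because at points of the open edge the tangential derivative of
  a cut-off polynomial is that of the polynomial: short steps along the tangent stay on the
  edge.\<close>

lemma (in mesh_edges) tangential_grad2_poly:
  assumes E: "E \<in> edges M" and q: "q \<in> H2_space k M"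
  shows "tangential_grad2 k M E q \<in> poly_space (int k) E"
proof -
  let ?S = "poly_space (int k) E"
  obtain a b where ab: "a \<noteq> b" "E = open_segment a b" "tangent M E = sgn (b - a)" using edge_segment[OF E] by blast
  have seg: "is_segment E" using edge_is_segment[OF E] .
  have qc: "continuous_on (closure E) (dis_E q E)" using q E by (auto simp: H2_space_def intro: poly_space_continuous)
  let ?t = "tangent M E"
  have dd: "directional_deriv ?t (cut E R) x = ?t $ 1 * pd 1 R x + ?t $ 2 * pd 2 R x" if R: "R \<in> pfun l" and x: "x \<in> E" for R l x
  proof -
    obtain u where u: "0 < u" "u < 1" "x = (1 - u) *\<^sub>R a + u *\<^sub>R b" using x ab by (auto simp: in_segment)
    define nd where "nd = norm (b - a)"
    have nd: "0 < nd" using ab by (simp add: nd_def)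
    \<comment> \<open>The radius is the distance from \<open>x\<close> to the nearer end point of
      the edge.\<close>
    have inE: "x + s *\<^sub>R ?t \<in> closure E" if "s \<in> ball 0 (min u (1 - u) * nd)" for s
    proof -
      have "\<bar>s\<bar> < min u (1 - u) * nd" using that by simp
      then have "\<bar>s / nd\<bar> < min u (1 - u)" using nd by (simp add: divide_less_eq del: min_less_iff_conj)
      then have s: "0 < u + s / nd" "u + s / nd < 1" by linarith+
      have "x + s *\<^sub>R ?t = (1 - (u + s / nd)) *\<^sub>R a + (u + s / nd) *\<^sub>R b"
        unfolding u(3) ab(3) sgn_div_norm nd_def[symmetric] by (simp add: algebra_simps divide_inverse)
      then have "x + s *\<^sub>R ?t \<in> E" using s ab by (auto simp: in_segment)
      then show ?thesis using closure_subset by blast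
    qed
    have "((\<lambda>s. R (x + s *\<^sub>R ?t)) has_real_derivative (?t $ 1 * pd 1 R x + ?t $ 2 * pd 2 R x)) (at 0)"
      using pfun_line_derivative[OF R, of x ?t 0 UNIV] by simp
    then have "((\<lambda>s. cut E R (x + s *\<^sub>R ?t)) has_real_derivative (?t $ 1 * pd 1 R x + ?t $ 2 * pd 2 R x)) (at 0)"
      by (rule has_field_derivative_transform_within_open[of _ _ _ "ball 0 (min u (1 - u) * nd)"]) (use nd u inE in auto)
    then show ?thesis unfolding directional_deriv_def by (rule DERIV_imp_deriv)
  qed
  have l1: "lin_on ?S (\<lambda>r. edge_integral E (\<lambda>x. dis_E q E x * directional_deriv ?t r x))"
    unfolding lin_on_def
  proof (intro conjI ballI allI)
    let ?d = "\<lambda>R x. ?t $ 1 * pd 1 R x + ?t $ 2 * pd 2 R x"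
    have dc: "continuous_on (closure E) (?d R)" if "R \<in> pfun l" for R l
      by (intro continuous_intros pfun_continuous_on[OF pfun_derivative(1)[OF that]])
    have eq: "edge_integral E (\<lambda>x. dis_E q E x * directional_deriv ?t (cut E R) x) = edge_integral E (\<lambda>x. dis_E q E x * ?d R x)"
      if "R \<in> pfun l" for R l
      by (rule edge_integral_cong[OF seg]) (simp add: dd[OF that])
    fix f assume "f \<in> ?S"
    then obtain F where F: "F \<in> pfun (int k)" "f = cut E F" by (auto simp: poly_space_iff)
    { fix g assume "g \<in> ?S"
      then obtain G where G: "G \<in> pfun (int k)" "g = cut E G" by (auto simp: poly_space_iff)
      have "(\<lambda>x. f x + g x) = cut E (\<lambda>x. F x + G x)" by (auto simp: F G cut_def)
      then have "edge_integral E (\<lambda>x. dis_E q E x * directional_deriv ?t (\<lambda>x. f x + g x) x) = edge_integral E (\<lambda>x. dis_E q E x * ?d (\<lambda>x. F x + G x) x)"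
        using eq[OF pfun_add[OF F(1) G(1)]] by simp
      also have "\<dots> = edge_integral E (\<lambda>x. dis_E q E x * ?d F x + dis_E q E x * ?d G x)"
        by (simp add: pd_add[OF F(1) G(1)] algebra_simps)
      also have "\<dots> = edge_integral E (\<lambda>x. dis_E q E x * ?d F x) + edge_integral E (\<lambda>x. dis_E q E x * ?d G x)"
        by (intro edge_integral_add seg continuous_on_mult qc dc[OF F(1)] dc[OF G(1)])
      finally show "edge_integral E (\<lambda>x. dis_E q E x * directional_deriv ?t (\<lambda>x. f x + g x) x) =
          edge_integral E (\<lambda>x. dis_E q E x * directional_deriv ?t f x) + edge_integral E (\<lambda>x. dis_E q E x * directional_deriv ?t g x)"
        by (simp add: F(2) G(2) eq[OF F(1)] eq[OF G(1)]) }
    fix a :: real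
    have "(\<lambda>x. a *\<^sub>R f x) = cut E (\<lambda>x. a * F x)" by (auto simp: F cut_def)
    then have "edge_integral E (\<lambda>x. dis_E q E x * directional_deriv ?t (\<lambda>x. a *\<^sub>R f x) x) = edge_integral E (\<lambda>x. a * (dis_E q E x * ?d F x))"
      using eq[OF pfun_scale[OF F(1), of a]] by (simp add: pd_scale[OF F(1)] algebra_simps)
    then show "edge_integral E (\<lambda>x. dis_E q E x * directional_deriv ?t (\<lambda>x. a *\<^sub>R f x) x) = a * edge_integral E (\<lambda>x. dis_E q E x * directional_deriv ?t f x)"
      by (simp only: F(2) eq[OF F(1)] edge_integral_cmul[OF seg])
  qed
  have l2: "lin_on ?S (\<lambda>r. \<Sum>V\<in>edge_vertices E. \<omega>EV M E V * dis_V q V * r V)"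
    by (auto simp: lin_on_def distrib_left sum.distrib sum_distrib_left mult_ac)
  have "lin_on ?S (\<lambda>r. - edge_integral E (\<lambda>x. dis_E q E x * directional_deriv ?t r x) + (\<Sum>V\<in>edge_vertices E. \<omega>EV M E V * dis_V q V * r V))"
    by (intro lin_on_addI lin_on_uminus l1 l2)
  from edge_riesz[OF seg _ _ this, of "\<lambda>_. 1"]
  have "\<exists>!g. g \<in> ?S \<and> (\<forall>r\<in>?S. edge_integral E (\<lambda>x. g x * r x) =
        - edge_integral E (\<lambda>x. dis_E q E x * directional_deriv ?t r x) + (\<Sum>V\<in>edge_vertices E. \<omega>EV M E V * dis_V q V * r V))"
    by simp
  from theI'[OF this] show ?thesis unfolding tangential_grad2_def by blast
qed

section \<open>Geometry of regular elements\<close>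

text \<open>A diameter of the ball parallel to the side is compared in barycentric coordinates. The
  coordinate of the opposite vertex does not change along it, so its length is a fraction at most 1
  of the side.\<close>

lemma ball_in_triangle:
  fixes a b d w :: point
  assumes nc: "\<not> collinear {a, b, d}" and sub: "ball w q \<subseteq> convex hull {a, b, d}" and q: "0 < q"
  shows "2 * q \<le> dist a b"
proof (rule field_le_epsilon)
  fix e :: real assume e: "0 < e"
  have ab: "a \<noteq> b" using nc by auto
  define u where "u = (1 / norm (b - a)) *\<^sub>R (b - a)"
  have nu: "norm u = 1" using ab by (simp add: u_def)
  \<comment> \<open>The ball is open, so a slightly smaller radius is used; the maximum keeps it
    positive.\<close>
  define p where "p = max (q / 2) (q - e / 2)"
  have p: "0 < p" "p < q" using q e by (auto simp: p_def)
  have "w + p *\<^sub>R u \<in> ball w q" "w - p *\<^sub>R u \<in> ball w q" using p nu by (auto simp: dist_norm)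
  then have "w + p *\<^sub>R u \<in> convex hull {a, b, d}" "w - p *\<^sub>R u \<in> convex hull {a, b, d}" using sub by auto
  then obtain a1 b1 d1 a2 b2 d2 where 1: "0 \<le> a1" "0 \<le> b1" "0 \<le> d1" "a1 + b1 + d1 = 1" "w + p *\<^sub>R u = a1 *\<^sub>R a + b1 *\<^sub>R b + d1 *\<^sub>R d"
    and 2: "0 \<le> a2" "0 \<le> b2" "0 \<le> d2" "a2 + b2 + d2 = 1" "w - p *\<^sub>R u = a2 *\<^sub>R a + b2 *\<^sub>R b + d2 *\<^sub>R d"
    unfolding convex_hull_3 by blast
  have a12: "a1 = 1 - b1 - d1" "a2 = 1 - b2 - d2" using 1(4) 2(4) by auto
  have "(2 * p) *\<^sub>R u = (w + p *\<^sub>R u) - (w - p *\<^sub>R u)" by (simp add: scaleR_2[symmetric])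
  also have "\<dots> = (b1 - b2) *\<^sub>R (b - a) + (d1 - d2) *\<^sub>R (d - a)"
    unfolding 1(5) 2(5) a12 by (simp add: algebra_simps)
  finally have eq: "(2 * p) *\<^sub>R u = (b1 - b2) *\<^sub>R (b - a) + (d1 - d2) *\<^sub>R (d - a)" .
  \<comment> \<open>Otherwise \<open>d - a\<close> would be a multiple of \<open>b - a\<close> and
    the triangle degenerate.\<close>
  have "d1 = d2"
  proof (rule ccontr)
    assume ne: "d1 \<noteq> d2"
    define s where "s = 2 * p / norm (b - a) - (b1 - b2)"
    have "(d1 - d2) *\<^sub>R (d - a) = s *\<^sub>R (b - a)" using eq by (simp add: s_def u_def algebra_simps)
    then have "(1 / (d1 - d2)) *\<^sub>R ((d1 - d2) *\<^sub>R (d - a)) = (1 / (d1 - d2)) *\<^sub>R (s *\<^sub>R (b - a))" by simp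
    then have "d - a = (s / (d1 - d2)) *\<^sub>R (b - a)" using ne by simp
    then have "d = (1 - s / (d1 - d2)) *\<^sub>R a + (1 - (1 - s / (d1 - d2))) *\<^sub>R b" by (simp add: algebra_simps)
    then have "collinear {a, d, b}" unfolding collinear_3_expand by blast
    then show False using nc by (simp add: insert_commute)
  qed
  then have "norm ((2 * p) *\<^sub>R u) = \<bar>b1 - b2\<bar> * norm (b - a)" using eq by simp
  then have "2 * p = \<bar>b1 - b2\<bar> * dist a b" using nu p by (simp add: dist_norm norm_minus_commute)
  also have "\<dots> \<le> 1 * dist a b" by (rule mult_right_mono) (use 1 2 in auto)
  finally have "2 * p \<le> dist a b" by simp
  moreover have "q - e / 2 \<le> p" by (simp add: p_def)
  ultimately show "2 * q \<le> dist a b + e" by linarith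
qed

text \<open>The mesh edge contains an edge of some triangle inside \<open>T\<close>. That side is at
  least twice the inradius, hence at least \<open>2 * \<rho>\<close> times the diameter of the
  triangle, which itself is at least \<open>\<rho> * diameter T\<close>; this gives the square of
  \<open>\<rho>\<close>.\<close>

lemma regular_edge_length:
  assumes sub: "matching_simplicial_submesh \<Omega> M \<S>"
    and inr: "\<And>\<tau>. \<tau> \<in> \<S> \<Longrightarrow> inradius \<tau> \<ge> \<rho> * diameter \<tau>"
    and siz: "\<And>\<tau>. \<tau> \<in> \<S> \<Longrightarrow> \<tau> \<subseteq> closure T \<Longrightarrow> diameter \<tau> \<ge> \<rho> * diameter T"
    and T: "T \<in> elements M" and E: "E \<in> edges M" "E \<subseteq> frontier T" "is_segment E" and \<rho>: "0 < \<rho>"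
  shows "2 * \<rho>\<^sup>2 * diameter T \<le> diameter E"
proof -
  have tri: "triangulation \<S>" and simp2: "\<And>\<tau>. \<tau> \<in> \<S> \<Longrightarrow> 2 simplex \<tau>"
    and clT: "closure T = \<Union>{\<tau> \<in> \<S>. \<tau> \<subseteq> closure T}"
    and clE: "closure E = \<Union>{e. (\<exists>\<tau>\<in>\<S>. e edge_of \<tau>) \<and> e \<subseteq> closure E}"
    using sub T E unfolding matching_simplicial_submesh_def by blast+
  obtain a0 b0 where seg: "a0 \<noteq> b0" "E = open_segment a0 b0" using E(3) by (auto simp: is_segment_def)
  then have "a0 \<in> closure E" by simp
  then have "a0 \<in> \<Union>{e. (\<exists>\<tau>\<in>\<S>. e edge_of \<tau>) \<and> e \<subseteq> closure E}"
    by (rule subsetD[OF equalityD1[OF clE]])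
  then obtain e \<tau>' where e: "\<tau>' \<in> \<S>" "e edge_of \<tau>'" "e \<subseteq> closure E" by blast
  have ef: "e face_of \<tau>'" "aff_dim e = 1" using e(2) by (auto simp: edge_of_def)
  \<comment> \<open>The triangle found with \<open>e\<close> may lie on the other side of the mesh
    edge. A relative interior point of \<open>e\<close> leads to a triangle inside \<open>T\<close>,
    and conformity of the triangulation makes \<open>e\<close> a face of it.\<close>
  have "convex e" "e \<noteq> {}" using ef face_of_imp_convex by auto
  then obtain x where x: "x \<in> rel_interior e" using rel_interior_eq_empty by blast
  have "x \<in> closure E" using x rel_interior_subset e(3) by blast
  then have "x \<in> closure T" using E(2) closure_mono[of E "closure T"] by (auto simp: frontier_def)
  then have "x \<in> \<Union>{\<tau> \<in> \<S>. \<tau> \<subseteq> closure T}" by (rule subsetD[OF equalityD1[OF clT]])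
  then obtain \<tau> where \<tau>: "\<tau> \<in> \<S>" "\<tau> \<subseteq> closure T" "x \<in> \<tau>" by blast
  have f1: "(\<tau> \<inter> \<tau>') face_of \<tau>'" and f2: "(\<tau> \<inter> \<tau>') face_of \<tau>"
    using tri \<tau>(1) e(1) unfolding triangulation_def by (metis inf_commute)+
  have "x \<in> \<tau>'" using x rel_interior_subset face_of_imp_subset[OF ef(1)] by blast
  then have "e \<subseteq> \<tau> \<inter> \<tau>'"
    by (intro subset_of_face_of[OF f1 face_of_imp_subset[OF ef(1)]]) (use x \<tau>(3) in blast)
  then have "e face_of (\<tau> \<inter> \<tau>')" using face_of_subset[OF ef(1)] by blast
  then have ef': "e face_of \<tau>" using face_of_trans f2 by blast
  obtain C where C: "finite C" "\<not> affine_dependent C" "card C = 3" "\<tau> = convex hull C"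
    using simp2[OF \<tau>(1)] by (auto simp: simplex)
  obtain c where c: "c \<subseteq> C" "e = convex hull c"
    using ef' face_of_convex_hull_affine_independent[OF C(2)] C(4) by blast
  have "\<not> affine_dependent c" using C(2) c(1) affine_dependent_subset by blast
  then have "aff_dim e = int (card c) - 1" using c(2) by (simp add: aff_dim_convex_hull aff_dim_affine_independent)
  then have "card c = 2" using ef(2) by simp
  then obtain a b where ab: "c = {a, b}" "a \<noteq> b" by (auto simp: card_2_iff)
  have "card (C - c) = 1" using C(1,3) c(1) \<open>card c = 2\<close> finite_subset by (subst card_Diff_subset) auto
  then obtain d where "C - c = {d}" by (auto simp: card_1_singleton_iff)
  then have Cd: "C = {a, b, d}" "d \<noteq> a" "d \<noteq> b" using ab c(1) by auto
  have nc: "\<not> collinear {a, b, d}" using C(2) Cd ab(2) collinear_3_eq_affine_dependent[of a b d] by auto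
  have "inradius \<tau> \<le> dist a b / 2" unfolding inradius_def
  proof (rule cSup_least)
    show "{r. 0 \<le> r \<and> (\<exists>z. ball z r \<subseteq> \<tau>)} \<noteq> {}" by (auto intro!: exI[of _ 0])
    fix q assume "q \<in> {r. 0 \<le> r \<and> (\<exists>z. ball z r \<subseteq> \<tau>)}"
    then obtain w where "0 \<le> q" "ball w q \<subseteq> \<tau>" by blast
    then show "q \<le> dist a b / 2" using ball_in_triangle[OF nc, of w q] C(4) Cd(1) by (cases "q = 0") auto
  qed
  moreover have "\<rho> * (\<rho> * diameter T) \<le> \<rho> * diameter \<tau>" using siz[OF \<tau>(1,2)] \<rho> by simp
  moreover have "dist a b \<le> diameter E"
  proof -
    have "a \<in> closure E" "b \<in> closure E" using e(3) c(2) ab(1) hull_inc[of _ c convex] by auto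
    then have "dist a b \<le> diameter (closure E)" by (intro diameter_bounded_bound) (auto simp: seg bounded_closed_segment)
    then show ?thesis by (metis diameter_closure bounded_open_segment seg(2))
  qed
  ultimately show ?thesis using inr[OF \<tau>(1)] by (simp add: power2_eq_square)
qed

locale regular_element = mesh_element +
  fixes \<rho> :: real
  assumes \<rho>: "0 < \<rho>" and r_def: "r = \<rho> * diameter T"
    and edge_length: "E \<in> element_edges M T \<Longrightarrow> 2 * \<rho>\<^sup>2 * diameter T \<le> diameter E"
begin

lemma h_pos: "0 < diameter T"
  using r \<rho> unfolding r_def by (simp add: zero_less_mult_iff)

lemma dist_le_diameter: "x \<in> closure T \<Longrightarrow> y \<in> closure T \<Longrightarrow> dist x y \<le> diameter T"
  using diameter_bounded_bound[OF bounded_closure[OF boundedT]] diameter_closure[OF boundedT] by metis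

lemma closure_cball: "closure T \<subseteq> cball z (diameter T)"
  using dist_le_diameter zT in_closure by auto

lemma edge_diameter_le: "E \<in> element_edges M T \<Longrightarrow> diameter E \<le> diameter T"
  using diameter_subset[of E "closure T"] bounded_closure[OF boundedT] diameter_closure[OF boundedT]
    closure_edge_subset closure_subset by (metis order.trans)

text \<open>The open triangle with apex \<open>z\<close> and base \<open>E\<close>. Counting these
  triangles by their area bounds the number of edges of an element.\<close>

definition cone :: "point set \<Rightarrow> point set" where
  "cone E = {z + u *\<^sub>R (x - z) |u x. x \<in> E \<and> 0 < u \<and> u < 1}"

lemma cone_subset: assumes "E \<in> element_edges M T" shows "cone E \<subseteq> T"
proof
  fix y assume "y \<in> cone E"
  then obtain u x where ux: "y = z + u *\<^sub>R (x - z)" "x \<in> E" "0 < u" "u < 1" by (auto simp: cone_def)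
  have xF: "x \<in> frontier T" using ux assms element_edge_frontier by blast
  have "z \<noteq> x" using xF zT frontier_disjoint by auto
  moreover have "y = (1 - u) *\<^sub>R z + u *\<^sub>R x" using ux by (simp add: algebra_simps)
  ultimately have "y \<in> open_segment z x" using ux by (auto simp: in_segment)
  then show "y \<in> T" using open_segment_star[of z x] r frontier_closure[OF xF] by auto
qed

text \<open>A common point would put two different frontier points on one ray from \<open>z\<close>;
  the nearer one would then lie in \<open>T\<close> by star-shapedness.\<close>

lemma cone_disjoint:
  assumes E: "E \<in> element_edges M T" and E': "E' \<in> element_edges M T" and ne: "E \<noteq> E'"
  shows "cone E \<inter> cone E' = {}"
proof (rule ccontr)
  have *: False if "E \<in> element_edges M T" "E' \<in> element_edges M T" "x \<in> E" "x' \<in> E'" "x \<noteq> x'"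
    "0 < u" "0 < u'" "u *\<^sub>R (x - z) = u' *\<^sub>R (x' - z)" "u \<le> u'" for E E' x x' u u'
  proof -
    have xF: "x \<in> frontier T" "x' \<in> frontier T" using that element_edge_frontier by blast+
    have "z \<noteq> x" using xF zT frontier_disjoint by auto
    have "u \<noteq> u'" using that by auto
    have "x' - z = (1 / u') *\<^sub>R (u' *\<^sub>R (x' - z))" using that(7) by simp
    also have "\<dots> = (u / u') *\<^sub>R (x - z)" unfolding that(8)[symmetric] by simp
    finally have "x' - z = (u / u') *\<^sub>R (x - z)" .
    then have "x' = (1 - u / u') *\<^sub>R z + (u / u') *\<^sub>R x" by (simp add: algebra_simps)
    moreover have "0 < u / u'" "u / u' < 1" using that \<open>u \<noteq> u'\<close> by auto
    ultimately have "x' \<in> open_segment z x" using \<open>z \<noteq> x\<close> by (auto simp: in_segment)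
    then have "x' \<in> T" using open_segment_star[of z x] r frontier_closure[OF xF(1)] by auto
    then show False using xF(2) frontier_disjoint by blast
  qed
  assume "cone E \<inter> cone E' \<noteq> {}"
  then obtain u x u' x' where ux: "x \<in> E" "x' \<in> E'" "0 < u" "0 < u'" "u *\<^sub>R (x - z) = u' *\<^sub>R (x' - z)"
    by (force simp: cone_def)
  have "x \<noteq> x'" using ux edges_disjoint[OF element_edge[OF E] element_edge[OF E'] ne] by auto
  then show False using *[OF E E' ux(1,2) _ ux(3,4,5)] *[OF E' E ux(2,1) _ ux(4,3) ux(5)[symmetric]]
    by (cases "u \<le> u'") auto
qed

text \<open>Half of base times height, where \<open>edge_distance\<close> bounds the height from
  below by \<open>r\<close>.\<close>

lemma cone_measure:
  assumes E: "E \<in> element_edges M T"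
  shows "open (cone E)" "diameter E * r / 2 \<le> measure lborel (cone E)"
proof -
  have EE: "E \<in> edges M" using E element_edge by blast
  obtain a b where ab: "a \<noteq> b" "E = open_segment a b" "normal M E \<bullet> (b - a) = 0"
    "normal M E $ 1 * norm (b - a) = - ((b - a) $ 2)" "normal M E $ 2 * norm (b - a) = (b - a) $ 1"
    using edgeE[OF EE] by metis
  let ?n = "normal M E"
  define x where "x = midpoint a b"
  have xE: "x \<in> E" using ab by (simp add: x_def)
  have aE: "a \<in> closure E" "b \<in> closure E" using ab by simp_all
  have an: "(a - z) \<bullet> ?n = (x - z) \<bullet> ?n" "(b - z) \<bullet> ?n = (x - z) \<bullet> ?n"
    using edge_normal_const[OF EE xE aE(1), of z] edge_normal_const[OF EE xE aE(2), of z] by simp_all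
  have ra: "r \<le> \<bar>(a - z) \<bullet> ?n\<bar>" using edge_distance[OF E xE] an by simp
  have nc: "\<not> collinear {z, a, b}"
  proof
    assume "collinear {z, a, b}"
    then have "collinear {a, z, b}" by (simp add: insert_commute)
    then obtain u where "z = u *\<^sub>R a + (1 - u) *\<^sub>R b" using ab(1) unfolding collinear_3_expand by blast
    then have "a - z = (u - 1) *\<^sub>R (b - a)" by (simp add: algebra_simps)
    then have "(a - z) \<bullet> ?n = 0" using ab(3) by (simp add: inner_commute)
    then show False using ra r by simp
  qed
  have dim2: "DIM(point) = 2" by simp
  have cone: "cone E = interior (convex hull {z, a, b})"
    unfolding interior_convex_hull_3_minimal[OF nc dim2]
  proof (intro set_eqI iffI)
    fix y assume "y \<in> cone E"
    then obtain u p where "y = z + u *\<^sub>R (p - z)" "p \<in> E" "0 < u" "u < 1" by (auto simp: cone_def)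
    moreover then obtain v where "0 < v" "v < 1" "p = (1 - v) *\<^sub>R a + v *\<^sub>R b" using ab(2) by (auto simp: in_segment)
    ultimately have "y = (1 - u) *\<^sub>R z + (u * (1 - v)) *\<^sub>R a + (u * v) *\<^sub>R b" "0 < 1 - u" "0 < u * (1 - v)" "0 < u * v"
      "(1 - u) + u * (1 - v) + u * v = 1" by (simp_all add: algebra_simps)
    then show "y \<in> {v. \<exists>x y w. 0 < x \<and> 0 < y \<and> 0 < w \<and> x + y + w = 1 \<and> x *\<^sub>R z + y *\<^sub>R a + w *\<^sub>R b = v}" by blast
  next
    fix y assume "y \<in> {v. \<exists>x y w. 0 < x \<and> 0 < y \<and> 0 < w \<and> x + y + w = 1 \<and> x *\<^sub>R z + y *\<^sub>R a + w *\<^sub>R b = v}"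
    then obtain p q w where pq: "0 < p" "0 < q" "0 < w" "p + q + w = 1" "p *\<^sub>R z + q *\<^sub>R a + w *\<^sub>R b = y" by blast
    define v where "v = w / (q + w)"
    have v: "0 < v" "v < 1" "(q + w) * v = w" using pq by (auto simp: v_def)
    let ?p = "(1 - v) *\<^sub>R a + v *\<^sub>R b"
    have "?p \<in> E" using ab v by (auto simp: in_segment)
    moreover have "y = z + (q + w) *\<^sub>R (?p - z)"
    proof -
      have "z + (q + w) *\<^sub>R (?p - z) = (1 - (q + w)) *\<^sub>R z + ((q + w) - (q + w) * v) *\<^sub>R a + ((q + w) * v) *\<^sub>R b"
        by (simp add: algebra_simps)
      also have "\<dots> = p *\<^sub>R z + q *\<^sub>R a + w *\<^sub>R b"
      proof -
        have "1 - (q + w) = p" "(q + w) - w = q" using pq(4) by linarith+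
        then show ?thesis unfolding v(3) by simp
      qed
      also have "\<dots> = y" by (rule pq(5))
      finally show ?thesis by simp
    qed
    ultimately show "y \<in> cone E" unfolding cone_def using pq by (intro CollectI exI[of _ "q + w"] exI[of _ ?p]) auto
  qed
  show "open (cone E)" unfolding cone by simp
  let ?H = "convex hull {z, a, b}"
  have cH: "compact ?H" by (intro finite_imp_compact_convex_hull) auto
  have "measure lborel (cone E) = measure lebesgue (interior ?H)" unfolding cone by simp
  also have "\<dots> = measure lebesgue ?H"
    by (intro measure_interior compact_imp_bounded[OF cH] negligible_convex_frontier convex_convex_hull)
  also have "\<dots> = measure lborel ?H" using cH by (simp add: compact_imp_closed borel_closed)
  also have "\<dots> = \<bar>(b $ 1 - z $ 1) * (a $ 2 - z $ 2) - (a $ 1 - z $ 1) * (b $ 2 - z $ 2)\<bar> / 2"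
    by (rule content_triangle)
  also have "(b $ 1 - z $ 1) * (a $ 2 - z $ 2) - (a $ 1 - z $ 1) * (b $ 2 - z $ 2) = ((a - z) \<bullet> ?n) * norm (b - a)"
  proof -
    have "((a - z) \<bullet> ?n) * norm (b - a) = (a - z) $ 1 * (?n $ 1 * norm (b - a)) + (a - z) $ 2 * (?n $ 2 * norm (b - a))"
      by (simp add: inner_vec_def sum_2 algebra_simps)
    also have "\<dots> = (a - z) $ 1 * (- ((b - a) $ 2)) + (a - z) $ 2 * ((b - a) $ 1)" unfolding ab(4,5) ..
    finally show ?thesis by (simp add: algebra_simps)
  qed
  also have "\<bar>((a - z) \<bullet> ?n) * norm (b - a)\<bar> = \<bar>(a - z) \<bullet> ?n\<bar> * diameter E"
    using ab diameter_open_segment[OF ab(1)] by (simp add: abs_mult dist_norm norm_minus_commute)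
  finally have "measure lborel (cone E) = \<bar>(a - z) \<bullet> ?n\<bar> * diameter E / 2" .
  moreover have "r * diameter E \<le> \<bar>(a - z) \<bullet> ?n\<bar> * diameter E"
    by (rule mult_right_mono[OF ra]) (simp add: ab diameter_open_segment[OF ab(1)])
  ultimately show "diameter E * r / 2 \<le> measure lborel (cone E)" by (simp add: mult.commute)
qed

text \<open>Each cone has area at least \<open>\<rho> ^ 3 * (diameter T)\<^sup>2\<close>: half of
  the base \<open>2 * \<rho>\<^sup>2 * diameter T\<close> times the height
  \<open>\<rho> * diameter T\<close>. The cones are disjoint inside a square of area
  \<open>4 * (diameter T)\<^sup>2\<close>.\<close>

lemma card_element_edges: "real (card (element_edges M T)) \<le> 4 / \<rho> ^ 3"
proof -
  let ?A = "element_edges M T" and ?h = "diameter T"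
  define B where "B = cbox (z - ?h *\<^sub>R 1) (z + ?h *\<^sub>R 1)"
  have TB: "T \<subseteq> B"
  proof
    fix x assume "x \<in> T"
    then have "norm (x - z) \<le> ?h" using dist_le_diameter[of x z] zT in_closure by (simp add: dist_norm)
    then have "\<bar>(x - z) $ i\<bar> \<le> ?h" for i using component_le_norm_cart[of "x - z" i] by linarith
    then have "z $ i - ?h \<le> x $ i \<and> x $ i \<le> z $ i + ?h" for i by (simp add: abs_le_iff) (smt (verit))
    then show "x \<in> B" by (simp add: B_def mem_box_cart)
  qed
  have Bm: "measure lborel B = 4 * ?h\<^sup>2"
    using content_cbox_cart[of "z - ?h *\<^sub>R 1" "z + ?h *\<^sub>R 1"] h_pos
    by (simp add: B_def interval_ne_empty_cart UNIV_2 power2_eq_square)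
  have fB: "emeasure lborel B \<noteq> \<infinity>" unfolding B_def by (simp add: emeasure_lborel_cbox_eq)
  have cs: "cone E \<subseteq> B" if "E \<in> ?A" for E using cone_subset[OF that] TB by blast
  have fin: "emeasure lborel (cone E) \<noteq> \<infinity>" if "E \<in> ?A" for E
    using emeasure_mono[OF cs[OF that], of lborel] fB by (auto simp: B_def top_unique)
  have sets: "cone ` ?A \<subseteq> sets lborel" using cone_measure(1) by auto
  have "(\<Sum>E\<in>?A. measure lborel (cone E)) = measure lborel (\<Union>E\<in>?A. cone E)"
    by (rule measure_finite_Union[symmetric, OF finite_element_edges sets _ fin])
      (auto simp: disjoint_family_on_def cone_disjoint)
  also have "\<dots> \<le> measure lborel B"
    by (rule measure_mono_fmeasurable) (use cs fB in \<open>auto simp: B_def fmeasurable_def less_top intro!: borel_open open_UN cone_measure(1)\<close>)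
  finally have "(\<Sum>E\<in>?A. measure lborel (cone E)) \<le> 4 * ?h\<^sup>2" using Bm by simp
  moreover have "(\<Sum>E\<in>?A. \<rho> ^ 3 * ?h\<^sup>2) \<le> (\<Sum>E\<in>?A. measure lborel (cone E))"
  proof (rule sum_mono)
    fix E assume E: "E \<in> ?A"
    have "(2 * \<rho>\<^sup>2 * ?h) * r \<le> diameter E * r" by (rule mult_right_mono[OF edge_length[OF E]]) (use r in simp)
    then have "\<rho> ^ 3 * ?h\<^sup>2 \<le> diameter E * r / 2" by (simp add: r_def power2_eq_square power3_eq_cube mult_ac)
    then show "\<rho> ^ 3 * ?h\<^sup>2 \<le> measure lborel (cone E)" using cone_measure(2)[OF E] by linarith
  qed
  ultimately have "real (card ?A) * (\<rho> ^ 3 * ?h\<^sup>2) \<le> 4 * ?h\<^sup>2" by simp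
  then have "(real (card ?A) * \<rho> ^ 3) * ?h\<^sup>2 \<le> 4 * ?h\<^sup>2" by (simp add: mult.assoc)
  then have "real (card ?A) * \<rho> ^ 3 \<le> 4" using h_pos by simp
  then show ?thesis using \<rho> by (simp add: pos_le_divide_eq)
qed

end

section \<open>Local bounds by the stabilisation\<close>

lemma norm_matrix_vector_le:
  fixes A :: "real^2^2" and x :: "real^2"
  shows "norm (A *v x) \<le> norm A * norm x"
proof (rule power2_le_imp_le)
  have sq: "(norm y)\<^sup>2 = y $ 1 \<bullet> y $ 1 + y $ 2 \<bullet> y $ 2" for y :: "'b::euclidean_space^2"
    by (simp add: power2_norm_eq_inner inner_vec_def sum_2)
  have "(norm (A *v x))\<^sup>2 = (A $ 1 \<bullet> x)\<^sup>2 + (A $ 2 \<bullet> x)\<^sup>2"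
    unfolding sq[of "A *v x"] by (simp add: matrix_vector_mul_component power2_eq_square)
  also have "\<dots> \<le> (norm (A $ 1) * norm x)\<^sup>2 + (norm (A $ 2) * norm x)\<^sup>2"
    by (intro add_mono abs_le_square_iff[THEN iffD1]) (auto simp: Cauchy_Schwarz_ineq2)
  also have "\<dots> = (norm A * norm x)\<^sup>2"
    by (simp add: power_mult_distrib sq[of A] power2_norm_eq_inner[symmetric] algebra_simps)
  finally show "(norm (A *v x))\<^sup>2 \<le> (norm A * norm x)\<^sup>2" .
qed simp

text \<open>Symmetric and skew-symmetric matrices are orthogonal in the Frobenius product.\<close>

lemma sym_part_inner: "sym_part A \<bullet> A = sym_part A \<bullet> sym_part A"
  by (simp add: sym_part_def inner_vec_def sum_2 transpose_def algebra_simps)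

lemma sym_part_diff: "sym_part (A - B) = sym_part A - sym_part B"
  by (simp add: sym_part_def vec_eq_iff transpose_def algebra_simps)

lemma sym_part_quadratic: "\<xi> \<bullet> (A *v \<xi>) = \<xi> \<bullet> (sym_part A *v \<xi>)"
  by (simp add: sym_part_def inner_vec_def sum_2 transpose_def matrix_vector_mult_def algebra_simps)

lemma sym_part_tensor: "w \<in> tensor_poly_space l T \<Longrightarrow> (\<lambda>x. sym_part (w x)) \<in> tensor_poly_space l T"
proof -
  assume "w \<in> tensor_poly_space l T"
  then obtain W where W: "\<And>i j. W i j \<in> pfun l" "\<And>x i j. w x $ i $ j = cut T (W i j) x" using tensor_poly_rep by blast
  show ?thesis
  proof (rule tensor_poly_cutI)
    show "(\<lambda>x. (1/2) * (W i j x + W j i x)) \<in> pfun l" for i j by (intro pfun_scale pfun_add W(1))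
    show "sym_part (w x) $ i $ j = cut T (\<lambda>x. (1/2) * (W i j x + W j i x)) x" for x i j
      by (simp add: sym_part_def transpose_def W(2) cut_def)
  qed
qed

text \<open>The inverse constants are named by predicates so that they can be fixed before any mesh
  is considered.\<close>

definition has_sup_const :: "real \<Rightarrow> int \<Rightarrow> real \<Rightarrow> bool" where
  "has_sup_const \<rho> l C \<longleftrightarrow> 0 < C \<and> (\<forall>p\<in>pfun l. \<forall>z::point. \<forall>h>0. \<forall>x\<in>cball z h.
    (p x)\<^sup>2 \<le> C / h\<^sup>2 * area_integral (ball z (\<rho> * h)) (\<lambda>x. (p x)\<^sup>2))"

definition has_edge_const :: "int \<Rightarrow> real \<Rightarrow> bool" where
  "has_edge_const l C \<longleftrightarrow> 0 < C \<and> (\<forall>E. is_segment E \<longrightarrow> (\<forall>f\<in>poly_space l E. \<forall>x\<in>closure E.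
    diameter E * (f x)\<^sup>2 \<le> C * edge_integral E (\<lambda>x. (f x)\<^sup>2)))"

text \<open>Taken of the global polynomials behind the potential, hence continuous on the plane,
  which integration along rays up to the boundary of an element requires.\<close>

definition sym_grad_of :: "(2 \<Rightarrow> point \<Rightarrow> real) \<Rightarrow> point \<Rightarrow> real^2^2" where
  "sym_grad_of P x = sym_part (\<chi> i j. pd j (P i) x)"

context regular_element
begin

definition jump :: "nat \<Rightarrow> rotation \<Rightarrow> point \<Rightarrow> real^2" where
  "jump k v x = potential k M T v x - trace1 k M T v x"

text \<open>The right-hand side of the edge inverse inequality: a bound for the maximum of the jump
  on \<open>E\<close> by its L2 norm, see \<open>jump_le_sup\<close>.\<close>

definition jump_sup :: "real \<Rightarrow> nat \<Rightarrow> rotation \<Rightarrow> point set \<Rightarrow> real" where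
  "jump_sup C k v E = sqrt (C / diameter E * edge_integral E (\<lambda>x. jump k v x \<bullet> jump k v x))"

lemma edge_diameter_pos: "E \<in> element_edges M T \<Longrightarrow> 0 < diameter E"
  using edge_length[of E] \<rho> h_pos by (auto intro: less_le_trans[rotated])

lemma jump_continuous:
  assumes v: "v \<in> H1_space k M" and E: "E \<in> element_edges M T"
  shows "continuous_on (closure E) (jump k v)"
  unfolding jump_def by (intro continuous_on_diff trace1_continuous[OF v E] on_edge[OF vec_poly_continuous[OF potential_vec[OF v]] E])

lemma edge_integral_nonneg:
  assumes "is_segment E" "continuous_on (closure E) f" "\<And>x. 0 \<le> f x"
  shows "0 \<le> edge_integral E f"
  using edge_integral_mono[OF assms(1) _ assms(2), of "\<lambda>x. 0"] edge_integral_const[OF assms(1), of 0] assms(3) by auto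

lemma jump_integral_nonneg:
  assumes v: "v \<in> H1_space k M" and E: "E \<in> element_edges M T"
  shows "0 \<le> edge_integral E (\<lambda>x. jump k v x \<bullet> jump k v x)"
  by (intro edge_integral_nonneg seg[OF E] continuous_on_inner jump_continuous[OF v E]) simp

lemma jump_le_sup:
  assumes C: "has_edge_const (int k + 2) C" and v: "v \<in> H1_space k M" and E: "E \<in> element_edges M T"
    and x: "x \<in> closure E"
  shows "norm (jump k v x) \<le> jump_sup C k v E"
proof -
  let ?J = "\<lambda>i x. if x \<in> closure E then jump k v x $ i else 0"
  have JP: "?J i \<in> poly_space (int k + 2) E" for i
  proof -
    obtain P where P: "P \<in> pfun (int k + 2)" "\<And>x. potential k M T v x $ i = cut T P x"
      using vec_poly_rep[OF potential_vec[OF v]] by metis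
    have "?J i = (\<lambda>x. cut E P x - (if x \<in> closure E then trace1 k M T v x $ i else 0))"
      using closure_edge_closure[OF E] by (auto simp: jump_def P(2) fun_eq_iff)
    then show ?thesis using poly_space_diff[OF cut_poly_space[OF P(1)] trace1_poly[OF v E, of i]] by simp
  qed
  have ci: "continuous_on (closure E) (\<lambda>x. (jump k v x $ i)\<^sup>2)" for i
    by (intro continuous_intros jump_continuous[OF v E])
  have "diameter E * (jump k v x $ i)\<^sup>2 \<le> C * edge_integral E (\<lambda>x. (jump k v x $ i)\<^sup>2)" for i
  proof -
    have "diameter E * (?J i x)\<^sup>2 \<le> C * edge_integral E (\<lambda>x. (?J i x)\<^sup>2)"
      by (rule C[unfolded has_edge_const_def, THEN conjunct2, rule_format, OF seg[OF E] JP x])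
    moreover have "edge_integral E (\<lambda>x. (?J i x)\<^sup>2) = edge_integral E (\<lambda>x. (jump k v x $ i)\<^sup>2)"
      by (rule edge_integral_cong[OF seg[OF E]]) (use closure_subset in auto)
    ultimately show ?thesis using x by simp
  qed
  from add_mono[OF this[of 1] this[of 2]]
  have "diameter E * ((jump k v x $ 1)\<^sup>2 + (jump k v x $ 2)\<^sup>2) \<le>
      C * (edge_integral E (\<lambda>x. (jump k v x $ 1)\<^sup>2) + edge_integral E (\<lambda>x. (jump k v x $ 2)\<^sup>2))"
    by (simp add: algebra_simps)
  also have "edge_integral E (\<lambda>x. (jump k v x $ 1)\<^sup>2) + edge_integral E (\<lambda>x. (jump k v x $ 2)\<^sup>2)
      = edge_integral E (\<lambda>x. jump k v x \<bullet> jump k v x)"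
    unfolding edge_integral_add[OF seg[OF E] ci ci, symmetric] by (simp add: inner_vec_def sum_2 power2_eq_square)
  also have "(jump k v x $ 1)\<^sup>2 + (jump k v x $ 2)\<^sup>2 = (norm (jump k v x))\<^sup>2"
    unfolding power2_norm_eq_inner inner_vec_def sum_2 by (simp add: power2_eq_square)
  finally have "(norm (jump k v x))\<^sup>2 \<le> C / diameter E * edge_integral E (\<lambda>x. jump k v x \<bullet> jump k v x)"
    using edge_diameter_pos[OF E] by (simp add: pos_le_divide_eq mult.commute)
  then show ?thesis unfolding jump_sup_def by (rule real_le_rsqrt)
qed

lemma jump_sup_nonneg: 
  assumes "0 < C" and v: "v \<in> H1_space k M" and E: "E \<in> element_edges M T"
  shows "0 \<le> jump_sup C k v E"
  unfolding jump_sup_def using assms(1) edge_diameter_pos[OF E] jump_integral_nonneg[OF v E] by simp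

text \<open>The stabilisation weighs an edge integral by \<open>diameter E\<close>, the squared
  maximum by its inverse. The edge length bound compares the two with a factor
  \<open>4 * \<rho> ^ 4 * (diameter T)\<^sup>2\<close>, and squaring the sum costs the number of
  edges, at most \<open>4 / \<rho> ^ 3\<close>; hence the power 7.\<close>

lemma jump_sup_stab:
  assumes C: "0 < C" and v: "v \<in> H1_space k M"
  shows "(\<Sum>E\<in>element_edges M T. jump_sup C k v E)\<^sup>2 \<le> C / \<rho> ^ 7 * (stab1 k M T v v / (diameter T)\<^sup>2)"
proof -
  let ?A = "element_edges M T" and ?h = "diameter T"
  let ?I = "\<lambda>E. edge_integral E (\<lambda>x. jump k v x \<bullet> jump k v x)"
  have one: "(jump_sup C k v E)\<^sup>2 \<le> C / (4 * \<rho> ^ 4 * ?h\<^sup>2) * (diameter E * ?I E)" if E: "E \<in> ?A" for E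
  proof -
    have I: "0 \<le> ?I E" by (rule jump_integral_nonneg[OF v E])
    have hE: "0 < diameter E" by (rule edge_diameter_pos[OF E])
    have "(2 * \<rho>\<^sup>2 * ?h)\<^sup>2 \<le> (diameter E)\<^sup>2" by (intro power_mono edge_length[OF E]) (use h_pos \<rho> in simp)
    then have sq: "4 * \<rho> ^ 4 * ?h\<^sup>2 \<le> (diameter E)\<^sup>2" by (simp add: power_mult_distrib power_mult[symmetric])
    have "(jump_sup C k v E)\<^sup>2 = C / diameter E * ?I E"
      unfolding jump_sup_def using C hE I by (simp del: times_divide_eq_left)
    also have "\<dots> = C / (diameter E)\<^sup>2 * (diameter E * ?I E)" using hE by (simp add: power2_eq_square)
    also have "\<dots> \<le> C / (4 * \<rho> ^ 4 * ?h\<^sup>2) * (diameter E * ?I E)"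
      by (intro mult_right_mono divide_left_mono sq) (use C hE I h_pos \<rho> in auto)
    finally show ?thesis .
  qed
  have nn: "0 \<le> C / (4 * \<rho> ^ 4 * ?h\<^sup>2) * (diameter E * ?I E)" if E: "E \<in> ?A" for E
    using C h_pos \<rho> less_imp_le[OF edge_diameter_pos[OF E]] jump_integral_nonneg[OF v E]
    by (intro mult_nonneg_nonneg divide_nonneg_nonneg) auto
  have "(\<Sum>E\<in>?A. jump_sup C k v E)\<^sup>2 \<le> (\<Sum>E\<in>?A. (jump_sup C k v E)\<^sup>2) * card ?A"
    by (rule sum_squared_le_sum_of_squares)
  also have "\<dots> \<le> (\<Sum>E\<in>?A. C / (4 * \<rho> ^ 4 * ?h\<^sup>2) * (diameter E * ?I E)) * (4 / \<rho> ^ 3)"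
    by (intro mult_mono sum_mono one card_element_edges sum_nonneg nn) auto
  also have "\<dots> = C / (4 * \<rho> ^ 4 * ?h\<^sup>2) * stab1 k M T v v * (4 / \<rho> ^ 3)"
    by (simp only: stab1_def jump_def sum_distrib_left)
  also have "\<dots> = C / \<rho> ^ 7 * (stab1 k M T v v / ?h\<^sup>2)"
  proof -
    have "\<rho> ^ 7 = \<rho> ^ 4 * \<rho> ^ 3" by (simp flip: power_add)
    then show ?thesis by simp
  qed
  finally show ?thesis .
qed

lemma stab1_nonneg: "v \<in> H1_space k M \<Longrightarrow> 0 \<le> stab1 k M T v v"
  unfolding stab1_def jump_def[symmetric]
  by (intro sum_nonneg mult_nonneg_nonneg jump_integral_nonneg less_imp_le[OF edge_diameter_pos])

text \<open>The consistency error of the symmetric gradient is tested with itself; integration by parts leaves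
  only the jumps on the boundary, and inverse inequalities absorb the test function.\<close>

lemma sym_grad_error:
  assumes C0: "has_sup_const \<rho> (int k + 1) C\<^sub>0" and C: "has_edge_const (int k + 2) C" and v: "v \<in> H1_space k M"
    and P: "\<And>i. P i \<in> pfun (int k + 2)" "\<And>x i. potential k M T v x $ i = cut T (P i) x"
  shows "area_integral T (\<lambda>x. sym_grad_of P x \<bullet> sym_grad_of P x) \<le>
    2 * area_integral T (\<lambda>x. sym_grad1 k M T v x \<bullet> sym_grad1 k M T v x)
    + 2 * C\<^sub>0 * (\<Sum>E\<in>element_edges M T. jump_sup C k v E)\<^sup>2"
proof -
  let ?A = "element_edges M T" and ?h = "diameter T"
  let ?p = "potential k M T v" and ?g = "trace1 k M T v" and ?G = "grad1 k M T v"
  let ?S = "tensor_poly_space (int k + 1) T"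
  note S = rep_space_tensor_poly[OF openT boundedT]
  have Cpos: "0 < C" "0 < C\<^sub>0" using C C0 by (auto simp: has_edge_const_def has_sup_const_def)
  define D :: "point \<Rightarrow> real^2^2" where "D x = (\<chi> i j. cut T (pd j (P i)) x)" for x
  have D: "D \<in> ?S"
    by (rule tensor_poly_cutI[of "\<lambda>i j. pd j (P i)"]) (use pfun_derivative(1)[OF P(1)] in \<open>auto simp: D_def add.commute\<close>)
  have GS: "?G \<in> ?S" by (rule grad1_tensor[OF v])
  have dDG: "(\<lambda>x. D x - ?G x) \<in> ?S" by (rule rep_space_diff[OF S D GS])
  define X where "X x = sym_part (D x - ?G x)" for x
  have X: "X \<in> ?S" unfolding X_def[abs_def] by (rule sym_part_tensor[OF dDG])
  have Xc: "continuous_on (closure T) X" by (rule tensor_continuous[OF X])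
  define N where "N = area_integral T (\<lambda>x. X x \<bullet> X x)"
  define m where "m = (\<Sum>E\<in>?A. jump_sup C k v E)"
  have m0: "0 \<le> m" unfolding m_def by (intro sum_nonneg jump_sup_nonneg Cpos v)
  have N0: "0 \<le> N" unfolding N_def by (rule area_integral_nonneg) simp
  obtain W where W: "\<And>i j. W i j \<in> pfun (int k + 1)" "\<And>x i j. X x $ i $ j = cut T (W i j) x"
    using tensor_poly_rep[OF X] by blast
  have XX: "X x \<bullet> X x = (\<Sum>i\<in>UNIV. \<Sum>j\<in>UNIV. (W i j x)\<^sup>2)" if "x \<in> closure T" for x
    using that by (simp add: inner_vec_def W(2) power2_eq_square)
  \<comment> \<open>The inverse inequality is applied to every entry of \<open>X\<close>, with the
    ball of star-shapedness as the inner and a ball around the element as the outer set.\<close>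
  have sup: "(norm (X x))\<^sup>2 \<le> C\<^sub>0 / ?h\<^sup>2 * N" if x: "x \<in> closure T" for x
  proof -
    let ?b = "ball z (\<rho> * ?h)"
    have bT: "?b \<subseteq> T" using ballT by (simp add: r_def)
    have Wc: "continuous_on Y (\<lambda>x. (W i j x)\<^sup>2)" for Y i j
      by (intro continuous_intros pfun_continuous_on[OF W(1)])
    have "(norm (X x))\<^sup>2 = (\<Sum>i\<in>UNIV. \<Sum>j\<in>UNIV. (W i j x)\<^sup>2)" using XX[OF x] by (simp add: power2_norm_eq_inner)
    also have "\<dots> \<le> (\<Sum>i\<in>UNIV. \<Sum>j\<in>UNIV. C\<^sub>0 / ?h\<^sup>2 * area_integral ?b (\<lambda>x. (W i j x)\<^sup>2))"
      using C0 W(1) h_pos closure_cball x unfolding has_sup_const_def by (intro sum_mono) blast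
    also have "\<dots> = C\<^sub>0 / ?h\<^sup>2 * ((area_integral ?b (\<lambda>x. (W 1 1 x)\<^sup>2) + area_integral ?b (\<lambda>x. (W 1 2 x)\<^sup>2))
       + (area_integral ?b (\<lambda>x. (W 2 1 x)\<^sup>2) + area_integral ?b (\<lambda>x. (W 2 2 x)\<^sup>2)))"
      by (simp add: sum_2 algebra_simps)
    also have "\<dots> = C\<^sub>0 / ?h\<^sup>2 * area_integral ?b (\<lambda>x. ((W 1 1 x)\<^sup>2 + (W 1 2 x)\<^sup>2) + ((W 2 1 x)\<^sup>2 + (W 2 2 x)\<^sup>2))"
      unfolding area_integral_add[OF open_ball bounded_ball Wc Wc]
        area_integral_add[OF open_ball bounded_ball continuous_on_add[OF Wc Wc] continuous_on_add[OF Wc Wc]] ..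
    also have "\<dots> = C\<^sub>0 / ?h\<^sup>2 * area_integral ?b (\<lambda>x. X x \<bullet> X x)"
      using bT in_closure by (intro arg_cong2[where f = "(*)"] refl area_integral_cong) (auto simp: XX sum_2)
    finally have 1: "(norm (X x))\<^sup>2 \<le> C\<^sub>0 / ?h\<^sup>2 * area_integral ?b (\<lambda>x. X x \<bullet> X x)" .
    have bb: "area_integral ?b (\<lambda>x. X x \<bullet> X x) \<le> N"
      unfolding N_def area_integral_def
    proof -
      have i: "set_integrable lborel T (\<lambda>x. X x \<bullet> X x)"
        by (intro area_integrable openT boundedT continuous_on_inner Xc)
      then have i': "set_integrable lborel ?b (\<lambda>x. X x \<bullet> X x)" by (rule set_integrable_subset) (use bT in auto)
      show "set_lebesgue_integral lborel ?b (\<lambda>x. X x \<bullet> X x) \<le> set_lebesgue_integral lborel T (\<lambda>x. X x \<bullet> X x)"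
        unfolding set_lebesgue_integral_def
        by (rule integral_mono) (use i i' bT in \<open>auto simp: set_integrable_def indicator_def\<close>)
    qed
    have "C\<^sub>0 / ?h\<^sup>2 * area_integral ?b (\<lambda>x. X x \<bullet> X x) \<le> C\<^sub>0 / ?h\<^sup>2 * N"
      by (rule mult_left_mono[OF bb]) (use Cpos in simp)
    then show ?thesis using 1 by linarith
  qed
  \<comment> \<open>A maximum bound for the test field in terms of its own L2 norm. The inverse
    power of \<open>?h\<close> is recovered from the length of the edges in the boundary
    integrals.\<close>
  define K where "K = sqrt (C\<^sub>0 * N) / ?h"
  have K: "norm (X x) \<le> K" if "x \<in> closure T" for x
  proof -
    have "norm (X x) \<le> sqrt (C\<^sub>0 / ?h\<^sup>2 * N)" by (rule real_le_rsqrt[OF sup[OF that]])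
    also have "\<dots> = K" using h_pos by (simp add: K_def real_sqrt_divide)
    finally show ?thesis .
  qed
  have K0: "0 \<le> K" unfolding K_def using Cpos N0 h_pos by simp
  \<comment> \<open>Since \<open>X\<close> is symmetric, pairing it with \<open>D - ?G\<close> is
    pairing it with itself. The two parts are then evaluated by \<open>green\<close> and
    \<open>potential_tensor\<close>, whose volume terms coincide.\<close>
  have "N = area_integral T (\<lambda>x. (D x - ?G x) \<bullet> X x)"
    unfolding N_def X_def by (simp add: sym_part_inner[symmetric] inner_commute)
  also have "\<dots> = area_integral T (\<lambda>x. D x \<bullet> X x) - area_integral T (\<lambda>x. ?G x \<bullet> X x)"
    by (rule area_inner_diff[OF tensor_continuous[OF D] tensor_continuous[OF GS] Xc])
  also have "\<dots> = (\<Sum>E\<in>?A. \<omega>TE M T E * edge_integral E (\<lambda>x. ?p x \<bullet> (X x *v normal M E)))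
      - (\<Sum>E\<in>?A. \<omega>TE M T E * edge_integral E (\<lambda>x. ?g x \<bullet> (X x *v normal M E)))"
    using green[OF P X] potential_tensor[OF v X] by (simp add: D_def pot_rhs_def)
  also have "\<dots> = (\<Sum>E\<in>?A. \<omega>TE M T E * edge_integral E (\<lambda>x. jump k v x \<bullet> (X x *v normal M E)))"
    unfolding sum_subtractf[symmetric] right_diff_distrib[symmetric]
  proof (rule sum.cong[OF refl], rule arg_cong2[where f = "(*)", OF refl])
    fix E assume E: "E \<in> ?A"
    have "edge_integral E (\<lambda>x. ?p x \<bullet> (X x *v normal M E) - ?g x \<bullet> (X x *v normal M E))
      = edge_integral E (\<lambda>x. ?p x \<bullet> (X x *v normal M E)) - edge_integral E (\<lambda>x. ?g x \<bullet> (X x *v normal M E))"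
      by (intro edge_integral_diff seg[OF E] continuous_on_inner trace1_continuous[OF v E] matrix_vector_continuous
        on_edge[OF Xc E] on_edge[OF vec_poly_continuous[OF potential_vec[OF v]] E])
    then show "edge_integral E (\<lambda>x. ?p x \<bullet> (X x *v normal M E)) - edge_integral E (\<lambda>x. ?g x \<bullet> (X x *v normal M E))
      = edge_integral E (\<lambda>x. jump k v x \<bullet> (X x *v normal M E))"
      by (simp add: jump_def inner_diff_left)
  qed
  also have "\<dots> \<le> (\<Sum>E\<in>?A. jump_sup C k v E * (?h * K))"
  proof (rule sum_mono)
    fix E assume E: "E \<in> ?A"
    let ?f = "\<lambda>x. jump k v x \<bullet> (X x *v normal M E)"
    have fc: "continuous_on (closure E) ?f"
      by (intro continuous_on_inner jump_continuous[OF v E] matrix_vector_continuous on_edge[OF Xc E])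
    have "\<bar>?f x\<bar> \<le> jump_sup C k v E * K" if x: "x \<in> closure E" for x
    proof -
      have "norm (X x *v normal M E) \<le> norm (X x) * 1"
        using norm_matrix_vector_le[of "X x" "normal M E"] norm_normal[OF element_edge[OF E]] by simp
      then have "norm (X x *v normal M E) \<le> K" using K[OF closure_edge_closure[OF E x]] by linarith
      then have "norm (jump k v x) * norm (X x *v normal M E) \<le> jump_sup C k v E * K"
        by (intro mult_mono jump_le_sup[OF C v E x] jump_sup_nonneg[OF Cpos(1) v E]) auto
      then show ?thesis using Cauchy_Schwarz_ineq2 order.trans by blast
    qed
    then have b: "- (jump_sup C k v E * K) \<le> ?f x" "?f x \<le> jump_sup C k v E * K" if "x \<in> closure E" for x
      using that by (auto simp: abs_le_iff minus_le_iff)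
    have "edge_integral E ?f \<le> edge_integral E (\<lambda>x. jump_sup C k v E * K)"
      by (rule edge_integral_mono[OF seg[OF E] fc]) (use b in auto)
    moreover have "edge_integral E (\<lambda>x. - (jump_sup C k v E * K)) \<le> edge_integral E ?f"
      by (rule edge_integral_mono[OF seg[OF E] _ fc]) (use b in auto)
    ultimately have "\<bar>edge_integral E ?f\<bar> \<le> jump_sup C k v E * K * diameter E"
      by (simp add: edge_integral_const[OF seg[OF E]] abs_le_iff)
    also have "\<dots> \<le> jump_sup C k v E * K * ?h"
      by (intro mult_left_mono edge_diameter_le[OF E] mult_nonneg_nonneg jump_sup_nonneg[OF Cpos(1) v E] K0)
    finally have "\<bar>edge_integral E ?f\<bar> \<le> jump_sup C k v E * (?h * K)" by (simp add: mult_ac)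
    moreover have "\<omega>TE M T E * edge_integral E ?f \<le> \<bar>edge_integral E ?f\<bar>"
      unfolding \<omega>TE_def by (auto simp: abs_ge_self abs_ge_minus_self)
    ultimately show "\<omega>TE M T E * edge_integral E ?f \<le> jump_sup C k v E * (?h * K)" by linarith
  qed
  also have "\<dots> = m * sqrt (C\<^sub>0 * N)" using h_pos by (simp add: sum_distrib_right[symmetric] m_def K_def)
  finally have Nm: "N \<le> m * sqrt (C\<^sub>0 * N)" .
  have "N \<le> C\<^sub>0 * m\<^sup>2"
  proof (cases "N = 0")
    case False
    then have "0 < N" using N0 by simp
    have "N\<^sup>2 \<le> (m * sqrt (C\<^sub>0 * N))\<^sup>2" using Nm N0 by (rule power_mono)
    also have "\<dots> = m\<^sup>2 * (C\<^sub>0 * N)" using Cpos N0 by (simp add: power_mult_distrib)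
    finally have "N * N \<le> (C\<^sub>0 * m\<^sup>2) * N" by (simp add: power2_eq_square mult_ac)
    then show ?thesis using \<open>0 < N\<close> by simp
  qed (use Cpos in simp)
  moreover have "area_integral T (\<lambda>x. sym_grad_of P x \<bullet> sym_grad_of P x)
    \<le> 2 * area_integral T (\<lambda>x. sym_grad1 k M T v x \<bullet> sym_grad1 k M T v x) + 2 * N"
  proof -
    let ?Y = "\<lambda>x. sym_part (D x)"
    have Yc: "continuous_on (closure T) ?Y" by (rule tensor_continuous[OF sym_part_tensor[OF D]])
    have Gc: "continuous_on (closure T) (sym_grad1 k M T v)"
      unfolding sym_grad1_def[abs_def] by (rule tensor_continuous[OF sym_part_tensor[OF GS]])
    have "area_integral T (\<lambda>x. sym_grad_of P x \<bullet> sym_grad_of P x) = area_integral T (\<lambda>x. ?Y x \<bullet> ?Y x)"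
    proof (rule area_integral_cong)
      fix x assume "x \<in> T"
      then have "D x = (\<chi> i j. pd j (P i) x)" using in_closure by (simp add: D_def)
      then show "sym_grad_of P x \<bullet> sym_grad_of P x = ?Y x \<bullet> ?Y x" by (simp add: sym_grad_of_def)
    qed
    also have "\<dots> \<le> area_integral T (\<lambda>x. 2 * (sym_grad1 k M T v x \<bullet> sym_grad1 k M T v x) + 2 * (X x \<bullet> X x))"
    proof (rule area_integral_mono[OF openT boundedT])
      fix x
      have Y: "?Y x = sym_grad1 k M T v x + X x" by (simp add: X_def sym_part_diff sym_grad1_def)
      have "0 \<le> (sym_grad1 k M T v x - X x) \<bullet> (sym_grad1 k M T v x - X x)" by simp
      then show "?Y x \<bullet> ?Y x \<le> 2 * (sym_grad1 k M T v x \<bullet> sym_grad1 k M T v x) + 2 * (X x \<bullet> X x)"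
        unfolding Y by (simp add: inner_add_left inner_add_right inner_diff_left inner_diff_right inner_commute)
    qed (intro continuous_intros Yc Gc Xc)+
    also have "\<dots> = area_integral T (\<lambda>x. 2 * (sym_grad1 k M T v x \<bullet> sym_grad1 k M T v x)) + area_integral T (\<lambda>x. 2 * (X x \<bullet> X x))"
      by (intro area_integral_add openT boundedT continuous_intros Gc Xc)
    finally show ?thesis by (simp add: area_integral_cmul N_def)
  qed
  ultimately show ?thesis unfolding m_def by linarith
qed

end

section \<open>The broken Poincare estimate along lines\<close>

locale regular_mesh_space =
  fixes \<Omega> :: "point set" and M :: mesh and \<rho> :: real
  assumes domain: "polygonal \<Omega>" and pmesh: "polygonal_mesh \<Omega> M" and regular: "regular_mesh \<Omega> \<rho> M" and \<rho>: "0 < \<rho>"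

sublocale regular_mesh_space \<subseteq> mesh_edges M
proof
  show "\<exists>a b. a \<noteq> b \<and> E = open_segment a b \<and> tangent M E = sgn (b - a)" if "E \<in> edges M" for E
    using pmesh that by (auto simp: polygonal_mesh_def)
  show "finite (edges M)" using pmesh by (simp add: polygonal_mesh_def)
  show "E \<inter> E' = {}" if "E \<in> edges M" "E' \<in> edges M" "E \<noteq> E'" for E E'
    using pmesh that by (auto simp: polygonal_mesh_def pairwise_def disjnt_def)
qed

context regular_mesh_space
begin

lemma finite_elements: "finite (elements M)"
  using pmesh by (simp add: polygonal_mesh_def)

lemma elements_disjoint: "T \<in> elements M \<Longrightarrow> T' \<in> elements M \<Longrightarrow> T \<noteq> T' \<Longrightarrow> T \<inter> T' = {}"
  using pmesh by (auto simp: polygonal_mesh_def pairwise_def disjnt_def)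

lemma element_subset: "T \<in> elements M \<Longrightarrow> T \<subseteq> \<Omega>"
  using pmesh by (simp add: polygonal_mesh_def)

text \<open>The star condition provides the ball, the submesh the edge lengths. The diameter is
  positive because elements are open and nonempty, so the ball is a proper one.\<close>

lemma ex_regular_element:
  assumes T: "T \<in> elements M"
  shows "\<exists>z. regular_element M T z (\<rho> * diameter T) \<rho>"
proof -
  have poly: "polygonal T" using pmesh T by (simp add: polygonal_mesh_def)
  then have T': "T \<noteq> {}" "open T" "bounded T" by (auto simp: polygonal_def)
  obtain z where z: "\<And>y. y \<in> ball z (\<rho> * diameter T) \<Longrightarrow> y \<in> T \<and> (\<forall>x\<in>T. closed_segment y x \<subseteq> T)"
    using bspec[OF conjunct2[OF regular[unfolded regular_mesh_def]] T] by blast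
  have h: "0 < diameter T"
  proof -
    obtain x where x: "x \<in> T" using T' by blast
    obtain e where e: "e > 0" "ball x e \<subseteq> T" using T'(2) x openE by blast
    let ?y = "x + (e / 2) *\<^sub>R axis 1 1"
    have "?y \<in> T" using e by (intro subsetD[OF e(2)]) (simp add: dist_norm)
    then have "dist x ?y \<le> diameter T" by (rule diameter_bounded_bound[OF T'(3) x])
    then show ?thesis using e by (simp add: dist_norm)
  qed
  have "regular_element M T z (\<rho> * diameter T) \<rho>"
  proof
    show "open T" "bounded T" using T' by auto
    show "frontier T = (\<Union>E\<in>element_edges M T. closure E)" using pmesh T by (simp add: polygonal_mesh_def)
    show "0 < \<rho> * diameter T" using h \<rho> by simp
    show "closed_segment y x \<subseteq> T" if "y \<in> ball z (\<rho> * diameter T)" "x \<in> T" for x y using z that by blast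
    show "ball z (\<rho> * diameter T) \<subseteq> T" using z by blast
    show "2 * \<rho>\<^sup>2 * diameter T \<le> diameter E" if E: "E \<in> element_edges M T" for E
    proof -
      obtain \<S> where "matching_simplicial_submesh \<Omega> M \<S>" "\<forall>\<tau>\<in>\<S>. inradius \<tau> \<ge> \<rho> * diameter \<tau>"
        "\<forall>T\<in>elements M. \<forall>\<tau>\<in>\<S>. \<tau> \<subseteq> closure T \<longrightarrow> diameter \<tau> \<ge> \<rho> * diameter T"
        using conjunct1[OF regular[unfolded regular_mesh_def]] by blast
      then show ?thesis
        by (intro regular_edge_length[OF _ _ _ T _ _ _ \<rho>])
          (use E T edge_is_segment in \<open>auto simp: element_edges_def\<close>)
    qed
  qed (use T \<rho> in auto)
  then show ?thesis by blast
qed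

definition star_centre :: "point set \<Rightarrow> point" where
  "star_centre T = (SOME z. regular_element M T z (\<rho> * diameter T) \<rho>)"

lemma regular_element: "T \<in> elements M \<Longrightarrow> regular_element M T (star_centre T) (\<rho> * diameter T) \<rho>"
  unfolding star_centre_def by (rule someI_ex[OF ex_regular_element])

lemma star_element: "T \<in> elements M \<Longrightarrow> star_element M T (star_centre T) (\<rho> * diameter T)"
  and mesh_element: "T \<in> elements M \<Longrightarrow> mesh_element M T (star_centre T) (\<rho> * diameter T)"
  using regular_element by (simp_all add: regular_element_def mesh_element_def)

text \<open>With equal signs, points just inside of the midpoint of the edge would belong to both
  elements, which are disjoint.\<close>

lemma opposite_orientation:
  assumes T: "T \<in> elements M" "E \<in> element_edges M T" and T': "T' \<in> elements M" "E \<in> element_edges M T'" and ne: "T \<noteq> T'"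
  shows "\<omega>TE M T E + \<omega>TE M T' E = 0"
proof (rule ccontr)
  assume "\<omega>TE M T E + \<omega>TE M T' E \<noteq> 0"
  then have eq: "\<omega>TE M T' E = \<omega>TE M T E" by (auto simp: \<omega>TE_def split: if_splits)
  have EE: "E \<in> edges M" using T(2) by (simp add: element_edges_def)
  obtain a b where "a \<noteq> b" "E = open_segment a b" using edge_segment[OF EE] by blast
  then have xE: "midpoint a b \<in> E" by simp
  let ?x = "midpoint a b" and ?n = "normal M E" and ?w = "\<omega>TE M T E"
  obtain \<delta> where \<delta>: "\<delta> > 0" "\<And>w. w \<in> ball ?x \<delta> \<Longrightarrow> ?w * ((w - ?x) \<bullet> ?n) < 0 \<Longrightarrow> w \<in> T"
    using star_element.omega_local[OF star_element[OF T(1)] T(2) xE] by metis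
  obtain \<delta>' where \<delta>': "\<delta>' > 0" "\<And>w. w \<in> ball ?x \<delta>' \<Longrightarrow> ?w * ((w - ?x) \<bullet> ?n) < 0 \<Longrightarrow> w \<in> T'"
    using star_element.omega_local[OF star_element[OF T'(1)] T'(2) xE] unfolding eq by metis
  define s where "s = min \<delta> \<delta>' / 2"
  have s: "0 < s" "s < \<delta>" "s < \<delta>'" using \<delta>(1) \<delta>'(1) by (auto simp: s_def)
  define y where "y = ?x - (s * ?w) *\<^sub>R ?n"
  have w1: "\<bar>?w\<bar> = 1" "?w * ?w = 1" by (auto simp: \<omega>TE_def)
  have "dist ?x y = s" using s w1 norm_normal[OF EE] by (simp add: y_def dist_norm abs_mult)
  then have "y \<in> ball ?x \<delta>" "y \<in> ball ?x \<delta>'" using s by auto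
  moreover have "?w * ((y - ?x) \<bullet> ?n) = - (s * (?w * ?w))"
    using normal_inner_self[OF EE] by (simp add: y_def)
  then have "?w * ((y - ?x) \<bullet> ?n) < 0" using w1 s by simp
  ultimately have "y \<in> T" "y \<in> T'" using \<delta>(2) \<delta>'(2) by auto
  then show False using elements_disjoint[OF T(1) T'(1) ne] by blast
qed

text \<open>Since the trace is single-valued on the edges and vanishes on the boundary, its contributions from
  the elements cancel.\<close>

lemma trace_cancel:
  assumes K: "\<And>E. E \<in> edges M \<Longrightarrow> E \<subseteq> frontier \<Omega> \<Longrightarrow> K E = 0"
  shows "(\<Sum>T\<in>elements M. \<Sum>E\<in>element_edges M T. \<omega>TE M T E * K E) = (0 :: real)"
proof -
  have "(\<Sum>T\<in>elements M. \<Sum>E\<in>element_edges M T. \<omega>TE M T E * K E)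
      = (\<Sum>T\<in>elements M. \<Sum>E\<in>edges M. if E \<subseteq> frontier T then \<omega>TE M T E * K E else 0)"
    unfolding element_edges_def by (rule sum.cong[OF refl]) (rule sum.inter_filter[OF finite_edges])
  also have "\<dots> = (\<Sum>E\<in>edges M. \<Sum>T\<in>elements M. if E \<subseteq> frontier T then \<omega>TE M T E * K E else 0)" by (rule sum.swap)
  also have "\<dots> = (\<Sum>E\<in>edges M. 0)"
  proof (rule sum.cong[OF refl])
    fix E assume E: "E \<in> edges M"
    have s: "(\<Sum>T\<in>elements M. if E \<subseteq> frontier T then \<omega>TE M T E * K E else 0) = (\<Sum>T | T \<in> elements M \<and> E \<subseteq> frontier T. \<omega>TE M T E * K E)"
      using finite_elements by (simp add: sum.inter_filter)
    show "(\<Sum>T\<in>elements M. if E \<subseteq> frontier T then \<omega>TE M T E * K E else 0) = 0"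
    proof (cases "E \<subseteq> frontier \<Omega>")
      case True then show ?thesis using K[OF E] by (intro sum.neutral) simp
    next
      case False
      then have "card {T \<in> elements M. E \<subseteq> frontier T} = 2" using pmesh E unfolding polygonal_mesh_def by blast
      then obtain T T' where TT: "{T \<in> elements M. E \<subseteq> frontier T} = {T, T'}" "T \<noteq> T'" by (auto simp: card_2_iff)
      then have "T \<in> elements M" "E \<in> element_edges M T" "T' \<in> elements M" "E \<in> element_edges M T'"
        using E by (auto simp: element_edges_def set_eq_iff)
      from opposite_orientation[OF this TT(2)] show ?thesis unfolding s TT(1) using TT(2) by (simp add: distrib_right[symmetric])
    qed
  qed
  finally show ?thesis by simp
qed

end

section \<open>Averages over rays\<close>

text \<open>Directions are parametrised by slope, so that averaging is Lebesgue integration over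
  \<open>{0..1}\<close> and the field enters affinely in \<open>s\<close>. The length stays between
  1 and \<open>sqrt 2\<close>.\<close>

definition dir :: "real \<Rightarrow> point" where
  "dir s = axis 1 1 + s *\<^sub>R axis 2 1"

lemma dir_nth [simp]: "dir s $ 1 = 1" "dir s $ 2 = s"
  by (simp_all add: dir_def axis_def)

lemma bounded_set_integrable:
  fixes f :: "real \<Rightarrow> real"
  assumes "f \<in> borel_measurable borel" "\<And>t. \<bar>f t\<bar> \<le> K"
  shows "set_integrable lborel {a..b} f"
  unfolding set_integrable_def
  by (rule integrableI_bounded_set_indicator[where B = K]) (use assms in \<open>auto simp: emeasure_lborel_Icc_eq\<close>)

lemma set_integral_const_interval: "a \<le> b \<Longrightarrow> set_lebesgue_integral lborel {a..b} (\<lambda>t. c :: real) = c * (b - a)"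
  by (simp add: set_lebesgue_integral_def)

text \<open>The integral of the squared deviation from the mean value is nonnegative.\<close>

lemma integral_square_le:
  fixes f :: "real \<Rightarrow> real"
  assumes ab: "a \<le> b" and f: "f \<in> borel_measurable borel" and K: "\<And>t. \<bar>f t\<bar> \<le> K"
  shows "(set_lebesgue_integral lborel {a..b} f)\<^sup>2 \<le> (b - a) * set_lebesgue_integral lborel {a..b} (\<lambda>t. (f t)\<^sup>2)"
proof (cases "a = b")
  case True
  have "set_lebesgue_integral lborel {a..a} f = integral\<^sup>L lborel (\<lambda>t::real. 0 :: real)"
    unfolding set_lebesgue_integral_def
    by (rule integral_discrete_difference[of "{a}"]) auto
  then show ?thesis using True by simp
next
  case False
  define L where "L = b - a"
  have L: "0 < L" using ab False by (simp add: L_def)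
  define I where "I = set_lebesgue_integral lborel {a..b} f"
  define Q where "Q = set_lebesgue_integral lborel {a..b} (\<lambda>t. (f t)\<^sup>2)"
  define c where "c = I / L"
  have K0: "0 \<le> K" using K[of 0] by linarith
  have fi: "set_integrable lborel {a..b} f" by (rule bounded_set_integrable[OF f K])
  have sq: "\<bar>(f t)\<^sup>2\<bar> \<le> K\<^sup>2" for t using power_mono[OF K[of t], of 2] by simp
  have qi: "set_integrable lborel {a..b} (\<lambda>t. (f t)\<^sup>2)" by (rule bounded_set_integrable[OF _ sq]) (use f in measurable)
  have ci: "set_integrable lborel {a..b} (\<lambda>t. c\<^sup>2)" by (rule bounded_set_integrable[of _ "c\<^sup>2"]) auto
  have fi2: "set_integrable lborel {a..b} (\<lambda>t. (2 * c) * f t)" using fi by simp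
  have "0 \<le> set_lebesgue_integral lborel {a..b} (\<lambda>t. (f t - c)\<^sup>2)"
    unfolding set_lebesgue_integral_def by (intro Bochner_Integration.integral_nonneg) (simp add: indicator_def)
  also have "(\<lambda>t. (f t - c)\<^sup>2) = (\<lambda>t. (f t)\<^sup>2 - (2 * c) * f t + c\<^sup>2)" by (simp add: power2_diff algebra_simps)
  also have "set_lebesgue_integral lborel {a..b} (\<lambda>t. (f t)\<^sup>2 - (2 * c) * f t + c\<^sup>2) = Q - (2 * c) * I + c\<^sup>2 * L"
    using set_integral_add(2)[OF set_integral_diff(1)[OF qi fi2] ci] set_integral_diff(2)[OF qi fi2] ab
    by (simp add: Q_def I_def L_def set_integral_const_interval)
  also have "\<dots> = Q - I\<^sup>2 / L" using L by (simp add: c_def power2_eq_square)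
  finally have "I\<^sup>2 / L \<le> Q" by simp
  then show ?thesis using L unfolding I_def[symmetric] Q_def[symmetric] L_def[symmetric]
    by (simp add: pos_divide_le_eq mult.commute)
qed

lemma ray_measurable:
  assumes "F \<in> borel_measurable borel"
  shows "(\<lambda>p. F (fst p + snd (snd p) *\<^sub>R dir (fst (snd p)))) \<in> borel_measurable (borel \<Otimes>\<^sub>M (borel \<Otimes>\<^sub>M borel))"
proof -
  have "continuous_on UNIV (\<lambda>p :: point \<times> real \<times> real. fst p + snd (snd p) *\<^sub>R dir (fst (snd p)))"
    unfolding dir_def by (intro continuous_intros)
  then have "(\<lambda>p :: point \<times> real \<times> real. fst p + snd (snd p) *\<^sub>R dir (fst (snd p))) \<in> borel_measurable (borel \<Otimes>\<^sub>M (borel \<Otimes>\<^sub>M borel))"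
    unfolding borel_prod by (rule borel_measurable_continuous_onI)
  from measurable_compose[OF this assms] show ?thesis .
qed

text \<open>\<open>F\<close> will be the elementwise norm of the symmetric gradient, extended by
  zero. Boundedness makes every integral along a ray or over the slopes finite.\<close>

locale ray_function =
  fixes F :: "point \<Rightarrow> real" and K D :: real
  assumes F_meas: "F \<in> borel_measurable borel" and F_nonneg: "0 \<le> F x" and F_le: "F x \<le> K" and D: "0 \<le> D"
begin

lemma F_abs: "\<bar>F x\<bar> \<le> K" using F_nonneg[of x] F_le[of x] by simp

lemma F2_abs: "\<bar>(F x)\<^sup>2\<bar> \<le> K\<^sup>2" using power_mono[OF F_le F_nonneg, of x 2] by simp

lemma slice_measurable: "(\<lambda>p. F (x + snd p *\<^sub>R dir (fst p))) \<in> borel_measurable (borel \<Otimes>\<^sub>M borel)"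
proof -
  have "(\<lambda>p. (x, fst p, snd p)) \<in> measurable (borel \<Otimes>\<^sub>M borel) (borel \<Otimes>\<^sub>M (borel \<Otimes>\<^sub>M borel))" by measurable
  from measurable_compose[OF this ray_measurable[OF F_meas]] show ?thesis by simp
qed

lemma line_measurable: "(\<lambda>t. F (x + t *\<^sub>R dir s)) \<in> borel_measurable borel"
proof -
  have "(\<lambda>t. (s, t)) \<in> measurable borel (borel \<Otimes>\<^sub>M borel)" by measurable
  from measurable_compose[OF this slice_measurable] show ?thesis by simp
qed

definition ray :: "point \<Rightarrow> real \<Rightarrow> real" where
  "ray x s = set_lebesgue_integral lborel {0..D} (\<lambda>t. F (x + t *\<^sub>R dir s))"

definition ray2 :: "point \<Rightarrow> real \<Rightarrow> real" where
  "ray2 x s = set_lebesgue_integral lborel {0..D} (\<lambda>t. (F (x + t *\<^sub>R dir s))\<^sup>2)"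

lemma ray_meas: "ray x \<in> borel_measurable borel"
  unfolding ray_def set_lebesgue_integral_def
proof (rule lborel.borel_measurable_lebesgue_integral)
  show "(\<lambda>(s, t). indicator {0..D} t *\<^sub>R F (x + t *\<^sub>R dir s)) \<in> borel_measurable (borel \<Otimes>\<^sub>M lborel)"
    using slice_measurable[of x] by (simp add: split_beta cong: measurable_cong_sets) 
qed

lemma ray2_meas: "ray2 x \<in> borel_measurable borel"
  unfolding ray2_def set_lebesgue_integral_def
proof (rule lborel.borel_measurable_lebesgue_integral)
  show "(\<lambda>(s, t). indicator {0..D} t *\<^sub>R (F (x + t *\<^sub>R dir s))\<^sup>2) \<in> borel_measurable (borel \<Otimes>\<^sub>M lborel)"
    using slice_measurable[of x] by (simp add: split_beta cong: measurable_cong_sets)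
qed

lemma interval_bound:
  assumes "f \<in> borel_measurable borel" "\<And>t. 0 \<le> f t" "\<And>t. f t \<le> (C :: real)"
  shows "0 \<le> set_lebesgue_integral lborel {0..D} f" "set_lebesgue_integral lborel {0..D} f \<le> C * D"
proof -
  show "0 \<le> set_lebesgue_integral lborel {0..D} f"
    unfolding set_lebesgue_integral_def by (intro Bochner_Integration.integral_nonneg) (simp add: indicator_def assms)
  have i: "set_integrable lborel {0..D} f" by (rule bounded_set_integrable[of _ C]) (use assms in auto)
  have "set_lebesgue_integral lborel {0..D} f \<le> set_lebesgue_integral lborel {0..D} (\<lambda>t. C)"
    by (rule set_integral_mono[OF i bounded_set_integrable[of _ "\<bar>C\<bar>"]]) (use assms in auto)
  then show "set_lebesgue_integral lborel {0..D} f \<le> C * D" using D by (simp add: set_integral_const_interval)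
qed

lemma ray_abs: "\<bar>ray x s\<bar> \<le> K * D"
  using interval_bound[OF line_measurable F_nonneg F_le, of x s] unfolding ray_def by simp

lemma ray2_nonneg: "0 \<le> ray2 x s" and ray2_abs: "\<bar>ray2 x s\<bar> \<le> K\<^sup>2 * D"
proof -
  have m: "(\<lambda>t. (F (x + t *\<^sub>R dir s))\<^sup>2) \<in> borel_measurable borel" by (intro borel_measurable_power line_measurable)
  have b: "(F (x + t *\<^sub>R dir s))\<^sup>2 \<le> K\<^sup>2" for t using F2_abs[of "x + t *\<^sub>R dir s"] by simp
  show "0 \<le> ray2 x s" "\<bar>ray2 x s\<bar> \<le> K\<^sup>2 * D" using interval_bound[OF m _ b] unfolding ray2_def by auto
qed

lemma ray_integrable: "set_integrable lborel {0..1} (ray x)"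
  by (rule bounded_set_integrable[OF ray_meas ray_abs])

text \<open>Cauchy-Schwarz twice: over the slopes, an interval of length 1, and along the ray, of
  parameter length \<open>D\<close>.\<close>

lemma ray_average_square:
  "(set_lebesgue_integral lborel {0..1} (ray x))\<^sup>2 \<le> D * set_lebesgue_integral lborel {0..1} (ray2 x)"
proof -
  have "(set_lebesgue_integral lborel {0..1} (ray x))\<^sup>2 \<le> set_lebesgue_integral lborel {0..1} (\<lambda>s. (ray x s)\<^sup>2)"
    using integral_square_le[OF _ ray_meas ray_abs, of 0 1] by simp
  also have "\<dots> \<le> set_lebesgue_integral lborel {0..1} (\<lambda>s. D * ray2 x s)"
  proof (rule set_integral_mono)
    have m: "(\<lambda>s. (ray x s)\<^sup>2) \<in> borel_measurable borel" by (intro borel_measurable_power ray_meas)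
    have "\<bar>(ray x s)\<^sup>2\<bar> \<le> (K * D)\<^sup>2" for s using power_mono[OF ray_abs[of x s], of 2] by simp
    then show "set_integrable lborel {0..1} (\<lambda>s. (ray x s)\<^sup>2)" by (rule bounded_set_integrable[OF m])
    show "set_integrable lborel {0..1} (\<lambda>s. D * ray2 x s)"
      using bounded_set_integrable[OF ray2_meas ray2_abs] by simp
    show "(ray x s)\<^sup>2 \<le> D * ray2 x s" for s
      using integral_square_le[OF D line_measurable F_abs, of x s] unfolding ray_def ray2_def by simp
  qed
  finally show ?thesis by simp
qed

lemma ray2_average_measurable:
  "(\<lambda>x. ennreal (set_lebesgue_integral lborel {0..1} (ray2 x))) \<in> borel_measurable borel"
proof -
  have "(\<lambda>q. ((fst (fst q)), (snd (fst q), snd q))) \<in> measurable ((borel \<Otimes>\<^sub>M borel) \<Otimes>\<^sub>M borel) (borel \<Otimes>\<^sub>M (borel \<Otimes>\<^sub>M borel))"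
    by measurable
  from measurable_compose[OF this ray_measurable[OF F_meas]]
  have "(\<lambda>q. F (fst (fst q) + snd q *\<^sub>R dir (snd (fst q)))) \<in> borel_measurable ((borel \<Otimes>\<^sub>M borel) \<Otimes>\<^sub>M borel)"
    by simp
  then have "(\<lambda>q. indicator {0..D} (snd q) *\<^sub>R (F (fst (fst q) + snd q *\<^sub>R dir (snd (fst q))))\<^sup>2) \<in> borel_measurable ((borel \<Otimes>\<^sub>M borel) \<Otimes>\<^sub>M lborel)"
    by (simp cong: measurable_cong_sets)
  then have "(\<lambda>p. \<integral>t. indicator {0..D} t *\<^sub>R (F (fst p + t *\<^sub>R dir (snd p)))\<^sup>2 \<partial>lborel) \<in> borel_measurable (borel \<Otimes>\<^sub>M borel)"
    by (intro lborel.borel_measurable_lebesgue_integral) (simp add: split_beta)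
  then have "(\<lambda>p. ray2 (fst p) (snd p)) \<in> borel_measurable (borel \<Otimes>\<^sub>M borel)"
    by (simp add: ray2_def set_lebesgue_integral_def)
  then have "(\<lambda>p. indicator {0..1} (snd p) *\<^sub>R ray2 (fst p) (snd p)) \<in> borel_measurable (borel \<Otimes>\<^sub>M lborel)"
    by (simp cong: measurable_cong_sets)
  then have "(\<lambda>x. \<integral>s. indicator {0..1} s *\<^sub>R ray2 x s \<partial>lborel) \<in> borel_measurable borel"
    by (intro lborel.borel_measurable_lebesgue_integral) (simp add: split_beta)
  then show ?thesis unfolding set_lebesgue_integral_def by (rule measurable_compose[OF _ measurable_ennreal])
qed

text \<open>Tonelli moves the integral over the starting point inside. By translation invariance it
  no longer depends on slope and time, and only the parameter length of the ray remains as a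
  factor.\<close>

lemma ray2_total:
  "(\<integral>\<^sup>+x. ennreal (set_lebesgue_integral lborel {0..1} (ray2 x)) \<partial>lborel) \<le> ennreal D * (\<integral>\<^sup>+x. ennreal ((F x)\<^sup>2) \<partial>lborel)"
proof -
  define H where "H x s t = ennreal (indicator {0..1} s * (indicator {0..D} t * (F (x + t *\<^sub>R dir s))\<^sup>2))" for x s t
  have Hm: "(\<lambda>p. H (fst p) (fst (snd p)) (snd (snd p))) \<in> borel_measurable (borel \<Otimes>\<^sub>M (borel \<Otimes>\<^sub>M borel))"
    unfolding H_def using ray_measurable[OF F_meas] by measurable
  have re: "ennreal (set_lebesgue_integral lborel {0..1} (ray2 x)) = (\<integral>\<^sup>+s. \<integral>\<^sup>+t. H x s t \<partial>lborel \<partial>lborel)" for x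
  proof -
    have in_: "(\<integral>\<^sup>+t. H x s t \<partial>lborel) = ennreal (indicator {0..1} s * ray2 x s)" for s
    proof -
      have m: "(\<lambda>t. (F (x + t *\<^sub>R dir s))\<^sup>2) \<in> borel_measurable borel" by (intro borel_measurable_power line_measurable)
      have i: "integrable lborel (\<lambda>t. indicator {0..D} t * (F (x + t *\<^sub>R dir s))\<^sup>2)"
        using bounded_set_integrable[OF m F2_abs] by (simp add: set_integrable_def)
      have "(\<integral>\<^sup>+t. H x s t \<partial>lborel) = ennreal (\<integral>t. indicator {0..1} s * (indicator {0..D} t * (F (x + t *\<^sub>R dir s))\<^sup>2) \<partial>lborel)"
        unfolding H_def by (rule nn_integral_eq_integral) (use i in auto)
      then show ?thesis by (simp add: ray2_def set_lebesgue_integral_def)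
    qed
    have "(\<integral>\<^sup>+s. ennreal (indicator {0..1} s * ray2 x s) \<partial>lborel) = ennreal (\<integral>s. indicator {0..1} s * ray2 x s \<partial>lborel)"
      by (rule nn_integral_eq_integral)
        (use bounded_set_integrable[OF ray2_meas ray2_abs] ray2_nonneg in \<open>auto simp: set_integrable_def\<close>)
    then show ?thesis by (simp add: in_ set_lebesgue_integral_def)
  qed
  have m1: "(\<lambda>(x, s). \<integral>\<^sup>+t. H x s t \<partial>lborel) \<in> borel_measurable (lborel \<Otimes>\<^sub>M lborel)"
  proof -
    have "(\<lambda>q. ((fst (fst q)), (snd (fst q), snd q))) \<in> measurable ((borel \<Otimes>\<^sub>M borel) \<Otimes>\<^sub>M borel) (borel \<Otimes>\<^sub>M (borel \<Otimes>\<^sub>M borel))"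
      by measurable
    from measurable_compose[OF this Hm]
    have "(\<lambda>q. H (fst (fst q)) (snd (fst q)) (snd q)) \<in> borel_measurable ((lborel \<Otimes>\<^sub>M lborel) \<Otimes>\<^sub>M lborel)"
      by (simp cong: measurable_cong_sets)
    then have "(\<lambda>p. \<integral>\<^sup>+t. H (fst p) (snd p) t \<partial>lborel) \<in> borel_measurable (lborel \<Otimes>\<^sub>M lborel)"
      by (intro lborel.borel_measurable_nn_integral) (simp add: split_beta)
    then show ?thesis by (simp add: split_beta)
  qed
  have "(\<integral>\<^sup>+x. ennreal (set_lebesgue_integral lborel {0..1} (ray2 x)) \<partial>lborel) = (\<integral>\<^sup>+x. \<integral>\<^sup>+s. \<integral>\<^sup>+t. H x s t \<partial>lborel \<partial>lborel \<partial>lborel)"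
    by (simp add: re)
  also have "\<dots> = (\<integral>\<^sup>+s. \<integral>\<^sup>+x. \<integral>\<^sup>+t. H x s t \<partial>lborel \<partial>lborel \<partial>lborel)"
    by (rule lborel_pair.Fubini'[OF m1, symmetric])
  also have "\<dots> = (\<integral>\<^sup>+s. \<integral>\<^sup>+t. \<integral>\<^sup>+x. H x s t \<partial>lborel \<partial>lborel \<partial>lborel)"
  proof (rule nn_integral_cong)
    fix s :: real
    have "(\<lambda>q. (fst q, (s, snd q))) \<in> measurable (borel \<Otimes>\<^sub>M borel) (borel \<Otimes>\<^sub>M (borel \<Otimes>\<^sub>M borel))" by measurable
    from measurable_compose[OF this Hm]
    have "(\<lambda>(x, t). H x s t) \<in> borel_measurable (lborel \<Otimes>\<^sub>M lborel)"
      by (simp add: split_beta cong: measurable_cong_sets)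
    then show "(\<integral>\<^sup>+x. \<integral>\<^sup>+t. H x s t \<partial>lborel \<partial>lborel) = (\<integral>\<^sup>+t. \<integral>\<^sup>+x. H x s t \<partial>lborel \<partial>lborel)"
      by (rule lborel_pair.Fubini'[symmetric])
  qed
  also have "\<dots> = (\<integral>\<^sup>+s. \<integral>\<^sup>+t. indicator {0..1::real} s * (indicator {0..D} t * (\<integral>\<^sup>+x. ennreal ((F x)\<^sup>2) \<partial>lborel)) \<partial>lborel \<partial>lborel)"
  proof (rule nn_integral_cong, rule nn_integral_cong)
    fix s t :: real
    have F2: "(\<lambda>x. ennreal ((F x)\<^sup>2)) \<in> borel_measurable borel" using F_meas by measurable
    have "(\<integral>\<^sup>+x. ennreal ((F x)\<^sup>2) \<partial>lborel) = (\<integral>\<^sup>+x. ennreal ((F x)\<^sup>2) \<partial>distr lborel borel ((+) (t *\<^sub>R dir s)))"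
      by (simp add: lborel_distr_plus)
    also have "\<dots> = (\<integral>\<^sup>+x. ennreal ((F (x + t *\<^sub>R dir s))\<^sup>2) \<partial>lborel)"
      by (subst nn_integral_distr) (use F2 in \<open>auto simp: add.commute\<close>)
    finally have tr: "(\<integral>\<^sup>+x. ennreal ((F (x + t *\<^sub>R dir s))\<^sup>2) \<partial>lborel) = (\<integral>\<^sup>+x. ennreal ((F x)\<^sup>2) \<partial>lborel)" by simp
    show "(\<integral>\<^sup>+x. H x s t \<partial>lborel) = indicator {0..1} s * (indicator {0..D} t * (\<integral>\<^sup>+x. ennreal ((F x)\<^sup>2) \<partial>lborel))"
      by (cases "s \<in> {0..1}"; cases "t \<in> {0..D}") (simp_all add: H_def tr)
  qed
  also have "\<dots> = (\<integral>\<^sup>+s. indicator {0..1::real} s * (\<integral>\<^sup>+t. indicator {0..D} t * (\<integral>\<^sup>+x. ennreal ((F x)\<^sup>2) \<partial>lborel) \<partial>lborel) \<partial>lborel)"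
    by (simp add: nn_integral_cmult)
  also have "\<dots> = (\<integral>\<^sup>+t. indicator {0..D} t * (\<integral>\<^sup>+x. ennreal ((F x)\<^sup>2) \<partial>lborel) \<partial>lborel)"
    by (simp add: nn_integral_multc)
  also have "\<dots> = ennreal D * (\<integral>\<^sup>+x. ennreal ((F x)\<^sup>2) \<partial>lborel)"
    using D by (simp add: nn_integral_multc)
  finally show ?thesis by simp
qed

end

text \<open>The functions \<open>4 - 6 * s\<close> and \<open>12 * s - 6\<close> are dual to
  \<open>1\<close> and \<open>s\<close> on the unit interval: integrated against
  \<open>u1 + s * u2\<close> they give \<open>u1\<close> and \<open>u2\<close>. The constants 4 and
  6 are their maximum norms there. Finitely many exceptional slopes form a null set.\<close>

lemma direction_average:
  fixes c :: "real \<Rightarrow> real" and u1 u2 :: real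
  assumes c: "set_integrable lborel {0..1} c" and N: "finite N"
    and le: "\<And>s. s \<in> {0..1} \<Longrightarrow> s \<notin> N \<Longrightarrow> \<bar>u1 + s * u2\<bar> \<le> c s"
  shows "\<bar>u1\<bar> \<le> 4 * set_lebesgue_integral lborel {0..1} c" "\<bar>u2\<bar> \<le> 6 * set_lebesgue_integral lborel {0..1} c"
proof -
  have main: "\<bar>w\<bar> \<le> B * set_lebesgue_integral lborel {0..1} c"
    if p: "continuous_on {0..1} p" and B: "\<And>s. s \<in> {0..1} \<Longrightarrow> \<bar>p s\<bar> \<le> B" "0 \<le> B"
      and w: "((\<lambda>s. p s * (u1 + s * u2)) has_integral w) {0..1}" for p B w
  proof -
    let ?f = "\<lambda>s. p s * (u1 + s * u2)"
    have fc: "continuous_on {0..1} ?f" by (intro continuous_intros p)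
    have fi: "set_integrable lborel {0..1} ?f" by (rule interval_integrable[OF fc])
    have "w = set_lebesgue_integral lborel {0..1} ?f"
      using set_borel_integral_eq_integral(2)[OF fi] w by (simp add: integral_unique)
    also have "\<bar>\<dots>\<bar> \<le> (\<integral>s. \<bar>indicator {0..1} s *\<^sub>R ?f s\<bar> \<partial>lborel)"
      unfolding set_lebesgue_integral_def using integral_norm_bound[of lborel "\<lambda>s. indicator {0..1} s *\<^sub>R ?f s"] by simp
    also have "\<dots> \<le> (\<integral>s. indicator {0..1} s *\<^sub>R (B * c s) \<partial>lborel)"
    proof (rule integral_mono_AE)
      show "integrable lborel (\<lambda>s. \<bar>indicator {0..1} s *\<^sub>R ?f s\<bar>)" using fi unfolding set_integrable_def by (rule integrable_abs)
      show "integrable lborel (\<lambda>s. indicator {0..1} s *\<^sub>R (B * c s))" using c unfolding set_integrable_def by (simp add: mult.left_commute[of _ B])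
      have "AE s in lborel. s \<notin> N" by (intro AE_not_in finite_imp_null_set_lborel N)
      then show "AE s in lborel. \<bar>indicator {0..1} s *\<^sub>R ?f s\<bar> \<le> indicator {0..1} s *\<^sub>R (B * c s)"
      proof eventually_elim
        case (elim s)
        show ?case
        proof (cases "s \<in> {0..1}")
          case True
          have "\<bar>p s\<bar> * \<bar>u1 + s * u2\<bar> \<le> B * c s" by (intro mult_mono B le True elim) auto
          then show ?thesis using True by (simp add: abs_mult)
        qed simp
      qed
    qed
    also have "\<dots> = B * set_lebesgue_integral lborel {0..1} c"
      by (simp add: set_lebesgue_integral_def mult.left_commute[of _ B])
    finally show ?thesis .
  qed
  have poly: "((\<lambda>s. a + b * s + e * s\<^sup>2) has_integral (a + b / 2 + e / 3)) {0..1::real}" for a b e :: real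
  proof -
    have "((\<lambda>s. a + b * s + e * s\<^sup>2) has_integral ((a * 1 + b * 1\<^sup>2 / 2 + e * 1 ^ 3 / 3) - (a * 0 + b * 0\<^sup>2 / 2 + e * 0 ^ 3 / 3))) {0..1::real}"
      by (rule fundamental_theorem_of_calculus)
        (auto simp: has_real_derivative_iff_has_vector_derivative[symmetric] power2_eq_square intro!: derivative_eq_intros)
    then show ?thesis by simp
  qed
  have "(\<lambda>s. (4 - 6 * s) * (u1 + s * u2)) = (\<lambda>s. 4 * u1 + (4 * u2 - 6 * u1) * s + (- 6 * u2) * s\<^sup>2)"
    by (auto simp: algebra_simps power2_eq_square)
  then have "((\<lambda>s. (4 - 6 * s) * (u1 + s * u2)) has_integral u1) {0..1}"
  proof (simp only:)
    have "4 * u1 + (4 * u2 - 6 * u1) / 2 + (- 6 * u2) / 3 = u1" by (simp add: field_simps)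
    then show "((\<lambda>s. 4 * u1 + (4 * u2 - 6 * u1) * s + (- 6 * u2) * s\<^sup>2) has_integral u1) {0..1}"
      using poly[of "4 * u1" "4 * u2 - 6 * u1" "- 6 * u2"] by argo
  qed
  then show "\<bar>u1\<bar> \<le> 4 * set_lebesgue_integral lborel {0..1} c"
    by (intro main[of "\<lambda>s. 4 - 6 * s"]) (auto intro!: continuous_intros simp: abs_le_iff)
  have "(\<lambda>s. (12 * s - 6) * (u1 + s * u2)) = (\<lambda>s. - 6 * u1 + (12 * u1 - 6 * u2) * s + (12 * u2) * s\<^sup>2)"
    by (auto simp: algebra_simps power2_eq_square)
  then have "((\<lambda>s. (12 * s - 6) * (u1 + s * u2)) has_integral u2) {0..1}"
  proof (simp only:)
    have "- 6 * u1 + (12 * u1 - 6 * u2) / 2 + (12 * u2) / 3 = u2" by (simp add: field_simps)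
    then show "((\<lambda>s. - 6 * u1 + (12 * u1 - 6 * u2) * s + (12 * u2) * s\<^sup>2) has_integral u2) {0..1}"
      using poly[of "- 6 * u1" "12 * u1 - 6 * u2" "12 * u2"] by argo
  qed
  then show "\<bar>u2\<bar> \<le> 6 * set_lebesgue_integral lborel {0..1} c"
    by (intro main[of "\<lambda>s. 12 * s - 6"]) (auto intro!: continuous_intros simp: abs_le_iff)
qed

section \<open>A Schur test\<close>

text \<open>Contains every slope of a line through \<open>x\<close> that meets the disc of radius
  \<open>h\<close> around \<open>z\<close>: the expression is the cross product of
  \<open>dir s\<close> with \<open>z - x\<close>.\<close>

definition tube :: "point \<Rightarrow> real \<Rightarrow> point \<Rightarrow> real set" where
  "tube z h x = {s. \<bar>(z $ 2 - x $ 2) - s * (z $ 1 - x $ 1)\<bar> \<le> 2 * h}"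

lemma tube_sets: "tube z h x \<in> sets borel"
proof -
  have "closed (tube z h x)" unfolding tube_def by (intro closed_Collect_le continuous_intros)
  then show ?thesis by (rule borel_closed)
qed

text \<open>If \<open>x\<close> is within \<open>7 * h\<close> of \<open>z\<close> the trivial bound
  1 suffices. Beyond that, a nonempty tube forces \<open>z\<close> and \<open>x\<close> to differ
  mainly in the first coordinate, by at least \<open>5 / 16\<close> of \<open>h + dist x z\<close>,
  and 7 is the threshold for this. The slopes then fill an interval of length at most
  \<open>64 / 5\<close> times \<open>h / (h + dist x z)\<close>.\<close>

lemma tube_average:
  assumes h: "0 < h"
  shows "set_lebesgue_integral lborel {0..1} (\<lambda>s. indicator (tube z h x) s :: real) \<le> 13 * (h / (h + dist x z))"
proof -
  let ?\<alpha> = "z $ 1 - x $ 1" and ?\<beta> = "z $ 2 - x $ 2" and ?d = "dist x z"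
  let ?W = "tube z h x \<inter> {0..1}"
  have W: "set_lebesgue_integral lborel {0..1} (\<lambda>s. indicator (tube z h x) s :: real) = measure lborel ?W"
    unfolding set_lebesgue_integral_def
    by (simp add: indicator_inter_arith[symmetric] Int_commute mult.commute)
  have pos: "0 < h + ?d" using h by (simp add: add_pos_nonneg)
  show ?thesis
  proof (cases "?W = {} \<or> ?d \<le> 7 * h")
    case True
    have "measure lborel ?W \<le> measure lborel {0..1::real}"
      by (rule measure_mono_fmeasurable) (use tube_sets in \<open>auto simp: fmeasurable_def emeasure_lborel_Icc_eq\<close>)
    then have m1: "measure lborel ?W \<le> 1" by simp
    show ?thesis
    proof (cases "?W = {}")
      case True then show ?thesis unfolding W using h pos by simp
    next
      case False
      then have "?d \<le> 7 * h" using True by blast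
      then have "h + ?d \<le> 13 * h" using h by linarith
      then have "1 \<le> 13 * (h / (h + ?d))" using pos by (simp add: pos_le_divide_eq)
      then show ?thesis unfolding W using m1 by linarith
    qed
  next
    case False
    then obtain s where s: "s \<in> tube z h x" "0 \<le> s" "s \<le> 1" and d: "7 * h < ?d" by auto
    have "?d \<le> \<bar>?\<alpha>\<bar> + \<bar>?\<beta>\<bar>"
    proof -
      have "?d = norm (z - x)" by (simp add: dist_norm norm_minus_commute)
      also have "\<dots> \<le> (\<Sum>i\<in>UNIV. \<bar>(z - x) $ i\<bar>)" by (rule norm_le_l1_cart)
      finally show ?thesis by (simp add: sum_2)
    qed
    moreover have "\<bar>?\<beta>\<bar> \<le> \<bar>?\<alpha>\<bar> + 2 * h"
    proof -
      have "\<bar>s * ?\<alpha>\<bar> \<le> 1 * \<bar>?\<alpha>\<bar>" unfolding abs_mult by (rule mult_right_mono) (use s in auto)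
      then show ?thesis using s(1) unfolding tube_def by simp
    qed
    moreover have "5 * (h + d) / 16 \<le> a" if "d \<le> a + b" "b \<le> a + 2 * h" "7 * h < d" for a b d
      using that by argo
    ultimately have \<alpha>: "5 * (h + ?d) / 16 \<le> \<bar>?\<alpha>\<bar>" using d by blast
    have "0 < 5 * (h + ?d) / 16" using pos by simp
    then have \<alpha>0: "0 < \<bar>?\<alpha>\<bar>" using \<alpha> by (rule less_le_trans)
    have "?W \<subseteq> {?\<beta> / ?\<alpha> - 2 * h / \<bar>?\<alpha>\<bar> .. ?\<beta> / ?\<alpha> + 2 * h / \<bar>?\<alpha>\<bar>}"
    proof
      fix q assume "q \<in> ?W"
      then have "\<bar>?\<beta> - q * ?\<alpha>\<bar> \<le> 2 * h" by (simp add: tube_def)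
      moreover have "b - q * a = (b / a - q) * a" if "a \<noteq> 0" for a b :: real
        using that by (simp add: left_diff_distrib)
      then have "?\<beta> - q * ?\<alpha> = (?\<beta> / ?\<alpha> - q) * ?\<alpha>" using \<alpha>0 by force
      ultimately have "\<bar>?\<beta> / ?\<alpha> - q\<bar> * \<bar>?\<alpha>\<bar> \<le> 2 * h" by (simp add: abs_mult)
      then have "\<bar>?\<beta> / ?\<alpha> - q\<bar> \<le> 2 * h / \<bar>?\<alpha>\<bar>" using \<alpha>0 by (simp add: pos_le_divide_eq)
      then show "q \<in> {?\<beta> / ?\<alpha> - 2 * h / \<bar>?\<alpha>\<bar> .. ?\<beta> / ?\<alpha> + 2 * h / \<bar>?\<alpha>\<bar>}" by (auto simp: abs_le_iff)
    qed
    then have "measure lborel ?W \<le> measure lborel {?\<beta> / ?\<alpha> - 2 * h / \<bar>?\<alpha>\<bar> .. ?\<beta> / ?\<alpha> + 2 * h / \<bar>?\<alpha>\<bar>}"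
      by (rule measure_mono_fmeasurable) (use tube_sets in \<open>auto simp: fmeasurable_def emeasure_lborel_Icc_eq\<close>)
    also have "\<dots> = 4 * h / \<bar>?\<alpha>\<bar>"
    proof -
      have "0 \<le> h / \<bar>?\<alpha>\<bar>" using h by simp
      then show ?thesis by simp
    qed
    also have "\<dots> \<le> 4 * h / (5 * (h + ?d) / 16)" by (rule divide_left_mono[OF \<alpha>]) (use h pos \<alpha>0 in auto)
    also have "\<dots> \<le> 13 * (h / (h + ?d))" using h pos by (simp add: field_simps)
    finally show ?thesis unfolding W .
  qed
qed

text \<open>\<open>0 powr a\<close> is 0, which would spoil lower bounds on the axes; the value
  \<open>top\<close> there changes a null set only.\<close>

definition root_kernel :: "real \<Rightarrow> ennreal" where
  "root_kernel t = (if t = 0 then top else ennreal (\<bar>t\<bar> powr (- 1/2)))"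

text \<open>A product kernel dominating $1/|y|$, integrable by one-dimensional integrals only.\<close>

definition kernel :: "point \<Rightarrow> ennreal" where
  "kernel y = (\<Prod>b\<in>Basis. root_kernel (y \<bullet> b))"

lemma Basis_point: "(Basis :: point set) = {axis 1 1, axis 2 1}"
  by (auto simp: Basis_vec_def UNIV_2)

lemma axis_distinct: "axis 1 1 \<noteq> (axis 2 1 :: point)"
  by (simp add: axis_eq_axis)

lemma kernel_eq: "kernel y = root_kernel (y $ 1) * root_kernel (y $ 2)"
  using axis_distinct by (simp add: kernel_def Basis_point inner_axis)

text \<open>Both coordinates are at most \<open>c\<close>, hence so is the square root of their
  product. Any upper bound \<open>c\<close> for the norm may be used, in particular a regularised
  distance such as \<open>h + dist x z\<close>.\<close>

lemma kernel_ge: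
  assumes c: "0 < c" and y: "norm y \<le> c"
  shows "ennreal (1 / c) \<le> kernel y"
proof (cases "y $ 1 = 0 \<or> y $ 2 = 0")
  case True
  have ne: "root_kernel t \<noteq> 0" for t by (simp add: root_kernel_def)
  have "root_kernel 0 = top" by (simp add: root_kernel_def)
  then have "kernel y = top" using True ne by (auto simp: kernel_eq ennreal_mult_top ennreal_top_mult)
  then show ?thesis by simp
next
  case False
  let ?p = "\<bar>y $ 1\<bar>" and ?q = "\<bar>y $ 2\<bar>"
  have pq: "0 < ?p" "0 < ?q" using False by auto
  have "?p \<le> c" "?q \<le> c" using component_le_norm_cart[of y] y order.trans by blast+
  then have "?p * ?q \<le> c * c" using pq by (intro mult_mono) auto
  then have "(c * c) powr (- 1/2) \<le> (?p * ?q) powr (- 1/2)" using pq by (intro powr_mono2') auto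
  moreover have "(c * c) powr (- 1/2) = 1 / c"
    using c by (simp add: powr_mult powr_add[symmetric] powr_minus_divide)
  moreover have "(?p * ?q) powr (- 1/2) = ?p powr (- 1/2) * ?q powr (- 1/2)" using pq by (simp add: powr_mult)
  ultimately show ?thesis using False by (simp add: kernel_eq root_kernel_def ennreal_mult[symmetric])
qed

lemma root_kernel_meas: "root_kernel \<in> borel_measurable borel"
  unfolding root_kernel_def by measurable

text \<open>The exponent \<open>- 1/2\<close> is integrable at 0; the negative half line is
  reflected to the positive one.\<close>

lemma root_kernel_integral:
  assumes R: "0 \<le> R"
  shows "(\<integral>\<^sup>+t. root_kernel t * indicator {-R..R} t \<partial>lborel) < top"
proof -
  let ?f = "\<lambda>t::real. indicator {0..R} t * t powr (- 1/2)"
  have hr: "((\<lambda>t. t powr (- 1/2)) has_integral (R powr (- 1/2 + 1) / (- 1/2 + 1))) {0..R}"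
    by (rule has_integral_powr_from_0) (use R in auto)
  have eq: "?f = (\<lambda>t. if t \<in> {0..R} then t powr (- 1/2) else 0)" by (auto simp: indicator_def)
  have hi: "(?f has_integral (R powr (- 1/2 + 1) / (- 1/2 + 1))) UNIV"
    unfolding eq has_integral_restrict_UNIV by (rule hr)
  have fm: "?f \<in> borel_measurable borel" by measurable
  have fin: "(\<integral>\<^sup>+t. ennreal (?f t) \<partial>lborel) < top"
    by (subst nn_integral_has_integral_lborel[OF fm _ hi]) auto
  have refl: "(\<integral>\<^sup>+t. ennreal (?f (- t)) \<partial>lborel) = (\<integral>\<^sup>+t. ennreal (?f t) \<partial>lborel)"
    using nn_integral_real_affine[of "\<lambda>t. ennreal (?f t)" "-1" 0] fm by simp
  have "(\<integral>\<^sup>+t. root_kernel t * indicator {-R..R} t \<partial>lborel) \<le> (\<integral>\<^sup>+t. ennreal (?f t) + ennreal (?f (- t)) \<partial>lborel)"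
  proof (rule nn_integral_mono_AE)
    have "AE t in lborel. t \<notin> {0::real}" by (intro AE_not_in finite_imp_null_set_lborel) auto
    then show "AE t in lborel. root_kernel t * indicator {-R..R} t \<le> ennreal (?f t) + ennreal (?f (- t))"
      by eventually_elim (auto simp: root_kernel_def indicator_def abs_if)
  qed
  also have "\<dots> = (\<integral>\<^sup>+t. ennreal (?f t) \<partial>lborel) + (\<integral>\<^sup>+t. ennreal (?f (- t)) \<partial>lborel)"
    by (rule nn_integral_add) (use fm in measurable)
  also have "\<dots> < top" using fin unfolding refl by simp
  finally show ?thesis .
qed

text \<open>The mass of the kernel on a square of half side \<open>R\<close>, one factor for each
  coordinate. With \<open>R\<close> bounding the diameter it depends on the domain alone.\<close>

definition kernel_mass :: "real \<Rightarrow> real" where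
  "kernel_mass R = enn2real ((\<integral>\<^sup>+t. root_kernel t * indicator {-R..R} t \<partial>lborel)\<^sup>2)"

lemma kernel_mass_nonneg: "0 \<le> kernel_mass R"
  by (simp add: kernel_mass_def)

text \<open>The set is contained in a square around \<open>x\<close>, on which the product kernel
  splits into one-dimensional integrals.\<close>

lemma kernel_integral:
  assumes R: "0 \<le> R" and U: "\<And>y. y \<in> U \<Longrightarrow> norm (y - x) \<le> R" 
  shows "(\<integral>\<^sup>+y. kernel (y - x) * indicator U y \<partial>lborel) \<le> ennreal (kernel_mass R)"
proof -
  let ?g = "\<lambda>t. root_kernel t * indicator {-R..R} t"
  have gm [measurable]: "?g \<in> borel_measurable borel" using root_kernel_meas by measurable
  have "(\<integral>\<^sup>+y. kernel (y - x) * indicator U y \<partial>lborel) \<le> (\<integral>\<^sup>+y. (\<Prod>b\<in>(Basis :: point set). ?g ((y - x) \<bullet> b)) \<partial>lborel)"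
  proof (rule nn_integral_mono)
    fix y show "kernel (y - x) * indicator U y \<le> (\<Prod>b\<in>Basis. ?g ((y - x) \<bullet> b))"
    proof (cases "y \<in> U")
      case True
      have "\<bar>(y - x) \<bullet> b\<bar> \<le> R" if "b \<in> Basis" for b
        using Basis_le_norm[OF that, of "y - x"] U[OF True] by linarith
      then have "(\<Prod>b\<in>Basis. ?g ((y - x) \<bullet> b)) = kernel (y - x)"
        unfolding kernel_def
      proof (intro prod.cong refl)
        fix b :: point assume "b \<in> Basis"
        then have "\<bar>(y - x) \<bullet> b\<bar> \<le> R" by fact
        then have "(y - x) \<bullet> b \<in> {-R..R}" by auto
        then show "?g ((y - x) \<bullet> b) = root_kernel ((y - x) \<bullet> b)" by simp
      qed
      then show ?thesis by (simp add: True)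
    qed simp
  qed
  also have "\<dots> = (\<integral>\<^sup>+y. (\<Prod>b\<in>(Basis :: point set). ?g (y \<bullet> b)) \<partial>lborel)"
  proof -
    have m: "(\<lambda>y::point. \<Prod>b\<in>Basis. ?g (y \<bullet> b)) \<in> borel_measurable borel" by measurable
    have "(\<integral>\<^sup>+y. (\<Prod>b\<in>(Basis :: point set). ?g (y \<bullet> b)) \<partial>lborel) = (\<integral>\<^sup>+y. (\<Prod>b\<in>(Basis :: point set). ?g (y \<bullet> b)) \<partial>distr lborel borel ((+) (- x)))"
      by (simp add: lborel_distr_plus)
    also have "\<dots> = (\<integral>\<^sup>+y. (\<Prod>b\<in>(Basis :: point set). ?g ((- x + y) \<bullet> b)) \<partial>lborel)"
      by (rule nn_integral_distr) (use m in auto)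
    finally show ?thesis by simp
  qed
  also have "\<dots> = (\<Prod>b\<in>(Basis :: point set). \<integral>\<^sup>+t. ?g t \<partial>lborel)"
    by (rule nn_integral_lborel_prod) auto
  also have "\<dots> = (\<integral>\<^sup>+t. ?g t \<partial>lborel)\<^sup>2" using axis_distinct by (simp add: Basis_point power2_eq_square)
  also have "\<dots> = ennreal (kernel_mass R)"
  proof -
    have "(\<integral>\<^sup>+t. ?g t \<partial>lborel)\<^sup>2 < top" using root_kernel_integral[OF R] by (simp add: power2_eq_square ennreal_mult_less_top)
    then show ?thesis unfolding kernel_mass_def by simp
  qed
  finally show ?thesis .
qed

section \<open>A broken Poincare-Korn inequality\<close>

text \<open>The data of the ray argument: global polynomials on the elements, an edge trace that
  does not refer to an element, and bounds \<open>j\<close> for the differences of the two.\<close>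

locale broken_field = regular_mesh_space +
  fixes l :: int and P :: "point set \<Rightarrow> 2 \<Rightarrow> point \<Rightarrow> real" and tr :: "point set \<Rightarrow> point \<Rightarrow> real^2"
    and j :: "point set \<Rightarrow> point set \<Rightarrow> real"
  assumes P: "T \<in> elements M \<Longrightarrow> P T i \<in> pfun l"
    and tr0: "E \<in> edges M \<Longrightarrow> E \<subseteq> frontier \<Omega> \<Longrightarrow> x \<in> E \<Longrightarrow> tr E x = 0"
    and j: "T \<in> elements M \<Longrightarrow> E \<in> element_edges M T \<Longrightarrow> x \<in> E \<Longrightarrow> norm ((\<chi> i. P T i x) - tr E x) \<le> j T E"
    and j0: "T \<in> elements M \<Longrightarrow> E \<in> element_edges M T \<Longrightarrow> 0 \<le> j T E"
begin

definition jsum :: "point set \<Rightarrow> real" where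
  "jsum T = (\<Sum>E\<in>element_edges M T. j T E)"

text \<open>The summand 1 makes distances in the closed domain strictly smaller than
  \<open>D\<close>, so at time \<open>D\<close> every ray has left the closure of each
  element.\<close>

definition D :: real where "D = diameter \<Omega> + 1"

definition F :: "point \<Rightarrow> real" where
  "F x = (\<Sum>T\<in>elements M. indicator T x * norm (sym_grad_of (P T) x))"

lemma jsum_nonneg: "T \<in> elements M \<Longrightarrow> 0 \<le> jsum T"
  unfolding jsum_def by (intro sum_nonneg j0)

lemma bounded_domain: "bounded \<Omega>"
  using domain by (simp add: polygonal_def)

lemma D_pos: "0 < D"
  using diameter_ge_0[OF bounded_domain] by (simp add: D_def)

lemma open_element: "T \<in> elements M \<Longrightarrow> open T" and bounded_element: "T \<in> elements M \<Longrightarrow> bounded T"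
  using star_element star_element.openT star_element.boundedT by blast+

lemma closure_domain_dist: "x \<in> closure \<Omega> \<Longrightarrow> y \<in> closure \<Omega> \<Longrightarrow> dist x y < D"
  using diameter_bounded_bound[OF bounded_closure[OF bounded_domain], of x y] diameter_closure[OF bounded_domain]
  by (simp add: D_def)

lemma element_closure_subset: "T \<in> elements M \<Longrightarrow> closure T \<subseteq> closure \<Omega>"
  using element_subset closure_mono by blast

lemma sum_elements_at:
  assumes T: "T \<in> elements M" "x \<in> T"
  shows "(\<Sum>T\<in>elements M. indicator T x * g T) = (g T :: real)"
proof -
  have "(\<Sum>T'\<in>elements M. indicator T' x * g T') = (\<Sum>T'\<in>{T}. indicator T' x * g T')"
    by (rule sum.mono_neutral_right[OF finite_elements])
      (use T elements_disjoint[OF _ T(1)] in \<open>auto simp: indicator_def\<close>)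
  then show ?thesis using T by simp
qed

lemma sum_elements_outside: "(\<And>T. T \<in> elements M \<Longrightarrow> x \<notin> T) \<Longrightarrow> (\<Sum>T\<in>elements M. indicator T x * g T) = (0 :: real)"
  by (intro sum.neutral) auto

lemma sym_grad_continuous: assumes "T \<in> elements M" shows "continuous_on S (sym_grad_of (P T))"
proof -
  have lin: "linear sym_part" by (simp add: linear_iff sym_part_def vec_eq_iff transpose_def algebra_simps)
  have "continuous_on S (\<lambda>x. \<chi> i j. pd j (P T i) x)"
    by (intro continuous_on_vec_lambda pfun_continuous_on[OF pfun_derivative(1)[OF P[OF assms]]])
  from linear_continuous_on_compose[OF this lin] show ?thesis unfolding sym_grad_of_def[abs_def] .
qed

lemma F_ray_function: "\<exists>K. ray_function F K D"
proof -
  have "\<exists>K. \<forall>x\<in>closure T. norm (sym_grad_of (P T) x) \<le> K" if T: "T \<in> elements M" for T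
  proof -
    have "compact (sym_grad_of (P T) ` closure T)"
      using T bounded_element by (intro compact_continuous_image sym_grad_continuous) auto
    from compact_imp_bounded[OF this] show ?thesis unfolding bounded_iff by auto
  qed
  then obtain K where K: "\<And>T x. T \<in> elements M \<Longrightarrow> x \<in> closure T \<Longrightarrow> norm (sym_grad_of (P T) x) \<le> K T" by metis
  have "ray_function F (\<Sum>T\<in>elements M. \<bar>K T\<bar>) D"
  proof
    have "(\<lambda>x. indicator T x * norm (sym_grad_of (P T) x)) \<in> borel_measurable borel" if T: "T \<in> elements M" for T
      by (intro borel_measurable_times borel_measurable_indicator borel_open open_element[OF T]
          borel_measurable_continuous_onI[OF continuous_on_norm[OF sym_grad_continuous[OF T]]])
    then show "F \<in> borel_measurable borel" unfolding F_def[abs_def] by (intro borel_measurable_sum)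
    show "0 \<le> F x" for x unfolding F_def by (intro sum_nonneg) simp
    show "F x \<le> (\<Sum>T\<in>elements M. \<bar>K T\<bar>)" for x unfolding F_def
    proof (rule sum_mono)
      fix T assume T: "T \<in> elements M"
      show "indicator T x * norm (sym_grad_of (P T) x) \<le> \<bar>K T\<bar>"
        using K[OF T, of x] closure_subset[of T] by (auto simp: indicator_def)
    qed
    show "0 \<le> D" using D_pos by simp
  qed
  then show ?thesis by blast
qed

lemma frontier_avoid:
  assumes T0: "T0 \<in> elements M" "x \<in> T0" and T: "T \<in> elements M"
  shows "x \<notin> frontier T"
proof (cases "T = T0")
  case True
  then show ?thesis using star_element.frontier_disjoint[OF star_element[OF T]] T0 by blast
next
  case False
  then have "T0 \<inter> closure T = {}"
    using elements_disjoint[OF T0(1) T] open_Int_closure_eq_empty[OF open_element[OF T0(1)], of T] by auto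
  then show ?thesis using T0(2) by (auto simp: frontier_def)
qed

text \<open>Each vertex excludes at most the slope of its line to \<open>x\<close>, each edge at
  most its own slope, and there are finitely many of both.\<close>

lemma finite_bad_directions:
  assumes T0: "T0 \<in> elements M" "x \<in> T0"
  shows "finite {s. \<exists>T\<in>elements M. \<not> star_element.generic_line M T x (dir s)}"
proof (rule finite_subset)
  let ?B = "\<lambda>T. (\<lambda>V. (V $ 2 - x $ 2) / (V $ 1 - x $ 1)) ` element_vertices M T
      \<union> (\<lambda>E. - (normal M E $ 1) / normal M E $ 2) ` element_edges M T"
  show "finite (\<Union>T\<in>elements M. ?B T)"
    using finite_elements star_element.finite_element_vertices[OF star_element] star_element.finite_element_edges[OF star_element]
    by blast
  show "{s. \<exists>T\<in>elements M. \<not> star_element.generic_line M T x (dir s)} \<subseteq> (\<Union>T\<in>elements M. ?B T)"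
  proof (clarify)
    fix s T assume T: "T \<in> elements M" and ng: "\<not> star_element.generic_line M T x (dir s)"
    interpret star_element M T "star_centre T" "\<rho> * diameter T" by (rule star_element[OF T])
    consider t where "x + t *\<^sub>R dir s \<in> element_vertices M T"
      | E t where "E \<in> element_edges M T" "x + t *\<^sub>R dir s \<in> E" "normal M E \<bullet> dir s = 0"
      using ng unfolding generic_line_def by blast
    then have "s \<in> ?B T"
    proof cases
      case (1 t)
      let ?V = "x + t *\<^sub>R dir s"
      have "?V \<in> frontier T" using 1 frontierT by (auto simp: element_vertices_def edge_vertices_def)
      then have "?V \<noteq> x" using frontier_avoid[OF T0 T] by auto
      \<comment> \<open>As \<open>x\<close> is inside an element it is no vertex. The first
        component of \<open>dir s\<close> is 1, so the denominator below is
        \<open>t\<close>.\<close>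
      then have "t \<noteq> 0" by auto
      then have "s = (?V $ 2 - x $ 2) / (?V $ 1 - x $ 1)" by simp
      then show ?thesis using 1 by blast
    next
      case (2 E t)
      have z: "normal M E $ 1 + s * normal M E $ 2 = 0"
        using 2(3) by (simp add: inner_vec_def sum_2 mult.commute)
      have "normal M E $ 2 \<noteq> 0"
      proof
        assume "normal M E $ 2 = 0"
        then have "normal M E \<bullet> normal M E = 0" using z by (simp add: inner_vec_def sum_2)
        then show False using normal_inner_self[OF element_edge[OF 2(1)]] by simp
      qed
      then have "s = - (normal M E $ 1) / normal M E $ 2" using z by (simp add: field_simps)
      then show ?thesis using 2(1) by blast
    qed
    then show "s \<in> (\<Union>T\<in>elements M. ?B T)" using T by blast
  qed
qed

lemma norm_dir: assumes "s \<in> {0..1}" shows "norm (dir s) \<le> sqrt 2" "1 \<le> norm (dir s)"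
proof -
  have "(norm (dir s))\<^sup>2 = 1 + s\<^sup>2"
    unfolding power2_norm_eq_inner by (simp add: inner_vec_def sum_2 power2_eq_square)
  moreover have "s\<^sup>2 \<le> 1" using assms by (simp add: power_le_one)
  ultimately show "norm (dir s) \<le> sqrt 2" "1 \<le> norm (dir s)"
    by (auto intro!: real_le_rsqrt power2_le_imp_le[of 1 "norm (dir s)"])
qed

text \<open>The slice identities of all elements are added. On one side stands the integral of the
  quadratic form of the symmetric gradient along the ray, on the other the crossing values minus the
  value at \<open>x\<close>. The signed trace values sum to zero and may be subtracted, which leaves
  differences between the field and its trace.\<close>

lemma slice_bound:
  assumes T0: "T0 \<in> elements M" "x \<in> T0" and s: "s \<in> {0..1}"
    and g: "\<And>T. T \<in> elements M \<Longrightarrow> star_element.generic_line M T x (dir s)"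
    and ray: "ray_function F K D"
  shows "\<bar>P T0 1 x + s * P T0 2 x\<bar> \<le> 2 * ray_function.ray F D x s
    + sqrt 2 * (\<Sum>T\<in>elements M. jsum T * indicator (tube (star_centre T) (diameter T) x) s)"
proof -
  let ?\<xi> = "dir s" and ?p = "\<lambda>t. x + t *\<^sub>R dir s"
  interpret ray_function F K D by (rule ray)
  define f where "f T y = P T 1 y + s * P T 2 y" for T y
  define f' where "f' T y = pd 1 (f T) y + s * pd 2 (f T) y" for T y
  have fP: "f T \<in> pfun l" if "T \<in> elements M" for T
    unfolding f_def[abs_def] by (intro pfun_add pfun_scale P that)
  have f_inner: "f T y = (\<chi> i. P T i y) \<bullet> ?\<xi>" for T y
    by (simp add: f_def inner_vec_def sum_2 mult.commute)
  have f'_eq: "f' T y = ?\<xi> \<bullet> (sym_grad_of (P T) y *v ?\<xi>)" if T: "T \<in> elements M" for T y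
  proof -
    have "pd i (f T) y = pd i (P T 1) y + s * pd i (P T 2) y" for i
      unfolding f_def[abs_def] by (simp add: pd_add[OF P[OF T] pfun_scale[OF P[OF T]]] pd_scale[OF P[OF T]])
    then have "f' T y = ?\<xi> \<bullet> ((\<chi> i j. pd j (P T i) y) *v ?\<xi>)"
      by (simp add: f'_def inner_vec_def matrix_vector_mult_def sum_2 algebra_simps)
    then show ?thesis unfolding sym_grad_of_def using sym_part_quadratic by metis
  qed
  have f'_le: "\<bar>f' T y\<bar> \<le> 2 * norm (sym_grad_of (P T) y)" if T: "T \<in> elements M" for T y
  proof -
    have "\<bar>f' T y\<bar> \<le> norm ?\<xi> * norm (sym_grad_of (P T) y *v ?\<xi>)" unfolding f'_eq[OF T] by (rule Cauchy_Schwarz_ineq2)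
    also have "\<dots> \<le> norm ?\<xi> * (norm (sym_grad_of (P T) y) * norm ?\<xi>)"
      by (intro mult_left_mono norm_matrix_vector_le) simp
    also have "\<dots> = (norm ?\<xi> * norm ?\<xi>) * norm (sym_grad_of (P T) y)" by simp
    also have "\<dots> \<le> (sqrt 2 * sqrt 2) * norm (sym_grad_of (P T) y)"
      by (intro mult_right_mono mult_mono norm_dir[OF s]) auto
    finally show ?thesis by simp
  qed
  have xc: "x \<in> closure \<Omega>" using T0 element_subset closure_subset by blast
  have far: "?p t \<notin> closure T" if T: "T \<in> elements M" and t: "D \<le> t" for T t
  proof
    assume "?p t \<in> closure T"
    then have "dist x (?p t) < D" using closure_domain_dist[OF xc] element_closure_subset[OF T] by blast
    moreover have "dist x (?p t) = t * norm ?\<xi>" using t D_pos by (simp add: dist_norm)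
    moreover have "t * 1 \<le> t * norm ?\<xi>" by (intro mult_left_mono norm_dir(2)[OF s]) (use t D_pos in simp)
    ultimately show False using t by linarith
  qed
  define B where "B T = (\<Sum>E\<in>element_edges M T. \<omega>TE M T E * sgn (normal M E \<bullet> ?\<xi>) * (\<Sum>t | 0 < t \<and> ?p t \<in> E. f T (?p t)))" for T
  have hi: "((\<lambda>t. indicator T (?p t) * f' T (?p t)) has_integral (B T - indicator T x * f T x)) {0..D}" if T: "T \<in> elements M" for T
    unfolding B_def
    by (rule star_element.slice_integral[OF star_element[OF T] g[OF T] frontier_avoid[OF T0 T] D_pos far[OF T]])
      (use pfun_line_derivative[OF fP[OF T], of x "dir s" _ UNIV] in \<open>auto simp: f'_def\<close>)
  define V where "V = (\<Sum>T\<in>elements M. B T) - f T0 x"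
  have "((\<lambda>t. \<Sum>T\<in>elements M. indicator T (?p t) * f' T (?p t)) has_integral (\<Sum>T\<in>elements M. B T - indicator T x * f T x)) {0..D}"
    by (rule has_integral_sum[OF finite_elements hi])
  also have "(\<Sum>T\<in>elements M. B T - indicator T x * f T x) = V"
    unfolding V_def sum_subtractf using sum_elements_at[OF T0, of "\<lambda>T. f T x"] by simp
  finally have hV: "((\<lambda>t. \<Sum>T\<in>elements M. indicator T (?p t) * f' T (?p t)) has_integral V) {0..D}" .
  have Fi: "set_integrable lborel {0..D} (\<lambda>t. F (?p t))" by (rule bounded_set_integrable[OF line_measurable F_abs])
  have "\<bar>V\<bar> \<le> integral {0..D} (\<lambda>t. 2 * F (?p t))"
  proof -
    have "norm (integral {0..D} (\<lambda>t. \<Sum>T\<in>elements M. indicator T (?p t) * f' T (?p t))) \<le> integral {0..D} (\<lambda>t. 2 * F (?p t))"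
    proof (rule integral_norm_bound_integral)
      show "(\<lambda>t. \<Sum>T\<in>elements M. indicator T (?p t) * f' T (?p t)) integrable_on {0..D}" using hV by blast
      show "(\<lambda>t. 2 * F (?p t)) integrable_on {0..D}"
        using integrable_cmul[OF set_borel_integral_eq_integral(1)[OF Fi], of 2] by simp
      fix t
      have "norm (\<Sum>T\<in>elements M. indicator T (?p t) * f' T (?p t)) \<le> (\<Sum>T\<in>elements M. norm (indicator T (?p t) * f' T (?p t)))"
        by (rule norm_sum)
      also have "\<dots> \<le> (\<Sum>T\<in>elements M. 2 * (indicator T (?p t) * norm (sym_grad_of (P T) (?p t))))"
        by (rule sum_mono) (use f'_le in \<open>auto simp: indicator_def\<close>)
      finally show "norm (\<Sum>T\<in>elements M. indicator T (?p t) * f' T (?p t)) \<le> 2 * F (?p t)"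
        by (simp add: F_def sum_distrib_left)
    qed
    then show ?thesis using hV by (simp add: integral_unique)
  qed
  also have "\<dots> = 2 * ray x s"
    unfolding ray_def using set_borel_integral_eq_integral(2)[OF Fi] by simp
  finally have V: "\<bar>V\<bar> \<le> 2 * ray x s" .
  \<comment> \<open>The trace at the crossing with the sign of the normal but without
    \<open>\<omega>TE\<close>: a quantity of the edge alone, as \<open>trace_cancel\<close>
    requires.\<close>
  define Q where "Q E = sgn (normal M E \<bullet> ?\<xi>) * (\<Sum>t | 0 < t \<and> ?p t \<in> E. tr E (?p t) \<bullet> ?\<xi>)" for E
  have "(\<Sum>T\<in>elements M. \<Sum>E\<in>element_edges M T. \<omega>TE M T E * Q E) = 0"
    by (rule trace_cancel) (simp add: Q_def tr0)
  then have BJ: "(\<Sum>T\<in>elements M. B T) = (\<Sum>T\<in>elements M. \<Sum>E\<in>element_edges M T. \<omega>TE M T E * sgn (normal M E \<bullet> ?\<xi>) *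
      (\<Sum>t | 0 < t \<and> ?p t \<in> E. f T (?p t) - tr E (?p t) \<bullet> ?\<xi>))"
    unfolding B_def Q_def by (simp add: sum_subtractf right_diff_distrib mult.assoc)
  have "\<bar>\<Sum>T\<in>elements M. B T\<bar> \<le> (\<Sum>T\<in>elements M. jsum T * sqrt 2 * indicator (tube (star_centre T) (diameter T) x) s)"
    unfolding BJ
  proof (rule order.trans[OF sum_abs], rule sum_mono)
    fix T assume T: "T \<in> elements M"
    interpret regular_element M T "star_centre T" "\<rho> * diameter T" \<rho> by (rule regular_element[OF T])
    let ?I = "indicator (tube (star_centre T) (diameter T) x) s :: real"
    have "\<bar>\<Sum>E\<in>element_edges M T. \<omega>TE M T E * sgn (normal M E \<bullet> ?\<xi>) * (\<Sum>t | 0 < t \<and> ?p t \<in> E. f T (?p t) - tr E (?p t) \<bullet> ?\<xi>)\<bar>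
      \<le> (\<Sum>E\<in>element_edges M T. j T E * sqrt 2 * ?I)"
    proof (rule order.trans[OF sum_abs], rule sum_mono)
      fix E assume E: "E \<in> element_edges M T"
      let ?S = "\<Sum>t | 0 < t \<and> ?p t \<in> E. f T (?p t) - tr E (?p t) \<bullet> ?\<xi>"
      have os: "\<bar>\<omega>TE M T E * sgn (normal M E \<bullet> ?\<xi>)\<bar> \<le> 1" by (simp add: \<omega>TE_def abs_mult sgn_if)
      have "\<bar>?S\<bar> \<le> j T E * sqrt 2 * ?I"
      proof (cases "{t. 0 < t \<and> ?p t \<in> E} = {}")
        case True
        have "0 \<le> j T E * sqrt 2 * ?I" using j0[OF T E] by simp
        then show ?thesis unfolding True by simp
      next
        case False
        then obtain t where t: "0 < t" "?p t \<in> E" by blast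
        have "{t. 0 < t \<and> ?p t \<in> E} = {t}" using crossing_unique[OF g[OF T] E _ t(2)] t by blast
        then have "\<bar>?S\<bar> = \<bar>((\<chi> i. P T i (?p t)) - tr E (?p t)) \<bullet> ?\<xi>\<bar>" by (simp add: f_inner inner_diff_left)
        also have "\<dots> \<le> norm ((\<chi> i. P T i (?p t)) - tr E (?p t)) * norm ?\<xi>" by (rule Cauchy_Schwarz_ineq2)
        also have "\<dots> \<le> j T E * sqrt 2" by (intro mult_mono j[OF T E t(2)] norm_dir[OF s] j0[OF T E]) auto
        \<comment> \<open>The crossing point is within \<open>diameter T\<close> of the centre; the
          factor 2 in \<open>tube\<close> pays for two coordinates with
          \<open>s \<le> 1\<close>.\<close>
        also have "s \<in> tube (star_centre T) (diameter T) x"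
        proof -
          have "?p t \<in> closure T" using t(2) closure_edge_subset[OF E] closure_subset by blast
          then have n: "norm (star_centre T - ?p t) \<le> diameter T" using closure_cball by (auto simp: dist_norm)
          let ?e = "star_centre T - ?p t"
          have "\<bar>?e $ 1\<bar> \<le> diameter T" "\<bar>?e $ 2\<bar> \<le> diameter T"
            using component_le_norm_cart[of ?e] n order.trans by blast+
          moreover have "\<bar>s * ?e $ 1\<bar> \<le> 1 * \<bar>?e $ 1\<bar>" unfolding abs_mult by (rule mult_right_mono) (use s in auto)
          ultimately have "\<bar>?e $ 2 - s * ?e $ 1\<bar> \<le> 2 * diameter T" by linarith
          moreover have "?e $ 2 - s * ?e $ 1 = (star_centre T $ 2 - x $ 2) - s * (star_centre T $ 1 - x $ 1)"
            by (simp add: algebra_simps)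
          ultimately show ?thesis by (simp add: tube_def)
        qed
        then have "j T E * sqrt 2 = j T E * sqrt 2 * ?I" by simp
        finally show ?thesis .
      qed
      then have "\<bar>\<omega>TE M T E * sgn (normal M E \<bullet> ?\<xi>)\<bar> * \<bar>?S\<bar> \<le> 1 * (j T E * sqrt 2 * ?I)"
        by (intro mult_mono os) auto
      then show "\<bar>\<omega>TE M T E * sgn (normal M E \<bullet> ?\<xi>) * ?S\<bar> \<le> j T E * sqrt 2 * ?I" by (simp add: abs_mult)
    qed
    also have "\<dots> = jsum T * sqrt 2 * ?I" by (simp add: jsum_def sum_distrib_right)
    finally show "\<bar>\<Sum>E\<in>element_edges M T. \<omega>TE M T E * sgn (normal M E \<bullet> ?\<xi>) * (\<Sum>t | 0 < t \<and> ?p t \<in> E. f T (?p t) - tr E (?p t) \<bullet> ?\<xi>)\<bar>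
      \<le> jsum T * sqrt 2 * ?I" .
  qed
  then have B: "\<bar>\<Sum>T\<in>elements M. B T\<bar> \<le> sqrt 2 * (\<Sum>T\<in>elements M. jsum T * indicator (tube (star_centre T) (diameter T) x) s)"
    by (simp add: sum_distrib_left mult_ac)
  have "\<bar>f T0 x\<bar> \<le> \<bar>V\<bar> + \<bar>\<Sum>T\<in>elements M. B T\<bar>" unfolding V_def by linarith
  then show ?thesis using V B by (simp add: f_def)
qed

text \<open>A discrete potential of the jumps: each element enters with the bound of
  \<open>tube_average\<close> for the fraction of rays that can meet it.\<close>

definition schur :: "point \<Rightarrow> real" where
  "schur x = (\<Sum>T\<in>elements M. jsum T * (diameter T / (diameter T + dist x (star_centre T))))"

text \<open>The slice bound is averaged over the slopes. The two components contribute
  \<open>4\<^sup>2 + 6\<^sup>2 = 52\<close>; splitting the square of the sum doubles this, and the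
  factors \<open>2\<^sup>2\<close> and \<open>2 * 13\<^sup>2\<close> give 416 and 35152.\<close>

lemma pointwise_bound:
  assumes T0: "T0 \<in> elements M" "x \<in> T0" and ray: "ray_function F K D"
  shows "(norm (\<chi> i. P T0 i x))\<^sup>2 \<le> 416 * D * set_lebesgue_integral lborel {0..1} (ray_function.ray2 F D x) + 35152 * (schur x)\<^sup>2"
proof -
  interpret ray_function F K D by (rule ray)
  let ?N = "{s. \<exists>T\<in>elements M. \<not> star_element.generic_line M T x (dir s)}"
  let ?i = "\<lambda>T s. indicator (tube (star_centre T) (diameter T) x) s :: real"
  define c where "c s = 2 * ray x s + sqrt 2 * (\<Sum>T\<in>elements M. jsum T * ?i T s)" for s
  define A where "A = set_lebesgue_integral lborel {0..1} (ray x)"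
  have ti: "set_integrable lborel {0..1} (?i T)" for T
    by (rule bounded_set_integrable[of _ 1, OF borel_measurable_indicator[OF tube_sets]]) (simp add: indicator_def)
  have si: "set_integrable lborel {0..1} (\<lambda>s. \<Sum>T\<in>elements M. jsum T * ?i T s)"
    and se: "set_lebesgue_integral lborel {0..1} (\<lambda>s. \<Sum>T\<in>elements M. jsum T * ?i T s)
      = (\<Sum>T\<in>elements M. jsum T * set_lebesgue_integral lborel {0..1} (?i T))"
  proof -
    have i: "set_integrable lborel {0..1} (\<lambda>s. jsum T * ?i T s)" for T using ti by simp
    show "set_integrable lborel {0..1} (\<lambda>s. \<Sum>T\<in>elements M. jsum T * ?i T s)"
      using i unfolding set_integrable_def scaleR_sum_right by (rule Bochner_Integration.integrable_sum)
    have "set_lebesgue_integral lborel {0..1} (\<lambda>s. \<Sum>T\<in>elements M. jsum T * ?i T s)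
      = (\<Sum>T\<in>elements M. set_lebesgue_integral lborel {0..1} (\<lambda>s. jsum T * ?i T s))"
      using i unfolding set_lebesgue_integral_def set_integrable_def scaleR_sum_right
      by (rule Bochner_Integration.integral_sum)
    then show "set_lebesgue_integral lborel {0..1} (\<lambda>s. \<Sum>T\<in>elements M. jsum T * ?i T s)
      = (\<Sum>T\<in>elements M. jsum T * set_lebesgue_integral lborel {0..1} (?i T))" by simp
  qed
  have ci: "set_integrable lborel {0..1} c"
    unfolding c_def[abs_def] by (intro set_integral_add(1)) (use ray_integrable si in auto)
  have "set_lebesgue_integral lborel {0..1} c = 2 * A + sqrt 2 * (\<Sum>T\<in>elements M. jsum T * set_lebesgue_integral lborel {0..1} (?i T))"
    unfolding c_def[abs_def] A_def by (subst set_integral_add(2)) (use ray_integrable si in \<open>auto simp: se\<close>)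
  also have "\<dots> \<le> 2 * A + sqrt 2 * (13 * schur x)"
    unfolding schur_def sum_distrib_left
  proof (intro add_left_mono sum_mono mult_left_mono)
    fix T assume T: "T \<in> elements M"
    have h: "0 < diameter T" using regular_element.h_pos[OF regular_element[OF T]] .
    have "jsum T * set_lebesgue_integral lborel {0..1} (?i T) \<le> jsum T * (13 * (diameter T / (diameter T + dist x (star_centre T))))"
      by (intro mult_left_mono tube_average[OF h] jsum_nonneg[OF T])
    then show "jsum T * set_lebesgue_integral lborel {0..1} (?i T) \<le> 13 * (jsum T * (diameter T / (diameter T + dist x (star_centre T))))"
      by (simp add: mult.left_commute)
  qed simp
  finally have C: "set_lebesgue_integral lborel {0..1} c \<le> 2 * A + sqrt 2 * (13 * schur x)" .
  have le: "\<bar>P T0 1 x + s * P T0 2 x\<bar> \<le> c s" if "s \<in> {0..1}" "s \<notin> ?N" for s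
    unfolding c_def by (rule slice_bound[OF T0 that(1) _ ray]) (use that in auto)
  define I where "I = set_lebesgue_integral lborel {0..1} c"
  note da = direction_average[OF ci finite_bad_directions[OF T0] le, folded I_def]
  have I0: "0 \<le> I" using da(1) by linarith
  have "(P T0 1 x)\<^sup>2 \<le> (4 * I)\<^sup>2" "(P T0 2 x)\<^sup>2 \<le> (6 * I)\<^sup>2"
    unfolding abs_le_square_iff[symmetric] using da I0 by auto
  then have "(norm (\<chi> i. P T0 i x))\<^sup>2 \<le> 52 * I\<^sup>2"
    unfolding power2_norm_eq_inner by (simp add: inner_vec_def sum_2 power2_eq_square)
  also have "52 * I\<^sup>2 \<le> 52 * (2 * A + sqrt 2 * (13 * schur x))\<^sup>2"
    using C I0 unfolding I_def[symmetric] by (intro mult_left_mono power_mono) auto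
  also have "\<dots> \<le> 52 * (2 * (2 * A)\<^sup>2 + 2 * (sqrt 2 * (13 * schur x))\<^sup>2)"
  proof -
    have "0 \<le> (2 * A - sqrt 2 * (13 * schur x))\<^sup>2" by simp
    then show ?thesis by (simp add: power2_sum power2_diff)
  qed
  also have "\<dots> = 416 * A\<^sup>2 + 35152 * (schur x)\<^sup>2" by (simp add: power_mult_distrib)
  also have "\<dots> \<le> 416 * (D * set_lebesgue_integral lborel {0..1} (ray2 x)) + 35152 * (schur x)\<^sup>2"
    using ray_average_square[of x] unfolding A_def by simp
  finally show ?thesis by simp
qed

abbreviation \<kappa>D :: real where "\<kappa>D \<equiv> kernel_mass D"

text \<open>Each summand is a Riemann-type lower estimate of the kernel integral: the ball inside
  the element has area at least \<open>\<rho>\<^sup>2 * (diameter T)\<^sup>2\<close>, and on it the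
  kernel is at least the inverse of the weight. The balls are disjoint in the domain, so the
  integrals add up to at most one kernel mass.\<close>

lemma schur_weights:
  assumes x: "x \<in> closure \<Omega>"
  shows "(\<Sum>T\<in>elements M. (diameter T)\<^sup>2 / (diameter T + dist x (star_centre T))) \<le> \<kappa>D / \<rho>\<^sup>2"
proof -
  let ?b = "\<lambda>T. ball (star_centre T) (\<rho> * diameter T)"
  let ?w = "\<lambda>T. diameter T + dist x (star_centre T)"
  have bT: "?b T \<subseteq> T" if "T \<in> elements M" for T by (rule star_element.ballT[OF star_element[OF that]])
  have pos: "0 < diameter T" if "T \<in> elements M" for T by (rule regular_element.h_pos[OF regular_element[OF that]])
  have wpos: "0 < ?w T" if "T \<in> elements M" for T using pos[OF that] by (simp add: add_pos_nonneg)
  have one: "ennreal (\<rho>\<^sup>2 * ((diameter T)\<^sup>2 / ?w T)) \<le> (\<integral>\<^sup>+y. kernel (y - x) * indicator (?b T) y \<partial>lborel)"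
    if T: "T \<in> elements M" for T
  proof -
    let ?q = "\<rho> * diameter T"
    \<comment> \<open>A square of side \<open>?q\<close> has half diagonal
      \<open>?q / sqrt 2\<close> and fits into the ball; its area is an elementary product.\<close>
    let ?Q = "cbox (star_centre T - (?q / 2) *\<^sub>R 1) (star_centre T + (?q / 2) *\<^sub>R 1)"
    have q: "0 < ?q" using pos[OF T] \<rho> by simp
    have Qb: "?Q \<subseteq> ?b T"
    proof
      fix y assume "y \<in> ?Q"
      then have "star_centre T $ i - ?q / 2 \<le> y $ i \<and> y $ i \<le> star_centre T $ i + ?q / 2" for i
        by (simp add: mem_box_cart)
      then have c: "\<bar>(star_centre T - y) $ i\<bar> \<le> ?q / 2" for i
        unfolding abs_le_iff vector_minus_component by (smt (verit))
      have "(norm (star_centre T - y))\<^sup>2 = ((star_centre T - y) $ 1)\<^sup>2 + ((star_centre T - y) $ 2)\<^sup>2"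
        unfolding power2_norm_eq_inner by (simp add: inner_vec_def sum_2 power2_eq_square)
      also have "\<dots> \<le> (?q / 2)\<^sup>2 + (?q / 2)\<^sup>2"
        using power_mono[OF c[of 1], of 2] power_mono[OF c[of 2], of 2] by (simp add: add_mono)
      also have "\<dots> < ?q\<^sup>2"
      proof -
        have "(?q / 2)\<^sup>2 + (?q / 2)\<^sup>2 = ?q\<^sup>2 / 2" by (simp add: power_divide)
        moreover have "0 < ?q\<^sup>2" using q by (rule zero_less_power)
        ultimately show ?thesis by linarith
      qed
      finally have "norm (star_centre T - y) < ?q" using q by (intro power2_less_imp_less[of _ ?q]) auto
      then show "y \<in> ?b T" by (simp add: dist_norm)
    qed
    have "measure lborel ?Q = ?q\<^sup>2"
      using content_cbox_cart[of "star_centre T - (?q / 2) *\<^sub>R 1" "star_centre T + (?q / 2) *\<^sub>R 1"] q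
      by (simp add: interval_ne_empty_cart UNIV_2 power2_eq_square)
    then have Qm: "emeasure lborel ?Q = ennreal (?q\<^sup>2)" by (subst emeasure_eq_ennreal_measure) (auto simp: emeasure_lborel_cbox_eq)
    have "ennreal (\<rho>\<^sup>2 * ((diameter T)\<^sup>2 / ?w T)) = ennreal (1 / ?w T) * emeasure lborel ?Q"
      unfolding Qm using wpos[OF T] by (subst ennreal_mult[symmetric]) (auto simp: power_mult_distrib)
    also have "\<dots> = (\<integral>\<^sup>+y. ennreal (1 / ?w T) * indicator ?Q y \<partial>lborel)" by (simp add: nn_integral_cmult)
    also have "\<dots> \<le> (\<integral>\<^sup>+y. kernel (y - x) * indicator (?b T) y \<partial>lborel)"
    proof (rule nn_integral_mono)
      fix y
      show "ennreal (1 / ?w T) * indicator ?Q y \<le> kernel (y - x) * indicator (?b T) y"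
      proof (cases "y \<in> ?Q")
        case True
        then have yb: "y \<in> ?b T" using Qb by blast
        have "y \<in> closure T" using bT[OF T] yb closure_subset by blast
        then have "dist (star_centre T) y \<le> diameter T"
          using regular_element.closure_cball[OF regular_element[OF T]] by auto
        then have "norm (y - x) \<le> ?w T"
          using dist_triangle[of y x "star_centre T"] by (simp add: dist_norm[symmetric] dist_commute)
        then show ?thesis using kernel_ge[OF wpos[OF T]] True yb by simp
      qed simp
    qed
    finally show ?thesis .
  qed
  have km: "kernel \<in> borel_measurable borel"
    unfolding kernel_def[abs_def] by (intro borel_measurable_prod_ennreal measurable_compose[OF _ root_kernel_meas]) auto
  have "ennreal (\<rho>\<^sup>2 * (\<Sum>T\<in>elements M. (diameter T)\<^sup>2 / ?w T)) = (\<Sum>T\<in>elements M. ennreal (\<rho>\<^sup>2 * ((diameter T)\<^sup>2 / ?w T)))"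
    unfolding sum_distrib_left by (rule sum_ennreal[symmetric]) (intro mult_nonneg_nonneg divide_nonneg_nonneg zero_le_power2 less_imp_le[OF wpos])
  also have "\<dots> \<le> (\<Sum>T\<in>elements M. \<integral>\<^sup>+y. kernel (y - x) * indicator (?b T) y \<partial>lborel)" by (rule sum_mono) (rule one)
  also have "\<dots> = (\<integral>\<^sup>+y. (\<Sum>T\<in>elements M. kernel (y - x) * indicator (?b T) y) \<partial>lborel)"
  proof (rule nn_integral_sum[symmetric])
    fix T show "(\<lambda>y. kernel (y - x) * indicator (?b T) y) \<in> borel_measurable lborel"
      using measurable_compose[OF _ km, of "\<lambda>y. y - x" borel]
      by (intro borel_measurable_times_ennreal borel_measurable_indicator) auto
  qed
  also have "\<dots> \<le> (\<integral>\<^sup>+y. kernel (y - x) * indicator \<Omega> y \<partial>lborel)"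
  proof (rule nn_integral_mono)
    fix y
    show "(\<Sum>T\<in>elements M. kernel (y - x) * indicator (?b T) y) \<le> kernel (y - x) * indicator \<Omega> y"
    proof (cases "\<exists>T\<in>elements M. y \<in> ?b T")
      case True
      then obtain T where T: "T \<in> elements M" "y \<in> ?b T" by blast
      have "y \<in> T" using bT[OF T(1)] T(2) by blast
      have "(\<Sum>T'\<in>elements M. kernel (y - x) * indicator (?b T') y) = (\<Sum>T'\<in>{T}. kernel (y - x) * indicator (?b T') y)"
      proof (rule sum.mono_neutral_right[OF finite_elements])
        show "\<forall>T'\<in>elements M - {T}. kernel (y - x) * indicator (?b T') y = 0"
        proof
          fix T' assume T': "T' \<in> elements M - {T}"
          then have "y \<notin> ?b T'" using elements_disjoint[OF T(1), of T'] bT[of T'] \<open>y \<in> T\<close> by blast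
          then show "kernel (y - x) * indicator (?b T') y = 0" by simp
        qed
      qed (use T in auto)
      also have "\<dots> = kernel (y - x) * indicator \<Omega> y" using T(2) element_subset[OF T(1)] \<open>y \<in> T\<close> by (simp add: subset_iff)
      finally show ?thesis by simp
    next
      case False
      then have "(\<Sum>T\<in>elements M. kernel (y - x) * indicator (?b T) y) = 0" by (intro sum.neutral) auto
      then show ?thesis by simp
    qed
  qed
  also have "\<dots> \<le> ennreal \<kappa>D"
  proof (rule kernel_integral)
    show "norm (y - x) \<le> D" if "y \<in> \<Omega>" for y
      using closure_domain_dist[OF x, of y] that closure_subset[of \<Omega>] by (auto simp: dist_norm norm_minus_commute)
  qed (use D_pos in simp)
  finally have "\<rho>\<^sup>2 * (\<Sum>T\<in>elements M. (diameter T)\<^sup>2 / ?w T) \<le> \<kappa>D"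
    by (simp add: ennreal_le_iff kernel_mass_nonneg)
  then show ?thesis using \<rho> by (simp add: pos_le_divide_eq mult.commute)
qed

text \<open>Cauchy-Schwarz with the weight distributed evenly over both factors; the factor without
  jumps is bounded uniformly by \<open>schur_weights\<close>.\<close>

lemma schur_square:
  assumes x: "x \<in> closure \<Omega>"
  shows "(schur x)\<^sup>2 \<le> \<kappa>D / \<rho>\<^sup>2 * (\<Sum>T\<in>elements M. (jsum T)\<^sup>2 / (diameter T + dist x (star_centre T)))"
proof -
  let ?w = "\<lambda>T. diameter T + dist x (star_centre T)"
  have wpos: "0 < ?w T" if "T \<in> elements M" for T
    using regular_element.h_pos[OF regular_element[OF that]] by (simp add: add_pos_nonneg)
  have "schur x = (\<Sum>T\<in>elements M. (diameter T / sqrt (?w T)) * (jsum T / sqrt (?w T)))"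
    unfolding schur_def
  proof (rule sum.cong[OF refl])
    fix T assume "T \<in> elements M"
    then have "sqrt (?w T) * sqrt (?w T) = ?w T" using less_imp_le[OF wpos] by simp
    then show "jsum T * (diameter T / ?w T) = (diameter T / sqrt (?w T)) * (jsum T / sqrt (?w T))"
      by (simp add: mult.commute)
  qed
  also have "\<dots>\<^sup>2 \<le> (\<Sum>T\<in>elements M. (diameter T / sqrt (?w T))\<^sup>2) * (\<Sum>T\<in>elements M. (jsum T / sqrt (?w T))\<^sup>2)"
    by (rule Cauchy_Schwarz_ineq_sum)
  also have "(\<Sum>T\<in>elements M. (diameter T / sqrt (?w T))\<^sup>2) = (\<Sum>T\<in>elements M. (diameter T)\<^sup>2 / ?w T)"
    by (rule sum.cong) (use wpos in \<open>auto simp: power_divide less_imp_le\<close>)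
  also have "(\<Sum>T\<in>elements M. (jsum T / sqrt (?w T))\<^sup>2) = (\<Sum>T\<in>elements M. (jsum T)\<^sup>2 / ?w T)"
    by (rule sum.cong) (use wpos in \<open>auto simp: power_divide less_imp_le\<close>)
  also have "(\<Sum>T\<in>elements M. (diameter T)\<^sup>2 / ?w T) * (\<Sum>T\<in>elements M. (jsum T)\<^sup>2 / ?w T)
      \<le> \<kappa>D / \<rho>\<^sup>2 * (\<Sum>T\<in>elements M. (jsum T)\<^sup>2 / ?w T)"
    by (rule mult_right_mono[OF schur_weights[OF x]]) (intro sum_nonneg divide_nonneg_nonneg, use wpos in \<open>auto intro: less_imp_le\<close>)
  finally show ?thesis .
qed

text \<open>The other half of the Schur test: the same kernel, now integrated in \<open>x\<close>
  for a fixed element.\<close>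

lemma schur_integral:
  assumes T: "T \<in> elements M"
  shows "(\<integral>\<^sup>+x. ennreal (1 / (diameter T + dist x (star_centre T))) * indicator \<Omega> x \<partial>lborel) \<le> ennreal \<kappa>D"
proof -
  have h: "0 < diameter T" by (rule regular_element.h_pos[OF regular_element[OF T]])
  have "(\<integral>\<^sup>+x. ennreal (1 / (diameter T + dist x (star_centre T))) * indicator \<Omega> x \<partial>lborel)
      \<le> (\<integral>\<^sup>+x. kernel (x - star_centre T) * indicator \<Omega> x \<partial>lborel)"
    by (intro nn_integral_mono mult_right_mono kernel_ge) (use h in \<open>auto simp: add_pos_nonneg dist_norm\<close>)
  also have "\<dots> \<le> ennreal \<kappa>D"
  proof (rule kernel_integral)
    have "star_centre T \<in> closure \<Omega>"
      using star_element.zT[OF star_element[OF T]] element_subset[OF T] closure_subset by blast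
    then show "norm (y - star_centre T) \<le> D" if "y \<in> \<Omega>" for y
      using closure_domain_dist[OF _ subsetD[OF closure_subset that], of "star_centre T"]
      by (simp add: dist_norm norm_minus_commute)
  qed (use D_pos in simp)
  finally show ?thesis .
qed

section \<open>Sums of element integrals as one nonnegative integral\<close>

lemma area_integral_nn:
  assumes "open T" "bounded T" "continuous_on (closure T) f" "\<And>x. 0 \<le> f x"
  shows "ennreal (area_integral T f) = (\<integral>\<^sup>+x. ennreal (indicator T x * f x) \<partial>lborel)"
proof -
  have "integrable lborel (\<lambda>x. indicator T x * f x)"
    using area_integrable[OF assms(1-3)] by (simp add: set_integrable_def)
  then have "(\<integral>\<^sup>+x. ennreal (indicator T x * f x) \<partial>lborel) = ennreal (\<integral>x. indicator T x * f x \<partial>lborel)"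
    by (rule nn_integral_eq_integral) (use assms(4) in auto)
  then show ?thesis by (simp add: area_integral_def set_lebesgue_integral_def)
qed

lemma area_sum_nn:
  assumes c: "\<And>T. T \<in> elements M \<Longrightarrow> continuous_on (closure T) (f T)" and n: "\<And>T x. 0 \<le> f T x"
  shows "ennreal (\<Sum>T\<in>elements M. area_integral T (f T)) = (\<integral>\<^sup>+x. ennreal (\<Sum>T\<in>elements M. indicator T x * f T x) \<partial>lborel)"
proof -
  have "ennreal (\<Sum>T\<in>elements M. area_integral T (f T)) = (\<Sum>T\<in>elements M. ennreal (area_integral T (f T)))"
    by (rule sum_ennreal[symmetric]) (rule area_integral_nonneg, rule n)
  also have "\<dots> = (\<Sum>T\<in>elements M. \<integral>\<^sup>+x. ennreal (indicator T x * f T x) \<partial>lborel)"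
    by (rule sum.cong[OF refl]) (intro area_integral_nn open_element bounded_element c n)
  also have "\<dots> = (\<integral>\<^sup>+x. (\<Sum>T\<in>elements M. ennreal (indicator T x * f T x)) \<partial>lborel)"
  proof (rule nn_integral_sum[symmetric])
    fix T assume T: "T \<in> elements M"
    have "integrable lborel (\<lambda>x. indicator T x * f T x)"
      using area_integrable[OF open_element[OF T] bounded_element[OF T] c[OF T]] by (simp add: set_integrable_def)
    then show "(\<lambda>x. ennreal (indicator T x * f T x)) \<in> borel_measurable lborel" by auto
  qed
  also have "\<dots> = (\<integral>\<^sup>+x. ennreal (\<Sum>T\<in>elements M. indicator T x * f T x) \<partial>lborel)"
    by (intro nn_integral_cong sum_ennreal) (use n in auto)
  finally show ?thesis .
qed

text \<open>The pointwise bound is integrated over the domain. One factor \<open>D\<close> comes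
  from the ray average and one from \<open>ray2_total\<close>; likewise one kernel mass comes from
  \<open>schur_square\<close> and one from \<open>schur_integral\<close>. Nonnegative integrals are
  used so that the majorant only has to be measurable.\<close>

theorem broken_poincare:
  "(\<Sum>T\<in>elements M. area_integral T (\<lambda>x. (norm (\<chi> i. P T i x))\<^sup>2)) \<le>
    416 * D\<^sup>2 * (\<Sum>T\<in>elements M. area_integral T (\<lambda>x. sym_grad_of (P T) x \<bullet> sym_grad_of (P T) x))
    + 35152 * \<kappa>D\<^sup>2 / \<rho>\<^sup>2 * (\<Sum>T\<in>elements M. (jsum T)\<^sup>2)"
proof -
  obtain K where ray: "ray_function F K D" using F_ray_function by blast
  interpret ray_function F K D by (rule ray)
  let ?u = "\<lambda>T x. (norm (\<chi> i. P T i x))\<^sup>2"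
  let ?S = "\<lambda>T x. sym_grad_of (P T) x \<bullet> sym_grad_of (P T) x"
  let ?w = "\<lambda>T x. diameter T + dist x (star_centre T)"
  have wpos: "0 < ?w T x" if "T \<in> elements M" for T x
    using regular_element.h_pos[OF regular_element[OF that]] by (simp add: add_pos_nonneg)
  define c where "c = 35152 * (\<kappa>D / \<rho>\<^sup>2)"
  have c0: "0 \<le> c" using kernel_mass_nonneg by (simp add: c_def)
  have uc: "continuous_on (closure T) (?u T)" if T: "T \<in> elements M" for T
    by (intro continuous_intros continuous_on_vec_lambda pfun_continuous_on[OF P[OF T]])
  have Sc: "continuous_on (closure T) (?S T)" if T: "T \<in> elements M" for T
    by (intro continuous_on_inner sym_grad_continuous T)
  have F2: "(F x)\<^sup>2 = (\<Sum>T\<in>elements M. indicator T x * ?S T x)" for x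
  proof (cases "\<exists>T\<in>elements M. x \<in> T")
    case True
    then obtain T where T: "T \<in> elements M" "x \<in> T" by blast
    show ?thesis unfolding F_def sum_elements_at[OF T] by (simp add: power2_norm_eq_inner)
  next
    case False
    then have "F x = 0" unfolding F_def by (intro sum_elements_outside) auto
    moreover have "(\<Sum>T\<in>elements M. indicator T x * ?S T x) = 0" by (rule sum_elements_outside) (use False in auto)
    ultimately show ?thesis by simp
  qed
  \<comment> \<open>Points outside all elements satisfy the bound trivially, since the left side is
    0 there.\<close>
  have pw: "ennreal (\<Sum>T\<in>elements M. indicator T x * ?u T x) \<le>
      ennreal (416 * D) * ennreal (set_lebesgue_integral lborel {0..1} (ray2 x))
      + (\<Sum>T\<in>elements M. ennreal (c * (jsum T)\<^sup>2) * (ennreal (1 / ?w T x) * indicator \<Omega> x))" for x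
  proof (cases "\<exists>T\<in>elements M. x \<in> T")
    case True
    then obtain T0 where T0: "T0 \<in> elements M" "x \<in> T0" by blast
    have x\<Omega>: "x \<in> \<Omega>" using T0 element_subset by blast
    then have xc: "x \<in> closure \<Omega>" using closure_subset by blast
    have r0: "0 \<le> set_lebesgue_integral lborel {0..1} (ray2 x)"
      unfolding set_lebesgue_integral_def by (intro Bochner_Integration.integral_nonneg) (simp add: ray2_nonneg indicator_def)
    have "(\<Sum>T\<in>elements M. indicator T x * ?u T x) = ?u T0 x" by (rule sum_elements_at[OF T0])
    also have "\<dots> \<le> 416 * D * set_lebesgue_integral lborel {0..1} (ray2 x) + 35152 * (schur x)\<^sup>2"
      by (rule pointwise_bound[OF T0 ray])
    also have "35152 * (schur x)\<^sup>2 \<le> c * (\<Sum>T\<in>elements M. (jsum T)\<^sup>2 / ?w T x)"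
      using schur_square[OF xc] by (simp add: c_def)
    also have "\<dots> = (\<Sum>T\<in>elements M. (c * (jsum T)\<^sup>2) * (1 / ?w T x))" by (simp add: sum_distrib_left)
    finally have "ennreal (\<Sum>T\<in>elements M. indicator T x * ?u T x) \<le>
        ennreal (416 * D * set_lebesgue_integral lborel {0..1} (ray2 x) + (\<Sum>T\<in>elements M. (c * (jsum T)\<^sup>2) * (1 / ?w T x)))"
      by (intro ennreal_leI) simp
    also have "\<dots> = ennreal (416 * D * set_lebesgue_integral lborel {0..1} (ray2 x)) + ennreal (\<Sum>T\<in>elements M. (c * (jsum T)\<^sup>2) * (1 / ?w T x))"
    proof (rule ennreal_plus)
      show "0 \<le> 416 * D * set_lebesgue_integral lborel {0..1} (ray2 x)" using D_pos r0 by simp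
      show "0 \<le> (\<Sum>T\<in>elements M. (c * (jsum T)\<^sup>2) * (1 / ?w T x))"
        by (intro sum_nonneg mult_nonneg_nonneg divide_nonneg_nonneg) (use c0 wpos in \<open>auto intro: less_imp_le\<close>)
    qed
    also have "ennreal (416 * D * set_lebesgue_integral lborel {0..1} (ray2 x)) = ennreal (416 * D) * ennreal (set_lebesgue_integral lborel {0..1} (ray2 x))"
      by (rule ennreal_mult) (use D_pos r0 in auto)
    also have "ennreal (\<Sum>T\<in>elements M. (c * (jsum T)\<^sup>2) * (1 / ?w T x)) = (\<Sum>T\<in>elements M. ennreal ((c * (jsum T)\<^sup>2) * (1 / ?w T x)))"
      by (rule sum_ennreal[symmetric], intro mult_nonneg_nonneg divide_nonneg_nonneg) (use c0 wpos in \<open>auto intro: less_imp_le\<close>)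
    also have "\<dots> = (\<Sum>T\<in>elements M. ennreal (c * (jsum T)\<^sup>2) * (ennreal (1 / ?w T x) * indicator \<Omega> x))"
    proof (rule sum.cong[OF refl])
      fix T assume T: "T \<in> elements M"
      show "ennreal ((c * (jsum T)\<^sup>2) * (1 / ?w T x)) = ennreal (c * (jsum T)\<^sup>2) * (ennreal (1 / ?w T x) * indicator \<Omega> x)"
        using c0 wpos[OF T, of x] x\<Omega> by (subst ennreal_mult) auto
    qed
    finally show ?thesis .
  next
    case False
    then have "(\<Sum>T\<in>elements M. indicator T x * ?u T x) = 0" by (intro sum_elements_outside) auto
    then show ?thesis by simp
  qed
  have wm: "(\<lambda>x. ennreal (1 / ?w T x) * indicator \<Omega> x) \<in> borel_measurable borel" if T: "T \<in> elements M" for T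
  proof -
    have "continuous_on UNIV (\<lambda>x. 1 / ?w T x)" using wpos[OF T] by (intro continuous_intros) (metis less_irrefl)
    then have "(\<lambda>x. 1 / ?w T x) \<in> borel_measurable borel" by (rule borel_measurable_continuous_onI)
    moreover have "open \<Omega>" using domain by (simp add: polygonal_def)
    ultimately show ?thesis by (intro borel_measurable_times_ennreal measurable_compose[OF _ measurable_ennreal] borel_measurable_indicator) auto
  qed
  have rm: "(\<lambda>x. ennreal (set_lebesgue_integral lborel {0..1} (ray2 x))) \<in> borel_measurable borel"
    by (rule ray2_average_measurable)
  have "ennreal (\<Sum>T\<in>elements M. area_integral T (?u T)) = (\<integral>\<^sup>+x. ennreal (\<Sum>T\<in>elements M. indicator T x * ?u T x) \<partial>lborel)"
    by (rule area_sum_nn) (auto intro: uc)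
  also have "\<dots> \<le> (\<integral>\<^sup>+x. ennreal (416 * D) * ennreal (set_lebesgue_integral lborel {0..1} (ray2 x))
      + (\<Sum>T\<in>elements M. ennreal (c * (jsum T)\<^sup>2) * (ennreal (1 / ?w T x) * indicator \<Omega> x)) \<partial>lborel)"
    by (intro nn_integral_mono pw)
  also have "\<dots> = ennreal (416 * D) * (\<integral>\<^sup>+x. ennreal (set_lebesgue_integral lborel {0..1} (ray2 x)) \<partial>lborel)
      + (\<Sum>T\<in>elements M. ennreal (c * (jsum T)\<^sup>2) * (\<integral>\<^sup>+x. ennreal (1 / ?w T x) * indicator \<Omega> x \<partial>lborel))"
  proof -
    let ?W = "\<lambda>T x. ennreal (c * (jsum T)\<^sup>2) * (ennreal (1 / ?w T x) * indicator \<Omega> x)"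
    let ?R = "\<lambda>x. ennreal (set_lebesgue_integral lborel {0..1} (ray2 x))"
    have Wm: "?W T \<in> borel_measurable lborel" if "T \<in> elements M" for T using wm[OF that] by simp
    have "(\<integral>\<^sup>+x. ennreal (416 * D) * ?R x + (\<Sum>T\<in>elements M. ?W T x) \<partial>lborel)
        = (\<integral>\<^sup>+x. ennreal (416 * D) * ?R x \<partial>lborel) + (\<integral>\<^sup>+x. (\<Sum>T\<in>elements M. ?W T x) \<partial>lborel)"
      by (rule nn_integral_add) (use rm Wm in \<open>auto intro!: borel_measurable_sum\<close>)
    also have "(\<integral>\<^sup>+x. ennreal (416 * D) * ?R x \<partial>lborel) = ennreal (416 * D) * (\<integral>\<^sup>+x. ?R x \<partial>lborel)"
      by (rule nn_integral_cmult) (use rm in simp)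
    also have "(\<integral>\<^sup>+x. (\<Sum>T\<in>elements M. ?W T x) \<partial>lborel) = (\<Sum>T\<in>elements M. \<integral>\<^sup>+x. ?W T x \<partial>lborel)"
      by (rule nn_integral_sum[OF Wm])
    also have "\<dots> = (\<Sum>T\<in>elements M. ennreal (c * (jsum T)\<^sup>2) * (\<integral>\<^sup>+x. ennreal (1 / ?w T x) * indicator \<Omega> x \<partial>lborel))"
      by (rule sum.cong[OF refl], rule nn_integral_cmult) (use wm in simp)
    finally show ?thesis .
  qed
  also have "\<dots> \<le> ennreal (416 * D) * (ennreal D * (\<integral>\<^sup>+x. ennreal ((F x)\<^sup>2) \<partial>lborel))
      + (\<Sum>T\<in>elements M. ennreal (c * (jsum T)\<^sup>2) * ennreal \<kappa>D)"
    by (intro add_mono mult_left_mono sum_mono ray2_total schur_integral) auto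
  also have "(\<integral>\<^sup>+x. ennreal ((F x)\<^sup>2) \<partial>lborel) = ennreal (\<Sum>T\<in>elements M. area_integral T (?S T))"
    unfolding F2 by (rule area_sum_nn[symmetric]) (auto intro: Sc)
  also have "ennreal (416 * D) * (ennreal D * ennreal (\<Sum>T\<in>elements M. area_integral T (?S T)))
      = ennreal (416 * D\<^sup>2 * (\<Sum>T\<in>elements M. area_integral T (?S T)))"
  proof -
    have "0 \<le> (\<Sum>T\<in>elements M. area_integral T (?S T))" by (intro sum_nonneg area_integral_nonneg) simp
    then show ?thesis using D_pos by (simp add: ennreal_mult[symmetric] power2_eq_square mult.assoc)
  qed
  also have "(\<Sum>T\<in>elements M. ennreal (c * (jsum T)\<^sup>2) * ennreal \<kappa>D) = ennreal (c * \<kappa>D * (\<Sum>T\<in>elements M. (jsum T)\<^sup>2))"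
  proof -
    have "(\<Sum>T\<in>elements M. ennreal (c * (jsum T)\<^sup>2) * ennreal \<kappa>D) = (\<Sum>T\<in>elements M. ennreal (c * \<kappa>D * (jsum T)\<^sup>2))"
      by (rule sum.cong[OF refl], subst ennreal_mult[symmetric]) (use c0 kernel_mass_nonneg in \<open>auto simp: mult_ac\<close>)
    also have "\<dots> = ennreal (\<Sum>T\<in>elements M. c * \<kappa>D * (jsum T)\<^sup>2)"
      by (rule sum_ennreal) (use c0 kernel_mass_nonneg in auto)
    finally show ?thesis by (simp add: sum_distrib_left)
  qed
  also have "ennreal (416 * D\<^sup>2 * (\<Sum>T\<in>elements M. area_integral T (?S T))) + ennreal (c * \<kappa>D * (\<Sum>T\<in>elements M. (jsum T)\<^sup>2))
      = ennreal (416 * D\<^sup>2 * (\<Sum>T\<in>elements M. area_integral T (?S T)) + c * \<kappa>D * (\<Sum>T\<in>elements M. (jsum T)\<^sup>2))"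
    by (rule ennreal_plus[symmetric])
      (use c0 kernel_mass_nonneg in \<open>auto intro!: mult_nonneg_nonneg sum_nonneg area_integral_nonneg\<close>)
  finally have "(\<Sum>T\<in>elements M. area_integral T (?u T)) \<le> 416 * D\<^sup>2 * (\<Sum>T\<in>elements M. area_integral T (?S T)) + c * \<kappa>D * (\<Sum>T\<in>elements M. (jsum T)\<^sup>2)"
    using c0 kernel_mass_nonneg by (subst (asm) ennreal_le_iff) (auto intro!: add_nonneg_nonneg mult_nonneg_nonneg sum_nonneg area_integral_nonneg)
  then show ?thesis by (simp add: c_def power2_eq_square)
qed

end

section \<open>Coercivity\<close>

lemma stiffness_lower:
  assumes "0 \<le> \<beta>\<^sub>1"
  shows "\<beta>\<^sub>0 * (sym_part B \<bullet> sym_part B) \<le> stiffness \<beta>\<^sub>0 \<beta>\<^sub>1 (sym_part B) \<bullet> sym_part B"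
proof -
  have "stiffness \<beta>\<^sub>0 \<beta>\<^sub>1 (sym_part B) \<bullet> sym_part B = \<beta>\<^sub>0 * (sym_part B \<bullet> sym_part B) + \<beta>\<^sub>1 * (trace (sym_part B))\<^sup>2"
    by (simp add: stiffness_def sym_part_def inner_vec_def sum_2 transpose_def trace_def mat_def power2_eq_square
        algebra_simps add_divide_distrib)
  then show ?thesis using assms by simp
qed

text \<open>The energy norm contains the square of the stress, the form its product with the strain.
  In the plane the squared trace of a matrix is at most twice its squared norm, which bounds the
  squared stress by \<open>(\<beta>\<^sub>0 + 2 * \<beta>\<^sub>1)\<^sup>2\<close> times the squared
  strain.\<close>

lemma stiffness_upper:
  assumes \<beta>: "0 < \<beta>\<^sub>0" "0 < \<beta>\<^sub>1"
  shows "(norm (stiffness \<beta>\<^sub>0 \<beta>\<^sub>1 (sym_part B)))\<^sup>2 \<le>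
    (\<beta>\<^sub>0 + 2 * \<beta>\<^sub>1)\<^sup>2 / \<beta>\<^sub>0 * (stiffness \<beta>\<^sub>0 \<beta>\<^sub>1 (sym_part B) \<bullet> sym_part B)"
proof -
  let ?A = "sym_part B"
  define s where "s = ?A \<bullet> ?A"
  define q where "q = (trace ?A)\<^sup>2"
  have "(norm (stiffness \<beta>\<^sub>0 \<beta>\<^sub>1 ?A))\<^sup>2 = \<beta>\<^sub>0\<^sup>2 * s + (2 * \<beta>\<^sub>0 * \<beta>\<^sub>1 + 2 * \<beta>\<^sub>1\<^sup>2) * q"
    unfolding power2_norm_eq_inner s_def q_def
    by (simp add: stiffness_def sym_part_def inner_vec_def sum_2 transpose_def trace_def mat_def power2_eq_square
        algebra_simps add_divide_distrib)
  also have "\<dots> \<le> \<beta>\<^sub>0\<^sup>2 * s + (2 * \<beta>\<^sub>0 * \<beta>\<^sub>1 + 2 * \<beta>\<^sub>1\<^sup>2) * (2 * s)"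
  proof (intro add_left_mono mult_left_mono)
    have "0 \<le> (?A $ 1 $ 1 - ?A $ 2 $ 2)\<^sup>2 + 2 * (?A $ 1 $ 2)\<^sup>2 + 2 * (?A $ 2 $ 1)\<^sup>2" by simp
    then show "q \<le> 2 * s" unfolding s_def q_def
      by (simp add: inner_vec_def sum_2 trace_def power2_eq_square algebra_simps)
  qed (use \<beta> in auto)
  also have "\<dots> = (\<beta>\<^sub>0 + 2 * \<beta>\<^sub>1)\<^sup>2 / \<beta>\<^sub>0 * (\<beta>\<^sub>0 * s)" using \<beta> by (simp add: power2_eq_square field_simps)
  also have "\<dots> \<le> (\<beta>\<^sub>0 + 2 * \<beta>\<^sub>1)\<^sup>2 / \<beta>\<^sub>0 * (stiffness \<beta>\<^sub>0 \<beta>\<^sub>1 ?A \<bullet> ?A)"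
    unfolding s_def using \<beta> by (intro mult_left_mono stiffness_lower) auto
  finally show ?thesis .
qed

text \<open>The number 832 is 416 times the factor 2 of \<open>sym_grad_error\<close>,
  \<open>C / \<rho> ^ 7\<close> is the constant of \<open>jump_sup_stab\<close>, and the last
  summand pays for the stabilisation inside \<open>inner1\<close>, whose weights differ by
  \<open>(diameter T)\<^sup>2\<close>.\<close>

definition korn_const :: "point set \<Rightarrow> real \<Rightarrow> real \<Rightarrow> real \<Rightarrow> real" where
  "korn_const \<Omega> \<rho> C\<^sub>0 C = (let D = diameter \<Omega> + 1 in
     832 * D\<^sup>2 + (832 * D\<^sup>2 * C\<^sub>0 + 35152 * (kernel_mass D)\<^sup>2 / \<rho>\<^sup>2) * (C / \<rho> ^ 7) + D\<^sup>2)"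

lemma korn_const_nonneg:
  assumes "0 < \<rho>" "0 < C\<^sub>0" "0 < C"
  shows "0 \<le> korn_const \<Omega> \<rho> C\<^sub>0 C"
  unfolding korn_const_def Let_def using assms
  by (intro add_nonneg_nonneg mult_nonneg_nonneg divide_nonneg_nonneg) auto

context regular_mesh_space
begin

lemma element_stab_nonneg: "v \<in> H1_space k M \<Longrightarrow> T \<in> elements M \<Longrightarrow> 0 \<le> stab1 k M T v v"
  by (rule regular_element.stab1_nonneg[OF regular_element])

lemma inner1_nonneg: "v \<in> H1_space k M \<Longrightarrow> 0 \<le> inner1 k M v v"
  unfolding inner1_def by (intro sum_nonneg add_nonneg_nonneg area_integral_nonneg element_stab_nonneg) auto

lemma sym_grad1_continuous:
  "v \<in> H1_space k M \<Longrightarrow> T \<in> elements M \<Longrightarrow> continuous_on (closure T) (sym_grad1 k M T v)"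
  unfolding sym_grad1_def[abs_def]
  by (rule mesh_element.tensor_continuous[OF mesh_element sym_part_tensor[OF mesh_element.grad1_tensor[OF mesh_element]]])

text \<open>At points of the domain on no open element the broken gradient is an empty or vanishing
  sum, and \<open>f 0 = 0\<close> makes both sides agree there.\<close>

lemma area_integral_global_sym_grad1:
  assumes v: "v \<in> H1_space k M" and f: "continuous_on UNIV f" and f0: "f 0 = (0 :: real)"
  shows "area_integral \<Omega> (\<lambda>x. f (global_sym_grad1 k M v x)) = (\<Sum>T\<in>elements M. area_integral T (\<lambda>x. f (sym_grad1 k M T v x)))"
proof -
  let ?g = "\<lambda>T x. sym_grad1 k M T v x"
  have pt: "indicator \<Omega> x *\<^sub>R f (global_sym_grad1 k M v x) = (\<Sum>T\<in>elements M. indicator T x *\<^sub>R f (?g T x))" for x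
  proof (cases "\<exists>T\<in>elements M. x \<in> T")
    case True
    then obtain T0 where T0: "T0 \<in> elements M" "x \<in> T0" by blast
    have i: "indicator T x = (if T = T0 then 1 else 0 :: real)" if "T \<in> elements M" for T
      using elements_disjoint[OF that T0(1)] T0(2) by (auto simp: indicator_def)
    have "global_sym_grad1 k M v x = ?g T0 x"
      unfolding global_sym_grad1_def using T0(1) finite_elements by (simp add: i sum.delta if_distrib[of "\<lambda>c. c *\<^sub>R _"] cong: sum.cong if_cong)
    moreover have "(\<Sum>T\<in>elements M. indicator T x *\<^sub>R f (?g T x)) = f (?g T0 x)"
      using T0(1) finite_elements by (simp add: i sum.delta if_distrib[of "\<lambda>c. c * _"] cong: sum.cong if_cong)
    moreover have "x \<in> \<Omega>" using element_subset[OF T0(1)] T0(2) by blast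
    ultimately show ?thesis by simp
  next
    case False
    then have "global_sym_grad1 k M v x = 0" unfolding global_sym_grad1_def by (intro sum.neutral) auto
    moreover have "(\<Sum>T\<in>elements M. indicator T x *\<^sub>R f (?g T x)) = 0" using False by (intro sum.neutral) auto
    ultimately show ?thesis using f0 by simp
  qed
  have "integrable lborel (\<lambda>x. indicator T x *\<^sub>R f (?g T x))" if T: "T \<in> elements M" for T
    unfolding set_integrable_def[symmetric]
    by (intro area_integrable star_element.openT[OF star_element[OF T]] star_element.boundedT[OF star_element[OF T]]
        continuous_on_compose2[OF f sym_grad1_continuous[OF v T]]) simp
  then show ?thesis unfolding area_integral_def set_lebesgue_integral_def pt
    by (rule Bochner_Integration.integral_sum)
qed

text \<open>Potential and jump are linear in the rotation, so the elementary inequality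
  \<open>sq\<close> can be integrated over elements and edges. It bounds the discrete gradient of
  the displacement by the rotation and the shear.\<close>

lemma inner1_triangle:
  assumes v: "v \<in> H1_space k M" and w: "w \<in> H1_space k M"
  shows "inner1 k M w w \<le> 2 * inner1 k M v v + 2 * inner1 k M (rot_diff v w) (rot_diff v w)"
proof -
  have sq: "b \<bullet> b \<le> 2 * (a \<bullet> a) + 2 * ((a - b) \<bullet> (a - b))" for a b :: "real^2"
  proof -
    have "0 \<le> (2 *\<^sub>R a - b) \<bullet> (2 *\<^sub>R a - b)" by simp
    then show ?thesis by (simp add: inner_diff_left inner_diff_right inner_commute[of b a])
  qed
  have "area_integral T (\<lambda>x. potential k M T w x \<bullet> potential k M T w x) + stab1 k M T w w
    \<le> 2 * (area_integral T (\<lambda>x. potential k M T v x \<bullet> potential k M T v x) + stab1 k M T v v)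
      + 2 * (area_integral T (\<lambda>x. potential k M T (rot_diff v w) x \<bullet> potential k M T (rot_diff v w) x)
        + stab1 k M T (rot_diff v w) (rot_diff v w))" if T: "T \<in> elements M" for T
  proof -
    interpret regular_element M T "star_centre T" "\<rho> * diameter T" \<rho> by (rule regular_element[OF T])
    note pc = vec_poly_continuous[OF potential_vec[OF v]] vec_poly_continuous[OF potential_vec[OF w]]
    have a: "area_integral T (\<lambda>x. potential k M T w x \<bullet> potential k M T w x) \<le>
        2 * area_integral T (\<lambda>x. potential k M T v x \<bullet> potential k M T v x)
        + 2 * area_integral T (\<lambda>x. potential k M T (rot_diff v w) x \<bullet> potential k M T (rot_diff v w) x)"
      unfolding area_integral_cmul[symmetric] potential_diff[OF v w]
      by (subst area_integral_add[symmetric, OF openT boundedT])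
        (intro area_integral_mono openT boundedT continuous_intros pc sq)+
    have "stab1 k M T w w \<le> 2 * stab1 k M T v v + 2 * stab1 k M T (rot_diff v w) (rot_diff v w)"
      unfolding stab1_def sum_distrib_left sum.distrib[symmetric]
    proof (rule sum_mono)
      fix E assume E: "E \<in> element_edges M T"
      note jc = jump_continuous[OF v E] jump_continuous[OF w E]
      let ?I = "\<lambda>u. edge_integral E (\<lambda>x. jump k u x \<bullet> jump k u x)"
      have jd: "jump k (rot_diff v w) x = jump k v x - jump k w x" for x
        by (simp add: jump_def potential_diff[OF v w] trace1_diff[OF v w])
      have "?I w \<le> 2 * ?I v + 2 * ?I (rot_diff v w)"
        unfolding edge_integral_cmul[OF seg[OF E], symmetric] jd
        by (subst edge_integral_add[symmetric, OF seg[OF E]])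
          (intro edge_integral_mono seg[OF E] continuous_intros jc sq)+
      from mult_left_mono[OF this less_imp_le[OF edge_diameter_pos[OF E]]]
      show "diameter E * edge_integral E (\<lambda>x. (potential k M T w x - trace1 k M T w x) \<bullet> (potential k M T w x - trace1 k M T w x))
        \<le> 2 * (diameter E * edge_integral E (\<lambda>x. (potential k M T v x - trace1 k M T v x) \<bullet> (potential k M T v x - trace1 k M T v x)))
          + 2 * (diameter E * edge_integral E (\<lambda>x. (potential k M T (rot_diff v w) x - trace1 k M T (rot_diff v w) x)
              \<bullet> (potential k M T (rot_diff v w) x - trace1 k M T (rot_diff v w) x)))"
        unfolding jump_def by (simp only: distrib_left mult.left_commute)
    qed
    from add_mono[OF a this] show ?thesis by (simp only: distrib_left add_ac)
  qed
  then show ?thesis unfolding inner1_def sum_distrib_left sum.distrib[symmetric] by (rule sum_mono)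
qed

lemma grad2_H1:
  assumes q: "q \<in> H2_space k M"
  shows "grad2 k M q \<in> H1_space k M"
proof -
  have "(\<lambda>x. (tangential_grad2 k M E q x *\<^sub>R tangent M E + dis_Gn q E x *\<^sub>R normal M E) $ i) \<in> poly_space (int k) E"
    if E: "E \<in> edges M" for E i
  proof -
    obtain f where f: "f \<in> pfun (int k)" "tangential_grad2 k M E q = cut E f"
      using tangential_grad2_poly[OF E q] by (auto simp: poly_space_iff)
    obtain g where g: "g \<in> pfun (int k)" "dis_Gn q E = cut E g"
      using q E by (auto simp: H2_space_def poly_space_iff)
    have "(\<lambda>x. tangent M E $ i * f x + normal M E $ i * g x) \<in> pfun (int k)" by (intro pfun_add pfun_scale f(1) g(1))
    moreover have "(\<lambda>x. (tangential_grad2 k M E q x *\<^sub>R tangent M E + dis_Gn q E x *\<^sub>R normal M E) $ i)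
        = cut E (\<lambda>x. tangent M E $ i * f x + normal M E $ i * g x)"
      unfolding f(2) g(2) by (auto simp: cut_def)
    ultimately show ?thesis by (auto simp: poly_space_iff)
  qed
  then show ?thesis
    using mesh_element.element_grad2_vec[OF mesh_element q] by (simp add: H1_space_def grad2_def vec_poly_space_def)
qed

text \<open>The broken estimate is applied to the polynomials behind the potentials. The consistency
  error turns their symmetric gradients into discrete ones, and both jump terms are absorbed by the
  stabilisation.\<close>

theorem discrete_korn:
  assumes C0: "has_sup_const \<rho> (int k + 1) C\<^sub>0" and C: "has_edge_const (int k + 2) C"
    and v: "v \<in> H10_space k \<Omega> M"
  shows "inner1 k M v v \<le> korn_const \<Omega> \<rho> C\<^sub>0 C *
    ((\<Sum>T\<in>elements M. area_integral T (\<lambda>x. sym_grad1 k M T v x \<bullet> sym_grad1 k M T v x))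
     + (\<Sum>T\<in>elements M. stab1 k M T v v / (diameter T)\<^sup>2))"
proof -
  have v1: "v \<in> H1_space k M" using v by (simp add: H10_space_def)
  have Cpos: "0 < C\<^sub>0" "0 < C" using C0 C by (auto simp: has_sup_const_def has_edge_const_def)
  have "\<forall>T\<in>elements M. \<exists>W. (\<forall>i. W i \<in> pfun (int k + 2)) \<and> (\<forall>x i. potential k M T v x $ i = cut T (W i) x)"
    using vec_poly_rep[OF mesh_element.potential_vec[OF mesh_element v1]] by metis
  then obtain P where "\<forall>T\<in>elements M. (\<forall>i. P T i \<in> pfun (int k + 2)) \<and> (\<forall>x i. potential k M T v x $ i = cut T (P T i) x)"
    by (rule bchoice[THEN exE])
  then have rep: "T \<in> elements M \<Longrightarrow> P T i \<in> pfun (int k + 2)"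
    "T \<in> elements M \<Longrightarrow> potential k M T v x $ i = cut T (P T i) x" for T x i by blast+
  \<comment> \<open>The trace is written as the edge interpolant, which mentions no element and is
    therefore the same for both neighbours.\<close>
  define tr where "tr E x = (\<chi> i. interp (int k + 2) E (\<lambda>x. rot_E v E x $ i) (\<lambda>V. rot_V v V $ i) x)" for E x
  define J where "J T E = regular_element.jump_sup M T C k v E" for T E
  have val: "(\<chi> i. P T i x) = potential k M T v x" if "T \<in> elements M" "x \<in> closure T" for T x
    by (simp add: vec_eq_iff rep(2)[OF that(1)] cut_def that(2))
  interpret broken_field \<Omega> M \<rho> "int k + 2" P tr J
  proof
    show "P T i \<in> pfun (int k + 2)" if "T \<in> elements M" for T i by (rule rep(1)[OF that])
    \<comment> \<open>The boundary conditions on edge and vertex components make all interpolation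
      data on a boundary edge vanish.\<close>
    show "tr E x = 0" if E: "E \<in> edges M" "E \<subseteq> frontier \<Omega>" and "x \<in> E" for E x
    proof -
      have 0: "rot_E v E = (\<lambda>x. 0)" using v E by (simp add: H10_space_def)
      have "rot_V v V = 0" if V: "V \<in> edge_vertices E" for V
      proof -
        have "V \<in> mesh_vertices M" using E(1) V by (auto simp: mesh_vertices_def)
        moreover have "closure E \<subseteq> frontier \<Omega>" by (rule closure_minimal[OF E(2) frontier_closed])
        ultimately show ?thesis using v V by (auto simp: H10_space_def edge_vertices_def)
      qed
      then show ?thesis unfolding tr_def 0 vec_eq_iff
        using interp_zero[OF edge_is_segment[OF E(1)], of "int k + 2"] by simp
    qed
    fix T E assume T: "T \<in> elements M" and E: "E \<in> element_edges M T"
    interpret regular_element M T "star_centre T" "\<rho> * diameter T" \<rho> by (rule regular_element[OF T])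
    show "0 \<le> J T E" unfolding J_def by (rule jump_sup_nonneg[OF Cpos(2) v1 E])
    show "norm ((\<chi> i. P T i x) - tr E x) \<le> J T E" if x: "x \<in> E" for x
    proof -
      have xc: "x \<in> closure E" using x closure_subset by blast
      then have "x \<in> closure T" using closure_edge_subset[OF E] by blast
      moreover have "tr E x = trace1 k M T v x" by (simp add: vec_eq_iff tr_def trace1_interp[OF v1 E xc])
      ultimately have "(\<chi> i. P T i x) - tr E x = jump k v x" by (simp add: val[OF T] jump_def)
      then show ?thesis unfolding J_def using jump_le_sup[OF C v1 E xc] by simp
    qed
  qed
  define g where "g T = area_integral T (\<lambda>x. sym_grad1 k M T v x \<bullet> sym_grad1 k M T v x)" for T
  define s where "s T = stab1 k M T v v / (diameter T)\<^sup>2" for T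
  define K where "K = 35152 * (kernel_mass D)\<^sup>2 / \<rho>\<^sup>2"
  have js: "(jsum T)\<^sup>2 \<le> C / \<rho> ^ 7 * s T" if T: "T \<in> elements M" for T
    unfolding jsum_def J_def s_def by (rule regular_element.jump_sup_stab[OF regular_element[OF T] Cpos(2) v1])
  have sg: "area_integral T (\<lambda>x. sym_grad_of (P T) x \<bullet> sym_grad_of (P T) x) \<le> 2 * g T + 2 * C\<^sub>0 * (C / \<rho> ^ 7 * s T)"
    if T: "T \<in> elements M" for T
  proof -
    have "area_integral T (\<lambda>x. sym_grad_of (P T) x \<bullet> sym_grad_of (P T) x) \<le> 2 * g T + 2 * C\<^sub>0 * (jsum T)\<^sup>2"
      unfolding jsum_def J_def g_def
      by (rule regular_element.sym_grad_error[OF regular_element[OF T] C0 C v1 rep(1)[OF T] rep(2)[OF T]])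
    moreover have "2 * C\<^sub>0 * (jsum T)\<^sup>2 \<le> 2 * C\<^sub>0 * (C / \<rho> ^ 7 * s T)" using Cpos by (intro mult_left_mono js[OF T]) auto
    ultimately show ?thesis by linarith
  qed
  have g0: "0 \<le> g T" for T unfolding g_def by (intro area_integral_nonneg) simp
  have s0: "0 \<le> s T" if "T \<in> elements M" for T unfolding s_def using element_stab_nonneg[OF v1 that] by simp
  \<comment> \<open>The discrete norm contains the stabilisation without the inverse square of the
    element diameter, and elements are no larger than the domain.\<close>
  have st: "stab1 k M T v v \<le> D\<^sup>2 * s T" if T: "T \<in> elements M" for T
  proof -
    interpret regular_element M T "star_centre T" "\<rho> * diameter T" \<rho> by (rule regular_element[OF T])
    have "diameter T \<le> D" using diameter_subset[OF element_subset[OF T] bounded_domain] by (simp add: D_def)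
    then have "(diameter T)\<^sup>2 \<le> D\<^sup>2" using h_pos by (intro power_mono) auto
    then have "(diameter T)\<^sup>2 * s T \<le> D\<^sup>2 * s T" by (rule mult_right_mono[OF _ s0[OF T]])
    moreover have "(diameter T)\<^sup>2 * s T = stab1 k M T v v" unfolding s_def using h_pos by simp
    ultimately show ?thesis by simp
  qed
  have "(\<Sum>T\<in>elements M. area_integral T (\<lambda>x. potential k M T v x \<bullet> potential k M T v x))
      = (\<Sum>T\<in>elements M. area_integral T (\<lambda>x. (norm (\<chi> i. P T i x))\<^sup>2))"
    by (intro sum.cong area_integral_cong refl) (simp add: val closure_subset[THEN subsetD] power2_norm_eq_inner)
  also have "\<dots> \<le> 416 * D\<^sup>2 * (\<Sum>T\<in>elements M. area_integral T (\<lambda>x. sym_grad_of (P T) x \<bullet> sym_grad_of (P T) x))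
      + K * (\<Sum>T\<in>elements M. (jsum T)\<^sup>2)"
    unfolding K_def by (rule broken_poincare)
  also have "\<dots> \<le> 416 * D\<^sup>2 * (\<Sum>T\<in>elements M. 2 * g T + 2 * C\<^sub>0 * (C / \<rho> ^ 7 * s T)) + K * (\<Sum>T\<in>elements M. C / \<rho> ^ 7 * s T)"
    by (intro add_mono mult_left_mono sum_mono sg js) (auto simp: K_def)
  also have "\<dots> = 832 * D\<^sup>2 * sum g (elements M) + (832 * D\<^sup>2 * C\<^sub>0 + K) * (C / \<rho> ^ 7) * sum s (elements M)"
    unfolding sum.distrib sum_distrib_left[symmetric] by (simp add: algebra_simps)
  finally have "(\<Sum>T\<in>elements M. area_integral T (\<lambda>x. potential k M T v x \<bullet> potential k M T v x))
      \<le> 832 * D\<^sup>2 * sum g (elements M) + (832 * D\<^sup>2 * C\<^sub>0 + K) * (C / \<rho> ^ 7) * sum s (elements M)" .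
  moreover have "(\<Sum>T\<in>elements M. stab1 k M T v v) \<le> D\<^sup>2 * sum s (elements M)"
    unfolding sum_distrib_left by (rule sum_mono) (rule st)
  ultimately have "inner1 k M v v \<le> 832 * D\<^sup>2 * sum g (elements M)
      + (832 * D\<^sup>2 * C\<^sub>0 + K) * (C / \<rho> ^ 7) * sum s (elements M) + D\<^sup>2 * sum s (elements M)"
    unfolding inner1_def sum.distrib by linarith
  \<comment> \<open>Two different coefficients are replaced by their sum, at the price of
    nonnegative cross terms.\<close>
  also have "\<dots> \<le> (832 * D\<^sup>2 + (832 * D\<^sup>2 * C\<^sub>0 + K) * (C / \<rho> ^ 7) + D\<^sup>2) * (sum g (elements M) + sum s (elements M))"
  proof -
    have "0 \<le> sum g (elements M)" "0 \<le> sum s (elements M)" by (intro sum_nonneg g0 s0; assumption)+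
    moreover have "0 \<le> (832 * D\<^sup>2 * C\<^sub>0 + K) * (C / \<rho> ^ 7) + D\<^sup>2"
      using Cpos \<rho> by (intro mult_nonneg_nonneg add_nonneg_nonneg) (auto simp: K_def)
    ultimately have "0 \<le> ((832 * D\<^sup>2 * C\<^sub>0 + K) * (C / \<rho> ^ 7) + D\<^sup>2) * sum g (elements M) + 832 * D\<^sup>2 * sum s (elements M)"
      by (intro add_nonneg_nonneg[OF mult_nonneg_nonneg mult_nonneg_nonneg]) auto
    then show ?thesis by (simp add: algebra_simps add_divide_distrib)
  qed
  also have "\<dots> = korn_const \<Omega> \<rho> C\<^sub>0 C * (sum g (elements M) + sum s (elements M))"
    by (simp add: korn_const_def Let_def K_def D_def)
  finally show ?thesis unfolding g_def s_def .
qed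

text \<open>The norms of the rotation and of the gradient together cost
  \<open>3 * I + 2 * d\<close>. The rotation part is absorbed by \<open>discrete_korn\<close>. The
  thickness enters only through the shear \<open>d\<close>, which the form weighs by
  \<open>\<kappa> / t\<^sup>2\<close>; this is where the bound \<open>t_max\<close> is
  spent.\<close>

lemma energy_coercive:
  assumes C0: "has_sup_const \<rho> (int k + 1) C\<^sub>0" and C: "has_edge_const (int k + 2) C"
    and pos: "\<kappa> > 0" "\<beta>\<^sub>0 > 0" "\<beta>\<^sub>1 > 0" and t: "0 < t" "t \<le> t_max"
    and \<phi>: "\<phi> \<in> H10_space k \<Omega> M" and v: "v \<in> H2_space k M"
  shows "(energy_norm k \<Omega> M \<kappa> \<beta>\<^sub>0 \<beta>\<^sub>1 t (\<phi>, v))\<^sup>2 \<le>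
    (1 + (\<beta>\<^sub>0 + 2 * \<beta>\<^sub>1)\<^sup>2 / \<beta>\<^sub>0 + 3 * min \<kappa> \<beta>\<^sub>0 * korn_const \<Omega> \<rho> C\<^sub>0 C / \<beta>\<^sub>0 + 2 * min \<kappa> \<beta>\<^sub>0 * t_max\<^sup>2 / \<kappa>)
      * A_form k \<Omega> M \<kappa> \<beta>\<^sub>0 \<beta>\<^sub>1 t (\<phi>, v) (\<phi>, v)"
proof -
  have \<phi>1: "\<phi> \<in> H1_space k M" using \<phi> by (simp add: H10_space_def)
  note G = grad2_H1[OF v]
  let ?g = "grad2 k M v" and ?S = "stiffness \<beta>\<^sub>0 \<beta>\<^sub>1"
  have dH: "rot_diff \<phi> ?g \<in> H1_space k M"
    using \<phi>1 G by (auto simp: H1_space_def rot_diff_def vec_poly_space_def intro: poly_space_diff)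
  define \<mu> where "\<mu> = min \<kappa> \<beta>\<^sub>0"
  define K where "K = korn_const \<Omega> \<rho> C\<^sub>0 C"
  define c where "c = (\<beta>\<^sub>0 + 2 * \<beta>\<^sub>1)\<^sup>2 / \<beta>\<^sub>0"
  define a where "a = area_integral \<Omega> (\<lambda>x. ?S (global_sym_grad1 k M \<phi> x) \<bullet> global_sym_grad1 k M \<phi> x)"
  define n where "n = area_integral \<Omega> (\<lambda>x. (norm (?S (global_sym_grad1 k M \<phi> x)))\<^sup>2)"
  define g where "g = (\<Sum>T\<in>elements M. area_integral T (\<lambda>x. sym_grad1 k M T \<phi> x \<bullet> sym_grad1 k M T \<phi> x))"
  define s where "s = (\<Sum>T\<in>elements M. stab1 k M T \<phi> \<phi> / (diameter T)\<^sup>2)"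
  define I where "I = inner1 k M \<phi> \<phi>"
  define IG where "IG = inner1 k M ?g ?g"
  define d where "d = inner1 k M (rot_diff \<phi> ?g) (rot_diff \<phi> ?g)"
  have lin: "linear ?S" by (simp add: linear_iff stiffness_def sym_part_def vec_eq_iff transpose_def trace_def sum_2 mat_def algebra_simps)
  have Sc: "continuous_on UNIV (\<lambda>x. ?S x)" by (rule linear_continuous_on) (use lin in \<open>simp add: linear_conv_bounded_linear\<close>)
  have S0: "?S 0 = 0" by (rule linear_0[OF lin])
  have a_eq: "a = (\<Sum>T\<in>elements M. area_integral T (\<lambda>x. ?S (sym_grad1 k M T \<phi> x) \<bullet> sym_grad1 k M T \<phi> x))"
    unfolding a_def by (rule area_integral_global_sym_grad1[OF \<phi>1, of "\<lambda>A. ?S A \<bullet> A"]) (auto intro!: continuous_intros Sc)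
  have n_eq: "n = (\<Sum>T\<in>elements M. area_integral T (\<lambda>x. (norm (?S (sym_grad1 k M T \<phi> x)))\<^sup>2))"
    unfolding n_def by (rule area_integral_global_sym_grad1[OF \<phi>1, of "\<lambda>A. (norm (?S A))\<^sup>2"]) (auto intro!: continuous_intros Sc simp: S0)
  have cs: "continuous_on (closure T) (\<lambda>x. ?S (sym_grad1 k M T \<phi> x))" if "T \<in> elements M" for T
    by (rule continuous_on_compose2[OF Sc sym_grad1_continuous[OF \<phi>1 that]]) simp
  have na: "n \<le> c * a"
    unfolding n_eq a_eq sum_distrib_left area_integral_cmul[symmetric]
  proof (rule sum_mono)
    fix T assume T: "T \<in> elements M"
    show "area_integral T (\<lambda>x. (norm (?S (sym_grad1 k M T \<phi> x)))\<^sup>2)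
      \<le> area_integral T (\<lambda>x. c * (?S (sym_grad1 k M T \<phi> x) \<bullet> sym_grad1 k M T \<phi> x))"
      by (intro area_integral_mono star_element.openT[OF star_element[OF T]] star_element.boundedT[OF star_element[OF T]]
          continuous_intros cs[OF T] sym_grad1_continuous[OF \<phi>1 T])
        (unfold c_def sym_grad1_def, rule stiffness_upper[OF pos(2,3)])
  qed
  have ga: "\<beta>\<^sub>0 * g \<le> a"
    unfolding g_def a_eq sum_distrib_left area_integral_cmul[symmetric]
  proof (rule sum_mono)
    fix T assume T: "T \<in> elements M"
    show "area_integral T (\<lambda>x. \<beta>\<^sub>0 * (sym_grad1 k M T \<phi> x \<bullet> sym_grad1 k M T \<phi> x))
      \<le> area_integral T (\<lambda>x. ?S (sym_grad1 k M T \<phi> x) \<bullet> sym_grad1 k M T \<phi> x)"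
      by (intro area_integral_mono star_element.openT[OF star_element[OF T]] star_element.boundedT[OF star_element[OF T]]
          continuous_intros cs[OF T] sym_grad1_continuous[OF \<phi>1 T])
        (unfold sym_grad1_def, rule stiffness_lower[OF less_imp_le[OF pos(3)]])
  qed
  have g0: "0 \<le> g" unfolding g_def by (intro sum_nonneg area_integral_nonneg) simp
  have s0: "0 \<le> s" unfolding s_def by (intro sum_nonneg divide_nonneg_nonneg element_stab_nonneg[OF \<phi>1]) auto
  have n0: "0 \<le> n" unfolding n_def by (intro area_integral_nonneg) simp
  have d0: "0 \<le> d" and I0: "0 \<le> I" and IG0: "0 \<le> IG" unfolding d_def I_def IG_def by (intro inner1_nonneg dH \<phi>1 G)+
  have a0: "0 \<le> a" using ga g0 pos(2) by (meson order.trans mult_nonneg_nonneg less_imp_le)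
  have K0: "0 \<le> K" unfolding K_def using C0 C by (intro korn_const_nonneg \<rho>) (auto simp: has_sup_const_def has_edge_const_def)
  have \<mu>0: "0 \<le> \<mu>" unfolding \<mu>_def using pos by simp
  define X where "X = \<kappa> / t\<^sup>2 * d"
  have X0: "0 \<le> X" unfolding X_def using pos(1) d0 by simp
  have IK: "I \<le> K * (g + s)" unfolding I_def K_def g_def s_def by (rule discrete_korn[OF C0 C \<phi>])
  have IGI: "IG \<le> 2 * I + 2 * d" unfolding IG_def I_def d_def by (rule inner1_triangle[OF \<phi>1 G])
  have gs: "g + s \<le> (a + \<beta>\<^sub>0 * s) / \<beta>\<^sub>0" using ga pos(2) by (simp add: pos_le_divide_eq algebra_simps)
  \<comment> \<open>For thin plates the weighted shear dominates the unweighted one, uniformly as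
    \<open>t\<close> tends to 0.\<close>
  have dX: "d \<le> t_max\<^sup>2 / \<kappa> * X"
  proof -
    have "d = t\<^sup>2 / \<kappa> * X" unfolding X_def using pos(1) t(1) by simp
    also have "\<dots> \<le> t_max\<^sup>2 / \<kappa> * X" using X0 t pos(1) by (intro mult_right_mono divide_right_mono power_mono) auto
    finally show ?thesis .
  qed
  have "(energy_norm k \<Omega> M \<kappa> \<beta>\<^sub>0 \<beta>\<^sub>1 t (\<phi>, v))\<^sup>2 = n + \<beta>\<^sub>0 * s + X + \<mu> * (I + IG)"
  proof -
    have "0 \<le> n + \<beta>\<^sub>0 * s + X + \<mu> * (I + IG)"
      using n0 s0 X0 \<mu>0 I0 IG0 pos(2) by (intro add_nonneg_nonneg mult_nonneg_nonneg) auto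
    moreover have "(norm1 k M w)\<^sup>2 = inner1 k M w w" if "w \<in> H1_space k M" for w
      unfolding norm1_def using inner1_nonneg[OF that] by simp
    ultimately show ?thesis
      by (simp add: energy_norm_def \<phi>1 G dH n_def s_def X_def I_def IG_def d_def \<mu>_def)
  qed
  also have "\<dots> \<le> c * a + \<beta>\<^sub>0 * s + X + \<mu> * (3 * (K * ((a + \<beta>\<^sub>0 * s) / \<beta>\<^sub>0)) + 2 * (t_max\<^sup>2 / \<kappa> * X))"
  proof -
    have "K * (g + s) \<le> K * ((a + \<beta>\<^sub>0 * s) / \<beta>\<^sub>0)" by (rule mult_left_mono[OF gs K0])
    then have "I + IG \<le> 3 * (K * ((a + \<beta>\<^sub>0 * s) / \<beta>\<^sub>0)) + 2 * (t_max\<^sup>2 / \<kappa> * X)" using IK IGI dX by linarith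
    from mult_left_mono[OF this \<mu>0] show ?thesis using na by linarith
  qed
  also have "\<dots> \<le> (1 + c + 3 * \<mu> * K / \<beta>\<^sub>0 + 2 * \<mu> * t_max\<^sup>2 / \<kappa>) * (a + \<beta>\<^sub>0 * s + X)"
  proof -
    define p q where "p = 3 * \<mu> * K / \<beta>\<^sub>0" and "q = 2 * \<mu> * t_max\<^sup>2 / \<kappa>"
    have nn: "0 \<le> p" "0 \<le> q" "0 \<le> c" "0 \<le> \<beta>\<^sub>0 * s" using \<mu>0 K0 pos s0 by (auto simp: p_def q_def c_def)
    have "c * a + \<beta>\<^sub>0 * s + X + \<mu> * (3 * (K * ((a + \<beta>\<^sub>0 * s) / \<beta>\<^sub>0)) + 2 * (t_max\<^sup>2 / \<kappa> * X))
        = c * a + \<beta>\<^sub>0 * s + X + p * (a + \<beta>\<^sub>0 * s) + q * X"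
      unfolding p_def q_def by (simp add: distrib_left mult_ac)
    \<comment> \<open>The added terms are nonnegative and complete the expansion of the product of
      the constant with the form.\<close>
    also have "\<dots> \<le> \<dots> + (a + c * (\<beta>\<^sub>0 * s + X) + p * X + q * (a + \<beta>\<^sub>0 * s))"
      using nn a0 X0 by simp
    also have "\<dots> = (1 + c + p + q) * (a + \<beta>\<^sub>0 * s + X)" by (simp add: algebra_simps)
    finally show ?thesis unfolding p_def q_def .
  qed
  also have "a + \<beta>\<^sub>0 * s + X = A_form k \<Omega> M \<kappa> \<beta>\<^sub>0 \<beta>\<^sub>1 t (\<phi>, v) (\<phi>, v)"
    by (simp add: A_form_def a_def s_def X_def d_def)
  finally show ?thesis unfolding c_def \<mu>_def K_def .
qed

end

theorem lemma7:
  fixes \<Omega> :: "point set" and \<rho> \<kappa> \<beta>\<^sub>0 \<beta>\<^sub>1 t_max :: real and k :: nat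
  assumes "polygonal \<Omega>"
    and "0 < \<rho>" and "\<rho> < 1"
    and "\<kappa> > 0" and "\<beta>\<^sub>0 > 0" and "\<beta>\<^sub>1 > 0"
    and "t_max > 0"
  shows "\<exists>C>0. \<forall>\<M> :: nat \<Rightarrow> mesh. regular_mesh_sequence \<Omega> \<rho> \<M> \<longrightarrow>
    (\<forall>n t. 0 < t \<and> t \<le> t_max \<longrightarrow>
      (\<forall>\<phi>\<in>H10_space k \<Omega> (\<M> n). \<forall>v\<in>H210_space k \<Omega> (\<M> n).
        (energy_norm k \<Omega> (\<M> n) \<kappa> \<beta>\<^sub>0 \<beta>\<^sub>1 t (\<phi>, v))\<^sup>2
          \<le> C * A_form k \<Omega> (\<M> n) \<kappa> \<beta>\<^sub>0 \<beta>\<^sub>1 t (\<phi>, v) (\<phi>, v)))"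
proof -
  \<comment> \<open>Both inverse constants are fixed before the mesh sequence and the thickness: one
    depends on \<open>\<rho>\<close> and \<open>k\<close>, the other on \<open>k\<close>
    only.\<close>
  obtain C\<^sub>0 where C0: "has_sup_const \<rho> (int k + 1) C\<^sub>0"
    unfolding has_sup_const_def using pfun_sup_bound[OF assms(2), of "int k + 1"] by blast
  obtain C where C: "has_edge_const (int k + 2) C"
    unfolding has_edge_const_def using edge_sup_bound[of "int k + 2"] by blast
  have Cpos: "0 < C\<^sub>0" "0 < C" using C0 C by (auto simp: has_sup_const_def has_edge_const_def)
  define K where "K = 1 + (\<beta>\<^sub>0 + 2 * \<beta>\<^sub>1)\<^sup>2 / \<beta>\<^sub>0 + 3 * min \<kappa> \<beta>\<^sub>0 * korn_const \<Omega> \<rho> C\<^sub>0 C / \<beta>\<^sub>0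
    + 2 * min \<kappa> \<beta>\<^sub>0 * t_max\<^sup>2 / \<kappa>"
  have "0 < K" unfolding K_def using assms korn_const_nonneg[OF assms(2) Cpos]
    by (intro add_pos_nonneg mult_nonneg_nonneg divide_nonneg_nonneg) auto
  moreover have "(energy_norm k \<Omega> (\<M> n) \<kappa> \<beta>\<^sub>0 \<beta>\<^sub>1 t (\<phi>, v))\<^sup>2 \<le> K * A_form k \<Omega> (\<M> n) \<kappa> \<beta>\<^sub>0 \<beta>\<^sub>1 t (\<phi>, v) (\<phi>, v)"
    if M: "regular_mesh_sequence \<Omega> \<rho> \<M>" and t: "0 < t" "t \<le> t_max"
      and \<phi>: "\<phi> \<in> H10_space k \<Omega> (\<M> n)" and v: "v \<in> H210_space k \<Omega> (\<M> n)" for \<M> n t \<phi> v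
  proof -
    interpret regular_mesh_space \<Omega> "\<M> n" \<rho>
      using M assms(1,2) by unfold_locales (auto simp: regular_mesh_sequence_def)
    show ?thesis unfolding K_def
      by (rule energy_coercive[OF C0 C assms(4-6) t \<phi>]) (use v in \<open>simp add: H210_space_def\<close>)
  qed
  ultimately show ?thesis by blast
qed

end
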